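(* Let $S,T$ be inverse semigroups. If $\mathcal{B}=\{\mathcal{B}_t\}_{t\in T}$ is a saturated refinement of a saturated, semi-abelian Fell bundle $\mathcal{A}=\{\mathcal{A}_s\}_{s\in S}$, then the twisted étale groupoids associated to $\mathcal{B}$ and to $\mathcal{A}$ are isomorphic.
   Context: For an inverse semigroup $S$, $E(S)$ is its set of idempotents, $s^*$ the inverse of $s$, and $s\le t$ the natural partial order ($s=ts^*s$). **Fell bundle.** A Fell bundle over $S$ is a collection $\mathcal{A}=\{\mathcal{A}_s\}_{s\in S}$ of Banach spaces (also viewed as their disjoint union) with a multiplication, an involution, and isometric linear maps $j_{t,s}:\mathcal{A}_s\to\mathcal{A}_t$ for $s\le t$, such that: (i) $\mathcal{A}_s\cdot\mathcal{A}_t\subseteq\mathcal{A}_{st}$, bilinearly; (ii) multiplication is associative; (iii) $\|ab\|\le\|a\|\|b\|$; (iv) $\mathcal{A}_s^*\subseteq\mathcal{A}_{s^*}$, conjugate-linearly; (v) $(a^* )^*=a$, $\|a^*\|=\|a\|$, $(ab)^*=b^*a^*$; (vi) $\|a^*a\|=\|a\|^2$ and $a^*a$ is a positive element of the $C^*$-algebra $\mathcal{A}_{s^*s}$ for $a\in\mathcal{A}_s$; (vii) $j_{t,r}=j_{t,s}\circ j_{s,r}$ if $r\le s\le t$; (viii) $j_{t,s}(a)j_{v,u}(b)=j_{tv,su}(ab)$ if $s\le t$, $u\le v$, $a\in\mathcal{A}_s$, $b\in\mathcal{A}_u$; (ix) $j_{t,s}(a)^*=j_{t^*,s^*}(a^*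 )$ if $s\le t$, $a\in\mathcal{A}_s$. It is saturated if $\mathcal{A}_s\cdot\mathcal{A}_t$ spans a dense subspace of $\mathcal{A}_{st}$ for all $s,t$, and semi-abelian if $\mathcal{A}_e$ is commutative for all $e\in E(S)$. **Refinement.** A morphism from $\mathcal{B}$ to $\mathcal{A}$ is a pair $(\phi,\psi)$ with $\phi:T\to S$ a semigroup homomorphism and $\psi:\mathcal{B}\to\mathcal{A}$ a map such that $\psi(\mathcal{B}_t)\subseteq\mathcal{A}_{\phi(t)}$ with linear restriction $\psi_t:\mathcal{B}_t\to\mathcal{A}_{\phi(t)}$; $\psi(ab)=\psi(a)\psi(b)$ and $\psi(a^* )=\psi(a)^*$; and $\psi_{t'}\circ j^{\mathcal{B}}_{t',t}=j^{\mathcal{A}}_{\phi(t'),\phi(t)}\circ\psi_t$ for $t\le t'$. $\mathcal{B}$ is a refinement of $\mathcal{A}$ if there is a morphism $(\phi,\psi)$ from $\mathcal{B}$ to $\mathcal{A}$ with $\phi$ surjective and essentially injective ($\phi(t)\in E(S)$ implies $t\in E(T)$), every $\psi_t$ injective, and $\mathcal{A}_s=\overline{\sum_{t\in\phi^{-1}(s)}\psi(\mathcal{B}_t)}$ for all $s\in S$. (A refinement of a semi-abelian Fell bundle is semi-abelian.) **Associated twisted étale groupoid.** Let $\mathcal{A}$ be saturated and semi-abelian, $\mathcal{E}=\{\mathcal{A}_e\}_{e\in E(S)}$. The universal $C^*$-algebra $C^*(\mathcal{E})$ of representations of $\mathcal{E}$ (families of linear maps into $\mathcal{L}(H)$ compatible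 with products, involutions and inclusion maps) is commutative, $C^*(\mathcal{E})\cong\mathcal{C}_0(X)$, and each $\mathcal{A}_e$ is an ideal, $\mathcal{A}_e=\mathcal{C}_0(\mathcal{U}_e)$ with $\mathcal{U}_e\subseteq X$ open. For $b\in\mathcal{A}_s$ let $\mathrm{dom}(b)=\{y:(b^*b)(y)>0\}$ and $\mathrm{ran}(b)=\{y:(bb^* )(y)>0\}$; there is a homeomorphism $\theta_b:\mathrm{dom}(b)\to\mathrm{ran}(b)$ determined by $(b^*ab)(y)=a(\theta_b(y))\,(b^*b)(y)$ for $a\in\mathcal{A}_{e}$, $e\in E(S)$, and the $\theta_b$, $b\in\mathcal{A}_s$, glue to a homeomorphism $\theta_s:\mathcal{U}_{s^*s}\to\mathcal{U}_{ss^*}$. The groupoid $\mathcal{G}$ is the groupoid of germs: classes $[s,x]$ of pairs $s\in S$, $x\in\mathcal{U}_{s^*s}$, with $(s,x)\sim(s',x')$ iff $x=x'$ and $se=s'e$ for some $e\in E(S)$ with $x\in\mathcal{U}_e$; $[s,\theta_t(y)][t,y]=[st,y]$, $[s,x]^{-1}=[s^*,\theta_s(x)]$, topology with basis $\{[s,x]:x\in U\}$ ($s\in S$, $U\subseteq\mathcal{U}_{s^*s}$ open), unit space $X$. The twist $\Sigma$ is the set of classes $[b,s,x]$ of triples $s\in S$, $b\in\mathcal{A}_s$, $x\in\mathrm{dom}(b)$, where $(b,s,x)\sim(b',s',x')$ iff $x=x'$ and there are $c,c'\in\mathcal{E}$ with $c(x),c'(x)>0$ and $bc=b'c'$ (as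 elements of $\mathcal{A}$, in particular in the same fiber); $[a,s,\theta_b(y)][b,t,y]=[ab,st,y]$, $[b,s,x]^{-1}=[b^*,s^*,\theta_b(x)]$, topology with basis $\{[zb,s,x]:z\in V,x\in U\}$ ($b\in\mathcal{A}_s$, $U\subseteq\mathrm{dom}(b)$ open, $V\subseteq\mathbb{T}$ open). The extension $\mathbb{T}\times X\hookrightarrow\Sigma\twoheadrightarrow\mathcal{G}$ is $(z,x)\mapsto[zc,e,x]$ (any $e\in E(S)$ and $c\in\mathcal{A}_e$ with $c(x)>0$) and $[b,s,x]\mapsto[s,x]$. An isomorphism of twisted étale groupoids $(\mathcal{G},\Sigma)\cong(\mathcal{G}',\Sigma')$ is a pair of isomorphisms of topological groupoids $\mathcal{G}\cong\mathcal{G}'$, $\Sigma\cong\Sigma'$ compatible with the maps of the extensions (equivalently, an isomorphism of the associated Fell line bundles $(\Sigma\times\mathbb{C})/\mathbb{T}$ over the groupoids). *)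

theory Defs
  imports "HOL-Analysis.Analysis" "HOL-Library.Complex_Order"
begin

section \<open>Inverse semigroups\<close>

class inverse_semigroup = semigroup_mult +
  assumes ex1_inverse: "\<exists>!t. s * t * s = s \<and> t * s * t = t"
begin

definition sinv :: "'a \<Rightarrow> 'a"
  where "sinv s = (THE t. s * t * s = s \<and> t * s * t = t)"

definition idem :: "'a \<Rightarrow> bool"
  where "idem e \<longleftrightarrow> e * e = e"

definition natural_le :: "'a \<Rightarrow> 'a \<Rightarrow> bool"
  where "natural_le s t \<longleftrightarrow> s = t * sinv s * s"

end


section \<open>Fell bundles\<close>

text \<open>
  The fibres are pairwise disjoint subsets of one type \<^typ>\<open>'a\<close>, so that this type hosts the
  disjoint union of the fibres: multiplication, involution, scalar multiplication and norm are
  single functions on it, and addition is only meaningful for two elements of the same fibre.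
  The map \<open>j\<^sub>t\<^sub>,\<^sub>s\<close> is \<open>incl A t s\<close>.
\<close>

record ('s, 'a) fell =
  fib :: "'s \<Rightarrow> 'a set"
  zero :: "'s \<Rightarrow> 'a"
  add :: "'a \<Rightarrow> 'a \<Rightarrow> 'a"
  scale :: "complex \<Rightarrow> 'a \<Rightarrow> 'a"
  nrm :: "'a \<Rightarrow> real"
  mul :: "'a \<Rightarrow> 'a \<Rightarrow> 'a"
  star :: "'a \<Rightarrow> 'a"
  incl :: "'s \<Rightarrow> 's \<Rightarrow> 'a \<Rightarrow> 'a"

definition fdist :: "('s, 'a) fell \<Rightarrow> 'a \<Rightarrow> 'a \<Rightarrow> real"
  where "fdist A a b = nrm A (add A a (scale A (-1) b))"

definition banach_fibre :: "('s, 'a) fell \<Rightarrow> 's \<Rightarrow> bool" where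
  "banach_fibre A s \<longleftrightarrow>
     zero A s \<in> fib A s \<and>
     (\<forall>a\<in>fib A s. \<forall>b\<in>fib A s. add A a b \<in> fib A s \<and> add A a b = add A b a) \<and>
     (\<forall>a\<in>fib A s. \<forall>b\<in>fib A s. \<forall>c\<in>fib A s. add A (add A a b) c = add A a (add A b c)) \<and>
     (\<forall>a\<in>fib A s. add A (zero A s) a = a \<and> add A a (scale A (-1) a) = zero A s) \<and>
     (\<forall>z. \<forall>a\<in>fib A s. scale A z a \<in> fib A s) \<and>
     (\<forall>z. \<forall>a\<in>fib A s. \<forall>b\<in>fib A s. scale A z (add A a b) = add A (scale A z a) (scale A z b)) \<and>
     (\<forall>z w. \<forall>a\<in>fib A s. scale A (z + w) a = add A (scale A z a) (scale A w a)) \<and>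
     (\<forall>z w. \<forall>a\<in>fib A s. scale A z (scale A w a) = scale A (z * w) a) \<and>
     (\<forall>a\<in>fib A s. scale A 1 a = a) \<and>
     (\<forall>a\<in>fib A s. 0 \<le> nrm A a \<and> (nrm A a = 0 \<longleftrightarrow> a = zero A s)) \<and>
     (\<forall>z. \<forall>a\<in>fib A s. nrm A (scale A z a) = cmod z * nrm A a) \<and>
     (\<forall>a\<in>fib A s. \<forall>b\<in>fib A s. nrm A (add A a b) \<le> nrm A a + nrm A b) \<and>
     (\<forall>f :: nat \<Rightarrow> 'a. range f \<subseteq> fib A s \<longrightarrow>
        (\<forall>\<epsilon>>0. \<exists>N. \<forall>m\<ge>N. \<forall>n\<ge>N. fdist A (f m) (f n) < \<epsilon>) \<longrightarrow>
        (\<exists>l\<in>fib A s. (\<lambda>n. fdist A (f n) l) \<longlonglongrightarrow> 0))"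

text \<open>Positive elements of the $C^*$-algebra \<open>fib A e\<close>, \<open>e\<close> idempotent, as the elements of the form \<open>c\<^sup>*c\<close>.\<close>

definition positive_in :: "('s, 'a) fell \<Rightarrow> 's \<Rightarrow> 'a \<Rightarrow> bool"
  where "positive_in A e p \<longleftrightarrow> (\<exists>c\<in>fib A e. p = mul A (star A c) c)"

locale fell_bundle =
  fixes A :: "('s :: inverse_semigroup, 'a) fell"
  assumes disjoint: "s \<noteq> t \<Longrightarrow> fib A s \<inter> fib A t = {}"
    and banach: "banach_fibre A s"
    and mul_closed: "a \<in> fib A s \<Longrightarrow> b \<in> fib A t \<Longrightarrow> mul A a b \<in> fib A (s * t)"
    and mul_add_left: "a \<in> fib A s \<Longrightarrow> a' \<in> fib A s \<Longrightarrow> b \<in> fib A t \<Longrightarrow>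
          mul A (add A a a') b = add A (mul A a b) (mul A a' b)"
    and mul_add_right: "a \<in> fib A s \<Longrightarrow> b \<in> fib A t \<Longrightarrow> b' \<in> fib A t \<Longrightarrow>
          mul A a (add A b b') = add A (mul A a b) (mul A a b')"
    and mul_scale_left: "a \<in> fib A s \<Longrightarrow> b \<in> fib A t \<Longrightarrow>
          mul A (scale A z a) b = scale A z (mul A a b)"
    and mul_scale_right: "a \<in> fib A s \<Longrightarrow> b \<in> fib A t \<Longrightarrow>
          mul A a (scale A z b) = scale A z (mul A a b)"
    and mul_assoc: "a \<in> fib A s \<Longrightarrow> b \<in> fib A t \<Longrightarrow> c \<in> fib A u \<Longrightarrow>
          mul A (mul A a b) c = mul A a (mul A b c)"
    and nrm_mul: "a \<in> fib A s \<Longrightarrow> b \<in> fib A t \<Longrightarrow> nrm A (mul A a b) \<le> nrm A a * nrm A b"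
    and star_closed: "a \<in> fib A s \<Longrightarrow> star A a \<in> fib A (sinv s)"
    and star_add: "a \<in> fib A s \<Longrightarrow> b \<in> fib A s \<Longrightarrow>
          star A (add A a b) = add A (star A a) (star A b)"
    and star_scale: "a \<in> fib A s \<Longrightarrow> star A (scale A z a) = scale A (cnj z) (star A a)"
    and star_star: "a \<in> fib A s \<Longrightarrow> star A (star A a) = a"
    and nrm_star: "a \<in> fib A s \<Longrightarrow> nrm A (star A a) = nrm A a"
    and star_mul: "a \<in> fib A s \<Longrightarrow> b \<in> fib A t \<Longrightarrow>
          star A (mul A a b) = mul A (star A b) (star A a)"
    and cstar_identity: "a \<in> fib A s \<Longrightarrow> nrm A (mul A (star A a) a) = (nrm A a)\<^sup>2"
    and star_mul_positive: "a \<in> fib A s \<Longrightarrow> positive_in A (sinv s * s) (mul A (star A a) a)"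
    and incl_closed: "natural_le s t \<Longrightarrow> a \<in> fib A s \<Longrightarrow> incl A t s a \<in> fib A t"
    and incl_add: "natural_le s t \<Longrightarrow> a \<in> fib A s \<Longrightarrow> b \<in> fib A s \<Longrightarrow>
          incl A t s (add A a b) = add A (incl A t s a) (incl A t s b)"
    and incl_scale: "natural_le s t \<Longrightarrow> a \<in> fib A s \<Longrightarrow>
          incl A t s (scale A z a) = scale A z (incl A t s a)"
    and nrm_incl: "natural_le s t \<Longrightarrow> a \<in> fib A s \<Longrightarrow> nrm A (incl A t s a) = nrm A a"
    and incl_incl: "natural_le r s \<Longrightarrow> natural_le s t \<Longrightarrow> a \<in> fib A r \<Longrightarrow>
          incl A t r a = incl A t s (incl A s r a)"
    and incl_mul: "natural_le s t \<Longrightarrow> natural_le u v \<Longrightarrow> a \<in> fib A s \<Longrightarrow> b \<in> fib A u \<Longrightarrow>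
          mul A (incl A t s a) (incl A v u b) = incl A (t * v) (s * u) (mul A a b)"
    and incl_star: "natural_le s t \<Longrightarrow> a \<in> fib A s \<Longrightarrow>
          star A (incl A t s a) = incl A (sinv t) (sinv s) (star A a)"

inductive_set fspan :: "('s, 'a) fell \<Rightarrow> 's \<Rightarrow> 'a set \<Rightarrow> 'a set"
  for A s M where
  zero: "zero A s \<in> fspan A s M"
| step: "m \<in> M \<Longrightarrow> x \<in> fspan A s M \<Longrightarrow> add A (scale A z m) x \<in> fspan A s M"

definition closed_fspan :: "('s, 'a) fell \<Rightarrow> 's \<Rightarrow> 'a set \<Rightarrow> 'a set" where
  "closed_fspan A s M = {x \<in> fib A s. \<forall>\<epsilon>>0. \<exists>y\<in>fspan A s M. fdist A x y < \<epsilon>}"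

definition saturated :: "('s :: inverse_semigroup, 'a) fell \<Rightarrow> bool" where
  "saturated A \<longleftrightarrow>
     (\<forall>s t. closed_fspan A (s * t) {mul A a b | a b. a \<in> fib A s \<and> b \<in> fib A t} = fib A (s * t))"

definition semi_abelian :: "('s :: inverse_semigroup, 'a) fell \<Rightarrow> bool" where
  "semi_abelian A \<longleftrightarrow> (\<forall>e. idem e \<longrightarrow> (\<forall>a\<in>fib A e. \<forall>b\<in>fib A e. mul A a b = mul A b a))"


section \<open>Refinements\<close>

definition fell_morphism ::
  "('t :: inverse_semigroup, 'b) fell \<Rightarrow> ('s :: inverse_semigroup, 'a) fell \<Rightarrow> ('t \<Rightarrow> 's) \<Rightarrow> ('b \<Rightarrow> 'a) \<Rightarrow> bool"
  where
  "fell_morphism B A \<phi> \<psi> \<longleftrightarrow>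
     (\<forall>t t'. \<phi> (t * t') = \<phi> t * \<phi> t') \<and>
     (\<forall>t. \<forall>a\<in>fib B t. \<psi> a \<in> fib A (\<phi> t)) \<and>
     (\<forall>t. \<forall>a\<in>fib B t. \<forall>b\<in>fib B t. \<psi> (add B a b) = add A (\<psi> a) (\<psi> b)) \<and>
     (\<forall>t z. \<forall>a\<in>fib B t. \<psi> (scale B z a) = scale A z (\<psi> a)) \<and>
     (\<forall>t t'. \<forall>a\<in>fib B t. \<forall>b\<in>fib B t'. \<psi> (mul B a b) = mul A (\<psi> a) (\<psi> b)) \<and>
     (\<forall>t. \<forall>a\<in>fib B t. \<psi> (star B a) = star A (\<psi> a)) \<and>
     (\<forall>t t'. natural_le t t' \<longrightarrow>
        (\<forall>a\<in>fib B t. \<psi> (incl B t' t a) = incl A (\<phi> t') (\<phi> t) (\<psi> a)))"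

definition refinement ::
  "('t :: inverse_semigroup, 'b) fell \<Rightarrow> ('s :: inverse_semigroup, 'a) fell \<Rightarrow> bool"
  where
  "refinement B A \<longleftrightarrow>
     (\<exists>\<phi> \<psi>. fell_morphism B A \<phi> \<psi> \<and>
        surj \<phi> \<and> (\<forall>t. idem (\<phi> t) \<longrightarrow> idem t) \<and>
        (\<forall>t. inj_on \<psi> (fib B t)) \<and>
        (\<forall>s. fib A s = closed_fspan A s (\<Union>t\<in>\<phi> -` {s}. \<psi> ` fib B t)))"


section \<open>The universal $C^*$-algebra of the restriction to the idempotents\<close>

type_synonym 'i vec = "'i \<Rightarrow> complex"
type_synonym 'i op = "'i vec \<Rightarrow> 'i vec"

definition ell2 :: "'i vec set"
  where "ell2 = {x. (\<lambda>i. (cmod (x i))\<^sup>2) summable_on UNIV}"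

definition ell2_norm :: "'i vec \<Rightarrow> real"
  where "ell2_norm x = sqrt (\<Sum>\<^sub>\<infinity>i. (cmod (x i))\<^sup>2)"

definition ell2_inner :: "'i vec \<Rightarrow> 'i vec \<Rightarrow> complex"
  where "ell2_inner x y = (\<Sum>\<^sub>\<infinity>i. cnj (x i) * y i)"

definition bounded_ops :: "'i op set" where
  "bounded_ops = {T \<in> ell2 \<rightarrow>\<^sub>E ell2.
     (\<forall>x\<in>ell2. \<forall>y\<in>ell2. T (\<lambda>i. x i + y i) = (\<lambda>i. T x i + T y i)) \<and>
     (\<forall>z. \<forall>x\<in>ell2. T (\<lambda>i. z * x i) = (\<lambda>i. z * T x i)) \<and>
     (\<exists>K. \<forall>x\<in>ell2. ell2_norm (T x) \<le> K * ell2_norm x)}"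

definition op_add :: "'i op \<Rightarrow> 'i op \<Rightarrow> 'i op"
  where "op_add S T = (\<lambda>x\<in>ell2. \<lambda>i. S x i + T x i)"

definition op_scale :: "complex \<Rightarrow> 'i op \<Rightarrow> 'i op"
  where "op_scale z T = (\<lambda>x\<in>ell2. \<lambda>i. z * T x i)"

definition op_mul :: "'i op \<Rightarrow> 'i op \<Rightarrow> 'i op"
  where "op_mul S T = compose ell2 S T"

definition is_adjoint :: "'i op \<Rightarrow> 'i op \<Rightarrow> bool"
  where "is_adjoint S T \<longleftrightarrow> (\<forall>x\<in>ell2. \<forall>y\<in>ell2. ell2_inner (S x) y = ell2_inner x (T y))"

definition idem_part :: "('s :: inverse_semigroup, 'a) fell \<Rightarrow> 'a set"
  where "idem_part A = (\<Union>e\<in>{e. idem e}. fib A e)"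

text \<open>
  Representations of \<open>\<E> = {\<A>\<^sub>e}\<close> on the Hilbert space \<open>\<ell>\<^sup>2('a)\<close>, where \<^typ>\<open>'a\<close> is the type hosting
  the bundle; they are allowed to be degenerate. Quantifying over this one Hilbert space loses
  nothing: every representation of \<open>\<E>\<close> is the direct sum of a zero representation and of cyclic
  ones; a cyclic representation space is spanned topologically by the vectors \<open>\<pi>(a)\<xi>\<close>, \<open>a \<in> \<E>\<close>,
  hence its dimension is at most the cardinality of \<^typ>\<open>'a\<close> and it embeds isometrically into
  \<open>\<ell>\<^sup>2('a)\<close>, where one extends by zero. So the supremum of \<open>\<parallel>\<Sum>\<pi>(a\<^sub>i)\<parallel>\<close> over all representations is
  already the supremum over these.
\<close>

definition reps :: "('s :: inverse_semigroup, 'a) fell \<Rightarrow> ('a \<Rightarrow> 'a op) set" where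
  "reps A = {\<pi> \<in> idem_part A \<rightarrow>\<^sub>E bounded_ops.
     (\<forall>e. idem e \<longrightarrow> (\<forall>a\<in>fib A e. \<forall>b\<in>fib A e. \<pi> (add A a b) = op_add (\<pi> a) (\<pi> b))) \<and>
     (\<forall>z. \<forall>a\<in>idem_part A. \<pi> (scale A z a) = op_scale z (\<pi> a)) \<and>
     (\<forall>a\<in>idem_part A. \<forall>b\<in>idem_part A. \<pi> (mul A a b) = op_mul (\<pi> a) (\<pi> b)) \<and>
     (\<forall>a\<in>idem_part A. is_adjoint (\<pi> a) (\<pi> (star A a))) \<and>
     (\<forall>e f. idem e \<longrightarrow> idem f \<longrightarrow> natural_le e f \<longrightarrow> (\<forall>a\<in>fib A e. \<pi> (incl A f e a) = \<pi> a))}"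

text \<open>
  \<open>C\<^sup>*(\<E>)\<close> is the closure, in the \<open>\<ell>\<^sup>\<infinity>\<close>-product of copies of \<open>\<L>(\<ell>\<^sup>2('a))\<close> indexed by all
  representations, of the linear span of the elements \<open>ucan A a = (\<pi>(a))\<^sub>\<pi>\<close>, \<open>a \<in> \<E>\<close>. This span is a
  \<open>*\<close>-subalgebra since \<open>\<E>\<close> is closed under products and involution. All operations are pointwise.
\<close>

type_synonym 'a uelem = "('a \<Rightarrow> 'a op) \<Rightarrow> 'a op"

definition ucan :: "('s :: inverse_semigroup, 'a) fell \<Rightarrow> 'a \<Rightarrow> 'a uelem"
  where "ucan A a = (\<lambda>\<pi>\<in>reps A. \<pi> a)"

definition uadd :: "('s :: inverse_semigroup, 'a) fell \<Rightarrow> 'a uelem \<Rightarrow> 'a uelem \<Rightarrow> 'a uelem"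
  where "uadd A S T = (\<lambda>\<pi>\<in>reps A. op_add (S \<pi>) (T \<pi>))"

definition uscale :: "('s :: inverse_semigroup, 'a) fell \<Rightarrow> complex \<Rightarrow> 'a uelem \<Rightarrow> 'a uelem"
  where "uscale A z T = (\<lambda>\<pi>\<in>reps A. op_scale z (T \<pi>))"

definition umul :: "('s :: inverse_semigroup, 'a) fell \<Rightarrow> 'a uelem \<Rightarrow> 'a uelem \<Rightarrow> 'a uelem"
  where "umul A S T = (\<lambda>\<pi>\<in>reps A. op_mul (S \<pi>) (T \<pi>))"

inductive_set uspan :: "('s :: inverse_semigroup, 'a) fell \<Rightarrow> 'a uelem set" for A where
  zero: "(\<lambda>\<pi>\<in>reps A. \<lambda>x\<in>ell2. \<lambda>i. 0) \<in> uspan A"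
| step: "a \<in> idem_part A \<Longrightarrow> T \<in> uspan A \<Longrightarrow> uadd A (uscale A z (ucan A a)) T \<in> uspan A"

definition universal_cstar :: "('s :: inverse_semigroup, 'a) fell \<Rightarrow> 'a uelem set" where
  "universal_cstar A = {T \<in> reps A \<rightarrow>\<^sub>E bounded_ops.
     \<forall>\<epsilon>>0. \<exists>R\<in>uspan A. \<forall>\<pi>\<in>reps A. \<forall>x\<in>ell2.
       ell2_norm (\<lambda>i. T \<pi> x i - R \<pi> x i) \<le> \<epsilon> * ell2_norm x}"

text \<open>
  The space \<open>X\<close> with \<open>C\<^sup>*(\<E>) \<cong> C\<^sub>0(X)\<close> is the Gelfand spectrum of \<open>C\<^sup>*(\<E>)\<close>: its characters, with the
  topology of pointwise convergence.
\<close>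

type_synonym 'a point = "'a uelem \<Rightarrow> complex"

definition spectrum :: "('s :: inverse_semigroup, 'a) fell \<Rightarrow> 'a point set" where
  "spectrum A = {x \<in> universal_cstar A \<rightarrow>\<^sub>E UNIV.
     (\<forall>S\<in>universal_cstar A. \<forall>T\<in>universal_cstar A. x (uadd A S T) = x S + x T) \<and>
     (\<forall>z. \<forall>T\<in>universal_cstar A. x (uscale A z T) = z * x T) \<and>
     (\<forall>S\<in>universal_cstar A. \<forall>T\<in>universal_cstar A. x (umul A S T) = x S * x T) \<and>
     (\<exists>T\<in>universal_cstar A. x T \<noteq> 0)}"

definition spectrum_top :: "('s :: inverse_semigroup, 'a) fell \<Rightarrow> 'a point topology" where
  "spectrum_top A = subtopology (product_topology (\<lambda>_. euclidean) (universal_cstar A)) (spectrum A)"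

text \<open>The value \<open>a(x)\<close> of \<open>a \<in> \<E>\<close> at \<open>x \<in> X\<close>, and the open set \<open>\<U>\<^sub>e\<close> with \<open>\<A>\<^sub>e = C\<^sub>0(\<U>\<^sub>e)\<close>.\<close>

definition ev :: "('s :: inverse_semigroup, 'a) fell \<Rightarrow> 'a \<Rightarrow> 'a point \<Rightarrow> complex"
  where "ev A a x = x (ucan A a)"

definition supp :: "('s :: inverse_semigroup, 'a) fell \<Rightarrow> 's \<Rightarrow> 'a point set"
  where "supp A e = {x \<in> spectrum A. \<exists>a\<in>fib A e. ev A a x \<noteq> 0}"


section \<open>Twisted groupoids\<close>

text \<open>
  In these records every structure map is given by its graph, because in the construction below it
  is prescribed on representatives of equivalence classes: \<open>(g, h, k) \<in> gmul G\<close> says that \<open>(g, h)\<close> is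
  composable with product \<open>k\<close>. The field \<open>unit\<close> is the identification of the space \<open>X\<close> with the unit
  space of the groupoid; \<open>emb\<close> and \<open>proj\<close> are the maps of the extension
  \<open>\<T> \<times> X \<hookrightarrow> \<Sigma> \<rightarrow> \<G>\<close>.
\<close>

record 'g top_groupoid =
  gtop :: "'g topology"
  gmul :: "('g \<times> 'g \<times> 'g) set"
  ginv :: "('g \<times> 'g) set"

record ('x, 'g, 'w) twisted_groupoid =
  base :: "'x topology"
  grpd :: "'g top_groupoid"
  twist :: "'w top_groupoid"
  unit :: "('x \<times> 'g) set"
  emb :: "((complex \<times> 'x) \<times> 'w) set"
  proj :: "('w \<times> 'g) set"

definition top_groupoid_iso :: "'g top_groupoid \<Rightarrow> 'h top_groupoid \<Rightarrow> ('g \<Rightarrow> 'h) \<Rightarrow> bool" where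
  "top_groupoid_iso G H f \<longleftrightarrow>
     homeomorphic_map (gtop G) (gtop H) f \<and>
     (\<forall>g\<in>topspace (gtop G). \<forall>h\<in>topspace (gtop G). \<forall>k\<in>topspace (gtop G).
        (g, h, k) \<in> gmul G \<longleftrightarrow> (f g, f h, f k) \<in> gmul H) \<and>
     (\<forall>g\<in>topspace (gtop G). \<forall>h\<in>topspace (gtop G). (g, h) \<in> ginv G \<longleftrightarrow> (f g, f h) \<in> ginv H)"

definition twisted_groupoid_isomorphic ::
  "('x, 'g, 'w) twisted_groupoid \<Rightarrow> ('x', 'g', 'w') twisted_groupoid \<Rightarrow> bool"
  where
  "twisted_groupoid_isomorphic G H \<longleftrightarrow>
     (\<exists>h f F. homeomorphic_map (base G) (base H) h \<and>
        top_groupoid_iso (grpd G) (grpd H) f \<and>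
        top_groupoid_iso (twist G) (twist H) F \<and>
        (\<forall>x\<in>topspace (base G). \<forall>g\<in>topspace (gtop (grpd G)).
           (x, g) \<in> unit G \<longleftrightarrow> (h x, f g) \<in> unit H) \<and>
        (\<forall>z\<in>sphere 0 1. \<forall>x\<in>topspace (base G). \<forall>w\<in>topspace (gtop (twist G)).
           ((z, x), w) \<in> emb G \<longleftrightarrow> ((z, h x), F w) \<in> emb H) \<and>
        (\<forall>w\<in>topspace (gtop (twist G)). \<forall>g\<in>topspace (gtop (grpd G)).
           (w, g) \<in> proj G \<longleftrightarrow> (F w, f g) \<in> proj H))"


section \<open>The twisted groupoid of a Fell bundle\<close>

text \<open>Here \<open>0 < z\<close> for a complex number \<open>z\<close> means that \<open>z\<close> is real and positive.\<close>

definition dom_of :: "('s :: inverse_semigroup, 'a) fell \<Rightarrow> 'a \<Rightarrow> 'a point set"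
  where "dom_of A b = {y \<in> spectrum A. 0 < ev A (mul A (star A b) b) y}"

definition theta_elem :: "('s :: inverse_semigroup, 'a) fell \<Rightarrow> 'a \<Rightarrow> 'a point \<Rightarrow> 'a point" where
  "theta_elem A b y = (THE z. z \<in> spectrum A \<and>
     (\<forall>a\<in>idem_part A.
        ev A (mul A (mul A (star A b) a) b) y = ev A a z * ev A (mul A (star A b) b) y))"

definition theta :: "('s :: inverse_semigroup, 'a) fell \<Rightarrow> 's \<Rightarrow> 'a point \<Rightarrow> 'a point" where
  "theta A s x = (THE z. \<exists>b\<in>fib A s. x \<in> dom_of A b \<and> z = theta_elem A b x)"

definition germ_rel ::
  "('s :: inverse_semigroup, 'a) fell \<Rightarrow> (('s \<times> 'a point) \<times> ('s \<times> 'a point)) set"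
  where
  "germ_rel A = {((s, x), (s', x')). x \<in> supp A (sinv s * s) \<and> x' \<in> supp A (sinv s' * s') \<and>
     x = x' \<and> (\<exists>e. idem e \<and> s * e = s' * e \<and> x \<in> supp A e)}"

definition germ :: "('s :: inverse_semigroup, 'a) fell \<Rightarrow> 's \<Rightarrow> 'a point \<Rightarrow> ('s \<times> 'a point) set"
  where "germ A s x = germ_rel A `` {(s, x)}"

definition germ_groupoid ::
  "('s :: inverse_semigroup, 'a) fell \<Rightarrow> ('s \<times> 'a point) set top_groupoid"
  where
  "germ_groupoid A = \<lparr>
     gtop = topology_generated_by
       {germ A s ` U | s U. U \<subseteq> supp A (sinv s * s) \<and> openin (spectrum_top A) U},
     gmul = {(germ A s (theta A t y), germ A t y, germ A (s * t) y) | s t y.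
       y \<in> supp A (sinv t * t) \<and> theta A t y \<in> supp A (sinv s * s)},
     ginv = {(germ A s x, germ A (sinv s) (theta A s x)) | s x. x \<in> supp A (sinv s * s)}\<rparr>"

definition twist_rel ::
  "('s :: inverse_semigroup, 'a) fell \<Rightarrow> (('a \<times> 's \<times> 'a point) \<times> ('a \<times> 's \<times> 'a point)) set"
  where
  "twist_rel A = {((b, s, x), (b', s', x')).
     b \<in> fib A s \<and> x \<in> dom_of A b \<and> b' \<in> fib A s' \<and> x' \<in> dom_of A b' \<and> x = x' \<and>
     (\<exists>c\<in>idem_part A. \<exists>c'\<in>idem_part A.
        0 < ev A c x \<and> 0 < ev A c' x \<and> mul A b c = mul A b' c')}"

definition twist_class ::
  "('s :: inverse_semigroup, 'a) fell \<Rightarrow> 'a \<Rightarrow> 's \<Rightarrow> 'a point \<Rightarrow> ('a \<times> 's \<times> 'a point) set"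
  where "twist_class A b s x = twist_rel A `` {(b, s, x)}"

definition twist_groupoid ::
  "('s :: inverse_semigroup, 'a) fell \<Rightarrow> ('a \<times> 's \<times> 'a point) set top_groupoid"
  where
  "twist_groupoid A = \<lparr>
     gtop = topology_generated_by
       {{twist_class A (scale A z b) s x | z x. z \<in> V \<and> x \<in> U} | b s U V.
          b \<in> fib A s \<and> U \<subseteq> dom_of A b \<and> openin (spectrum_top A) U \<and>
          openin (top_of_set (sphere 0 1)) V},
     gmul = {(twist_class A a s (theta_elem A b y), twist_class A b t y,
              twist_class A (mul A a b) (s * t) y) | a b s t y.
       a \<in> fib A s \<and> b \<in> fib A t \<and> y \<in> dom_of A b \<and> theta_elem A b y \<in> dom_of A a},
     ginv = {(twist_class A b s x, twist_class A (star A b) (sinv s) (theta_elem A b x)) | b s x.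
       b \<in> fib A s \<and> x \<in> dom_of A b}\<rparr>"

definition associated_twisted_groupoid ::
  "('s :: inverse_semigroup, 'a) fell \<Rightarrow>
     ('a point, ('s \<times> 'a point) set, ('a \<times> 's \<times> 'a point) set) twisted_groupoid"
  where
  "associated_twisted_groupoid A = \<lparr>
     base = spectrum_top A,
     grpd = germ_groupoid A,
     twist = twist_groupoid A,
     unit = {(x, germ A e x) | e x. idem e \<and> x \<in> supp A e},
     emb = {((z, x), twist_class A (scale A z c) e x) | z c e x.
       z \<in> sphere 0 1 \<and> idem e \<and> c \<in> fib A e \<and> x \<in> spectrum A \<and> 0 < ev A c x},
     proj = {(twist_class A b s x, germ A s x) | b s x. b \<in> fib A s \<and> x \<in> dom_of A b}\<rparr>"

end

theory Submission
  imports Defs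
begin

text \<open>
  The isomorphism is induced by the refinement morphism \<open>(\<phi>, \<psi>)\<close>: on base spaces by an extension \<open>h\<close>
  of characters along \<open>\<psi>\<close>, on groupoids by \<open>[t, x] \<mapsto> [\<phi> t, h x]\<close> and on twists by
  \<open>[b, t, x] \<mapsto> [\<psi> b, \<phi> t, h x]\<close>.

  A point of the base space is the same as a character of the bundle over the idempotents
  (\<open>spectrum_of_char\<close>, \<open>spectrum_eqI\<close>): characters of \<open>C\<^sup>*(\<E>)\<close> restrict to \<open>\<E>\<close>, and conversely a
  character of \<open>\<E>\<close> is a representation by scalar operators and so factors through \<open>C\<^sup>*(\<E>)\<close>. The images
  \<open>\<psi>(fib B t)\<close> with \<open>\<phi> t = e\<close> span a dense subspace of \<open>fib A e\<close>. Hence \<open>y \<mapsto> y \<circ> \<psi>\<close> maps the space of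
  \<open>A\<close> to that of \<open>B\<close>, and it is injective. For surjectivity, a character \<open>x\<close> of \<open>B\<close> that does not
  vanish at \<open>b \<in> fib B f\<close> is extended to \<open>A\<close> by \<open>a \<mapsto> x(a b) / x(b)\<close>, where \<open>B\<close> is identified with its
  image (\<open>extend_point\<close>). Here \<open>\<psi>(fib B f)\<close> absorbs the products \<open>a b\<close>: by density and essential
  injectivity they are limits of elements of \<open>\<psi>(fib B f)\<close>, and this image is closed as \<open>\<psi>\<close> is
  isometric on \<open>fib B f\<close>. Uniform approximation shows that \<open>h\<close> is a homeomorphism
  (\<open>point_map_homeomorphic\<close>); it intertwines the partial homeomorphisms \<open>\<theta>\<close>, which are given by an
  algebraic formula.

  The facts of operator theory that enter are that injective homomorphisms of commutative
  \<open>C\<^sup>*\<close>-algebras are isometric, that representations and characters are contractive, and that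
  characters preserve the involution. They are derived from square roots, constructed by an
  iteration, and from geometric series.

  Germs correspond bijectively. Every arrow \<open>[s, h x]\<close> lifts: some \<open>b \<in> fib B t\<close> with \<open>\<phi> t = s\<close> does
  not vanish at \<open>x\<close>, again by density (\<open>lift_fibre\<close>). Conversely, if \<open>\<phi> t\<close> and \<open>\<phi> t'\<close> agree on an
  idempotent whose support contains \<open>h x\<close>, restrict \<open>t\<close> and \<open>t'\<close> to an idempotent \<open>g\<close> of \<open>T\<close> lying
  over it; then \<open>p = t g\<close> and \<open>q = t' g\<close> have the same image, so \<open>\<phi>(p\<^sup>*q)\<close> and \<open>\<phi>(pq\<^sup>*)\<close> are idempotent,
  and by essential injectivity \<open>p\<^sup>*q\<close> and \<open>pq\<^sup>*\<close> are idempotent, that is, \<open>p\<close> and \<open>q\<close> are compatible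
  and agree near \<open>x\<close> (\<open>agree_near_point\<close>).

  For the twists the main point is that in a semi-abelian bundle two elements \<open>b, b'\<close> of one fibre
  behave like sections of a line bundle: \<open>b' (b\<^sup>*b) = b (b\<^sup>*b')\<close> (\<open>same_fibre_exchange\<close>). So at a point
  their classes differ by the phase of \<open>(b\<^sup>*b')(x)\<close>, and positivity of this number, which decides
  whether the classes coincide, is preserved and reflected by \<open>\<psi>\<close>. Since the phase depends
  continuously on the point, the comparison of the twists is a homeomorphism as well
  (\<open>twist_map_homeomorphic\<close>).
\<close>

section \<open>Inverse semigroups\<close>

context inverse_semigroup
begin

lemma sinv_left: "s * sinv s * s = s" and sinv_right: "sinv s * s * sinv s = sinv s"
  using theI'[OF ex1_inverse[of s]] unfolding sinv_def by auto

lemma sinv_eqI: "s * t * s = s \<Longrightarrow> t * s * t = t \<Longrightarrow> sinv s = t"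
  using ex1_inverse[of s] sinv_left sinv_right by blast

lemma sinv_sinv [simp]: "sinv (sinv s) = s"
  by (intro sinv_eqI sinv_left sinv_right)

lemma sinv_idem: "idem e \<Longrightarrow> sinv e = e"
  by (intro sinv_eqI) (auto simp: idem_def)

text \<open>The inverse \<open>x\<close> of \<open>e f\<close> is also given by \<open>f x e\<close>, and this makes \<open>x\<close> idempotent.\<close>

lemma idem_mult:
  assumes "idem e" "idem f" shows "idem (e * f)"
proof -
  define x where "x = sinv (e * f)"
  have ee: "e * e = e" "\<And>z. e * (e * z) = e * z" and ff: "f * f = f" "\<And>z. f * (f * z) = f * z"
    using assms by (metis idem_def mult.assoc)+
  have 1: "e * (f * (x * (e * f))) = e * f" and 2: "x * (e * (f * x)) = x"
    using sinv_left[of "e * f"] sinv_right[of "e * f"] by (simp_all add: x_def mult.assoc)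
  have 3: "f * (x * (e * (f * (x * e)))) = f * (x * e)"
    using arg_cong[OF 2, of "\<lambda>z. f * (z * e)"] by (simp add: mult.assoc)
  have fxe: "x = f * x * e"
    unfolding x_def by (rule sinv_eqI) (simp_all add: mult.assoc ee ff x_def[symmetric] 1 3)
  have "x * x = f * (x * (e * (f * (x * e))))" by (subst (1 2) fxe) (simp add: mult.assoc)
  also have "\<dots> = x" using 3 fxe by (simp add: mult.assoc)
  finally have "idem x" by (simp add: idem_def)
  moreover have "e * f = sinv x" by (simp add: x_def)
  ultimately show ?thesis by (simp add: sinv_idem)
qed

lemma idem_commute:
  assumes "idem e" "idem f" shows "e * f = f * e"
proof -
  have ee: "e * e = e" "\<And>z. e * (e * z) = e * z" and ff: "f * f = f" "\<And>z. f * (f * z) = f * z"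
    using assms by (metis idem_def mult.assoc)+
  have "e * (f * (e * f)) = e * f" "f * (e * (f * e)) = f * e"
    using idem_mult[of e f] idem_mult[of f e] assms by (simp_all add: idem_def mult.assoc)
  then have "sinv (e * f) = f * e" by (intro sinv_eqI) (simp_all add: mult.assoc ee ff)
  then show ?thesis using sinv_idem[OF idem_mult[OF assms]] by simp
qed

lemma idem_sinv_mult [simp]: "idem (sinv s * s)" "idem (s * sinv s)"
  using sinv_left[of s] sinv_right[of s] by (simp_all add: idem_def mult.assoc)

lemma sinv_mult: "sinv (s * t) = sinv t * sinv s"
proof (rule sinv_eqI)
  have c: "t * sinv t * (sinv s * s) = sinv s * s * (t * sinv t)" by (rule idem_commute) simp_all
  have "s * t * (sinv t * sinv s) * (s * t) = s * (t * sinv t * (sinv s * s)) * t"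
    by (simp add: mult.assoc)
  also have "\<dots> = (s * sinv s * s) * (t * sinv t * t)" unfolding c by (simp add: mult.assoc)
  finally show "s * t * (sinv t * sinv s) * (s * t) = s * t" by (simp only: sinv_left)
  have "sinv t * sinv s * (s * t) * (sinv t * sinv s) = sinv t * (sinv s * s * (t * sinv t)) * sinv s"
    by (simp add: mult.assoc)
  also have "\<dots> = (sinv t * t * sinv t) * (sinv s * s * sinv s)"
    unfolding c[symmetric] by (simp add: mult.assoc)
  finally show "sinv t * sinv s * (s * t) * (sinv t * sinv s) = sinv t * sinv s"
    by (simp only: sinv_right)
qed

lemma natural_le_idem: "idem e \<Longrightarrow> idem f \<Longrightarrow> natural_le (e * f) f"
  by (metis idem_mult idem_commute idem_def mult.assoc natural_le_def sinv_idem)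

lemma natural_le_refl: "natural_le s s"
  by (simp add: natural_le_def sinv_left)

text \<open>Two elements are \<^emph>\<open>compatible\<close> if \<open>p\<^sup>*q\<close> and \<open>pq\<^sup>*\<close> are idempotent. Such elements agree
  on the largest idempotent on which both are defined.\<close>

lemma compatible_restrict_eq:
  assumes i: "idem (sinv p * q)" and k: "idem (p * sinv q)"
  shows "p * (sinv q * q) = q * (sinv p * p)"
proof -
  have k': "q * sinv p = p * sinv q" using sinv_idem[OF k] by (simp add: sinv_mult)
  have "q * sinv p = (p * sinv q) * (q * sinv p)" using k unfolding k' by (simp add: idem_def)
  then have "q * (sinv p * q) = p * ((sinv q * q) * (sinv p * q))"
    using arg_cong[of _ _ "\<lambda>z. z * q"] by (metis mult.assoc)
  also have "\<dots> = p * ((sinv p * q) * (sinv q * q))" by (simp add: idem_commute i)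
  also have "\<dots> = p * (sinv p * (q * sinv q * q))" by (simp add: mult.assoc)
  also have "\<dots> = p * sinv p * q" by (simp only: sinv_left mult.assoc[of p "sinv p" q])
  finally have 1: "q * (sinv p * q) = p * sinv p * q" .
  have i': "sinv q * p = sinv p * q" using sinv_idem[OF i] by (simp add: sinv_mult)
  have "p * (sinv q * q) = q * (sinv p * q)" by (metis k' mult.assoc)
  also have "\<dots> = p * (sinv q * p)" unfolding 1 i' by (simp add: mult.assoc)
  also have "\<dots> = q * (sinv p * p)" by (metis k' mult.assoc)
  finally show ?thesis .
qed

lemma compatible_agree:
  assumes "idem (sinv p * q)" and "idem (p * sinv q)"
  shows "p * ((sinv p * p) * (sinv q * q)) = q * ((sinv p * p) * (sinv q * q))"
proof -
  have "p * ((sinv p * p) * (sinv q * q)) = p * (sinv q * q)"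
    by (metis mult.assoc sinv_left)
  also have "\<dots> = q * (sinv p * p)" by (rule compatible_restrict_eq[OF assms])
  also have "\<dots> = q * ((sinv q * q) * (sinv p * p))" by (metis mult.assoc sinv_left)
  finally show ?thesis by (simp add: idem_commute[of "sinv q * q"])
qed

end

lemma hom_sinv:
  fixes \<phi> :: "'t :: inverse_semigroup \<Rightarrow> 's :: inverse_semigroup"
  assumes "\<And>a b. \<phi> (a * b) = \<phi> a * \<phi> b"
  shows "\<phi> (sinv t) = sinv (\<phi> t)"
  by (rule sinv_eqI[symmetric]) (metis assms sinv_left sinv_right)+

lemma hom_idem:
  fixes \<phi> :: "'t :: inverse_semigroup \<Rightarrow> 's :: inverse_semigroup"
  assumes "\<And>a b. \<phi> (a * b) = \<phi> a * \<phi> b" and "idem e"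
  shows "idem (\<phi> e)"
  by (metis assms idem_def)


section \<open>Commutative $C^*$-algebras\<close>

text \<open>Commutative $C^*$-algebras, possibly without a unit, as real Banach algebras with an involution
  \<open>adj\<close> and the multiplication \<open>imul\<close> by the imaginary unit.\<close>

class comm_cstar = real_normed_algebra + ab_semigroup_mult + banach +
  fixes adj :: "'a \<Rightarrow> 'a" and imul :: "'a \<Rightarrow> 'a"
  assumes adj_add: "adj (x + y) = adj x + adj y"
    and adj_scaleR: "adj (scaleR r x) = scaleR r (adj x)"
    and adj_mult: "adj (x * y) = adj y * adj x"
    and adj_adj [simp]: "adj (adj x) = x"
    and imul_add: "imul (x + y) = imul x + imul y"
    and imul_scaleR: "imul (scaleR r x) = scaleR r (imul x)"
    and imul_imul [simp]: "imul (imul x) = - x"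
    and imul_mult: "imul x * y = imul (x * y)"
    and adj_imul: "adj (imul x) = - imul (adj x)"
    and norm_adj_mult: "norm (adj x * x) = (norm x)\<^sup>2"
begin

subclass comm_ring by standard (rule distrib_right)

lemma adj_0 [simp]: "adj 0 = 0" using adj_add[of 0 0] by simp
lemma adj_minus: "adj (- x) = - adj x"
  using adj_add[of x "- x"] by (simp add: eq_neg_iff_add_eq_0 add.commute)
lemma adj_diff: "adj (x - y) = adj x - adj y"
  using adj_add[of x "- y"] by (simp add: adj_minus)
lemma imul_0 [simp]: "imul 0 = 0" using imul_add[of 0 0] by simp
lemma imul_minus: "imul (- x) = - imul x"
  using imul_add[of x "- x"] by (simp add: eq_neg_iff_add_eq_0 add.commute)
lemma mult_imul: "x * imul y = imul (x * y)" by (metis imul_mult mult.commute)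

lemma norm_le_adj: "norm x \<le> norm (adj x)"
proof -
  have "(norm x)\<^sup>2 \<le> norm (adj x) * norm x"
    using norm_mult_ineq[of "adj x" x] by (simp add: norm_adj_mult)
  then show ?thesis by (cases "norm x = 0") (auto simp: power2_eq_square)
qed

lemma norm_adj [simp]: "norm (adj x) = norm x"
  using norm_le_adj[of x] norm_le_adj[of "adj x"] by simp

lemma norm_imul [simp]: "norm (imul x) = norm x"
proof -
  have "adj (imul x) * imul x = adj x * x"
    by (simp add: adj_imul imul_mult mult_imul imul_minus)
  then have "(norm (imul x))\<^sup>2 = (norm x)\<^sup>2" by (metis norm_adj_mult)
  then show ?thesis by simp
qed

end

text \<open>Think of \<open>1 - h + i s\<close> as a unitary in the unitization, with real part \<open>1 - h\<close> and imaginary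
  part \<open>s\<close>: multiplication by it is isometric, so its real and imaginary parts are contractions.\<close>

definition unitary_parts :: "'a :: comm_cstar \<Rightarrow> 'a \<Rightarrow> bool" where
  "unitary_parts h s \<longleftrightarrow> adj h = h \<and> adj s = s \<and> s * s + h * h = h + h"

lemma unitary_parts_isometric:
  fixes h s c :: "'a :: comm_cstar"
  assumes "unitary_parts h s"
  shows "norm (c - h * c + imul (s * c)) = norm c"
proof -
  have hs: "adj h = h" "adj s = s" "s * s = h + h - h * h"
    using assms by (auto simp: unitary_parts_def algebra_simps)
  let ?u = "c - h * c + imul (s * c)"
  have "adj ?u = adj c - h * adj c - imul (s * adj c)"
    by (simp add: adj_add adj_diff adj_mult adj_imul hs mult.commute)
  then have "adj ?u * ?u = (adj c - h * adj c - imul (s * adj c)) * ?u" by simp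
  also have "\<dots> = (adj c - h * adj c) * (c - h * c) + (s * adj c) * (s * c)"
    by (simp add: algebra_simps imul_mult mult_imul imul_add)
  also have "\<dots> = (adj c - h * adj c) * (c - h * c) + (s * s) * (adj c * c)"
    by (simp add: algebra_simps)
  also have "\<dots> = adj c * c" unfolding hs by (simp add: algebra_simps)
  finally have "(norm ?u)\<^sup>2 = (norm c)\<^sup>2" by (metis norm_adj_mult)
  then show ?thesis by simp
qed

lemma unitary_parts_minus: "unitary_parts h s \<Longrightarrow> unitary_parts h (- s)"
  by (simp add: unitary_parts_def adj_minus)

lemma unitary_parts_contract:
  fixes h s c :: "'a :: comm_cstar"
  assumes "unitary_parts h s"
  shows "norm (c - h * c) \<le> norm c" and "norm (s * c) \<le> norm c" and "norm s \<le> 1"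
proof -
  let ?u = "c - h * c + imul (s * c)" and ?v = "c - h * c + imul (- s * c)"
  have u: "norm ?u = norm c" by (rule unitary_parts_isometric[OF assms])
  have v: "norm ?v = norm c" by (rule unitary_parts_isometric[OF unitary_parts_minus[OF assms]])
  have "2 *\<^sub>R (c - h * c) = ?u + ?v" by (simp add: scaleR_2 imul_minus)
  then have "2 * norm (c - h * c) \<le> norm ?u + norm ?v"
    by (metis norm_triangle_ineq norm_scaleR abs_numeral)
  then show "norm (c - h * c) \<le> norm c" using u v by simp
  have s: "norm (s * c) \<le> norm c" for c
  proof -
    let ?u = "c - h * c + imul (s * c)" and ?v = "c - h * c + imul (- s * c)"
    have "2 *\<^sub>R imul (s * c) = ?u - ?v" by (simp add: scaleR_2 imul_minus)
    then have "2 * norm (imul (s * c)) \<le> norm ?u + norm ?v"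
      by (metis norm_triangle_ineq4 norm_scaleR abs_numeral)
    then show ?thesis
      using unitary_parts_isometric[OF assms, of c]
        unitary_parts_isometric[OF unitary_parts_minus[OF assms], of c] by simp
  qed
  show "norm (s * c) \<le> norm c" by (rule s)
  have "(norm s)\<^sup>2 \<le> norm s"
    using s[of s] norm_adj_mult[of s] assms by (simp add: unitary_parts_def)
  then show "norm s \<le> 1" by (cases "norm s = 0") (auto simp: power2_eq_square)
qed

text \<open>The iteration \<open>v \<mapsto> (w + v\<^sup>2)/2\<close> solves \<open>2v - v\<^sup>2 = w\<close>, that is, \<open>(1 - v)\<^sup>2 = 1 - w\<close>. Its
  iterates are polynomials in \<open>w\<close> with nonnegative coefficients, so for \<open>\<parallel>w\<parallel> \<le> 1\<close> they are
  dominated by the iterates for the number \<open>w = 1\<close>, which increase to \<open>1\<close>; this covers the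
  boundary case \<open>\<parallel>w\<parallel> = 1\<close>, in which the map is not a strict contraction.\<close>

primrec sqrt_iter :: "'a :: real_algebra \<Rightarrow> nat \<Rightarrow> 'a" where
  "sqrt_iter w 0 = 0"
| "sqrt_iter w (Suc k) = (1/2) *\<^sub>R (w + sqrt_iter w k * sqrt_iter w k)"

lemma norm_sqrt_iter_le:
  fixes w :: "'a :: real_normed_algebra"
  assumes "norm w \<le> t" and "(t + r\<^sup>2) / 2 \<le> r" and "0 \<le> r"
  shows "norm (sqrt_iter w k) \<le> r"
proof (induction k)
  case (Suc k)
  let ?v = "sqrt_iter w k"
  have "norm (w + ?v * ?v) \<le> norm w + norm (?v * ?v)" by (rule norm_triangle_ineq)
  also have "\<dots> \<le> t + r\<^sup>2"
    using assms Suc norm_mult_ineq[of ?v ?v] mult_mono[OF Suc Suc] by (simp add: power2_eq_square)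
  finally show ?case using assms by simp
qed (use assms in simp)

lemma sqrt_iter_one: "0 \<le> sqrt_iter (1::real) k" "sqrt_iter (1::real) k \<le> 1"
  "sqrt_iter (1::real) k \<le> sqrt_iter 1 (Suc k)"
proof -
  show 0: "0 \<le> sqrt_iter (1::real) k" for k by (induction k) auto
  show "sqrt_iter (1::real) k \<le> 1" using norm_sqrt_iter_le[of "1::real" 1 1 k] by simp
  have "0 \<le> (1 - sqrt_iter (1::real) k)\<^sup>2" by simp
  then show "sqrt_iter (1::real) k \<le> sqrt_iter 1 (Suc k)"
    by (simp add: power2_eq_square algebra_simps)
qed

lemma sqrt_iter_dominated:
  fixes w :: "'a :: comm_cstar"
  assumes w: "norm w \<le> 1"
  shows "norm (sqrt_iter w k) \<le> sqrt_iter 1 k"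
    and "norm (sqrt_iter w (Suc k) - sqrt_iter w k) \<le> sqrt_iter 1 (Suc k) - sqrt_iter 1 k"
proof -
  show 1: "norm (sqrt_iter w k) \<le> sqrt_iter 1 k" for k
  proof (induction k)
    case (Suc k)
    let ?v = "sqrt_iter w k"
    have "norm (w + ?v * ?v) \<le> norm w + norm (?v * ?v)" by (rule norm_triangle_ineq)
    also have "\<dots> \<le> 1 + sqrt_iter 1 k * sqrt_iter 1 k"
      using w norm_mult_ineq[of ?v ?v] mult_mono[OF Suc Suc] sqrt_iter_one(1)[of k] by simp
    finally show ?case by simp
  qed simp
  show "norm (sqrt_iter w (Suc k) - sqrt_iter w k) \<le> sqrt_iter 1 (Suc k) - sqrt_iter 1 k"
  proof (induction k)
    case (Suc k)
    let ?a = "sqrt_iter w (Suc k)" and ?b = "sqrt_iter w k"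
    let ?s = "sqrt_iter (1::real) (Suc k)" and ?t = "sqrt_iter (1::real) k"
    have "sqrt_iter w (Suc (Suc k)) - ?a = (1/2) *\<^sub>R (?a * ?a - ?b * ?b)"
      unfolding sqrt_iter.simps(2)[of w "Suc k"] by (simp add: algebra_simps)
    also have "?a * ?a - ?b * ?b = (?a + ?b) * (?a - ?b)" by (simp only: algebra_simps)
    finally have "norm (sqrt_iter w (Suc (Suc k)) - ?a) = norm ((?a + ?b) * (?a - ?b)) / 2" by simp
    also have "\<dots> \<le> norm (?a + ?b) * norm (?a - ?b) / 2"
      by (simp add: norm_mult_ineq divide_right_mono)
    also have "\<dots> \<le> (?s + ?t) * (?s - ?t) / 2"
      using norm_triangle_le[OF add_mono[OF 1[of "Suc k"] 1[of k]]] Suc sqrt_iter_one(1)[of k]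
        sqrt_iter_one(1)[of "Suc k"]
      by (intro divide_right_mono mult_mono) simp_all
    also have "\<dots> = sqrt_iter 1 (Suc (Suc k)) - ?s"
      unfolding sqrt_iter.simps(2)[of _ "Suc k"] by (simp add: field_simps)
    finally show ?case .
  qed (use w in simp)
qed

lemma adj_tendsto:
  fixes x :: "nat \<Rightarrow> 'a :: comm_cstar"
  assumes "x \<longlonglongrightarrow> l" shows "(\<lambda>n. adj (x n)) \<longlonglongrightarrow> adj l"
  using assms by (simp add: LIMSEQ_iff adj_diff[symmetric])

lemma one_minus_sqrt:
  fixes w :: "'a :: comm_cstar"
  assumes w: "norm w \<le> 1" "adj w = w"
  obtains v where "sqrt_iter w \<longlonglongrightarrow> v" "adj v = v" "v + v = w + v * v" "norm v \<le> 1"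
proof -
  let ?t = "sqrt_iter (1::real)"
  have mono: "incseq ?t" using sqrt_iter_one(3) by (rule incseq_SucI)
  have "Cauchy ?t"
    using incseq_convergent[OF mono, of 1] sqrt_iter_one(2) convergent_Cauchy
    by (metis convergentI)
  have bd: "norm (sqrt_iter w (n + d) - sqrt_iter w n) \<le> ?t (n + d) - ?t n" for n d
  proof (induction d)
    case (Suc d)
    have "norm (sqrt_iter w (n + Suc d) - sqrt_iter w n)
      \<le> norm (sqrt_iter w (Suc (n + d)) - sqrt_iter w (n + d)) + norm (sqrt_iter w (n + d) - sqrt_iter w n)"
      using norm_triangle_ineq[of "sqrt_iter w (Suc (n + d)) - sqrt_iter w (n + d)"
          "sqrt_iter w (n + d) - sqrt_iter w n"] by simp
    also have "\<dots> \<le> ?t (n + Suc d) - ?t n"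
      using Suc sqrt_iter_dominated(2)[OF w(1), of "n + d"] unfolding add_Suc_right by linarith
    finally show ?case .
  qed simp
  have "Cauchy (sqrt_iter w)"
  proof (rule CauchyI')
    fix e :: real assume "e > 0"
    then obtain N where N: "\<And>m n. m \<ge> N \<Longrightarrow> n \<ge> N \<Longrightarrow> norm (?t m - ?t n) < e"
      using CauchyD[OF \<open>Cauchy ?t\<close>] by blast
    have "norm (sqrt_iter w m - sqrt_iter w n) < e" if "m \<ge> N" "n > m" for m n
      using bd[of m "n - m"] N[of n m] that by (simp add: norm_minus_commute)
    then show "\<exists>M. \<forall>m\<ge>M. \<forall>n>m. dist (sqrt_iter w m) (sqrt_iter w n) < e"
      unfolding dist_norm by blast
  qed
  then obtain v where v: "sqrt_iter w \<longlonglongrightarrow> v" by (metis Cauchy_convergent convergent_def)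
  have "(\<lambda>k. sqrt_iter w (Suc k)) \<longlonglongrightarrow> (1/2) *\<^sub>R (w + v * v)"
    unfolding sqrt_iter.simps by (intro tendsto_intros v)
  then have "v = (1/2) *\<^sub>R (w + v * v)" using LIMSEQ_unique LIMSEQ_Suc[OF v] by blast
  then have "2 *\<^sub>R v = 2 *\<^sub>R ((1/2) *\<^sub>R (w + v * v))" by simp
  then have "2 *\<^sub>R v = w + v * v" by (simp only: scaleR_scaleR) simp
  then have eq: "v + v = w + v * v" by (simp add: scaleR_2)
  have "adj (sqrt_iter w k) = sqrt_iter w k" for k
    by (induction k) (simp_all add: adj_scaleR adj_add adj_mult w)
  then have "adj v = v" using adj_tendsto[OF v] v LIMSEQ_unique by auto
  moreover have "norm v \<le> 1"
    by (rule LIMSEQ_le_const2[OF tendsto_norm[OF v]])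
      (meson order_trans sqrt_iter_dominated(1)[OF w(1)] sqrt_iter_one(2))
  ultimately show ?thesis using that v eq by blast
qed

lemma self_adjoint_unitary_part:
  fixes m :: "'a :: comm_cstar"
  assumes "adj m = m" "norm m \<le> 1"
  obtains v where "unitary_parts v m"
proof -
  have "norm (m * m) \<le> 1" using norm_mult_ineq[of m m] assms mult_mono[of "norm m" 1 "norm m" 1] by simp
  then obtain v where "adj v = v" "v + v = m * m + v * v"
    using one_minus_sqrt[of "m * m"] assms by (metis adj_mult)
  then show ?thesis using that[of v] assms by (simp add: unitary_parts_def)
qed

text \<open>If \<open>1 - v\<close> is the real part of a unitary with imaginary part \<open>m\<close>, then \<open>1 - m\<^sup>2 = (1 - v)\<^sup>2\<close>.\<close>

lemma norm_diff_square_mult_le: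
  fixes m c :: "'a :: comm_cstar"
  assumes "adj m = m" "norm m \<le> 1"
  shows "norm (c - m * m * c) \<le> norm c"
proof -
  obtain v where v: "unitary_parts v m" using self_adjoint_unitary_part[OF assms] .
  have mm: "m * m = v + v - v * v" using v by (simp add: unitary_parts_def algebra_simps)
  have "c - m * m * c = (c - v * c) - v * (c - v * c)" unfolding mm by (simp add: algebra_simps)
  also have "norm \<dots> \<le> norm (c - v * c)" by (rule unitary_parts_contract(1)[OF v])
  also have "\<dots> \<le> norm c" by (rule unitary_parts_contract(1)[OF v])
  finally show ?thesis .
qed

text \<open>\<open>y = b\<^sup>2 (1 + b\<^sup>2)\<^sup>-\<^sup>1\<close>. Averaging the equation \<open>y = b\<^sup>2 - b\<^sup>2 y\<close> with \<open>y = y\<close> turns it into a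
  fixed point equation for a strict contraction, whatever the size of \<open>b\<close>.\<close>

lemma quasi_inverse_square:
  fixes b :: "'a :: comm_cstar"
  assumes b: "adj b = b"
  obtains y where "adj y = y" "y + b * b * y = b * b"
proof (cases "b = 0")
  case False
  define N where "N = (norm b)\<^sup>2"
  define \<alpha> where "\<alpha> = 1 / (1 + N)"
  define m where "m = (1 / norm b) *\<^sub>R b"
  have N: "N > 0" using False by (simp add: N_def)
  have \<alpha>: "0 < \<alpha>" "\<alpha> < 1" using N by (simp_all add: \<alpha>_def)
  have "\<alpha> * (1 + N) = 1" using N by (simp add: \<alpha>_def)
  then have "(1 - \<alpha>) / N = \<alpha>" using N by (simp add: field_simps)
  note \<alpha> = \<alpha> this
  have m: "adj m = m" "norm m \<le> 1" using False by (simp_all add: m_def adj_scaleR b)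
  define f where "f y = (1 - \<alpha>) *\<^sub>R (y - m * m * y) + \<alpha> *\<^sub>R (b * b)" for y
  have "dist (f x) (f y) \<le> (1 - \<alpha>) * dist x y" for x y
  proof -
    have "f x - f y = (1 - \<alpha>) *\<^sub>R ((x - y) - m * m * (x - y))"
      by (simp add: f_def algebra_simps)
    then show ?thesis using norm_diff_square_mult_le[OF m, of "x - y"] \<alpha>
      by (simp add: dist_norm mult_left_mono)
  qed
  then obtain y where "f y = y" using banach_fix_type[of "1 - \<alpha>" f] \<alpha> by auto
  moreover have "m * m = (1 / N) *\<^sub>R (b * b)"
    by (simp add: m_def N_def power2_eq_square)
  then have "f y = (1 - \<alpha>) *\<^sub>R y - \<alpha> *\<^sub>R (b * b * y) + \<alpha> *\<^sub>R (b * b)"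
    using \<alpha>(3) by (simp add: f_def scaleR_diff_right)
  ultimately have "\<alpha> *\<^sub>R (y + b * b * y - b * b) = 0" by (simp add: algebra_simps)
  then have y: "y + b * b * y = b * b" using \<alpha> by simp
  then have y': "adj y + b * b * adj y = b * b"
    by (metis adj_add adj_mult b mult.commute)
  let ?y = "(1/2) *\<^sub>R (y + adj y)"
  have "?y + b * b * ?y = (1/2) *\<^sub>R ((y + b * b * y) + (adj y + b * b * adj y))"
    by (simp add: algebra_simps)
  also have "\<dots> = b * b" unfolding y y' by (simp flip: scaleR_2)
  finally show ?thesis using that[of ?y] by (simp add: adj_scaleR adj_add add.commute)
qed (use that[of 0] in simp)

text \<open>Without a unit, the geometric series \<open>k + k\<^sup>2 + \<dots>\<close> takes the place of \<open>(1 - k)\<^sup>-\<^sup>1\<close>.\<close>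

lemma quasi_inverse:
  fixes k :: "'a :: comm_cstar"
  assumes "norm k < 1"
  obtains q where "q = k + k * q"
proof -
  have "dist (k + k * x) (k + k * y) \<le> norm k * dist x y" for x y
    using norm_mult_ineq[of k "x - y"] by (simp add: dist_norm algebra_simps)
  then have "\<exists>!x. k + k * x = x" using banach_fix_type[of "norm k" "\<lambda>x. k + k * x"] assms by simp
  then obtain q where "k + k * q = q" by blast
  then show ?thesis using that[of q] by simp
qed

subsection \<open>Homomorphisms\<close>

definition star_hom :: "('b :: comm_cstar \<Rightarrow> 'a :: comm_cstar) \<Rightarrow> bool" where
  "star_hom f \<longleftrightarrow> (\<forall>x y. f (x + y) = f x + f y) \<and> (\<forall>r x. f (r *\<^sub>R x) = r *\<^sub>R f x) \<and>
     (\<forall>x y. f (x * y) = f x * f y) \<and> (\<forall>x. f (adj x) = adj (f x))"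

context
  fixes f :: "'b :: comm_cstar \<Rightarrow> 'a :: comm_cstar"
  assumes f: "star_hom f"
begin

lemma star_hom_simps: "f (x + y) = f x + f y" "f (r *\<^sub>R x) = r *\<^sub>R f x"
  "f (x * y) = f x * f y" "f (adj x) = adj (f x)"
  using f by (auto simp: star_hom_def)

lemma star_hom_0: "f 0 = 0" using star_hom_simps(2)[of 0 0] by simp
lemma star_hom_diff: "f (x - y) = f x - f y"
  using star_hom_simps(1)[of "x - y" y] by (simp add: algebra_simps)

text \<open>A self-adjoint contraction is the imaginary part of a unitary, and this algebraic property is
  preserved by homomorphisms; this replaces the usual argument with spectral radii.\<close>

lemma star_hom_norm_le: "norm (f x) \<le> norm x"
proof (cases "x = 0")
  case False
  define m where "m = (1 / (norm x)\<^sup>2) *\<^sub>R (adj x * x)"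
  have "adj m = m" "norm m \<le> 1"
    using False by (simp_all add: m_def adj_scaleR adj_mult norm_adj_mult)
  then obtain v where "unitary_parts v m" using self_adjoint_unitary_part by blast
  then have "unitary_parts (f v) (f m)" by (metis unitary_parts_def star_hom_simps(1,3,4))
  then have "norm (f m) \<le> 1" by (rule unitary_parts_contract)
  moreover have "norm (f m) = (norm (f x))\<^sup>2 / (norm x)\<^sup>2"
    by (simp add: m_def star_hom_simps norm_adj_mult)
  ultimately have "(norm (f x))\<^sup>2 \<le> (norm x)\<^sup>2"
    using False by (simp add: divide_le_eq_1)
  then show ?thesis by (simp add: power2_le_iff_abs_le)
qed (simp add: star_hom_0)

lemma star_hom_sqrt_iter: "f (sqrt_iter w k) = sqrt_iter (f w) k"
  by (induction k) (simp_all add: star_hom_0 star_hom_simps)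

lemma star_hom_tendsto:
  assumes "x \<longlonglongrightarrow> l" shows "(\<lambda>n. f (x n)) \<longlonglongrightarrow> f l"
proof (rule LIMSEQ_I)
  fix e :: real assume "e > 0"
  then obtain N where "\<And>n. n \<ge> N \<Longrightarrow> norm (x n - l) < e" using LIMSEQ_D[OF assms] by blast
  then have "norm (f (x n) - f l) < e" if "n \<ge> N" for n
    using star_hom_norm_le[of "x n - l"] that by (simp add: star_hom_diff) (meson le_less_trans)
  then show "\<exists>N. \<forall>n\<ge>N. norm (f (x n) - f l) < e" by blast
qed

end

lemma norm_diff_mult_le:
  fixes a b c :: "'a :: real_normed_algebra"
  shows "norm (a - b * c) \<le> norm a + norm b * norm c"
  using norm_triangle_ineq4[of a "b * c"] norm_mult_ineq[of b c] by linarith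

text \<open>An injective homomorphism is isometric. The statement is for a homomorphism \<open>f\<close> that is only
  injective on the range of a projection \<open>P\<close> along the kernel of \<open>f\<close>. If \<open>f\<close> shrank some element of
  that range, then suitable powers would yield a self-adjoint \<open>b\<close> with \<open>\<parallel>b\<parallel> = 3\<close> and \<open>f b\<close> small. Let
  \<open>h = 2 b\<^sup>2 / (1 + b\<^sup>2)\<close>, the image of \<open>b\<close> under a Cayley transform, so that \<open>w = 1 - (1 - h)\<^sup>2\<close> is a
  square \<open>s\<^sup>2\<close> and thus \<open>\<parallel>w\<parallel> \<le> 1\<close>; let \<open>v = 1 - \<bar>1 - h\<bar>\<close>, the solution of \<open>2v - v\<^sup>2 = w\<close> given by the
  iteration. Then \<open>k = (v + h)/2 = min h 1\<close> and \<open>z = h - v = 2 max (h - 1) 0\<close> satisfy \<open>z = k z\<close>. Now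
  \<open>f k\<close> is small and \<open>f z = f k f z\<close>, so \<open>f z = 0\<close> and \<open>z = 0\<close>; but then \<open>\<parallel>h\<parallel> = \<parallel>v\<parallel> \<le> 1\<close>,
  which contradicts \<open>\<parallel>b\<parallel> = 3\<close>.\<close>

lemma star_hom_isometric:
  fixes f :: "'b :: comm_cstar \<Rightarrow> 'a :: comm_cstar" and P :: "'b \<Rightarrow> 'b"
  assumes f: "star_hom f" and P: "star_hom P"
    and fP: "\<And>x. f (P x) = f x" and ker: "\<And>x. f x = 0 \<Longrightarrow> P x = 0"
  shows "norm (P x) \<le> norm (f x)"
proof (rule ccontr)
  assume less: "\<not> ?thesis"
  have PP: "P (P z) = P z" for z
    using ker[of "P z - z"] by (simp add: star_hom_diff f P fP)
  note F = star_hom_simps[OF f] star_hom_diff[OF f] and PS = star_hom_simps[OF P] star_hom_diff[OF P]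
  define r where "r = (norm (f x))\<^sup>2 / (norm (P x))\<^sup>2"
  have pos: "norm (P x) > 0" using less by (meson norm_ge_zero not_le le_less_trans)
  have r: "0 \<le> r" "r < 1"
    using less pos power_strict_mono[of "norm (f x)" "norm (P x)" 2] by (auto simp: r_def)
  have "\<exists>a. adj a = a \<and> P a = a \<and> norm a = 1 \<and> norm (f a) \<le> r ^ (2 ^ n)" for n
  proof (induction n)
    case 0
    let ?a = "(1 / (norm (P x))\<^sup>2) *\<^sub>R (adj (P x) * P x)"
    have "norm (f ?a) = r"
      by (simp add: F fP norm_adj_mult r_def)
    then show ?case
      using pos by (intro exI[of _ ?a]) (simp add: adj_scaleR adj_mult PS PP norm_adj_mult)
  next
    case (Suc n)
    then obtain a where a: "adj a = a" "P a = a" "norm a = 1" "norm (f a) \<le> r ^ (2 ^ n)" by blast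
    have "norm (f (a * a)) \<le> r ^ (2 ^ Suc n)"
      using norm_mult_ineq[of "f a" "f a"] mult_mono[OF a(4) a(4)] r
      by (simp add: F power_add[symmetric] mult_2)
    moreover have "norm (a * a) = 1" using norm_adj_mult[of a] a by simp
    ultimately show ?case using a by (intro exI[of _ "a * a"]) (simp add: adj_mult PS)
  qed
  moreover obtain n where "r ^ n < 1 / 30" using real_arch_pow_inv[of "1/30" r] r by auto
  then have "r ^ (2 ^ n) < 1 / 30"
    using power_decreasing[of n "2 ^ n" r] r less_exp[of n] by (simp add: less_imp_le)
  ultimately obtain a where a: "adj a = a" "P a = a" "norm a = 1" "norm (f a) \<le> 1 / 30"
    by (meson le_less_trans less_imp_le)
  define b where "b = 3 *\<^sub>R a"
  have b: "adj b = b" "P b = b" "norm b = 3" "norm (f b) \<le> 1 / 10"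
    using a by (simp_all add: b_def adj_scaleR PS F)
  obtain y0 where y0: "adj y0 = y0" "y0 + b * b * y0 = b * b"
    using quasi_inverse_square[OF b(1)] .
  define y where "y = P y0"
  have y: "adj y = y" "P y = y" "y + b * b * y = b * b"
    using y0 b PS by (simp_all add: y_def PP) metis+
  have fbb: "norm (f b * f b) \<le> 1 / 100"
    using norm_mult_ineq[of "f b" "f b"] mult_mono[OF b(4) b(4)] by simp
  have fy: "norm (f y) \<le> 1 / 50"
  proof -
    have "f y = f b * f b - f b * f b * f y" using y(3) by (metis F(1,3) add_diff_cancel_right')
    then have "norm (f y) \<le> norm (f b * f b) + norm (f b * f b) * norm (f y)"
      using norm_diff_mult_le[of "f b * f b" "f b * f b" "f y"] by simp
    also have "\<dots> \<le> 1 / 100 + 1 / 100 * norm (f y)"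
      using fbb by (intro add_mono mult_right_mono) auto
    finally show ?thesis by simp
  qed
  define h where "h = y + y"
  define s where "s = (b - b * y) + (b - b * y)"
  define w where "w = s * s"
  have "s = 2 *\<^sub>R (b - b * y)" by (simp only: s_def scaleR_2)
  then have "w = 4 *\<^sub>R ((b - b * y) * (b - b * y))" by (simp add: w_def)
  also have "(b - b * y) * (b - b * y) = (b * b - b * b * y) - (b * b - b * b * y) * y"
    by (simp add: algebra_simps)
  finally have "w = 4 *\<^sub>R ((b * b - b * b * y) - (b * b - b * b * y) * y)" .
  moreover have "b * b - b * b * y = y" using y(3) by (metis add_diff_cancel_right')
  ultimately have w4: "w = 4 *\<^sub>R (y - y * y)" by simp
  have h2: "h = 2 *\<^sub>R y" by (simp only: h_def scaleR_2)
  have wh: "w = h + h - h * h"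
    unfolding w4 h2 scaleR_add_left[symmetric] by (simp add: scaleR_diff_right)
  have s: "adj s = s" "P s = s" by (simp_all add: s_def adj_add adj_diff adj_mult y b PS mult.commute)
  have h: "adj h = h" "P h = h" by (simp_all add: h_def adj_add y PS)
  have "unitary_parts h s" using wh s h by (simp add: unitary_parts_def w_def)
  then have s1: "norm s \<le> 1" by (rule unitary_parts_contract)
  have "norm w \<le> 1"
    using norm_mult_ineq[of s s] mult_mono[OF s1 s1] by (simp add: w_def)
  moreover have w: "adj w = w" "P w = w" by (simp_all add: w_def adj_mult s PS)
  ultimately obtain v0 where v0: "sqrt_iter w \<longlonglongrightarrow> v0" "v0 + v0 = w + v0 * v0" "norm v0 \<le> 1"
    using one_minus_sqrt by metis
  have fs: "norm (f s) \<le> 1 / 4"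
  proof -
    have "f s = 2 *\<^sub>R (f b - f b * f y)" by (simp add: s_def F scaleR_2)
    moreover have "norm (f b - f b * f y) \<le> norm (f b) + norm (f b) * norm (f y)"
      by (rule norm_diff_mult_le)
    moreover have "norm (f b) * norm (f y) \<le> 1/10 * (1/50)" using b fy by (intro mult_mono) auto
    ultimately show ?thesis using b by simp
  qed
  have "norm (f w) \<le> 1 / 16"
    using norm_mult_ineq[of "f s" "f s"] mult_mono[OF fs fs] by (simp add: w_def F)
  then have "norm (sqrt_iter (f w) k) \<le> 1 / 2" for k
    by (rule norm_sqrt_iter_le) (simp_all add: power2_eq_square)
  then have fv0: "norm (f v0) \<le> 1 / 2"
    using LIMSEQ_le_const2[OF tendsto_norm[OF star_hom_tendsto[OF f v0(1)]], of "1/2"]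
    by (simp add: star_hom_sqrt_iter[OF f])
  define v where "v = P v0"
  have v: "v + v = w + v * v" "P v = v" "norm v \<le> 1" "norm (f v) \<le> 1 / 2"
    using v0 w PS star_hom_norm_le[OF P, of v0] fv0 by (auto simp: v_def PP fP) (metis PS(1,3))
  define k where "k = (1/2) *\<^sub>R (v + h)"
  define z where "z = h - v"
  have "k * z = (1/2) *\<^sub>R (h * h - v * v)" by (simp add: k_def z_def algebra_simps)
  also have "h * h - v * v = (h + h - w) - (v + v - w)" using v(1) wh by simp
  also have "\<dots> = 2 *\<^sub>R z" by (simp add: z_def scaleR_2)
  finally have kz: "k * z = z" by simp
  have fk: "norm (f k) \<le> 1 / 2"
  proof -
    have "norm (f v + (f y + f y)) \<le> norm (f v) + (norm (f y) + norm (f y))"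
      by (intro norm_triangle_le add_left_mono norm_triangle_ineq)
    then show ?thesis using v(4) fy by (simp add: k_def h_def F)
  qed
  have "norm (f z) \<le> norm (f k) * norm (f z)" by (metis kz F(3) norm_mult_ineq)
  also have "\<dots> \<le> 1 / 2 * norm (f z)" using fk by (intro mult_right_mono) auto
  finally have "f z = 0" by simp
  then have "P z = 0" by (rule ker)
  then have "h = v" by (simp add: z_def PS h v)
  then have "norm (2 *\<^sub>R y) \<le> 1" using v by (simp add: h_def scaleR_2)
  then have y1: "norm y \<le> 1 / 2" by simp
  have "norm (b * b) \<le> norm y + norm (b * b) * norm y"
    using norm_triangle_ineq[of y "b * b * y"] norm_mult_ineq[of "b * b" y] y(3) by simp
  also have "\<dots> \<le> 1 / 2 + norm (b * b) * (1 / 2)" using y1 by (intro add_mono mult_left_mono) auto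
  finally have "norm (b * b) \<le> 1" by simp
  moreover have "norm (b * b) = 9" using norm_adj_mult[of b] b by simp
  ultimately show False by simp
qed

subsection \<open>Characters\<close>

definition cscale :: "complex \<Rightarrow> 'a :: comm_cstar \<Rightarrow> 'a" where
  "cscale z x = Re z *\<^sub>R x + imul (Im z *\<^sub>R x)"

lemma norm_cscale: "norm (cscale z x) = cmod z * norm x"
proof -
  have "adj (cscale z x) * cscale z x = ((Re z)\<^sup>2 + (Im z)\<^sup>2) *\<^sub>R (adj x * x)"
    unfolding cscale_def
    by (simp add: adj_add adj_scaleR adj_imul imul_mult mult_imul imul_scaleR algebra_simps power2_eq_square)
  then have "(norm (cscale z x))\<^sup>2 = (cmod z * norm x)\<^sup>2"
    by (metis norm_adj_mult norm_scaleR abs_of_nonneg cmod_power2 power_mult_distrib zero_le_power2)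
  then show ?thesis by (simp add: power2_eq_iff_nonneg)
qed

definition mult_functional :: "('a :: comm_cstar \<Rightarrow> complex) \<Rightarrow> bool" where
  "mult_functional f \<longleftrightarrow> (\<forall>x y. f (x + y) = f x + f y) \<and> (\<forall>z x. f (cscale z x) = z * f x) \<and>
     (\<forall>x y. f (x * y) = f x * f y)"

context
  fixes f :: "'a :: comm_cstar \<Rightarrow> complex"
  assumes f: "mult_functional f"
begin

text \<open>If \<open>\<parallel>x\<parallel> < \<bar>f x\<bar>\<close>, then \<open>k = x / f x\<close> has a quasi-inverse \<open>q\<close>, and \<open>f q = 1 + f q\<close>.\<close>

lemma mult_functional_norm_le: "cmod (f x) \<le> norm x"
proof (rule ccontr)
  assume less: "\<not> ?thesis"
  then have nz: "f x \<noteq> 0" using norm_ge_zero[of x] by auto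
  let ?k = "cscale (1 / f x) x"
  have "norm ?k < 1" using less nz by (simp add: norm_cscale norm_divide)
  then obtain q where "q = ?k + ?k * q" by (rule quasi_inverse)
  then have "f q = f ?k + f ?k * f q" using f by (metis mult_functional_def)
  moreover have "f ?k = 1" using f nz by (simp add: mult_functional_def)
  ultimately show False by simp
qed

text \<open>If \<open>a\<close> is self-adjoint, then multiplication by \<open>a + i t\<close> has norm at most
  \<open>sqrt (\<parallel>a\<parallel>\<^sup>2 + t\<^sup>2)\<close>. Comparing large powers bounds the modulus of \<open>f a + i t\<close>, for all real
  \<open>t\<close>, which forces \<open>f a\<close> to be real.\<close>

lemma mult_functional_self_adjoint:
  assumes a: "adj a = a"
  shows "Im (f a) = 0"
proof (rule ccontr)
  assume im: "Im (f a) \<noteq> 0"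
  then have fa: "f a \<noteq> 0" by auto
  have bound: "(cmod (f a + \<i> * of_real t))\<^sup>2 \<le> (norm a)\<^sup>2 + t\<^sup>2" (is "?l \<le> ?r") for t
  proof (rule ccontr)
    assume less: "\<not> ?thesis"
    then have l: "?l > 0" by (smt (verit) zero_le_power2)
    define L where "L c = a * c + imul (t *\<^sub>R c)" for c
    have fL: "f (L c) = (f a + \<i> * of_real t) * f c" for c
    proof -
      have "imul (t *\<^sub>R c) = cscale (\<i> * of_real t) c" by (simp add: cscale_def)
      then show ?thesis using f by (simp add: L_def mult_functional_def algebra_simps)
    qed
    have nL: "(norm (L c))\<^sup>2 \<le> ?r * (norm c)\<^sup>2" for c
    proof -
      have "adj (L c) = a * adj c - imul (t *\<^sub>R adj c)"
        by (simp add: L_def adj_add adj_mult adj_imul adj_scaleR a mult.commute)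
      then have "adj (L c) * L c = (a * adj c - imul (t *\<^sub>R adj c)) * (a * c + imul (t *\<^sub>R c))"
        by (simp add: L_def)
      also have "\<dots> = (adj a * a) * (adj c * c) + (t\<^sup>2) *\<^sub>R (adj c * c)"
        unfolding a by (simp add: algebra_simps imul_mult mult_imul imul_scaleR power2_eq_square)
      finally have "(norm (L c))\<^sup>2 = norm ((adj a * a) * (adj c * c) + (t\<^sup>2) *\<^sub>R (adj c * c))"
        by (metis norm_adj_mult)
      also have "\<dots> \<le> norm (adj a * a) * norm (adj c * c) + norm ((t\<^sup>2) *\<^sub>R (adj c * c))"
        by (intro norm_triangle_le add_right_mono norm_mult_ineq)
      also have "\<dots> = ?r * (norm c)\<^sup>2" unfolding norm_scaleR norm_adj_mult by (simp add: distrib_right)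
      finally show ?thesis .
    qed
    have "?l ^ n * (cmod (f a))\<^sup>2 \<le> ?r ^ n * (norm a)\<^sup>2" for n
    proof -
      have "(norm ((L ^^ n) a))\<^sup>2 \<le> ?r ^ n * (norm a)\<^sup>2"
      proof (induction n)
        case (Suc n)
        have "(norm ((L ^^ Suc n) a))\<^sup>2 \<le> ?r * (norm ((L ^^ n) a))\<^sup>2" using nL by simp
        also have "\<dots> \<le> ?r * (?r ^ n * (norm a)\<^sup>2)" using Suc by (intro mult_left_mono) auto
        finally show ?case by (simp add: mult.assoc)
      qed simp
      moreover have "f ((L ^^ n) a) = (f a + \<i> * of_real t) ^ n * f a"
        by (induction n) (simp_all add: fL)
      then have "?l ^ n * (cmod (f a))\<^sup>2 = (cmod (f ((L ^^ n) a)))\<^sup>2"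
        by (simp add: norm_mult norm_power power_mult_distrib flip: power_mult) (simp add: mult.commute)
      ultimately show ?thesis
        using mult_functional_norm_le[of "(L ^^ n) a"] power_mono[of "cmod (f ((L ^^ n) a))" _ 2]
        by (smt (verit) norm_ge_zero)
    qed
    moreover define q where "q = ?r / ?l"
    ultimately have "(cmod (f a))\<^sup>2 \<le> q ^ n * (norm a)\<^sup>2" for n
      using l by (simp add: q_def power_divide field_simps)
    moreover have "(\<lambda>n. q ^ n * (norm a)\<^sup>2) \<longlonglongrightarrow> 0 * (norm a)\<^sup>2"
      using less l by (intro tendsto_intros LIMSEQ_power_zero) (simp add: q_def)
    ultimately have "(cmod (f a))\<^sup>2 \<le> 0 * (norm a)\<^sup>2"
      by (intro LIMSEQ_le_const) auto
    then show False using fa by simp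
  qed
  have "2 * Im (f a) * t \<le> (norm a)\<^sup>2" for t
  proof -
    have "(Re (f a))\<^sup>2 + ((Im (f a))\<^sup>2 + 2 * Im (f a) * t) \<le> (norm a)\<^sup>2"
      using bound[of t] by (simp add: cmod_power2 power2_sum)
    then show ?thesis using zero_le_power2[of "Re (f a)"] zero_le_power2[of "Im (f a)"] by linarith
  qed
  from this[of "((norm a)\<^sup>2 + 1) / (2 * Im (f a))"] show False using im by simp
qed

lemma mult_functional_adj: "f (adj x) = cnj (f x)"
proof -
  have imul: "imul y = cscale \<i> y" and minus: "- y = cscale (-1) y" for y :: 'a
    by (simp_all add: cscale_def)
  have fi: "f (imul y) = \<i> * f y" and fm: "f (- y) = - f y" for y
    using f by (simp_all add: imul minus mult_functional_def)
  have fd: "f (y + z) = f y + f z" for y z using f by (simp add: mult_functional_def)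
  have "Im (f (x + adj x)) = 0" and "Im (f (imul x + - imul (adj x))) = 0"
    by (intro mult_functional_self_adjoint; simp add: adj_add adj_diff adj_minus adj_imul imul_minus add.commute)+
  then show ?thesis by (simp add: fd fi fm complex_eq_iff del: add_uminus_conv_diff)
qed

end


section \<open>Fell bundles\<close>

context fell_bundle
begin

lemma zero_in [simp, intro]: "zero A s \<in> fib A s"
  and add_in [simp, intro]: "a \<in> fib A s \<Longrightarrow> b \<in> fib A s \<Longrightarrow> add A a b \<in> fib A s"
  and add_comm: "a \<in> fib A s \<Longrightarrow> b \<in> fib A s \<Longrightarrow> add A a b = add A b a"
  and scale_in [simp, intro]: "a \<in> fib A s \<Longrightarrow> scale A z a \<in> fib A s"
  and scale_add: "a \<in> fib A s \<Longrightarrow> b \<in> fib A s \<Longrightarrow>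
        scale A z (add A a b) = add A (scale A z a) (scale A z b)"
  and scale_plus: "a \<in> fib A s \<Longrightarrow> scale A (z + w) a = add A (scale A z a) (scale A w a)"
  and scale_scale: "a \<in> fib A s \<Longrightarrow> scale A z (scale A w a) = scale A (z * w) a"
  and scale_one: "a \<in> fib A s \<Longrightarrow> scale A 1 a = a"
  and nrm_nonneg: "a \<in> fib A s \<Longrightarrow> 0 \<le> nrm A a"
  and nrm_eq_0: "a \<in> fib A s \<Longrightarrow> nrm A a = 0 \<longleftrightarrow> a = zero A s"
  and nrm_scale: "a \<in> fib A s \<Longrightarrow> nrm A (scale A z a) = cmod z * nrm A a"
  and nrm_add: "a \<in> fib A s \<Longrightarrow> b \<in> fib A s \<Longrightarrow> nrm A (add A a b) \<le> nrm A a + nrm A b"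
  using banach[of s] unfolding banach_fibre_def by simp_all

lemma add_zero_left: "a \<in> fib A s \<Longrightarrow> add A (zero A s) a = a"
  by (rule banach[of s, unfolded banach_fibre_def, THEN conjunct2, THEN conjunct2, THEN conjunct2,
        THEN conjunct1, THEN bspec, THEN conjunct1])

lemma add_minus: "a \<in> fib A s \<Longrightarrow> add A a (scale A (-1) a) = zero A s"
  by (rule banach[of s, unfolded banach_fibre_def, THEN conjunct2, THEN conjunct2, THEN conjunct2,
        THEN conjunct1, THEN bspec, THEN conjunct2])

lemma add_assoc: "a \<in> fib A s \<Longrightarrow> b \<in> fib A s \<Longrightarrow> c \<in> fib A s \<Longrightarrow>
    add A (add A a b) c = add A a (add A b c)"
  by (rule banach[of s, unfolded banach_fibre_def, THEN conjunct2, THEN conjunct2, THEN conjunct1, rule_format])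

lemma fibre_complete:
  assumes "\<And>n. f n \<in> fib A s"
    and "\<And>\<epsilon>. \<epsilon> > 0 \<Longrightarrow> \<exists>N. \<forall>m\<ge>N. \<forall>n\<ge>N. fdist A (f m) (f n) < \<epsilon>"
  obtains l where "l \<in> fib A s" "(\<lambda>n. fdist A (f n) l) \<longlonglongrightarrow> 0"
proof -
  have "range f \<subseteq> fib A s" using assms(1) by auto
  moreover have "\<forall>f. range f \<subseteq> fib A s \<longrightarrow>
      (\<forall>\<epsilon>>0. \<exists>N. \<forall>m\<ge>N. \<forall>n\<ge>N. fdist A (f m) (f n) < \<epsilon>) \<longrightarrow>
      (\<exists>l\<in>fib A s. (\<lambda>n. fdist A (f n) l) \<longlonglongrightarrow> 0)"
    using banach[of s] unfolding banach_fibre_def by (elim conjE) assumption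
  ultimately show ?thesis using assms(2) that by blast
qed

lemma add_zero_right: "a \<in> fib A s \<Longrightarrow> add A a (zero A s) = a"
  using add_comm[of a s "zero A s"] add_zero_left[of a s] by simp

lemma scale_zero: "a \<in> fib A s \<Longrightarrow> scale A 0 a = zero A s"
  using scale_plus[of a s 1 "-1"] by (simp add: scale_one add_minus)

lemma scale_zero_right: "scale A z (zero A s) = zero A s"
  using scale_scale[OF zero_in, of z 0 s] by (simp add: scale_zero[OF zero_in])

lemma nrm_zero [simp]: "nrm A (zero A s) = 0"
  using nrm_eq_0[OF zero_in] by simp

lemma fdist_nonneg: "a \<in> fib A s \<Longrightarrow> b \<in> fib A s \<Longrightarrow> 0 \<le> fdist A a b"
  unfolding fdist_def by (rule nrm_nonneg[where s = s]) simp

lemma fdist_commute: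
  assumes a: "a \<in> fib A s" and b: "b \<in> fib A s" shows "fdist A a b = fdist A b a"
proof -
  have "scale A (-1) (add A a (scale A (-1) b)) = add A (scale A (-1) a) b"
    using a b by (simp add: scale_add[where s = s] scale_scale[where s = s] scale_one[where s = s])
  also have "\<dots> = add A b (scale A (-1) a)" using a b by (intro add_comm[where s = s]) auto
  finally have "nrm A (add A b (scale A (-1) a)) = cmod (-1) * nrm A (add A a (scale A (-1) b))"
    using nrm_scale[of "add A a (scale A (-1) b)" s "-1"] a b by simp
  then show ?thesis by (simp add: fdist_def)
qed

lemma fdist_split:
  assumes "a \<in> fib A s" "b \<in> fib A s" "c \<in> fib A s"
  shows "add A (add A a (scale A (-1) b)) (add A b (scale A (-1) c)) = add A a (scale A (-1) c)"
proof -
  have "add A (scale A (-1) b) (add A b (scale A (-1) c)) = scale A (-1) c"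
    using assms add_assoc[of "scale A (-1) b" s b "scale A (-1) c"] add_comm[of "scale A (-1) b" s b]
    by (simp add: add_minus[where s = s] add_zero_left[where s = s])
  then show ?thesis using assms by (simp add: add_assoc[where s = s])
qed

lemma fdist_triangle:
  "a \<in> fib A s \<Longrightarrow> b \<in> fib A s \<Longrightarrow> c \<in> fib A s \<Longrightarrow> fdist A a c \<le> fdist A a b + fdist A b c"
  unfolding fdist_def fdist_split[symmetric, of a s b c] by (rule nrm_add[where s = s]) simp_all

lemma fdist_self: "a \<in> fib A s \<Longrightarrow> fdist A a a = 0"
  by (simp add: fdist_def add_minus)

lemma fdist_eq_0: "a \<in> fib A s \<Longrightarrow> b \<in> fib A s \<Longrightarrow> fdist A a b = 0 \<longleftrightarrow> a = b"
proof
  assume ab: "a \<in> fib A s" "b \<in> fib A s" and "fdist A a b = 0"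
  then have "add A a (scale A (-1) b) = zero A s"
    unfolding fdist_def by (subst (asm) nrm_eq_0[where s = s]) simp_all
  then have "add A (add A a (scale A (-1) b)) b = b" using ab by (simp add: add_zero_left)
  moreover have "add A (scale A (-1) b) b = zero A s"
    using ab add_comm[of b s "scale A (-1) b"] by (simp add: add_minus)
  ultimately show "a = b" using ab by (simp add: add_assoc[where s = s] add_zero_right)
qed (simp add: fdist_self)

lemma star_in_idem: "idem e \<Longrightarrow> a \<in> fib A e \<Longrightarrow> star A a \<in> fib A e"
  using star_closed[of a e] by (simp add: sinv_idem)

lemma mul_in_idem: "idem e \<Longrightarrow> a \<in> fib A e \<Longrightarrow> b \<in> fib A e \<Longrightarrow> mul A a b \<in> fib A e"
  using mul_closed[of a e b e] by (simp add: idem_def)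

lemma mul_diff_left:
  "a \<in> fib A s \<Longrightarrow> a' \<in> fib A s \<Longrightarrow> b \<in> fib A t \<Longrightarrow>
    mul A (add A a (scale A (-1) a')) b = add A (mul A a b) (scale A (-1) (mul A a' b))"
  by (simp add: mul_add_left[where s = s and t = t] mul_scale_left[where s = s and t = t])

lemma mul_diff_right:
  "a \<in> fib A s \<Longrightarrow> b \<in> fib A t \<Longrightarrow> b' \<in> fib A t \<Longrightarrow>
    mul A a (add A b (scale A (-1) b')) = add A (mul A a b) (scale A (-1) (mul A a b'))"
  by (simp add: mul_add_right[where s = s and t = t] mul_scale_right[where s = s and t = t])

lemma fdist_mul_left:
  "a \<in> fib A s \<Longrightarrow> a' \<in> fib A s \<Longrightarrow> b \<in> fib A t \<Longrightarrow>
    fdist A (mul A a b) (mul A a' b) \<le> fdist A a a' * nrm A b"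
  unfolding fdist_def mul_diff_left[symmetric] by (rule nrm_mul) auto

lemma star_diff: "a \<in> fib A s \<Longrightarrow> b \<in> fib A s \<Longrightarrow>
    star A (add A a (scale A (-1) b)) = add A (star A a) (scale A (-1) (star A b))"
  using star_add[of a s "scale A (-1) b"] star_scale[of b s "-1"] by simp

lemma incl_diff: "natural_le s t \<Longrightarrow> a \<in> fib A s \<Longrightarrow> b \<in> fib A s \<Longrightarrow>
    incl A t s (add A a (scale A (-1) b)) = add A (incl A t s a) (scale A (-1) (incl A t s b))"
  using incl_add[of s t a "scale A (-1) b"] incl_scale[of s t b "-1"] by simp

lemma fdist_incl: "natural_le s t \<Longrightarrow> a \<in> fib A s \<Longrightarrow> b \<in> fib A s \<Longrightarrow>
    fdist A (incl A t s a) (incl A t s b) = fdist A a b"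
  unfolding fdist_def incl_diff[symmetric] by (rule nrm_incl) auto

lemma incl_self:
  assumes "a \<in> fib A s" shows "incl A s s a = a"
proof -
  have 1: "incl A s s a \<in> fib A s" using assms natural_le_refl by (blast intro: incl_closed)
  have "incl A s s (incl A s s a) = incl A s s a"
    using incl_incl[OF natural_le_refl natural_le_refl assms] by simp
  then have "fdist A (incl A s s (incl A s s a)) (incl A s s a) = 0" using 1 by (simp add: fdist_self)
  then have "fdist A (incl A s s a) a = 0" using fdist_incl[OF natural_le_refl 1 assms] by simp
  then show ?thesis using fdist_eq_0[OF 1 assms] by simp
qed

end

section \<open>The algebra of bounded sections\<close>

text \<open>The bounded sections of all fibres over idempotents of all semi-abelian Fell bundles on a given
  pair of types form one commutative $C^*$-algebra, and each single fibre \<open>fib A e\<close> is a direct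
  summand of it: \<open>section_at F A e\<close> is the projection and \<open>single A e\<close> the embedding. In this way
  the results for the class of commutative $C^*$-algebras, which are about types, become available
  for the fibres, which are subsets of a type.\<close>

definition comm_fibre :: "('s :: inverse_semigroup, 'a) fell \<Rightarrow> 's \<Rightarrow> bool" where
  "comm_fibre A e \<longleftrightarrow> fell_bundle A \<and> semi_abelian A \<and> idem e"

lemma comm_fibreD:
  assumes "comm_fibre A e"
  shows "fell_bundle A" "idem e" "a \<in> fib A e \<Longrightarrow> b \<in> fib A e \<Longrightarrow> mul A a b = mul A b a"
  using assms by (auto simp: comm_fibre_def semi_abelian_def)

lemma comm_fibre_zero [simp]: "comm_fibre A e \<Longrightarrow> zero A e \<in> fib A e"
  "comm_fibre A e \<Longrightarrow> nrm A (zero A e) = 0"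
  by (simp_all add: comm_fibreD(1) fell_bundle.zero_in fell_bundle.nrm_zero)

text \<open>The fixed value outside the admissible pairs makes a section determined by its values in the
  fibres.\<close>

definition is_section :: "(('s :: inverse_semigroup, 'a) fell \<times> 's \<Rightarrow> 'a) \<Rightarrow> bool" where
  "is_section F \<longleftrightarrow> (\<forall>A e. comm_fibre A e \<longrightarrow> F (A, e) \<in> fib A e) \<and>
     (\<forall>A e. \<not> comm_fibre A e \<longrightarrow> F (A, e) = undefined) \<and>
     (\<exists>K. \<forall>A e. comm_fibre A e \<longrightarrow> nrm A (F (A, e)) \<le> K)"

typedef (overloaded) ('s, 'a) sections = "{F :: ('s :: inverse_semigroup, 'a) fell \<times> 's \<Rightarrow> 'a. is_section F}"
proof
  show "(\<lambda>(A, e). if comm_fibre A e then zero A e else undefined) \<in> {F. is_section F}"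
    by (auto simp: is_section_def intro!: exI[of _ 0] fell_bundle.zero_in comm_fibreD
        eq_refl[OF fell_bundle.nrm_zero])
qed

definition section_at :: "('s :: inverse_semigroup, 'a) sections \<Rightarrow> ('s, 'a) fell \<Rightarrow> 's \<Rightarrow> 'a" where
  "section_at F A e = Rep_sections F (A, e)"

definition mk_section :: "(('s :: inverse_semigroup, 'a) fell \<Rightarrow> 's \<Rightarrow> 'a) \<Rightarrow> ('s, 'a) sections" where
  "mk_section f = Abs_sections (\<lambda>(A, e). if comm_fibre A e then f A e else undefined)"

lemma section_at_mk:
  assumes "comm_fibre A e"
    and "\<And>A e. comm_fibre A e \<Longrightarrow> f A e \<in> fib A e"
    and "\<And>A e. comm_fibre A e \<Longrightarrow> nrm A (f A e) \<le> K"
  shows "section_at (mk_section f) A e = f A e"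
proof -
  have "is_section (\<lambda>(A, e). if comm_fibre A e then f A e else undefined)"
    using assms(2,3) unfolding is_section_def by auto
  then show ?thesis using assms(1) by (simp add: section_at_def mk_section_def Abs_sections_inverse)
qed

lemma section_in: "comm_fibre A e \<Longrightarrow> section_at F A e \<in> fib A e"
  using Rep_sections[of F] by (simp add: section_at_def is_section_def)

lemma section_bounded: "\<exists>K. \<forall>A e. comm_fibre A e \<longrightarrow> nrm A (section_at F A e) \<le> K"
  using Rep_sections[of F] by (simp add: section_at_def is_section_def)

lemma section_eqI:
  assumes "\<And>A e. comm_fibre A e \<Longrightarrow> section_at F A e = section_at G A e"
  shows "F = G"
proof -
  have "Rep_sections F (A, e) = Rep_sections G (A, e)" for A e
    using assms[of A e] Rep_sections[of F] Rep_sections[of G]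
    by (cases "comm_fibre A e") (auto simp: section_at_def is_section_def)
  then have "Rep_sections F = Rep_sections G" by (intro ext) auto
  then show ?thesis by (simp add: Rep_sections_inject)
qed

instantiation sections :: (inverse_semigroup, type) real_normed_vector
begin

definition "0 = mk_section zero"
definition "F + G = mk_section (\<lambda>A e. add A (section_at F A e) (section_at G A e))"
definition "- F = mk_section (\<lambda>A e. scale A (-1) (section_at F A e))" for F :: "('a, 'b) sections"
definition "F - G = F + - G" for F G :: "('a, 'b) sections"
definition "scaleR r F = mk_section (\<lambda>A e. scale A (of_real r) (section_at F A e))"
(* Inserting 0 gives the supremum the right value when there are no admissible pairs. *)
definition "norm F = Sup (insert 0 {nrm A (section_at F A e) | A e. comm_fibre A e})"
definition "sgn F = scaleR (inverse (norm F)) F" for F :: "('a, 'b) sections"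
definition "dist F G = norm (F - G)" for F G :: "('a, 'b) sections"
definition "(uniformity :: (('a, 'b) sections \<times> ('a, 'b) sections) filter) =
  (INF e\<in>{0 <..}. principal {(x, y). dist x y < e})"
definition "open (U :: ('a, 'b) sections set) \<longleftrightarrow>
  (\<forall>x\<in>U. eventually (\<lambda>(x', y). x' = x \<longrightarrow> y \<in> U) uniformity)"

lemma sections_norm_ge: "comm_fibre A e \<Longrightarrow> nrm A (section_at F A e) \<le> norm F"
proof -
  assume "comm_fibre A e"
  moreover obtain K where "\<And>A e. comm_fibre A e \<Longrightarrow> nrm A (section_at F A e) \<le> K"
    using section_bounded by blast
  then have "bdd_above (insert 0 {nrm A (section_at F A e) | A e. comm_fibre A e})"
    by (intro bdd_aboveI[of _ "max 0 K"]) (auto simp: le_max_iff_disj)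
  ultimately show ?thesis unfolding norm_sections_def by (intro cSup_upper) auto
qed

lemma sections_norm_le:
  "0 \<le> K \<Longrightarrow> (\<And>A e. comm_fibre A e \<Longrightarrow> nrm A (section_at F A e) \<le> K) \<Longrightarrow> norm F \<le> K"
  unfolding norm_sections_def by (intro cSup_least) auto

lemma section_at_scale:
  fixes F :: "('a, 'b) sections"
  assumes "comm_fibre A e"
  shows "section_at (mk_section (\<lambda>A e. scale A z (section_at F A e))) A e = scale A z (section_at F A e)"
proof (rule section_at_mk[OF assms, where K = "cmod z * norm F"])
  fix A :: "('a, 'b) fell" and e assume c: "comm_fibre A e"
  interpret fell_bundle A by (rule comm_fibreD(1)[OF c])
  show "scale A z (section_at F A e) \<in> fib A e" by (rule scale_in[OF section_in[OF c]])
  show "nrm A (scale A z (section_at F A e)) \<le> cmod z * norm F"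
    unfolding nrm_scale[OF section_in[OF c]] by (intro mult_left_mono sections_norm_ge[OF c]) simp
qed

lemma section_at_vector_simps [simp]:
  assumes "comm_fibre A e"
  shows "section_at 0 A e = zero A e"
    "section_at (F + G) A e = add A (section_at F A e) (section_at G A e)"
    "section_at (- F) A e = scale A (-1) (section_at F A e)"
    "section_at (F - G) A e = add A (section_at F A e) (scale A (-1) (section_at G A e))"
    "section_at (scaleR r F) A e = scale A (of_real r) (section_at F A e)"
proof -
  note fb = comm_fibreD(1)
  show "section_at 0 A e = zero A e"
    unfolding zero_sections_def
    by (rule section_at_mk[OF assms, of zero 0])
      (simp_all add: fell_bundle.nrm_zero fb fell_bundle.zero_in)
  show plus: "section_at (F + G) A e = add A (section_at F A e) (section_at G A e)" for F G
    unfolding plus_sections_def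
  proof (rule section_at_mk[OF assms, where K = "norm F + norm G"])
    fix A :: "('a, 'b) fell" and e assume c: "comm_fibre A e"
    interpret fell_bundle A by (rule comm_fibreD(1)[OF c])
    show "add A (section_at F A e) (section_at G A e) \<in> fib A e"
      by (intro add_in section_in[OF c])
    show "nrm A (add A (section_at F A e) (section_at G A e)) \<le> norm F + norm G"
      using nrm_add[OF section_in[OF c, of F] section_in[OF c, of G]]
        sections_norm_ge[OF c, of F] sections_norm_ge[OF c, of G] by linarith
  qed
  show minus: "section_at (- F) A e = scale A (-1) (section_at F A e)" for F
    unfolding uminus_sections_def by (rule section_at_scale[OF assms])
  show "section_at (F - G) A e = add A (section_at F A e) (scale A (-1) (section_at G A e))"
    unfolding minus_sections_def by (simp add: plus minus)
  show "section_at (scaleR r F) A e = scale A (of_real r) (section_at F A e)"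
    unfolding scaleR_sections_def by (rule section_at_scale[OF assms])
qed

instance
proof
  fix F G H :: "('a, 'b) sections" and r q :: real
  show "dist F G = norm (F - G)" by (rule dist_sections_def)
  show "sgn F = scaleR (inverse (norm F)) F" by (rule sgn_sections_def)
  show "(uniformity :: (('a, 'b) sections \<times> ('a, 'b) sections) filter) =
    (INF e\<in>{0 <..}. principal {(x, y). dist x y < e})" by (rule uniformity_sections_def)
  show "open U \<longleftrightarrow> (\<forall>x\<in>U. eventually (\<lambda>(x', y). x' = x \<longrightarrow> y \<in> U) uniformity)"
    for U :: "('a, 'b) sections set" by (rule open_sections_def)
  show "F + G + H = F + (G + H)" "F + G = G + F" "0 + F = F" "- F + F = 0" "F - G = F + - G"
    "scaleR r (F + G) = scaleR r F + scaleR r G" "scaleR (r + q) F = scaleR r F + scaleR q F"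
    "scaleR r (scaleR q F) = scaleR (r * q) F" "scaleR 1 F = F"
  proof (rule_tac [!] section_eqI)
    fix A :: "('a, 'b) fell" and e assume c: "comm_fibre A e"
    interpret fell_bundle A by (rule comm_fibreD(1)[OF c])
    note S = section_in[OF c]
    show "section_at (F + G + H) A e = section_at (F + (G + H)) A e" by (simp add: c add_assoc[OF S S S])
    show "section_at (F + G) A e = section_at (G + F) A e" by (simp add: c add_comm[OF S S])
    show "section_at (0 + F) A e = section_at F A e" by (simp add: c add_zero_left[OF S])
    show "section_at (- F + F) A e = section_at 0 A e"
      by (simp add: c add_comm[OF scale_in[OF S] S] add_minus[OF S])
    show "section_at (F - G) A e = section_at (F + - G) A e" by (simp add: c)
    show "section_at (scaleR r (F + G)) A e = section_at (scaleR r F + scaleR r G) A e"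
      by (simp add: c scale_add[OF S S])
    show "section_at (scaleR (r + q) F) A e = section_at (scaleR r F + scaleR q F) A e"
      by (simp add: c scale_plus[OF S])
    show "section_at (scaleR r (scaleR q F)) A e = section_at (scaleR (r * q) F) A e"
      by (simp add: c scale_scale[OF S])
    show "section_at (scaleR 1 F) A e = section_at F A e" by (simp add: c scale_one[OF S])
  qed
  have norm_nonneg: "0 \<le> norm F" for F :: "('a, 'b) sections"
  proof -
    obtain K where "\<And>A e. comm_fibre A e \<Longrightarrow> nrm A (section_at F A e) \<le> K"
      using section_bounded by blast
    then have "bdd_above (insert 0 {nrm A (section_at F A e) | A e. comm_fibre A e})"
      by (intro bdd_aboveI[of _ "max 0 K"]) (auto simp: le_max_iff_disj)
    then show ?thesis unfolding norm_sections_def by (intro cSup_upper) auto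
  qed
  show "norm F = 0 \<longleftrightarrow> F = 0"
  proof
    assume 0: "norm F = 0"
    show "F = 0"
    proof (rule section_eqI)
      fix A :: "('a, 'b) fell" and e assume c: "comm_fibre A e"
      interpret fell_bundle A by (rule comm_fibreD(1)[OF c])
      have "nrm A (section_at F A e) = 0"
        using sections_norm_ge[OF c, of F] nrm_nonneg[OF section_in[OF c, of F]] 0 by simp
      then show "section_at F A e = section_at 0 A e"
        using nrm_eq_0[OF section_in[OF c, of F]] by (simp add: c)
    qed
  next
    assume "F = 0"
    then have "norm F \<le> 0"
      by (intro sections_norm_le) (auto simp: fell_bundle.nrm_zero comm_fibreD(1))
    then show "norm F = 0" using norm_nonneg[of F] by simp
  qed
  show "norm (F + G) \<le> norm F + norm G"
  proof (rule sections_norm_le)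
    fix A :: "('a, 'b) fell" and e assume c: "comm_fibre A e"
    interpret fell_bundle A by (rule comm_fibreD(1)[OF c])
    show "nrm A (section_at (F + G) A e) \<le> norm F + norm G"
      using nrm_add[OF section_in[OF c, of F] section_in[OF c, of G]]
        sections_norm_ge[OF c, of F] sections_norm_ge[OF c, of G] by (simp add: c)
  qed (simp add: norm_nonneg)
  have scale_le: "norm (scaleR r F) \<le> \<bar>r\<bar> * norm F" for r and F :: "('a, 'b) sections"
  proof (rule sections_norm_le)
    fix A :: "('a, 'b) fell" and e assume c: "comm_fibre A e"
    interpret fell_bundle A by (rule comm_fibreD(1)[OF c])
    show "nrm A (section_at (scaleR r F) A e) \<le> \<bar>r\<bar> * norm F"
      using sections_norm_ge[OF c, of F]
      by (simp add: c nrm_scale[OF section_in[OF c, of F]] mult_left_mono)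
  qed (simp add: norm_nonneg)
  have s_s: "scaleR r (scaleR q F) = scaleR (r * q) F" and s_1: "scaleR 1 F = F"
    for r q and F :: "('a, 'b) sections"
    by (rule section_eqI; simp add: fell_bundle.scale_scale[OF comm_fibreD(1) section_in]
          fell_bundle.scale_one[OF comm_fibreD(1) section_in])+
  show "norm (scaleR r F) = \<bar>r\<bar> * norm F"
  proof (cases "r = 0")
    case False
    then have "\<bar>r\<bar> * norm F = \<bar>r\<bar> * norm (scaleR (1 / r) (scaleR r F))" by (simp add: s_s s_1)
    also have "\<dots> \<le> \<bar>r\<bar> * (\<bar>1 / r\<bar> * norm (scaleR r F))" by (intro mult_left_mono scale_le) auto
    finally show ?thesis using scale_le[of r F] False by simp
  qed (use scale_le[of 0 F] norm_nonneg[of "scaleR 0 F"] in simp)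
qed

end

instantiation sections :: (inverse_semigroup, type) comm_cstar
begin

definition "F * G = mk_section (\<lambda>A e. mul A (section_at F A e) (section_at G A e))"
definition "adj F = mk_section (\<lambda>A e. star A (section_at F A e))"
definition "imul F = mk_section (\<lambda>A e. scale A \<i> (section_at F A e))"

lemma section_at_simps [simp]:
  assumes "comm_fibre A e"
  shows "section_at (F * G) A e = mul A (section_at F A e) (section_at G A e)"
    "section_at (adj F) A e = star A (section_at F A e)"
    "section_at (imul F) A e = scale A \<i> (section_at F A e)"
proof -
  show "section_at (imul F) A e = scale A \<i> (section_at F A e)"
    unfolding imul_sections_def by (rule section_at_scale[OF assms])
  show "section_at (adj F) A e = star A (section_at F A e)"
    unfolding adj_sections_def
  proof (rule section_at_mk[OF assms, where K = "norm F"])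
    fix A :: "('a, 'b) fell" and e assume c: "comm_fibre A e"
    interpret fell_bundle A by (rule comm_fibreD(1)[OF c])
    show "star A (section_at F A e) \<in> fib A e"
      by (rule star_in_idem[OF comm_fibreD(2)[OF c] section_in[OF c]])
    show "nrm A (star A (section_at F A e)) \<le> norm F"
      unfolding nrm_star[OF section_in[OF c]] by (rule sections_norm_ge[OF c])
  qed
  show "section_at (F * G) A e = mul A (section_at F A e) (section_at G A e)"
    unfolding times_sections_def
  proof (rule section_at_mk[OF assms, where K = "norm F * norm G"])
    fix A :: "('a, 'b) fell" and e assume c: "comm_fibre A e"
    interpret fell_bundle A by (rule comm_fibreD(1)[OF c])
    show "mul A (section_at F A e) (section_at G A e) \<in> fib A e"
      by (rule mul_in_idem[OF comm_fibreD(2)[OF c] section_in[OF c] section_in[OF c]])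
    have "nrm A (mul A (section_at F A e) (section_at G A e))
        \<le> nrm A (section_at F A e) * nrm A (section_at G A e)"
      by (rule nrm_mul[OF section_in[OF c] section_in[OF c]])
    also have "\<dots> \<le> norm F * norm G"
      using nrm_nonneg[OF section_in[OF c]] by (intro mult_mono sections_norm_ge[OF c]) auto
    finally show "nrm A (mul A (section_at F A e) (section_at G A e)) \<le> norm F * norm G" .
  qed
qed

instance
proof
  fix F G H :: "('a, 'b) sections" and r q :: real
  show "(F * G) * H = F * (G * H)" "(F + G) * H = F * H + G * H" "F * (G + H) = F * G + F * H"
    "scaleR r F * G = scaleR r (F * G)" "F * scaleR r G = scaleR r (F * G)" "F * G = G * F"
    "adj (F + G) = adj F + adj G" "adj (scaleR r F) = scaleR r (adj F)"
    "adj (F * G) = adj G * adj F" "adj (adj F) = F" "imul (F + G) = imul F + imul G"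
    "imul (scaleR r F) = scaleR r (imul F)" "imul (imul F) = - F" "imul F * G = imul (F * G)"
    "adj (imul F) = - imul (adj F)"
  proof (rule_tac [!] section_eqI)
    fix A :: "('a, 'b) fell" and e assume c: "comm_fibre A e"
    interpret fell_bundle A by (rule comm_fibreD(1)[OF c])
    note S = section_in[OF c]
    note S' = star_in_idem[OF comm_fibreD(2)[OF c] S]
    show "section_at ((F * G) * H) A e = section_at (F * (G * H)) A e"
      by (simp add: c mul_assoc[OF S S S])
    show "section_at ((F + G) * H) A e = section_at (F * H + G * H) A e"
      by (simp add: c mul_add_left[OF S S S])
    show "section_at (F * (G + H)) A e = section_at (F * G + F * H) A e"
      by (simp add: c mul_add_right[OF S S S])
    show "section_at (scaleR r F * G) A e = section_at (scaleR r (F * G)) A e"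
      by (simp add: c mul_scale_left[OF S S])
    show "section_at (F * scaleR r G) A e = section_at (scaleR r (F * G)) A e"
      by (simp add: c mul_scale_right[OF S S])
    show "section_at (F * G) A e = section_at (G * F) A e"
      by (simp add: c comm_fibreD(3)[OF c S S])
    show "section_at (adj (F + G)) A e = section_at (adj F + adj G) A e"
      by (simp add: c star_add[OF S S])
    show "section_at (adj (scaleR r F)) A e = section_at (scaleR r (adj F)) A e"
      by (simp add: c star_scale[OF S])
    show "section_at (adj (F * G)) A e = section_at (adj G * adj F) A e"
      by (simp add: c star_mul[OF S S])
    show "section_at (adj (adj F)) A e = section_at F A e" by (simp add: c star_star[OF S])
    show "section_at (imul (F + G)) A e = section_at (imul F + imul G) A e"
      by (simp add: c scale_add[OF S S])
    show "section_at (imul (scaleR r F)) A e = section_at (scaleR r (imul F)) A e"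
      by (simp add: c scale_scale[OF S] mult.commute)
    show "section_at (imul (imul F)) A e = section_at (- F) A e" by (simp add: c scale_scale[OF S])
    show "section_at (imul F * G) A e = section_at (imul (F * G)) A e"
      by (simp add: c mul_scale_left[OF S S])
    show "section_at (adj (imul F)) A e = section_at (- imul (adj F)) A e"
      by (simp add: c star_scale[OF S] scale_scale[OF S'])
  qed
  show "norm (F * G) \<le> norm F * norm G"
  proof (rule sections_norm_le)
    fix A :: "('a, 'b) fell" and e assume c: "comm_fibre A e"
    interpret fell_bundle A by (rule comm_fibreD(1)[OF c])
    have "nrm A (section_at (F * G) A e) \<le> nrm A (section_at F A e) * nrm A (section_at G A e)"
      using nrm_mul[OF section_in[OF c, of F] section_in[OF c, of G]] by (simp add: c)
    also have "\<dots> \<le> norm F * norm G"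
      using nrm_nonneg[OF section_in[OF c]] by (intro mult_mono sections_norm_ge[OF c]) auto
    finally show "nrm A (section_at (F * G) A e) \<le> norm F * norm G" .
  qed simp
  show "norm (adj F * F) = (norm F)\<^sup>2"
  proof (rule antisym)
    show "norm (adj F * F) \<le> (norm F)\<^sup>2"
    proof (rule sections_norm_le)
      fix A :: "('a, 'b) fell" and e assume c: "comm_fibre A e"
      interpret fell_bundle A by (rule comm_fibreD(1)[OF c])
      show "nrm A (section_at (adj F * F) A e) \<le> (norm F)\<^sup>2"
        using sections_norm_ge[OF c, of F] nrm_nonneg[OF section_in[OF c, of F]]
        by (simp add: c cstar_identity[OF section_in[OF c]] power_mono)
    qed simp
    have "norm F \<le> sqrt (norm (adj F * F))"
    proof (rule sections_norm_le)
      fix A :: "('a, 'b) fell" and e assume c: "comm_fibre A e"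
      interpret fell_bundle A by (rule comm_fibreD(1)[OF c])
      show "nrm A (section_at F A e) \<le> sqrt (norm (adj F * F))"
        using sections_norm_ge[OF c, of "adj F * F"]
        by (intro real_le_rsqrt) (simp add: c cstar_identity[OF section_in[OF c]])
    qed simp
    then show "(norm F)\<^sup>2 \<le> norm (adj F * F)"
      using power_mono[OF _ norm_ge_zero, of F "sqrt (norm (adj F * F))" 2] norm_ge_zero[of "adj F * F"]
      by simp
  qed
  have dist_le: "fdist A (section_at F A e) (section_at G A e) \<le> norm (F - G)"
    if "comm_fibre A e" for A :: "('a, 'b) fell" and e F G
    using sections_norm_ge[OF that, of "F - G"] that by (simp add: fdist_def)
  have le_dist: "norm (F - G) \<le> K"
    if "0 \<le> K" "\<And>A e. comm_fibre A e \<Longrightarrow> fdist A (section_at F A e) (section_at G A e) \<le> K"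
    for F G :: "('a, 'b) sections" and K
    using that by (intro sections_norm_le) (auto simp: fdist_def)
  show "convergent X" if X: "Cauchy X" for X :: "nat \<Rightarrow> ('a, 'b) sections"
  proof -
    have C: "\<exists>N. \<forall>m\<ge>N. \<forall>n\<ge>N. norm (X m - X n) < \<epsilon>" if "\<epsilon> > 0" for \<epsilon>
      using CauchyD[OF X that] .
    have "\<exists>l. l \<in> fib A e \<and> (\<lambda>n. fdist A (section_at (X n) A e) l) \<longlonglongrightarrow> 0"
      if c: "comm_fibre A e" for A :: "('a, 'b) fell" and e
    proof -
      interpret fell_bundle A by (rule comm_fibreD(1)[OF c])
      show ?thesis
      proof (rule fibre_complete[of "\<lambda>n. section_at (X n) A e" e])
        fix \<epsilon> :: real assume "\<epsilon> > 0"
        then show "\<exists>N. \<forall>m\<ge>N. \<forall>n\<ge>N. fdist A (section_at (X m) A e) (section_at (X n) A e) < \<epsilon>"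
          using C[of \<epsilon>] dist_le[OF c] by (meson le_less_trans)
      qed (use section_in[OF c] in auto)
    qed
    then obtain l where l: "\<And>A e. comm_fibre A e \<Longrightarrow> l A e \<in> fib A e"
      "\<And>A e. comm_fibre A e \<Longrightarrow> (\<lambda>n. fdist A (section_at (X n) A e) (l A e)) \<longlonglongrightarrow> 0"
      by metis
    have near: "fdist A (section_at (X m) A e) (l A e) \<le> \<epsilon>"
      if N: "\<forall>m\<ge>N. \<forall>n\<ge>N. norm (X m - X n) < \<epsilon>" and m: "m \<ge> N" and c: "comm_fibre A e"
      for \<epsilon> N m and A :: "('a, 'b) fell" and e
    proof -
      interpret fell_bundle A by (rule comm_fibreD(1)[OF c])
      have "fdist A (section_at (X m) A e) (l A e) \<le> \<epsilon> + fdist A (section_at (X n) A e) (l A e)"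
        if "n \<ge> N" for n
        using fdist_triangle[OF section_in[OF c, of "X m"] section_in[OF c, of "X n"] l(1)[OF c]]
          dist_le[OF c, of "X m" "X n"] N[rule_format, OF m that] by linarith
      moreover have "(\<lambda>n. \<epsilon> + fdist A (section_at (X n) A e) (l A e)) \<longlonglongrightarrow> \<epsilon> + 0"
        by (intro tendsto_intros l(2)[OF c])
      ultimately show ?thesis
        using LIMSEQ_le_const[of "\<lambda>n. \<epsilon> + fdist A (section_at (X n) A e) (l A e)" "\<epsilon> + 0"
            "fdist A (section_at (X m) A e) (l A e)"] by auto
    qed
    obtain N1 where N1: "\<forall>m\<ge>N1. \<forall>n\<ge>N1. norm (X m - X n) < 1" using C[of 1] by auto
    define L where "L = mk_section l"
    have L: "section_at L A e = l A e" if c: "comm_fibre A e" for A :: "('a, 'b) fell" and e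
      unfolding L_def
    proof (rule section_at_mk[OF c l(1), where K = "1 + norm (X N1)"])
      fix A :: "('a, 'b) fell" and e assume c: "comm_fibre A e"
      interpret fell_bundle A by (rule comm_fibreD(1)[OF c])
      have "nrm A (l A e) = fdist A (l A e) (zero A e)"
        unfolding fdist_def using l(1)[OF c]
        by (simp add: scale_zero_right add_zero_right[where s = e])
      also have "\<dots> \<le> fdist A (l A e) (section_at (X N1) A e)
          + fdist A (section_at (X N1) A e) (section_at 0 A e)"
        using fdist_triangle[OF l(1)[OF c] section_in[OF c] zero_in[of e]] by (simp add: c)
      also have "\<dots> \<le> 1 + norm (X N1 - 0)"
        using near[OF N1 _ c, of N1] fdist_commute[OF l(1)[OF c] section_in[OF c]]
        by (intro add_mono dist_le[OF c]) auto
      finally show "nrm A (l A e) \<le> 1 + norm (X N1)" by simp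
    qed
    have "X \<longlonglongrightarrow> L"
      unfolding lim_sequentially
    proof (intro allI impI)
      fix \<epsilon> :: real assume e: "\<epsilon> > 0"
      then obtain N where N: "\<forall>m\<ge>N. \<forall>n\<ge>N. norm (X m - X n) < \<epsilon> / 2" using C[of "\<epsilon> / 2"] by auto
      have "norm (X m - L) \<le> \<epsilon> / 2" if "m \<ge> N" for m
        using near[OF N that] L e by (intro le_dist) auto
      then have "dist (X m) L < \<epsilon>" if "m \<ge> N" for m
        using e that unfolding dist_norm by (rule_tac le_less_trans[of _ "\<epsilon> / 2"]) auto
      then show "\<exists>N. \<forall>n\<ge>N. dist (X n) L < \<epsilon>"
        by blast
    qed
    then show ?thesis by (rule convergentI)
  qed
qed

end


subsection \<open>Fibres over idempotents\<close>

definition single :: "('s :: inverse_semigroup, 'a) fell \<Rightarrow> 's \<Rightarrow> 'a \<Rightarrow> ('s, 'a) sections" where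
  "single A e a = mk_section (\<lambda>A' e'. if A' = A \<and> e' = e then a else zero A' e')"

context
  fixes A :: "('s :: inverse_semigroup, 'a) fell" and e :: 's
  assumes c: "comm_fibre A e"
begin

interpretation fell_bundle A by (rule comm_fibreD(1)[OF c])

lemma section_at_single:
  assumes "a \<in> fib A e" and "comm_fibre A' e'"
  shows "section_at (single A e a) A' e' = (if A' = A \<and> e' = e then a else zero A' e')"
  unfolding single_def
  by (rule section_at_mk[OF assms(2), where K = "nrm A a"])
    (use assms(1) nrm_nonneg[OF assms(1)] in auto)

lemma section_at_single_self [simp]: "a \<in> fib A e \<Longrightarrow> section_at (single A e a) A e = a"
  by (simp add: section_at_single c)

lemma norm_single: "a \<in> fib A e \<Longrightarrow> norm (single A e a) = nrm A a"
proof (rule antisym)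
  assume a: "a \<in> fib A e"
  show "norm (single A e a) \<le> nrm A a"
    by (rule sections_norm_le)
      (use a nrm_nonneg[OF a] in \<open>auto simp: section_at_single\<close>)
  show "nrm A a \<le> norm (single A e a)"
    using sections_norm_ge[OF c, of "single A e a"] a by simp
qed

lemma single_eqI:
  assumes "a \<in> fib A e" and "section_at F A e = a"
    and "\<And>A' e'. comm_fibre A' e' \<Longrightarrow> A' \<noteq> A \<or> e' \<noteq> e \<Longrightarrow> section_at F A' e' = zero A' e'"
  shows "F = single A e a"
  by (rule section_eqI) (use assms in \<open>auto simp: section_at_single\<close>)

lemma mul_zero_right: "fell_bundle B \<Longrightarrow> a \<in> fib B s \<Longrightarrow> mul B a (zero B t) = zero B (s * t)"
proof -
  assume B: "fell_bundle B" and a: "a \<in> fib B s"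
  interpret B: fell_bundle B by (rule B)
  have "mul B a (scale B 0 (zero B t)) = scale B 0 (mul B a (zero B t))"
    by (rule B.mul_scale_right[OF a B.zero_in])
  then show ?thesis
    by (simp add: B.scale_zero[OF B.zero_in] B.scale_zero[OF B.mul_closed[OF a B.zero_in]])
qed

lemma single_simps:
  assumes a: "a \<in> fib A e" and b: "b \<in> fib A e"
  shows "single A e (add A a b) = single A e a + single A e b"
    "single A e (mul A a b) = single A e a * single A e b"
    "single A e (star A a) = adj (single A e a)"
    "single A e (scale A (of_real r) a) = r *\<^sub>R single A e a"
    "single A e (scale A \<i> a) = imul (single A e a)"
proof -
  note id = comm_fibreD(2)[OF c]
  have z: "zero A' e' = star A' (zero A' e')" "zero A' e' = scale A' z (zero A' e')"
      "zero A' e' = mul A' (zero A' e') (zero A' e')" "zero A' e' = add A' (zero A' e') (zero A' e')"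
    if c': "comm_fibre A' e'" for A' :: "('s, 'a) fell" and e' z
  proof -
    interpret A': fell_bundle A' by (rule comm_fibreD(1)[OF c'])
    show "zero A' e' = scale A' z (zero A' e')" by (simp add: A'.scale_zero_right)
    show "zero A' e' = add A' (zero A' e') (zero A' e')" by (simp add: A'.add_zero_left[OF A'.zero_in])
    show "zero A' e' = mul A' (zero A' e') (zero A' e')"
      using mul_zero_right[OF comm_fibreD(1)[OF c'] A'.zero_in, of e' e'] comm_fibreD(2)[OF c']
      by (simp add: idem_def)
    have "star A' (zero A' e') \<in> fib A' e'"
      by (rule A'.star_in_idem[OF comm_fibreD(2)[OF c'] A'.zero_in])
    moreover have "nrm A' (star A' (zero A' e')) = 0" by (simp add: A'.nrm_star[OF A'.zero_in])
    ultimately show "zero A' e' = star A' (zero A' e')" using A'.nrm_eq_0 by simp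
  qed
  show "single A e (add A a b) = single A e a + single A e b"
    by (rule single_eqI[symmetric]) (use a b c in \<open>auto simp: section_at_single z(4)[symmetric]\<close>)
  show "single A e (mul A a b) = single A e a * single A e b"
    by (rule single_eqI[symmetric])
      (use a b c mul_in_idem[OF id a b] in \<open>auto simp: section_at_single z(3)[symmetric]\<close>)
  show "single A e (star A a) = adj (single A e a)"
    by (rule single_eqI[symmetric])
      (use a c star_in_idem[OF id a] in \<open>auto simp: section_at_single z(1)[symmetric]\<close>)
  show "single A e (scale A (of_real r) a) = r *\<^sub>R single A e a"
    by (rule single_eqI[symmetric]) (use a c in \<open>auto simp: section_at_single z(2)[symmetric]\<close>)
  show "single A e (scale A \<i> a) = imul (single A e a)"
    by (rule single_eqI[symmetric]) (use a c in \<open>auto simp: section_at_single z(2)[symmetric]\<close>)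
qed

lemma section_at_cscale: "section_at (cscale z F) A e = scale A z (section_at F A e)"
proof -
  have "scale A (of_real (Re z) + \<i> * of_real (Im z)) (section_at F A e) = section_at (cscale z F) A e"
    unfolding cscale_def
    by (simp add: c scale_plus[OF section_in[OF c]] scale_scale[OF section_in[OF c]])
  then show ?thesis by (simp flip: complex_eq)
qed

lemma fibre_one_minus_sqrt:
  assumes m: "m \<in> fib A e" "star A m = m" "nrm A m \<le> 1"
  obtains v where "v \<in> fib A e" "star A v = v" "add A (mul A m m) (mul A v v) = add A v v"
proof -
  have "adj (single A e m) = single A e m" using m single_simps(3)[OF m(1) m(1)] by simp
  then obtain v where "unitary_parts v (single A e m)"
    using self_adjoint_unitary_part m(3) norm_single[OF m(1)] by metis
  then have "adj v = v" "single A e m * single A e m + v * v = v + v"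
    by (auto simp: unitary_parts_def)
  from this[THEN arg_cong[of _ _ "\<lambda>F. section_at F A e"]] show ?thesis
    using that[OF section_in[OF c, of v]] by (simp add: c m(1))
qed

lemma fibre_functional:
  assumes add: "\<And>a b. a \<in> fib A e \<Longrightarrow> b \<in> fib A e \<Longrightarrow> f (add A a b) = f a + f b"
    and scale: "\<And>z a. a \<in> fib A e \<Longrightarrow> f (scale A z a) = z * f a"
    and mul: "\<And>a b. a \<in> fib A e \<Longrightarrow> b \<in> fib A e \<Longrightarrow> f (mul A a b) = f a * f b"
    and a: "a \<in> fib A e"
  shows "cmod (f a) \<le> nrm A a" and "f (star A a) = cnj (f a)"
proof -
  have *: "mult_functional (\<lambda>F. f (section_at F A e))"
    unfolding mult_functional_def
    by (simp add: c section_at_cscale add[OF section_in section_in] scale[OF section_in]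
        mul[OF section_in section_in])
  show "cmod (f a) \<le> nrm A a" "f (star A a) = cnj (f a)"
    using mult_functional_norm_le[OF *, of "single A e a"] mult_functional_adj[OF *, of "single A e a"]
    by (simp_all add: a c norm_single)
qed

end

text \<open>An injective homomorphism between fibres extends by zero to the algebras of sections; there the
  projection onto the summand \<open>fib B f\<close> has the same kernel.\<close>

lemma fibre_hom_isometric:
  fixes B :: "('t :: inverse_semigroup, 'b) fell" and A :: "('s :: inverse_semigroup, 'a) fell"
  assumes cB: "comm_fibre B f" and cA: "comm_fibre A e"
    and \<psi>: "\<And>a. a \<in> fib B f \<Longrightarrow> \<psi> a \<in> fib A e"
      "\<And>a b. a \<in> fib B f \<Longrightarrow> b \<in> fib B f \<Longrightarrow> \<psi> (add B a b) = add A (\<psi> a) (\<psi> b)"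
      "\<And>z a. a \<in> fib B f \<Longrightarrow> \<psi> (scale B z a) = scale A z (\<psi> a)"
      "\<And>a b. a \<in> fib B f \<Longrightarrow> b \<in> fib B f \<Longrightarrow> \<psi> (mul B a b) = mul A (\<psi> a) (\<psi> b)"
      "\<And>a. a \<in> fib B f \<Longrightarrow> \<psi> (star B a) = star A (\<psi> a)"
    and inj: "inj_on \<psi> (fib B f)" and b: "b \<in> fib B f"
  shows "nrm A (\<psi> b) = nrm B b"
proof -
  interpret B: fell_bundle B by (rule comm_fibreD(1)[OF cB])
  interpret A: fell_bundle A by (rule comm_fibreD(1)[OF cA])
  define F where "F x = single A e (\<psi> (section_at x B f))" for x
  define P where "P x = single B f (section_at x B f)" for x
  note S = section_in[OF cB]
  have F: "star_hom F"
    unfolding star_hom_def F_def using cB S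
    by (simp add: \<psi> single_simps[OF cA \<psi>(1)[OF S] \<psi>(1)[OF S]])
  have P: "star_hom P"
    unfolding star_hom_def P_def using cB by (simp add: single_simps[OF cB S S])
  have FP: "F (P x) = F x" for x by (simp add: F_def P_def cB S)
  have z: "\<psi> (zero B f) = zero A e"
    using \<psi>(3)[OF B.zero_in, of 0] B.scale_zero[OF B.zero_in] A.scale_zero[OF \<psi>(1)[OF B.zero_in]]
    by simp
  have s0: "single B f (zero B f) = 0"
    using norm_single[OF cB B.zero_in] by simp
  have ker: "P x = 0" if "F x = 0" for x
  proof -
    have "\<psi> (section_at x B f) = section_at 0 A e"
      using arg_cong[OF that, of "\<lambda>F. section_at F A e"] by (simp add: F_def cA S \<psi>(1))
    then have "\<psi> (section_at x B f) = \<psi> (zero B f)" by (simp add: cA z)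
    then have "section_at x B f = zero B f" using inj S B.zero_in by (auto dest: inj_onD)
    then show ?thesis by (simp add: P_def s0)
  qed
  let ?x = "single B f b"
  have "norm (P ?x) = nrm B b" "norm (F ?x) = nrm A (\<psi> b)" "norm ?x = nrm B b"
    by (simp_all add: P_def F_def b cB cA \<psi>(1) norm_single)
  moreover have "norm (P ?x) \<le> norm (F ?x)"
    by (rule star_hom_isometric[OF F P]) (fact FP, fact ker)
  moreover have "norm (F ?x) \<le> norm ?x" by (rule star_hom_norm_le[OF F])
  ultimately show ?thesis by simp
qed


section \<open>Multiplication in a semi-abelian Fell bundle\<close>

definition total :: "('s, 'a) fell \<Rightarrow> 'a set" where "total A = (\<Union>s. fib A s)"

context fell_bundle
begin

lemma totalI: "a \<in> fib A s \<Longrightarrow> a \<in> total A"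
  by (auto simp: total_def)

lemma idem_partI: "idem e \<Longrightarrow> a \<in> fib A e \<Longrightarrow> a \<in> idem_part A"
  by (auto simp: idem_part_def)

lemma idem_partE: "a \<in> idem_part A \<Longrightarrow> (\<And>e. idem e \<Longrightarrow> a \<in> fib A e \<Longrightarrow> P) \<Longrightarrow> P"
  by (auto simp: idem_part_def)

lemma idem_part_total [simp]: "a \<in> idem_part A \<Longrightarrow> a \<in> total A"
  by (auto simp: idem_part_def total_def)

lemma total_mul [simp]: "a \<in> total A \<Longrightarrow> b \<in> total A \<Longrightarrow> mul A a b \<in> total A"
  by (auto simp: total_def intro: mul_closed)

lemma total_star [simp]: "a \<in> total A \<Longrightarrow> star A a \<in> total A"
  by (auto simp: total_def intro: star_closed)

lemma total_assoc: "a \<in> total A \<Longrightarrow> b \<in> total A \<Longrightarrow> c \<in> total A \<Longrightarrow>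
    mul A (mul A a b) c = mul A a (mul A b c)"
  by (auto simp: total_def mul_assoc)

lemma total_star_mul [simp]: "a \<in> total A \<Longrightarrow> b \<in> total A \<Longrightarrow>
    star A (mul A a b) = mul A (star A b) (star A a)"
  by (auto simp: total_def star_mul)

lemma total_star_star [simp]: "a \<in> total A \<Longrightarrow> star A (star A a) = a"
  by (auto simp: total_def star_star)

lemma idem_part_mul [simp]: "a \<in> idem_part A \<Longrightarrow> b \<in> idem_part A \<Longrightarrow> mul A a b \<in> idem_part A"
  by (auto elim!: idem_partE intro: idem_partI[OF idem_mult] mul_closed)

lemma idem_part_star [simp]: "a \<in> idem_part A \<Longrightarrow> star A a \<in> idem_part A"
  by (auto simp: idem_part_def intro: star_in_idem)

lemma idem_part_scale [simp]: "a \<in> idem_part A \<Longrightarrow> scale A z a \<in> idem_part A"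
  by (auto simp: idem_part_def)

lemma star_mul_same_fib [simp]:
  assumes "a \<in> fib A s" "b \<in> fib A s"
  shows "mul A (star A a) b \<in> idem_part A" "mul A a (star A b) \<in> idem_part A"
  using assms mul_closed[OF star_closed[OF assms(1)] assms(2)]
    mul_closed[OF assms(1) star_closed[OF assms(2)]]
  by (auto intro!: idem_partI)

lemma star_mul_self [simp]:
  assumes "a \<in> total A" shows "mul A (star A a) a \<in> idem_part A" "mul A a (star A a) \<in> idem_part A"
  using assms by (auto simp: total_def)

lemma idem_conj:
  assumes e: "idem e" shows "idem (sinv s * e * s)"
proof -
  have "sinv s * e * s * (sinv s * e * s) = sinv s * (e * (s * sinv s) * e) * s"
    by (simp add: mult.assoc)
  also have "\<dots> = sinv s * (s * sinv s * e * e) * s" using e by (simp add: idem_commute[of e])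
  also have "\<dots> = (sinv s * s * sinv s) * (e * e) * s" by (simp add: mult.assoc)
  finally show ?thesis using e by (simp add: idem_def sinv_right)
qed

lemma conj_in_idem [simp]:
  assumes "b \<in> total A" "a \<in> idem_part A"
  shows "mul A (star A b) (mul A a b) \<in> idem_part A" "mul A b (mul A a (star A b)) \<in> idem_part A"
proof -
  obtain s e where b: "b \<in> fib A s" and a: "a \<in> fib A e" "idem e"
    using assms by (auto simp: total_def idem_part_def)
  have "mul A (star A b) (mul A a b) \<in> fib A (sinv s * (e * s))"
    by (intro mul_closed star_closed a b)
  then show "mul A (star A b) (mul A a b) \<in> idem_part A"
    using idem_conj[OF a(2), of s] by (auto simp: mult.assoc intro: idem_partI)
  have "mul A b (mul A a (star A b)) \<in> fib A (s * (e * sinv s))"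
    by (intro mul_closed star_closed a b)
  then show "mul A b (mul A a (star A b)) \<in> idem_part A"
    using idem_conj[OF a(2), of "sinv s"] by (auto simp: mult.assoc intro: idem_partI)
qed

lemma mul_zero: "a \<in> fib A s \<Longrightarrow> mul A a (zero A t) = zero A (s * t)"
  "a \<in> fib A s \<Longrightarrow> mul A (zero A t) a = zero A (t * s)"
  using mul_scale_right[OF _ zero_in, of a s 0 t] mul_scale_left[OF zero_in, of a s 0 t]
    scale_zero[OF mul_closed[OF zero_in, of a s t]] scale_zero[OF mul_closed[OF _ zero_in, of a s t]]
  by (simp_all add: scale_zero[OF zero_in])

lemma eq_zero_if_star_mul: "a \<in> fib A s \<Longrightarrow> nrm A (mul A (star A a) a) = 0 \<Longrightarrow> a = zero A s"
  using cstar_identity[of a s] nrm_eq_0[of a s] by simp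

text \<open>If \<open>h = a\<^sup>*a\<close> and \<open>a h = 0\<close>, then \<open>h\<^sup>*h = a\<^sup>*(a h) = 0\<close>.\<close>

lemma eq_zero_if_mul_star_mul:
  assumes a: "a \<in> fib A s" and 0: "nrm A (mul A a (mul A (star A a) a)) = 0"
  shows "a = zero A s"
proof -
  let ?h = "mul A (star A a) a"
  have h: "?h \<in> fib A (sinv s * s)" by (intro mul_closed star_closed a)
  have t: "a \<in> total A" using a by (rule totalI)
  have "nrm A (mul A (star A ?h) ?h) \<le> nrm A (star A a) * nrm A (mul A a ?h)"
    using nrm_mul[OF star_closed[OF a] mul_closed[OF a h]] t by (simp add: total_assoc)
  then have "(nrm A ?h)\<^sup>2 \<le> 0" using 0 cstar_identity[OF h] by simp
  then show ?thesis using a by (intro eq_zero_if_star_mul) auto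
qed

end

locale semiabelian_bundle = fell_bundle A for A :: "('s :: inverse_semigroup, 'a) fell" +
  assumes semi_abelian: "semi_abelian A"
begin

lemma comm_fibre: "idem e \<Longrightarrow> comm_fibre A e"
  by (simp add: comm_fibre_def semi_abelian fell_bundle_axioms)

lemma fibre_commute: "idem e \<Longrightarrow> a \<in> fib A e \<Longrightarrow> b \<in> fib A e \<Longrightarrow> mul A a b = mul A b a"
  using semi_abelian by (auto simp: semi_abelian_def)

text \<open>Commutativity is only assumed inside the single fibres. For \<open>a \<in> fib A e\<close>,
  \<open>c \<in> fib A f\<close> the commutator \<open>w = ac - ca\<close> lies in \<open>fib A (e * f)\<close> and is annihilated by
  products \<open>d\<^sub>1 d\<^sub>2\<close> of elements of that fibre, in particular by \<open>w\<^sup>* w\<close>.\<close>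

lemma idem_part_commute:
  assumes "a \<in> idem_part A" "c \<in> idem_part A"
  shows "mul A a c = mul A c a"
proof -
  obtain e f where a: "a \<in> fib A e" "idem e" and c: "c \<in> fib A f" "idem f"
    using assms by (auto simp: idem_part_def)
  let ?D = "fib A (e * f)"
  have id: "idem (e * f)" using a c by (simp add: idem_mult)
  have ef: "e * (e * f) = e * f" "e * f * e = e * f" "f * (e * f) = e * f" "e * f * f = e * f" "f * e = e * f"
    using a c by (metis idem_def idem_commute mult.assoc)+
  have in1: "mul A a d \<in> ?D" "mul A d a \<in> ?D" "mul A c d \<in> ?D" "mul A d c \<in> ?D" if "d \<in> ?D" for d
    using mul_closed[OF a(1) that] mul_closed[OF that a(1)] mul_closed[OF c(1) that]
      mul_closed[OF that c(1)] by (simp_all add: ef)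
  have ac: "mul A a c \<in> ?D" "mul A c a \<in> ?D"
    using mul_closed[OF a(1) c(1)] mul_closed[OF c(1) a(1)] by (simp_all add: ef)
  note comm = fibre_commute[OF id]
  have t: "a \<in> total A" "c \<in> total A" "\<And>d. d \<in> ?D \<Longrightarrow> d \<in> total A"
    using assms by (auto intro: totalI)
  have kill: "mul A (mul A a c) (mul A x y) = mul A (mul A c a) (mul A x y)"
    if x: "x \<in> ?D" and y: "y \<in> ?D" for x y
  proof -
    have a_xy: "mul A a (mul A x y) = mul A (mul A x y) a"
    proof -
      have "mul A a (mul A x y) = mul A (mul A a x) y" using t x y by (simp add: total_assoc)
      also have "\<dots> = mul A (mul A y a) x" using t x y comm[OF in1(1)[OF x] y] by (simp add: total_assoc)
      also have "\<dots> = mul A (mul A x y) a" using t x y comm[OF x in1(2)[OF y]] by (simp add: total_assoc)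
      finally show ?thesis .
    qed
    have "mul A (mul A a c) (mul A x y) = mul A a (mul A (mul A c x) y)"
      using t x y by (simp add: total_assoc)
    also have "\<dots> = mul A (mul A a y) (mul A c x)"
      using t x y comm[OF in1(3)[OF x] y] by (simp add: total_assoc)
    also have "\<dots> = mul A (mul A c x) (mul A a y)"
      by (rule comm[OF in1(1)[OF y] in1(3)[OF x]])
    also have "\<dots> = mul A c (mul A (mul A x a) y)" using t x y by (simp add: total_assoc)
    also have "\<dots> = mul A c (mul A (mul A y x) a)"
      using t x y comm[OF in1(2)[OF x] y] by (simp add: total_assoc)
    also have "mul A (mul A y x) a = mul A a (mul A x y)" using a_xy comm[OF x y] by simp
    finally show ?thesis using t x y by (simp add: total_assoc)
  qed
  let ?w = "add A (mul A a c) (scale A (-1) (mul A c a))"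
  have w: "?w \<in> ?D" using ac by simp
  have "mul A ?w (mul A (star A ?w) ?w) = zero A (e * f * (e * f))"
    using kill[OF star_in_idem[OF id w] w] mul_in_idem[OF id star_in_idem[OF id w] w]
    by (simp add: mul_diff_left[OF ac] add_minus[OF mul_closed[OF ac(2)]])
  then have "?w = zero A (e * f)" by (intro eq_zero_if_mul_star_mul w) simp
  then have "fdist A (mul A a c) (mul A c a) = 0" by (simp add: fdist_def)
  then show ?thesis using fdist_eq_0[OF ac] by simp
qed

lemma idem_part_left_commute:
  assumes "a \<in> idem_part A" "c \<in> idem_part A" "x \<in> total A"
  shows "mul A a (mul A c x) = mul A c (mul A a x)"
  using total_assoc[of a c x] total_assoc[of c a x] idem_part_commute[OF assms(1,2)] assms by simp

text \<open>In a line bundle this holds since \<open>b b\<^sub>1\<^sup>* b\<^sub>1\<close> and \<open>b\<^sub>1 b\<^sub>1\<^sup>* b\<close> are the same product of three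
  scalars. Here the difference \<open>w\<close> satisfies \<open>w b\<^sub>1\<^sup>* = 0 = b\<^sub>1\<^sup>* w\<close> because the two idempotent fibres
  involved are commutative, and this gives \<open>w\<^sup>* w = 0\<close>.\<close>

lemma same_fibre_exchange:
  assumes b1: "b1 \<in> fib A s" and b: "b \<in> fib A s"
  shows "mul A b (mul A (star A b1) b1) = mul A b1 (mul A (star A b1) b)"
proof -
  let ?x = "mul A b (mul A (star A b1) b1)" and ?y = "mul A b1 (mul A (star A b1) b)"
  have ss: "s * (sinv s * s) = s" by (simp add: sinv_left flip: mult.assoc)
  have xy: "?x \<in> fib A s" "?y \<in> fib A s"
    using mul_closed[OF b mul_closed[OF star_closed[OF b1] b1]]
      mul_closed[OF b1 mul_closed[OF star_closed[OF b1] b]] by (simp_all add: ss)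
  have t [simp]: "b \<in> total A" "b1 \<in> total A" using b b1 by (auto intro: totalI)
  have D: "mul A (star A p) q \<in> idem_part A" "mul A p (star A q) \<in> idem_part A"
    if "p \<in> {b, b1}" "q \<in> {b, b1}" for p q using that b b1 by auto
  have r: "mul A ?x (star A b1) = mul A ?y (star A b1)"
    using idem_part_commute[OF D(2)[of b b1] D(2)[of b1 b1]] by (simp add: total_assoc)
  have l: "mul A (star A b1) ?x = mul A (star A b1) ?y"
    using idem_part_commute[OF D(1)[of b1 b] D(1)[of b1 b1]] by (simp add: total_assoc)
  let ?w = "add A ?x (scale A (-1) ?y)"
  have w: "?w \<in> fib A s" using xy by simp
  then have wt [simp]: "?w \<in> total A" by (rule totalI)
  have wb: "mul A ?w (star A b1) = zero A (s * sinv s)"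
    using mul_diff_left[OF xy star_closed[OF b1]] r
    by (simp add: add_minus[OF mul_closed[OF xy(2) star_closed[OF b1]]])
  have bw: "mul A (star A b1) ?w = zero A (sinv s * s)"
    using mul_diff_right[OF star_closed[OF b1] xy] l
    by (simp add: add_minus[OF mul_closed[OF star_closed[OF b1] xy(2)]])
  have bsw: "mul A (star A b) ?w \<in> idem_part A" by (rule star_mul_same_fib(1)[OF b w])
  have "mul A (star A ?x) ?w = mul A (mul A (star A b1) b1) (mul A (star A b) ?w)"
    by (simp add: total_assoc)
  also have "\<dots> = mul A (mul A (star A b) ?w) (mul A (star A b1) b1)"
    by (rule idem_part_commute[OF _ bsw]) simp
  also have "\<dots> = mul A (star A b) (mul A (mul A ?w (star A b1)) b1)" by (simp add: total_assoc)
  also have "\<dots> = zero A (sinv s * (s * sinv s * s))"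
    unfolding wb by (simp add: mul_zero[OF b1] mul_zero[OF star_closed[OF b]])
  finally have 1: "mul A (star A ?x) ?w = zero A (sinv s * s)" by (simp add: sinv_left)
  have "mul A (star A ?y) ?w = mul A (star A b) (mul A b1 (mul A (star A b1) ?w))"
    by (simp add: total_assoc)
  also have "\<dots> = zero A (sinv s * s)"
    unfolding bw by (simp add: mul_zero[OF b1] mul_zero[OF star_closed[OF b]] ss)
  finally have 2: "mul A (star A ?y) ?w = zero A (sinv s * s)" .
  have "mul A (star A ?w) ?w = zero A (sinv s * s)"
    by (subst star_diff[OF xy], subst mul_diff_left[OF star_closed[OF xy(1)] star_closed[OF xy(2)] w])
      (simp only: 1 2 add_minus[OF zero_in])
  then have "?w = zero A s" by (intro eq_zero_if_star_mul w) simp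
  then have "fdist A ?x ?y = 0" by (simp add: fdist_def)
  then show ?thesis using fdist_eq_0[OF xy] by simp
qed

end

section \<open>The Hilbert space \<open>\<ell>\<^sup>2\<close>\<close>

lemma ell2_normI:
  assumes "\<And>F. finite F \<Longrightarrow> L2_set (\<lambda>i. cmod (x i)) F \<le> K"
  shows "x \<in> ell2" and "ell2_norm x \<le> K"
proof -
  have K: "0 \<le> K" using assms[of "{}"] by simp
  have b: "(\<Sum>i\<in>F. (cmod (x i))\<^sup>2) \<le> K\<^sup>2" if "finite F" for F
    using assms[OF that] power_mono[of "L2_set (\<lambda>i. cmod (x i)) F" K 2]
    by (simp add: L2_set_def sum_nonneg)
  then have s: "(\<lambda>i. (cmod (x i))\<^sup>2) summable_on UNIV"
    by (intro nonneg_bdd_above_summable_on bdd_aboveI[of _ "K\<^sup>2"]) auto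
  then show "x \<in> ell2" by (simp add: ell2_def)
  have "(\<Sum>\<^sub>\<infinity>i. (cmod (x i))\<^sup>2) \<le> K\<^sup>2" by (intro infsum_le_finite_sums s b)
  then show "ell2_norm x \<le> K" unfolding ell2_norm_def by (metis K real_le_lsqrt)
qed

lemma L2_set_le_ell2_norm:
  assumes "x \<in> ell2" "finite F" shows "L2_set (\<lambda>i. cmod (x i)) F \<le> ell2_norm x"
  unfolding L2_set_def ell2_norm_def
  using assms by (intro real_sqrt_le_mono finite_sum_le_infsum) (auto simp: ell2_def)

lemma cmod_le_ell2_norm: "x \<in> ell2 \<Longrightarrow> cmod (x i) \<le> ell2_norm x"
  using L2_set_le_ell2_norm[of x "{i}"] by (simp add: L2_set_def)

lemma ell2_norm_nonneg [simp]: "0 \<le> ell2_norm x"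
  unfolding ell2_norm_def by (simp add: infsum_nonneg)

lemma ell2_norm_sq: "(ell2_norm x)\<^sup>2 = (\<Sum>\<^sub>\<infinity>i. (cmod (x i))\<^sup>2)"
  unfolding ell2_norm_def by (simp add: infsum_nonneg)

lemma ell2_add:
  assumes "x \<in> ell2" "y \<in> ell2"
  shows "(\<lambda>i. x i + y i) \<in> ell2" "ell2_norm (\<lambda>i. x i + y i) \<le> ell2_norm x + ell2_norm y"
proof -
  have "L2_set (\<lambda>i. cmod (x i + y i)) F \<le> ell2_norm x + ell2_norm y" if "finite F" for F
  proof -
    have "L2_set (\<lambda>i. cmod (x i + y i)) F \<le> L2_set (\<lambda>i. cmod (x i) + cmod (y i)) F"
      by (intro L2_set_mono norm_triangle_ineq) auto
    also have "\<dots> \<le> L2_set (\<lambda>i. cmod (x i)) F + L2_set (\<lambda>i. cmod (y i)) F"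
      by (rule L2_set_triangle_ineq)
    finally show ?thesis
      using L2_set_le_ell2_norm[OF assms(1) that] L2_set_le_ell2_norm[OF assms(2) that] by linarith
  qed
  then show "(\<lambda>i. x i + y i) \<in> ell2" "ell2_norm (\<lambda>i. x i + y i) \<le> ell2_norm x + ell2_norm y"
    by (fact ell2_normI)+
qed

lemma ell2_norm_scale: "ell2_norm (\<lambda>i. z * x i) = cmod z * ell2_norm x"
  unfolding ell2_norm_def
  by (simp add: norm_mult power_mult_distrib infsum_cmult_right' real_sqrt_mult)

lemma ell2_scale: "x \<in> ell2 \<Longrightarrow> (\<lambda>i. z * x i) \<in> ell2"
  by (simp add: ell2_def norm_mult power_mult_distrib summable_on_cmult_right)

lemma ell2_zero [simp]: "(\<lambda>i. 0) \<in> ell2" "ell2_norm (\<lambda>i. 0) = 0"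
  by (simp_all add: ell2_def ell2_norm_def)

lemma ell2_diff:
  assumes "x \<in> ell2" "y \<in> ell2"
  shows "(\<lambda>i. x i - y i) \<in> ell2" "ell2_norm (\<lambda>i. x i - y i) \<le> ell2_norm x + ell2_norm y"
  using ell2_add[OF assms(1) ell2_scale[OF assms(2), of "-1"]] ell2_norm_scale[of "-1" y] by simp_all

lemma ell2_norm_diff_commute: "ell2_norm (\<lambda>i. x i - y i) = ell2_norm (\<lambda>i. y i - x i)"
  by (simp add: ell2_norm_def norm_minus_commute)

lemma ell2_norm_diff_triangle:
  assumes "x \<in> ell2" "y \<in> ell2" "z \<in> ell2"
  shows "ell2_norm (\<lambda>i. x i - z i) \<le> ell2_norm (\<lambda>i. x i - y i) + ell2_norm (\<lambda>i. y i - z i)"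
  using ell2_add(2)[OF ell2_diff(1)[OF assms(1,2)] ell2_diff(1)[OF assms(2,3)]] by simp

lemma ell2_inner_summable:
  assumes "x \<in> ell2" "y \<in> ell2" shows "(\<lambda>i. cnj (x i) * y i) summable_on UNIV"
proof (rule abs_summable_summable, rule Infinite_Sum.abs_summable_on_comparison_test')
  show "(\<lambda>i. (cmod (x i))\<^sup>2 + (cmod (y i))\<^sup>2) summable_on UNIV"
    using assms by (intro summable_on_add) (auto simp: ell2_def)
  show "norm (cnj (x i) * y i) \<le> (cmod (x i))\<^sup>2 + (cmod (y i))\<^sup>2" for i
  proof -
    have "2 * (cmod (x i) * cmod (y i)) \<le> (cmod (x i))\<^sup>2 + (cmod (y i))\<^sup>2"
      using sum_squares_bound[of "cmod (x i)" "cmod (y i)"] by simp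
    moreover have "0 \<le> cmod (x i) * cmod (y i)" by simp
    ultimately show ?thesis unfolding norm_mult complex_mod_cnj by linarith
  qed
qed

lemma ell2_inner_add: "x \<in> ell2 \<Longrightarrow> y \<in> ell2 \<Longrightarrow> z \<in> ell2 \<Longrightarrow>
    ell2_inner x (\<lambda>i. y i + z i) = ell2_inner x y + ell2_inner x z"
  unfolding ell2_inner_def by (simp add: distrib_left infsum_add ell2_inner_summable)

lemma ell2_inner_self:
  assumes "x \<in> ell2" shows "Re (ell2_inner x x) = (ell2_norm x)\<^sup>2"
proof -
  have "cnj (x i) * x i = of_real ((cmod (x i))\<^sup>2)" for i
    by (metis complex_norm_square mult.commute)
  then have "ell2_inner x x = of_real (\<Sum>\<^sub>\<infinity>i. (cmod (x i))\<^sup>2)"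
    unfolding ell2_inner_def using assms
    by (simp only: ell2_def mem_Collect_eq) (intro infsumI has_sum_of_real has_sum_infsum)
  then show ?thesis by (simp add: ell2_norm_sq)
qed

lemma ell2_polarization_ge:
  assumes "x \<in> ell2" "y \<in> ell2"
  shows "2 * Re (ell2_inner x y) \<le> (ell2_norm x)\<^sup>2 + (ell2_norm y)\<^sup>2"
proof -
  note s = ell2_inner_summable[OF assms]
  have "2 * Re (ell2_inner x y) = (\<Sum>\<^sub>\<infinity>i. 2 * Re (cnj (x i) * y i))"
    unfolding ell2_inner_def infsum_Re[OF s, symmetric] by (simp only: infsum_cmult_right')
  also have "\<dots> \<le> (\<Sum>\<^sub>\<infinity>i. (cmod (x i))\<^sup>2 + (cmod (y i))\<^sup>2)"
  proof (rule infsum_mono)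
    show "(\<lambda>i. 2 * Re (cnj (x i) * y i)) summable_on UNIV"
      by (intro summable_on_cmult_right summable_on_Re s)
    show "(\<lambda>i. (cmod (x i))\<^sup>2 + (cmod (y i))\<^sup>2) summable_on UNIV"
      using assms by (intro summable_on_add) (auto simp: ell2_def)
    show "2 * Re (cnj (x i) * y i) \<le> (cmod (x i))\<^sup>2 + (cmod (y i))\<^sup>2" for i
      using zero_le_power2[of "Re (x i) - Re (y i)"] zero_le_power2[of "Im (x i) - Im (y i)"]
      by (simp add: cmod_power2 power2_diff)
  qed
  also have "\<dots> = (ell2_norm x)\<^sup>2 + (ell2_norm y)\<^sup>2"
    using assms by (simp add: infsum_add ell2_def ell2_norm_sq)
  finally show ?thesis .
qed

lemma bounded_opsD:
  assumes "T \<in> bounded_ops"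
  shows "x \<in> ell2 \<Longrightarrow> T x \<in> ell2" "T \<in> extensional ell2"
    "x \<in> ell2 \<Longrightarrow> y \<in> ell2 \<Longrightarrow> T (\<lambda>i. x i + y i) = (\<lambda>i. T x i + T y i)"
    "x \<in> ell2 \<Longrightarrow> T (\<lambda>i. z * x i) = (\<lambda>i. z * T x i)"
    "\<exists>K. \<forall>x\<in>ell2. ell2_norm (T x) \<le> K * ell2_norm x"
  using assms unfolding bounded_ops_def PiE_def by auto

context semiabelian_bundle
begin

text \<open>Representations are contractive: for self-adjoint \<open>m\<close> in the unit ball choose \<open>v\<close> with
  \<open>2v = m\<^sup>2 + v\<^sup>2\<close>; then \<open>\<parallel>m\<xi>\<parallel>\<^sup>2 + \<parallel>\<xi> - v\<xi>\<parallel>\<^sup>2 = \<parallel>\<xi>\<parallel>\<^sup>2\<close>.\<close>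

lemma reps_contractive:
  assumes \<pi>: "\<pi> \<in> reps A" and a: "a \<in> idem_part A" and \<xi>: "\<xi> \<in> ell2"
  shows "ell2_norm (\<pi> a \<xi>) \<le> nrm A a * ell2_norm \<xi>"
proof -
  have ops: "\<pi> a \<in> bounded_ops" if "a \<in> idem_part A" for a using \<pi> that by (auto simp: reps_def)
  have adj: "ell2_inner (\<pi> a x) y = ell2_inner x (\<pi> (star A a) y)"
    if "a \<in> idem_part A" "x \<in> ell2" "y \<in> ell2" for a x y
    using \<pi> that by (auto simp: reps_def is_adjoint_def)
  have mul: "\<pi> (mul A a b) x = \<pi> a (\<pi> b x)"
    if "a \<in> idem_part A" "b \<in> idem_part A" "x \<in> ell2" for a b x
    using \<pi> that by (simp add: reps_def op_mul_def compose_def)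
  have add: "\<pi> (add A a b) x = (\<lambda>i. \<pi> a x i + \<pi> b x i)"
    if "idem e" "a \<in> fib A e" "b \<in> fib A e" "x \<in> ell2" for e a b x
    using \<pi> that by (simp add: reps_def op_add_def)
  have scale: "\<pi> (scale A z a) x = (\<lambda>i. z * \<pi> a x i)" if "a \<in> idem_part A" "x \<in> ell2" for z a x
    using \<pi> that by (simp add: reps_def op_scale_def)
  have selfadj: "ell2_norm (\<pi> m \<xi>) \<le> ell2_norm \<xi>"
    if e: "idem e" and m: "m \<in> fib A e" "star A m = m" "nrm A m \<le> 1" for m e
  proof -
    obtain v where v: "v \<in> fib A e" "star A v = v" "add A (mul A m m) (mul A v v) = add A v v"
      using fibre_one_minus_sqrt[OF comm_fibre[OF e] m] .
    have E: "m \<in> idem_part A" "v \<in> idem_part A" using m v e by (auto intro: idem_partI)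
    let ?M = "\<pi> m \<xi>" and ?V = "\<pi> v \<xi>"
    have M: "?M \<in> ell2" and V: "?V \<in> ell2" and MM: "\<pi> m ?M \<in> ell2" and VV: "\<pi> v ?V \<in> ell2"
      using ops[OF E(1)] ops[OF E(2)] \<xi> bounded_opsD(1) by blast+
    have "(\<lambda>i. \<pi> m ?M i + \<pi> v ?V i) = (\<lambda>i. ?V i + ?V i)"
      using arg_cong[OF v(3), of "\<lambda>a. \<pi> a \<xi>"] add[OF e v(1) v(1) \<xi>]
        add[OF e mul_in_idem[OF e m(1) m(1)] mul_in_idem[OF e v(1) v(1)] \<xi>]
      by (simp add: mul E \<xi>)
    then have "ell2_inner \<xi> (\<pi> m ?M) + ell2_inner \<xi> (\<pi> v ?V) = ell2_inner \<xi> ?V + ell2_inner \<xi> ?V"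
      by (metis ell2_inner_add[OF \<xi> MM VV] ell2_inner_add[OF \<xi> V V])
    moreover have "ell2_inner \<xi> (\<pi> m ?M) = ell2_inner ?M ?M" "ell2_inner \<xi> (\<pi> v ?V) = ell2_inner ?V ?V"
      using adj[OF E(1) \<xi> M] adj[OF E(2) \<xi> V] m v by simp_all
    ultimately have "Re (ell2_inner ?M ?M + ell2_inner ?V ?V) = Re (ell2_inner \<xi> ?V + ell2_inner \<xi> ?V)"
      by simp
    then have "(ell2_norm ?M)\<^sup>2 + (ell2_norm ?V)\<^sup>2 = 2 * Re (ell2_inner \<xi> ?V)"
      by (simp add: ell2_inner_self[OF M] ell2_inner_self[OF V])
    then have "(ell2_norm ?M)\<^sup>2 \<le> (ell2_norm \<xi>)\<^sup>2"
      using ell2_polarization_ge[OF \<xi> V] by linarith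
    then show ?thesis by (rule power2_le_imp_le) simp
  qed
  obtain e where e: "idem e" "a \<in> fib A e" using a by (auto simp: idem_part_def)
  show ?thesis
  proof (cases "nrm A a = 0")
    case True
    then have "\<pi> a = \<pi> (scale A 0 a)" using e nrm_eq_0[OF e(2)] scale_zero[OF e(2)] by simp
    then have "\<pi> a \<xi> = (\<lambda>i. 0)" using scale[OF a \<xi>, of 0] by simp
    then show ?thesis using True by simp
  next
    case False
    then have pos: "nrm A a > 0" using nrm_nonneg[OF e(2)] by simp
    define r where "r = 1 / nrm A a"
    define b where "b = scale A (of_real r) a"
    have b: "b \<in> fib A e" "nrm A b = 1" using e pos by (simp_all add: b_def nrm_scale[OF e(2)] r_def norm_divide)
    have bE: "b \<in> idem_part A" using b e by (auto intro: idem_partI)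
    let ?m = "mul A (star A b) b"
    have "nrm A ?m = 1" using cstar_identity[OF b(1)] b by simp
    then have m: "ell2_norm (\<pi> ?m \<xi>) \<le> ell2_norm \<xi>"
      using selfadj[OF e(1) mul_in_idem[OF e(1) star_in_idem[OF e(1) b(1)] b(1)]] bE by simp
    have bx: "\<pi> b \<xi> \<in> ell2" using ops[OF bE] \<xi> bounded_opsD(1) by blast
    have mx: "\<pi> ?m \<xi> \<in> ell2" using ops[of ?m] bE \<xi> bounded_opsD(1) by simp
    have "ell2_inner (\<pi> b \<xi>) (\<pi> b \<xi>) = ell2_inner \<xi> (\<pi> ?m \<xi>)"
      using adj[OF bE \<xi> bx] mul[OF _ bE \<xi>, of "star A b"] bE by simp
    then have "2 * (ell2_norm (\<pi> b \<xi>))\<^sup>2 \<le> (ell2_norm \<xi>)\<^sup>2 + (ell2_norm (\<pi> ?m \<xi>))\<^sup>2"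
      using ell2_polarization_ge[OF \<xi> mx] ell2_inner_self[OF bx] by simp
    also have "\<dots> \<le> 2 * (ell2_norm \<xi>)\<^sup>2" using power_mono[OF m, of 2] by simp
    finally have "(ell2_norm (\<pi> b \<xi>))\<^sup>2 \<le> (ell2_norm \<xi>)\<^sup>2" by linarith
    then have "ell2_norm (\<pi> b \<xi>) \<le> ell2_norm \<xi>" by (rule power2_le_imp_le) simp
    moreover have "ell2_norm (\<pi> b \<xi>) = r * ell2_norm (\<pi> a \<xi>)"
      using pos unfolding b_def scale[OF a \<xi>] ell2_norm_scale norm_of_real by (simp add: r_def)
    ultimately show ?thesis using pos by (simp add: r_def field_simps)
  qed
qed

end


section \<open>The universal $C^*$-algebra\<close>

lemma bounded_opsI:
  assumes "T \<in> extensional ell2" "\<And>x. x \<in> ell2 \<Longrightarrow> T x \<in> ell2"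
    "\<And>x y. x \<in> ell2 \<Longrightarrow> y \<in> ell2 \<Longrightarrow> T (\<lambda>i. x i + y i) = (\<lambda>i. T x i + T y i)"
    "\<And>z x. x \<in> ell2 \<Longrightarrow> T (\<lambda>i. z * x i) = (\<lambda>i. z * T x i)"
    "\<And>x. x \<in> ell2 \<Longrightarrow> ell2_norm (T x) \<le> K * ell2_norm x"
  shows "T \<in> bounded_ops"
  using assms unfolding bounded_ops_def PiE_def by (auto intro!: exI[of _ K])

lemma bounded_ops_zero_arg: "T \<in> bounded_ops \<Longrightarrow> T (\<lambda>i. 0) = (\<lambda>i. 0)"
  using bounded_opsD(4)[of T "\<lambda>i. 0" 0] by simp

lemma bounded_ops_diff:
  assumes "T \<in> bounded_ops" "x \<in> ell2" "y \<in> ell2"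
  shows "T (\<lambda>i. x i - y i) = (\<lambda>i. T x i - T y i)"
  using bounded_opsD(3)[OF assms(1,2) ell2_scale[OF assms(3), of "-1"]] bounded_opsD(4)[OF assms(1,3), of "-1"]
  by simp

lemma op_add_bounded:
  assumes S: "S \<in> bounded_ops" and T: "T \<in> bounded_ops" shows "op_add S T \<in> bounded_ops"
proof -
  obtain K L where KL: "\<forall>x\<in>ell2. ell2_norm (S x) \<le> K * ell2_norm x" "\<forall>x\<in>ell2. ell2_norm (T x) \<le> L * ell2_norm x"
    using bounded_opsD(5)[OF S] bounded_opsD(5)[OF T] by blast
  note D = bounded_opsD[OF S] bounded_opsD[OF T]
  show ?thesis
  proof (rule bounded_opsI[where K = "K + L"])
    fix x :: "'a vec" assume x: "x \<in> ell2"
    have "ell2_norm (op_add S T x) \<le> ell2_norm (S x) + ell2_norm (T x)"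
      using ell2_add(2)[OF D(1)[OF x] D(6)[OF x]] x by (simp add: op_add_def)
    also have "\<dots> \<le> (K + L) * ell2_norm x" using KL x by (simp add: distrib_right add_mono)
    finally show "ell2_norm (op_add S T x) \<le> (K + L) * ell2_norm x" .
  qed (use D in \<open>simp_all add: op_add_def ell2_add ell2_scale algebra_simps\<close>)
qed

lemma op_scale_bounded:
  assumes S: "S \<in> bounded_ops" shows "op_scale z S \<in> bounded_ops"
proof -
  obtain K where K: "\<forall>x\<in>ell2. ell2_norm (S x) \<le> K * ell2_norm x" using bounded_opsD(5)[OF S] by blast
  note D = bounded_opsD[OF S]
  show ?thesis
  proof (rule bounded_opsI[where K = "cmod z * K"])
    fix x :: "'a vec" assume x: "x \<in> ell2"
    show "ell2_norm (op_scale z S x) \<le> cmod z * K * ell2_norm x"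
      using K x by (simp add: op_scale_def ell2_norm_scale mult.assoc mult_left_mono)
  qed (use D in \<open>simp_all add: op_scale_def ell2_add ell2_scale algebra_simps\<close>)
qed

lemma op_mul_bounded:
  assumes S: "S \<in> bounded_ops" and T: "T \<in> bounded_ops" shows "op_mul S T \<in> bounded_ops"
proof -
  obtain K0 L where KL: "\<forall>x\<in>ell2. ell2_norm (S x) \<le> K0 * ell2_norm x" "\<forall>x\<in>ell2. ell2_norm (T x) \<le> L * ell2_norm x"
    using bounded_opsD(5)[OF S] bounded_opsD(5)[OF T] by blast
  define K where "K = max K0 0"
  have K: "ell2_norm (S x) \<le> K * ell2_norm x" if "x \<in> ell2" for x
    using KL(1) that mult_right_mono[of K0 K "ell2_norm x"] by (force simp: K_def)
  note D = bounded_opsD[OF S] bounded_opsD[OF T]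
  show ?thesis
  proof (rule bounded_opsI[where K = "K * L"])
    fix x :: "'a vec" assume x: "x \<in> ell2"
    have "ell2_norm (op_mul S T x) \<le> K * ell2_norm (T x)"
      using K[OF D(6)[OF x]] x by (simp add: op_mul_def compose_def)
    also have "\<dots> \<le> K * (L * ell2_norm x)" using KL(2) x by (intro mult_left_mono) (auto simp: K_def)
    finally show "ell2_norm (op_mul S T x) \<le> K * L * ell2_norm x" by (simp add: mult.assoc)
  qed (use D in \<open>simp_all add: op_mul_def compose_def ell2_add ell2_scale\<close>)
qed

lemma op_zero_bounded: "(\<lambda>x\<in>ell2. \<lambda>i. 0) \<in> bounded_ops"
  by (rule bounded_opsI[where K = 0]) (auto simp: ell2_add ell2_scale)

abbreviation uops :: "('s :: inverse_semigroup, 'a) fell \<Rightarrow> 'a uelem set" where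
  "uops A \<equiv> reps A \<rightarrow>\<^sub>E bounded_ops"

definition uzero :: "('s :: inverse_semigroup, 'a) fell \<Rightarrow> 'a uelem" where
  "uzero A = (\<lambda>\<pi>\<in>reps A. \<lambda>x\<in>ell2. \<lambda>i. 0)"

lemmas uspan_zero = uspan.zero[folded uzero_def]
lemmas uspan_induct [consumes 1, case_names zero step] = uspan.induct[folded uzero_def]

text \<open>The norm of the \<open>\<ell>\<^sup>\<infinity>\<close>-product over all representations enters only through upper bounds \<open>K\<close> for the
  norm of \<open>T\<close> and \<open>\<epsilon>\<close> for the distance of \<open>S\<close> and \<open>T\<close>; so no supremum over the representations has to
  be formed.\<close>

definition unorm_le :: "('s :: inverse_semigroup, 'a) fell \<Rightarrow> 'a uelem \<Rightarrow> real \<Rightarrow> bool" where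
  "unorm_le A T K \<longleftrightarrow> (\<forall>\<pi>\<in>reps A. \<forall>x\<in>ell2. ell2_norm (T \<pi> x) \<le> K * ell2_norm x)"

definition unear :: "('s :: inverse_semigroup, 'a) fell \<Rightarrow> 'a uelem \<Rightarrow> 'a uelem \<Rightarrow> real \<Rightarrow> bool" where
  "unear A S T \<epsilon> \<longleftrightarrow>
     (\<forall>\<pi>\<in>reps A. \<forall>x\<in>ell2. ell2_norm (\<lambda>i. S \<pi> x i - T \<pi> x i) \<le> \<epsilon> * ell2_norm x)"

lemma uops_eqI:
  assumes "S \<in> uops A" "T \<in> uops A"
    and "\<And>\<pi> x. \<pi> \<in> reps A \<Longrightarrow> x \<in> ell2 \<Longrightarrow> S \<pi> x = T \<pi> x"
  shows "S = T"
proof (rule PiE_ext[OF assms(1,2)])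
  fix \<pi> assume \<pi>: "\<pi> \<in> reps A"
  then have "S \<pi> \<in> bounded_ops" "T \<pi> \<in> bounded_ops" using assms by auto
  then show "S \<pi> = T \<pi>" using assms(3)[OF \<pi>] by (intro extensionalityI[of _ ell2] bounded_opsD(2)) auto
qed

lemma uops_apply:
  assumes "T \<in> uops A" "\<pi> \<in> reps A"
  shows "T \<pi> \<in> bounded_ops" "x \<in> ell2 \<Longrightarrow> T \<pi> x \<in> ell2"
  using assms bounded_opsD(1) by auto

lemma uops_closed:
  "S \<in> uops A \<Longrightarrow> T \<in> uops A \<Longrightarrow> uadd A S T \<in> uops A"
  "S \<in> uops A \<Longrightarrow> uscale A z S \<in> uops A"
  "S \<in> uops A \<Longrightarrow> T \<in> uops A \<Longrightarrow> umul A S T \<in> uops A"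
  "uzero A \<in> uops A"
  by (auto simp: uadd_def uscale_def umul_def uzero_def dest!: PiE_mem
      intro!: op_add_bounded op_scale_bounded op_mul_bounded op_zero_bounded)

lemma uapply [simp]:
  assumes "\<pi> \<in> reps A" "x \<in> ell2"
  shows "uadd A S T \<pi> x = (\<lambda>i. S \<pi> x i + T \<pi> x i)" "uscale A z S \<pi> x = (\<lambda>i. z * S \<pi> x i)"
    "umul A S T \<pi> x = S \<pi> (T \<pi> x)" "ucan A a \<pi> x = \<pi> a x" "uzero A \<pi> x = (\<lambda>i. 0)"
  using assms
  by (simp_all add: uzero_def uadd_def uscale_def umul_def ucan_def op_add_def op_scale_def op_mul_def compose_def)

lemma ucan_uops: "a \<in> idem_part A \<Longrightarrow> ucan A a \<in> uops A"
  by (auto simp: ucan_def reps_def)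

lemma universal_cstar_iff:
  "T \<in> universal_cstar A \<longleftrightarrow> T \<in> uops A \<and> (\<forall>\<epsilon>>0. \<exists>R\<in>uspan A. unear A T R \<epsilon>)"
  by (simp add: universal_cstar_def unear_def)

lemma repsD:
  assumes "\<pi> \<in> reps A"
  shows "a \<in> idem_part A \<Longrightarrow> \<pi> a \<in> bounded_ops"
    "idem e \<Longrightarrow> a \<in> fib A e \<Longrightarrow> b \<in> fib A e \<Longrightarrow> \<pi> (add A a b) = op_add (\<pi> a) (\<pi> b)"
    "a \<in> idem_part A \<Longrightarrow> \<pi> (scale A z a) = op_scale z (\<pi> a)"
    "a \<in> idem_part A \<Longrightarrow> b \<in> idem_part A \<Longrightarrow> \<pi> (mul A a b) = op_mul (\<pi> a) (\<pi> b)"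
    "idem e \<Longrightarrow> idem f \<Longrightarrow> natural_le e f \<Longrightarrow> a \<in> fib A e \<Longrightarrow> \<pi> (incl A f e a) = \<pi> a"
  using assms by (auto simp: reps_def)

context semiabelian_bundle
begin

lemma ucan_simps:
  "idem e \<Longrightarrow> a \<in> fib A e \<Longrightarrow> b \<in> fib A e \<Longrightarrow> ucan A (add A a b) = uadd A (ucan A a) (ucan A b)"
  "a \<in> idem_part A \<Longrightarrow> ucan A (scale A z a) = uscale A z (ucan A a)"
  "a \<in> idem_part A \<Longrightarrow> b \<in> idem_part A \<Longrightarrow> ucan A (mul A a b) = umul A (ucan A a) (ucan A b)"
  "idem e \<Longrightarrow> idem f \<Longrightarrow> natural_le e f \<Longrightarrow> a \<in> fib A e \<Longrightarrow> ucan A (incl A f e a) = ucan A a"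
  by (auto simp: fun_eq_iff ucan_def uadd_def uscale_def umul_def repsD)

lemma unorm_le_ucan: "a \<in> idem_part A \<Longrightarrow> unorm_le A (ucan A a) (nrm A a)"
  by (simp add: unorm_le_def reps_contractive)

lemma uspan_uops: "T \<in> uspan A \<Longrightarrow> T \<in> uops A"
  by (induction rule: uspan_induct) (auto intro!: uops_closed ucan_uops)

lemma uadd_assoc: "uadd A (uadd A S T) R = uadd A S (uadd A T R)"
  by (auto simp: uadd_def op_add_def add.assoc intro!: ext split: if_splits)

lemma uadd_zero: "T \<in> uops A \<Longrightarrow> uadd A (uzero A) T = T"
  by (rule uops_eqI[OF uops_closed(1)[OF uops_closed(4)]]) auto

lemma uspan_uadd: "S \<in> uspan A \<Longrightarrow> T \<in> uspan A \<Longrightarrow> uadd A S T \<in> uspan A"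
  by (induction rule: uspan_induct) (auto simp: uadd_zero uspan_uops uadd_assoc intro: uspan.step)

lemma uspan_uscale: "S \<in> uspan A \<Longrightarrow> uscale A w S \<in> uspan A"
proof (induction rule: uspan_induct)
  case zero
  have "uscale A w (uzero A) = uzero A"
    by (rule uops_eqI[OF uops_closed(2)[OF uops_closed(4)] uops_closed(4)]) auto
  then show ?case using uspan_zero[of A] by simp
next
  case (step a T z)
  have "uscale A w (uadd A (uscale A z (ucan A a)) T) = uadd A (uscale A (w * z) (ucan A a)) (uscale A w T)"
    using step by (intro uops_eqI[where A = A] uops_closed ucan_uops uspan_uops) (auto simp: algebra_simps)
  then show ?case using step by (auto intro: uspan.step)
qed

lemma ucan_uspan: "a \<in> idem_part A \<Longrightarrow> ucan A a \<in> uspan A"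
proof -
  assume a: "a \<in> idem_part A"
  have "uadd A (uscale A 1 (ucan A a)) (uzero A) = ucan A a"
    using a by (intro uops_eqI[where A = A] uops_closed ucan_uops) auto
  then show ?thesis using uspan.step[OF a uspan_zero[of A], of 1] by simp
qed

lemma umul_distrib_right: "S \<in> uops A \<Longrightarrow> T \<in> uops A \<Longrightarrow> R \<in> uops A \<Longrightarrow>
    umul A (uadd A S T) R = uadd A (umul A S R) (umul A T R)"
  by (intro uops_eqI[where A = A] uops_closed) (auto simp: uops_apply)

lemma umul_distrib_left: "S \<in> uops A \<Longrightarrow> T \<in> uops A \<Longrightarrow> R \<in> uops A \<Longrightarrow>
    umul A R (uadd A S T) = uadd A (umul A R S) (umul A R T)"
  by (intro uops_eqI[where A = A] uops_closed) (auto simp: uops_apply bounded_opsD(3)[OF uops_apply(1)])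

lemma umul_uscale_left: "S \<in> uops A \<Longrightarrow> T \<in> uops A \<Longrightarrow> umul A (uscale A z S) T = uscale A z (umul A S T)"
  by (intro uops_eqI[where A = A] uops_closed) (auto simp: uops_apply)

lemma umul_uscale_right: "S \<in> uops A \<Longrightarrow> T \<in> uops A \<Longrightarrow> umul A S (uscale A z T) = uscale A z (umul A S T)"
  by (intro uops_eqI[where A = A] uops_closed) (auto simp: uops_apply bounded_opsD(4)[OF uops_apply(1)])

lemma umul_zero_left: "T \<in> uops A \<Longrightarrow> umul A (uzero A) T = uzero A"
  by (intro uops_eqI[where A = A] uops_closed) (auto simp: uops_apply)

lemma umul_zero_right: "T \<in> uops A \<Longrightarrow> umul A T (uzero A) = uzero A"
  by (intro uops_eqI[where A = A] uops_closed) (auto simp: uops_apply bounded_ops_zero_arg[OF uops_apply(1)])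

lemma uspan_umul:
  assumes S: "S \<in> uspan A" and T: "T \<in> uspan A" shows "umul A S T \<in> uspan A"
proof -
  have 1: "umul A (ucan A a) T \<in> uspan A" if a: "a \<in> idem_part A" for a
    using T
  proof (induction rule: uspan_induct)
    case (step b T z)
    have "umul A (ucan A a) (uadd A (uscale A z (ucan A b)) T)
        = uadd A (uscale A z (ucan A (mul A a b))) (umul A (ucan A a) T)"
      using a step by (simp add: umul_distrib_left uops_closed ucan_uops uspan_uops umul_uscale_left umul_uscale_right ucan_simps(3))
    then show ?case using step a by (simp add: uspan.step)
  qed (simp add: umul_zero_right ucan_uops a uspan_zero)
  show ?thesis
    using S
  proof (induction rule: uspan_induct)
    case (step a S z)
    have "umul A (uadd A (uscale A z (ucan A a)) S) T
        = uadd A (uscale A z (umul A (ucan A a) T)) (umul A S T)"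
      using step uspan_uops[OF T]
      by (simp add: umul_distrib_right uops_closed ucan_uops uspan_uops umul_uscale_left)
    then show ?case using step 1 by (simp add: uspan_uadd uspan_uscale)
  qed (simp add: umul_zero_left uspan_uops[OF T] uspan_zero)
qed

lemma uspan_norm_bound: "R \<in> uspan A \<Longrightarrow> \<exists>K\<ge>0. unorm_le A R K"
proof (induction rule: uspan_induct)
  case zero
  then show ?case by (auto simp: unorm_le_def)
next
  case (step a T z)
  then obtain K where K: "K \<ge> 0" "unorm_le A T K" by blast
  have "unorm_le A (uadd A (uscale A z (ucan A a)) T) (cmod z * nrm A a + K)"
    unfolding unorm_le_def
  proof (intro ballI)
    fix \<pi> and x :: "'a vec" assume \<pi>: "\<pi> \<in> reps A" and x: "x \<in> ell2"
    have "\<pi> a x \<in> ell2" using uops_apply(2)[OF ucan_uops[OF step(1)] \<pi> x] \<pi> x by simp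
    then have "ell2_norm (uadd A (uscale A z (ucan A a)) T \<pi> x) \<le> cmod z * ell2_norm (\<pi> a x) + ell2_norm (T \<pi> x)"
      using ell2_add(2)[OF ell2_scale uops_apply(2)[OF uspan_uops[OF step(2)] \<pi> x]] \<pi> x
      by (simp add: ell2_norm_scale[symmetric])
    also have "\<dots> \<le> cmod z * (nrm A a * ell2_norm x) + K * ell2_norm x"
      using K \<pi> x reps_contractive[OF \<pi> step(1) x]
      by (intro add_mono mult_left_mono) (auto simp: unorm_le_def)
    finally show "ell2_norm (uadd A (uscale A z (ucan A a)) T \<pi> x) \<le> (cmod z * nrm A a + K) * ell2_norm x"
      by (simp add: algebra_simps)
  qed
  moreover have "0 \<le> cmod z * nrm A a + K"
    using K step(1) nrm_nonneg by (auto simp: idem_part_def)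
  ultimately show ?case by blast
qed

lemma unearD: "unear A S T \<epsilon> \<Longrightarrow> \<pi> \<in> reps A \<Longrightarrow> x \<in> ell2 \<Longrightarrow>
    ell2_norm (\<lambda>i. S \<pi> x i - T \<pi> x i) \<le> \<epsilon> * ell2_norm x"
  by (simp add: unear_def)

lemma unorm_leD: "unorm_le A T K \<Longrightarrow> \<pi> \<in> reps A \<Longrightarrow> x \<in> ell2 \<Longrightarrow> ell2_norm (T \<pi> x) \<le> K * ell2_norm x"
  by (simp add: unorm_le_def)

lemma universal_uops: "T \<in> universal_cstar A \<Longrightarrow> T \<in> uops A"
  by (simp add: universal_cstar_iff)

lemma uspan_universal: "T \<in> uspan A \<Longrightarrow> T \<in> universal_cstar A"
  unfolding universal_cstar_iff by (auto simp: uspan_uops unear_def intro!: bexI[of _ T])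

lemma universal_norm_bound:
  assumes T: "T \<in> universal_cstar A" shows "\<exists>K\<ge>0. unorm_le A T K"
proof -
  obtain R where R: "R \<in> uspan A" "unear A T R 1"
    using T unfolding universal_cstar_iff by (meson zero_less_one)
  obtain K where K: "K \<ge> 0" "unorm_le A R K" using uspan_norm_bound[OF R(1)] by blast
  have "unorm_le A T (1 + K)"
    unfolding unorm_le_def
  proof (intro ballI)
    fix \<pi> and x :: "'a vec" assume \<pi>: "\<pi> \<in> reps A" and x: "x \<in> ell2"
    have m: "T \<pi> x \<in> ell2" "R \<pi> x \<in> ell2"
      using uops_apply(2)[OF universal_uops[OF T] \<pi> x] uops_apply(2)[OF uspan_uops[OF R(1)] \<pi> x] by auto
    show "ell2_norm (T \<pi> x) \<le> (1 + K) * ell2_norm x"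
      using ell2_add(2)[OF ell2_diff(1)[OF m] m(2)] unearD[OF R(2) \<pi> x] unorm_leD[OF K(2) \<pi> x]
      by (simp add: distrib_right)
  qed
  then show ?thesis using K by (intro exI[of _ "1 + K"]) auto
qed

lemma universal_uadd:
  assumes S: "S \<in> universal_cstar A" and T: "T \<in> universal_cstar A"
  shows "uadd A S T \<in> universal_cstar A"
  unfolding universal_cstar_iff
proof (intro conjI allI impI)
  show "uadd A S T \<in> uops A" by (intro uops_closed universal_uops S T)
  fix \<epsilon> :: real assume "\<epsilon> > 0"
  then obtain P Q where P: "P \<in> uspan A" "unear A S P (\<epsilon> / 2)" and Q: "Q \<in> uspan A" "unear A T Q (\<epsilon> / 2)"
    using S T unfolding universal_cstar_iff by (meson half_gt_zero)
  have "unear A (uadd A S T) (uadd A P Q) \<epsilon>"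
    unfolding unear_def
  proof (intro ballI)
    fix \<pi> and x :: "'a vec" assume \<pi>: "\<pi> \<in> reps A" and x: "x \<in> ell2"
    note m = uops_apply(2)[OF universal_uops[OF S] \<pi> x] uops_apply(2)[OF uspan_uops[OF P(1)] \<pi> x]
      uops_apply(2)[OF universal_uops[OF T] \<pi> x] uops_apply(2)[OF uspan_uops[OF Q(1)] \<pi> x]
    have "(\<lambda>i. uadd A S T \<pi> x i - uadd A P Q \<pi> x i)
        = (\<lambda>i. (S \<pi> x i - P \<pi> x i) + (T \<pi> x i - Q \<pi> x i))" using \<pi> x by (simp add: algebra_simps)
    then have "ell2_norm (\<lambda>i. uadd A S T \<pi> x i - uadd A P Q \<pi> x i)
        \<le> ell2_norm (\<lambda>i. S \<pi> x i - P \<pi> x i) + ell2_norm (\<lambda>i. T \<pi> x i - Q \<pi> x i)"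
      using ell2_add(2)[OF ell2_diff(1)[OF m(1,2)] ell2_diff(1)[OF m(3,4)]] by simp
    then show "ell2_norm (\<lambda>i. uadd A S T \<pi> x i - uadd A P Q \<pi> x i) \<le> \<epsilon> * ell2_norm x"
      using unearD[OF P(2) \<pi> x] unearD[OF Q(2) \<pi> x] by simp
  qed
  then show "\<exists>R\<in>uspan A. unear A (uadd A S T) R \<epsilon>" using uspan_uadd[OF P(1) Q(1)] by blast
qed

lemma universal_uscale:
  assumes T: "T \<in> universal_cstar A"
  shows "uscale A z T \<in> universal_cstar A"
  unfolding universal_cstar_iff
proof (intro conjI allI impI)
  show "uscale A z T \<in> uops A" by (intro uops_closed universal_uops T)
  fix \<epsilon> :: real assume e: "\<epsilon> > 0"
  have d: "\<epsilon> / (1 + cmod z) > 0" using e by (simp add: add_pos_nonneg)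
  then obtain R where R: "R \<in> uspan A" "unear A T R (\<epsilon> / (1 + cmod z))"
    using T unfolding universal_cstar_iff by blast
  have "unear A (uscale A z T) (uscale A z R) \<epsilon>"
    unfolding unear_def
  proof (intro ballI)
    fix \<pi> and x :: "'a vec" assume \<pi>: "\<pi> \<in> reps A" and x: "x \<in> ell2"
    have "ell2_norm (\<lambda>i. uscale A z T \<pi> x i - uscale A z R \<pi> x i)
        = cmod z * ell2_norm (\<lambda>i. T \<pi> x i - R \<pi> x i)"
      using \<pi> x by (simp add: ell2_norm_scale[symmetric] right_diff_distrib)
    also have "\<dots> \<le> (1 + cmod z) * (\<epsilon> / (1 + cmod z) * ell2_norm x)"
      by (intro mult_mono unearD[OF R(2) \<pi> x]) auto
    also have "\<dots> = \<epsilon> * ell2_norm x" using d e by (simp add: add_nonneg_eq_0_iff)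
    finally show "ell2_norm (\<lambda>i. uscale A z T \<pi> x i - uscale A z R \<pi> x i) \<le> \<epsilon> * ell2_norm x" .
  qed
  then show "\<exists>R\<in>uspan A. unear A (uscale A z T) R \<epsilon>" using uspan_uscale[OF R(1)] by blast
qed

lemma universal_umul:
  assumes S: "S \<in> universal_cstar A" and T: "T \<in> universal_cstar A"
  shows "umul A S T \<in> universal_cstar A"
  unfolding universal_cstar_iff
proof (intro conjI allI impI)
  show "umul A S T \<in> uops A" by (intro uops_closed universal_uops S T)
  fix \<epsilon> :: real assume e: "\<epsilon> > 0"
  obtain K where K: "K \<ge> 0" "unorm_le A T K" using universal_norm_bound[OF T] by blast
  have "\<epsilon> / (2 * (K + 1)) > 0" using e K by simp
  then obtain P where P: "P \<in> uspan A" "unear A S P (\<epsilon> / (2 * (K + 1)))"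
    using S unfolding universal_cstar_iff by blast
  obtain L where L: "L \<ge> 0" "unorm_le A P L" using uspan_norm_bound[OF P(1)] by blast
  have "\<epsilon> / (2 * (L + 1)) > 0" using e L by simp
  then obtain Q where Q: "Q \<in> uspan A" "unear A T Q (\<epsilon> / (2 * (L + 1)))"
    using T unfolding universal_cstar_iff by blast
  have "unear A (umul A S T) (umul A P Q) \<epsilon>"
    unfolding unear_def
  proof (intro ballI)
    fix \<pi> and x :: "'a vec" assume \<pi>: "\<pi> \<in> reps A" and x: "x \<in> ell2"
    note mem = uops_apply(2)[OF universal_uops[OF S] \<pi>] uops_apply(2)[OF uspan_uops[OF P(1)] \<pi>]
      uops_apply(2)[OF universal_uops[OF T] \<pi>] uops_apply(2)[OF uspan_uops[OF Q(1)] \<pi>]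
    let ?t = "T \<pi> x" and ?q = "Q \<pi> x"
    have t: "?t \<in> ell2" and q: "?q \<in> ell2" using mem x by auto
    have PP: "P \<pi> (\<lambda>i. ?t i - ?q i) = (\<lambda>i. P \<pi> ?t i - P \<pi> ?q i)"
      using bounded_ops_diff[OF uops_apply(1)[OF uspan_uops[OF P(1)] \<pi>] t q] .
    have K': "ell2_norm ?t \<le> (K + 1) * ell2_norm x"
      by (rule order_trans[OF unorm_leD[OF K(2) \<pi> x]]) (intro mult_right_mono, auto)
    have "ell2_norm (\<lambda>i. umul A S T \<pi> x i - umul A P Q \<pi> x i)
        \<le> ell2_norm (\<lambda>i. S \<pi> ?t i - P \<pi> ?t i) + ell2_norm (P \<pi> (\<lambda>i. ?t i - ?q i))"
      using ell2_norm_diff_triangle[OF mem(1)[OF t] mem(2)[OF t] mem(2)[OF q]] \<pi> x by (simp add: PP)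
    also have "\<dots> \<le> \<epsilon> / (2 * (K + 1)) * ell2_norm ?t + L * ell2_norm (\<lambda>i. ?t i - ?q i)"
      using unearD[OF P(2) \<pi> t] unorm_leD[OF L(2) \<pi> ell2_diff(1)[OF t q]] by linarith
    also have "\<dots> \<le> \<epsilon> / (2 * (K + 1)) * ((K + 1) * ell2_norm x) + (L + 1) * (\<epsilon> / (2 * (L + 1)) * ell2_norm x)"
      using e K L
      by (intro add_mono mult_left_mono[OF K'] mult_mono unearD[OF Q(2) \<pi> x]) auto
    also have "\<dots> = \<epsilon> * ell2_norm x"
    proof -
      have "\<epsilon> / (2 * c) * (c * r) = \<epsilon> * r / 2" "c * (\<epsilon> / (2 * c) * r) = \<epsilon> * r / 2"
        if "c > 0" for c r :: real using that by auto
      note eq = this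
      have "0 < K + 1" "0 < L + 1" using K L by auto
      then show ?thesis unfolding eq(1)[OF \<open>0 < K + 1\<close>] eq(2)[OF \<open>0 < L + 1\<close>] by simp
    qed
    finally show "ell2_norm (\<lambda>i. umul A S T \<pi> x i - umul A P Q \<pi> x i) \<le> \<epsilon> * ell2_norm x" .
  qed
  then show "\<exists>R\<in>uspan A. unear A (umul A S T) R \<epsilon>" using uspan_umul[OF P(1) Q(1)] by blast
qed

lemma ucan_universal [simp]: "a \<in> idem_part A \<Longrightarrow> ucan A a \<in> universal_cstar A"
  by (intro uspan_universal ucan_uspan)

lemma unear_mono: "unear A S T \<epsilon> \<Longrightarrow> \<epsilon> \<le> \<delta> \<Longrightarrow> unear A S T \<delta>"
  unfolding unear_def by (meson ell2_norm_nonneg mult_right_mono order_trans)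

lemma unear_trans:
  assumes "S \<in> uops A" "T \<in> uops A" "R \<in> uops A" "unear A S T \<epsilon>" "unear A T R \<delta>"
  shows "unear A S R (\<epsilon> + \<delta>)"
  unfolding unear_def
proof (intro ballI)
  fix \<pi> and x :: "'a vec" assume \<pi>: "\<pi> \<in> reps A" and x: "x \<in> ell2"
  show "ell2_norm (\<lambda>i. S \<pi> x i - R \<pi> x i) \<le> (\<epsilon> + \<delta>) * ell2_norm x"
    using ell2_norm_diff_triangle[OF uops_apply(2)[OF assms(1) \<pi> x] uops_apply(2)[OF assms(2) \<pi> x]
        uops_apply(2)[OF assms(3) \<pi> x]] unearD[OF assms(4) \<pi> x] unearD[OF assms(5) \<pi> x]
    by (simp add: distrib_right)
qed

text \<open>The limit exists in each coordinate \<open>i\<close>, since coordinates are bounded by the norm, and the bounds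
  \<open>\<epsilon> n\<close> pass to it because they hold for the \<open>\<ell>\<^sup>2\<close>-norms of all finite parts.\<close>

lemma universal_complete:
  assumes X: "\<And>n. X n \<in> universal_cstar A"
    and near: "\<And>n m. n \<le> m \<Longrightarrow> unear A (X m) (X n) (\<epsilon> n)" and \<epsilon>: "\<epsilon> \<longlonglongrightarrow> 0"
  obtains L where "L \<in> universal_cstar A" "\<And>n. unear A L (X n) (\<epsilon> n)"
    "\<And>\<pi> x i. \<pi> \<in> reps A \<Longrightarrow> x \<in> ell2 \<Longrightarrow> (\<lambda>n. X n \<pi> x i) \<longlonglongrightarrow> L \<pi> x i"
proof -
  define L where "L = (\<lambda>\<pi>\<in>reps A. \<lambda>x\<in>ell2. \<lambda>i. lim (\<lambda>n. X n \<pi> x i))"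
  note Xu = universal_uops[OF X]
  have lim: "(\<lambda>n. X n \<pi> x i) \<longlonglongrightarrow> L \<pi> x i" if \<pi>: "\<pi> \<in> reps A" and x: "x \<in> ell2" for \<pi> x i
  proof -
    have "Cauchy (\<lambda>n. X n \<pi> x i)"
    proof (rule CauchyI')
      fix e :: real assume "e > 0"
      moreover have "(\<lambda>n. \<epsilon> n * ell2_norm x) \<longlonglongrightarrow> 0 * ell2_norm x" by (intro tendsto_intros \<epsilon>)
      ultimately obtain N where N: "\<epsilon> N * ell2_norm x < e / 2"
        using order_tendstoD(2)[of "\<lambda>n. \<epsilon> n * ell2_norm x" "0 * ell2_norm x" sequentially "e / 2"]
        by (auto simp: eventually_sequentially)
      have 1: "cmod (X m \<pi> x i - X N \<pi> x i) < e / 2" if "m \<ge> N" for m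
        using cmod_le_ell2_norm[OF ell2_diff(1)[OF uops_apply(2)[OF Xu[of m] \<pi> x] uops_apply(2)[OF Xu[of N] \<pi> x]], of i]
          unearD[OF near[OF that] \<pi> x] N by linarith
      have "cmod (X m \<pi> x i - X n \<pi> x i) < e" if "m \<ge> N" "n > m" for m n
        using 1[of m] 1[of n] that dist_triangle_half_l[of "X m \<pi> x i" "X N \<pi> x i" e "X n \<pi> x i"]
        by (auto simp: dist_norm)
      then show "\<exists>M. \<forall>m\<ge>M. \<forall>n>m. dist (X m \<pi> x i) (X n \<pi> x i) < e" by (auto simp: dist_norm)
    qed
    then show ?thesis using \<pi> x by (simp add: L_def Cauchy_convergent convergent_LIMSEQ_iff[symmetric])
  qed
  have nearL: "(\<lambda>i. L \<pi> x i - X n \<pi> x i) \<in> ell2"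
      "ell2_norm (\<lambda>i. L \<pi> x i - X n \<pi> x i) \<le> \<epsilon> n * ell2_norm x"
    if \<pi>: "\<pi> \<in> reps A" and x: "x \<in> ell2" for \<pi> x n
  proof -
    have "L2_set (\<lambda>i. cmod (L \<pi> x i - X n \<pi> x i)) F \<le> \<epsilon> n * ell2_norm x" if F: "finite F" for F
    proof -
      have "(\<lambda>m. L2_set (\<lambda>i. cmod (X m \<pi> x i - X n \<pi> x i)) F) \<longlonglongrightarrow> L2_set (\<lambda>i. cmod (L \<pi> x i - X n \<pi> x i)) F"
        unfolding L2_set_def by (intro tendsto_intros lim \<pi> x)
      moreover have "L2_set (\<lambda>i. cmod (X m \<pi> x i - X n \<pi> x i)) F \<le> \<epsilon> n * ell2_norm x" if "m \<ge> n" for m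
        using L2_set_le_ell2_norm[OF ell2_diff(1)[OF uops_apply(2)[OF Xu[of m] \<pi> x] uops_apply(2)[OF Xu[of n] \<pi> x]] F]
          unearD[OF near[OF that] \<pi> x] by linarith
      ultimately show ?thesis by (intro LIMSEQ_le_const2) auto
    qed
    then show "(\<lambda>i. L \<pi> x i - X n \<pi> x i) \<in> ell2"
      "ell2_norm (\<lambda>i. L \<pi> x i - X n \<pi> x i) \<le> \<epsilon> n * ell2_norm x" by (fact ell2_normI)+
  qed
  have LX: "unear A L (X n) (\<epsilon> n)" for n using nearL(2) by (simp add: unear_def)
  obtain K where K: "K \<ge> 0" "unorm_le A (X 0) K" using universal_norm_bound[OF X] by blast
  have "L \<pi> \<in> bounded_ops" if \<pi>: "\<pi> \<in> reps A" for \<pi>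
  proof (rule bounded_opsI[where K = "\<epsilon> 0 + K"])
    show "L \<pi> \<in> extensional ell2" using \<pi> by (simp add: L_def)
    fix x :: "'a vec" assume x: "x \<in> ell2"
    have X0: "X 0 \<pi> x \<in> ell2" by (rule uops_apply(2)[OF Xu \<pi> x])
    show "L \<pi> x \<in> ell2" using ell2_add(1)[OF nearL(1)[OF \<pi> x, of 0] X0] by simp
    show "ell2_norm (L \<pi> x) \<le> (\<epsilon> 0 + K) * ell2_norm x"
      using ell2_add(2)[OF nearL(1)[OF \<pi> x, of 0] X0] nearL(2)[OF \<pi> x, of 0] unorm_leD[OF K(2) \<pi> x]
      by (simp add: distrib_right)
    show "L \<pi> (\<lambda>i. z * x i) = (\<lambda>i. z * L \<pi> x i)" for z
    proof
      fix i
      have "(\<lambda>n. z * X n \<pi> x i) \<longlonglongrightarrow> z * L \<pi> x i" by (intro tendsto_intros lim \<pi> x)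
      moreover have "(\<lambda>n. z * X n \<pi> x i) \<longlonglongrightarrow> L \<pi> (\<lambda>i. z * x i) i"
        using lim[OF \<pi> ell2_scale[OF x], of z i] bounded_opsD(4)[OF uops_apply(1)[OF Xu \<pi>] x] by simp
      ultimately show "L \<pi> (\<lambda>i. z * x i) i = z * L \<pi> x i" using LIMSEQ_unique by blast
    qed
    show "L \<pi> (\<lambda>i. x i + y i) = (\<lambda>i. L \<pi> x i + L \<pi> y i)" if y: "y \<in> ell2" for y
    proof
      fix i
      have "(\<lambda>n. X n \<pi> x i + X n \<pi> y i) \<longlonglongrightarrow> L \<pi> x i + L \<pi> y i" by (intro tendsto_intros lim \<pi> x y)
      moreover have "(\<lambda>n. X n \<pi> x i + X n \<pi> y i) \<longlonglongrightarrow> L \<pi> (\<lambda>i. x i + y i) i"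
        using lim[OF \<pi> ell2_add(1)[OF x y], of i] bounded_opsD(3)[OF uops_apply(1)[OF Xu \<pi>] x y] by simp
      ultimately show "L \<pi> (\<lambda>i. x i + y i) i = L \<pi> x i + L \<pi> y i" using LIMSEQ_unique by blast
    qed
  qed
  then have Lu: "L \<in> uops A" by (auto simp: L_def)
  have "\<exists>R\<in>uspan A. unear A L R e" if e: "e > 0" for e
  proof -
    obtain n where n: "\<epsilon> n < e / 2"
      using order_tendstoD(2)[OF \<epsilon>, of "e / 2"] e by (auto simp: eventually_sequentially)
    obtain R where R: "R \<in> uspan A" "unear A (X n) R (e / 2)"
      using X[of n] e unfolding universal_cstar_iff by (meson half_gt_zero)
    have "unear A L R (\<epsilon> n + e / 2)"
      by (rule unear_trans[OF Lu Xu uspan_uops[OF R(1)] LX R(2)])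
    then have "unear A L R e"
      using n by (intro unear_mono[of _ _ "\<epsilon> n + e / 2" e]) auto
    then show ?thesis using R by blast
  qed
  then have "L \<in> universal_cstar A" using Lu by (simp add: universal_cstar_iff)
  then show ?thesis using that LX lim by blast
qed

text \<open>The partial sums of the geometric series \<open>T + T\<^sup>2 + \<dots>\<close> stay in \<open>C\<^sup>*(\<E>)\<close>. As for a single commutative
  $C^*$-algebra, this makes all characters of \<open>C\<^sup>*(\<E>)\<close> contractive.\<close>

lemma universal_quasi_inverse:
  assumes T: "T \<in> universal_cstar A" and \<rho>: "unorm_le A T \<rho>" "0 \<le> \<rho>" "\<rho> < 1"
  obtains S where "S \<in> universal_cstar A" "S = uadd A T (umul A T S)"
proof -
  define X where "X = rec_nat (uzero A) (\<lambda>_ S. uadd A T (umul A T S))"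
  have X0: "X 0 = uzero A" and XS: "\<And>n. X (Suc n) = uadd A T (umul A T (X n))" by (simp_all add: X_def)
  have X: "X n \<in> universal_cstar A" for n
    by (induction n) (simp_all add: X0 XS uspan_universal uspan_zero universal_uadd universal_umul T)
  note Xu = universal_uops[OF X] and Tu = universal_uops[OF T]
  have step: "unear A (X (Suc n)) (X n) (\<rho> ^ n)" for n
  proof (induction n)
    case 0
    show ?case
      unfolding unear_def
    proof (intro ballI)
      fix \<pi> and x :: "'a vec" assume \<pi>: "\<pi> \<in> reps A" and x: "x \<in> ell2"
      have "ell2_norm (T \<pi> x) \<le> 1 * ell2_norm x"
        using unorm_leD[OF \<rho>(1) \<pi> x] mult_right_mono[of \<rho> 1 "ell2_norm x"] \<rho>(3) by simp
      then show "ell2_norm (\<lambda>i. X (Suc 0) \<pi> x i - X 0 \<pi> x i) \<le> \<rho> ^ 0 * ell2_norm x"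
        using \<pi> x by (simp add: XS X0 bounded_ops_zero_arg[OF uops_apply(1)[OF Tu \<pi>]])
    qed
  next
    case (Suc n)
    show ?case
      unfolding unear_def
    proof (intro ballI)
      fix \<pi> and x :: "'a vec" assume \<pi>: "\<pi> \<in> reps A" and x: "x \<in> ell2"
      note m = uops_apply(2)[OF Xu[of "Suc n"] \<pi> x] uops_apply(2)[OF Xu[of n] \<pi> x]
      have "(\<lambda>i. X (Suc (Suc n)) \<pi> x i - X (Suc n) \<pi> x i) = T \<pi> (\<lambda>i. X (Suc n) \<pi> x i - X n \<pi> x i)"
      proof
        fix i
        have "X (Suc (Suc n)) \<pi> x i = T \<pi> x i + T \<pi> (X (Suc n) \<pi> x) i"
          and "X (Suc n) \<pi> x i = T \<pi> x i + T \<pi> (X n \<pi> x) i"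
          using XS[of "Suc n"] XS[of n] \<pi> x by simp_all
        then show "X (Suc (Suc n)) \<pi> x i - X (Suc n) \<pi> x i = T \<pi> (\<lambda>i. X (Suc n) \<pi> x i - X n \<pi> x i) i"
          unfolding bounded_ops_diff[OF uops_apply(1)[OF Tu \<pi>] m] by simp
      qed
      then have "ell2_norm (\<lambda>i. X (Suc (Suc n)) \<pi> x i - X (Suc n) \<pi> x i)
          \<le> \<rho> * ell2_norm (\<lambda>i. X (Suc n) \<pi> x i - X n \<pi> x i)"
        using unorm_leD[OF \<rho>(1) \<pi> ell2_diff(1)[OF m]] by simp
      also have "\<dots> \<le> \<rho> * (\<rho> ^ n * ell2_norm x)" by (intro mult_left_mono unearD[OF Suc \<pi> x] \<rho>)
      finally show "ell2_norm (\<lambda>i. X (Suc (Suc n)) \<pi> x i - X (Suc n) \<pi> x i) \<le> \<rho> ^ Suc n * ell2_norm x"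
        by (simp add: mult.assoc)
    qed
  qed
  have tele: "unear A (X (n + k)) (X n) ((\<rho> ^ n - \<rho> ^ (n + k)) / (1 - \<rho>))" for n k
  proof (induction k)
    case (Suc k)
    have eq: "\<rho> ^ (n + k) + (\<rho> ^ n - \<rho> ^ (n + k)) / (1 - \<rho>) = (\<rho> ^ n - \<rho> ^ (n + Suc k)) / (1 - \<rho>)"
      using \<rho> by (simp add: field_simps)
    show ?case
      using unear_trans[OF Xu Xu Xu step[of "n + k"] Suc] unfolding eq by simp
  qed (simp add: unear_def)
  have near: "unear A (X m) (X n) (\<rho> ^ n / (1 - \<rho>))" if "n \<le> m" for n m
    unfolding unear_def
  proof (intro ballI)
    fix \<pi> and x :: "'a vec" assume \<pi>: "\<pi> \<in> reps A" and x: "x \<in> ell2"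
    have "(\<rho> ^ n - \<rho> ^ m) / (1 - \<rho>) \<le> \<rho> ^ n / (1 - \<rho>)" using \<rho> by (intro divide_right_mono) auto
    then have "(\<rho> ^ n - \<rho> ^ m) / (1 - \<rho>) * ell2_norm x \<le> \<rho> ^ n / (1 - \<rho>) * ell2_norm x"
      by (intro mult_right_mono) auto
    then show "ell2_norm (\<lambda>i. X m \<pi> x i - X n \<pi> x i) \<le> \<rho> ^ n / (1 - \<rho>) * ell2_norm x"
      using unearD[OF tele[of n "m - n"] \<pi> x] that by simp
  qed
  have "(\<lambda>n. \<rho> ^ n / (1 - \<rho>)) \<longlonglongrightarrow> 0 / (1 - \<rho>)"
    using \<rho> by (intro tendsto_intros LIMSEQ_power_zero) auto
  then have e0: "(\<lambda>n. \<rho> ^ n / (1 - \<rho>)) \<longlonglongrightarrow> 0" by simp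
  obtain L where L: "L \<in> universal_cstar A" "\<And>n. unear A L (X n) (\<rho> ^ n / (1 - \<rho>))"
    "\<And>\<pi> x i. \<pi> \<in> reps A \<Longrightarrow> x \<in> ell2 \<Longrightarrow> (\<lambda>n. X n \<pi> x i) \<longlonglongrightarrow> L \<pi> x i"
    using universal_complete[of X, OF X near e0] by metis
  note Lu = universal_uops[OF L(1)]
  have "L = uadd A T (umul A T L)"
  proof (rule uops_eqI[OF Lu])
    show "uadd A T (umul A T L) \<in> uops A" by (intro uops_closed Tu Lu)
    fix \<pi> and x :: "'a vec" assume \<pi>: "\<pi> \<in> reps A" and x: "x \<in> ell2"
    have "L \<pi> x i = T \<pi> x i + T \<pi> (L \<pi> x) i" for i
    proof -
      note m = uops_apply(2)[OF Lu \<pi> x] uops_apply(2)[OF Xu \<pi> x]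
      have bound: "cmod (T \<pi> (X n \<pi> x) i - T \<pi> (L \<pi> x) i) \<le> \<rho> * (\<rho> ^ n / (1 - \<rho>) * ell2_norm x)" for n
      proof -
        have d: "(\<lambda>i. X n \<pi> x i - L \<pi> x i) \<in> ell2" using ell2_diff(1)[OF m(2) m(1)] .
        have "cmod (T \<pi> (X n \<pi> x) i - T \<pi> (L \<pi> x) i) \<le> ell2_norm (T \<pi> (\<lambda>i. X n \<pi> x i - L \<pi> x i))"
          using cmod_le_ell2_norm[OF uops_apply(2)[OF Tu \<pi> d], of i]
          unfolding bounded_ops_diff[OF uops_apply(1)[OF Tu \<pi>] m(2) m(1)] .
        also have "\<dots> \<le> \<rho> * ell2_norm (\<lambda>i. X n \<pi> x i - L \<pi> x i)" by (rule unorm_leD[OF \<rho>(1) \<pi> d])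
        also have "\<dots> \<le> \<rho> * (\<rho> ^ n / (1 - \<rho>) * ell2_norm x)"
          using unearD[OF L(2) \<pi> x] by (intro mult_left_mono \<rho>) (simp add: ell2_norm_diff_commute)
        finally show ?thesis .
      qed
      have "(\<lambda>n. \<rho> * (\<rho> ^ n / (1 - \<rho>) * ell2_norm x)) \<longlonglongrightarrow> \<rho> * (0 * ell2_norm x)"
        by (intro tendsto_mult tendsto_const e0)
      then have "(\<lambda>n. \<rho> * (\<rho> ^ n / (1 - \<rho>) * ell2_norm x)) \<longlonglongrightarrow> 0" by simp
      then have "(\<lambda>n. T \<pi> (X n \<pi> x) i - T \<pi> (L \<pi> x) i) \<longlonglongrightarrow> 0"
        by (rule Lim_null_comparison[OF always_eventually[OF allI[OF bound]]])
      then have "(\<lambda>n. T \<pi> (X n \<pi> x) i) \<longlonglongrightarrow> T \<pi> (L \<pi> x) i" by (rule LIM_zero_cancel)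
      then have "(\<lambda>n. T \<pi> x i + T \<pi> (X n \<pi> x) i) \<longlonglongrightarrow> T \<pi> x i + T \<pi> (L \<pi> x) i"
        by (intro tendsto_add tendsto_const)
      moreover have "(\<lambda>n. X (Suc n) \<pi> x i) \<longlonglongrightarrow> L \<pi> x i" by (rule LIMSEQ_Suc[OF L(3)[OF \<pi> x]])
      then have "(\<lambda>n. T \<pi> x i + T \<pi> (X n \<pi> x) i) \<longlonglongrightarrow> L \<pi> x i" using \<pi> x by (simp add: XS)
      ultimately show ?thesis using LIMSEQ_unique by blast
    qed
    then show "L \<pi> x = uadd A T (umul A T L) \<pi> x" using \<pi> x by auto
  qed
  then show ?thesis using that L(1) by blast
qed


section \<open>The spectrum\<close>

lemma spectrumD:
  assumes "x \<in> spectrum A"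
  shows "S \<in> universal_cstar A \<Longrightarrow> T \<in> universal_cstar A \<Longrightarrow> x (uadd A S T) = x S + x T"
    "T \<in> universal_cstar A \<Longrightarrow> x (uscale A z T) = z * x T"
    "S \<in> universal_cstar A \<Longrightarrow> T \<in> universal_cstar A \<Longrightarrow> x (umul A S T) = x S * x T"
    "\<exists>T\<in>universal_cstar A. x T \<noteq> 0" "x \<in> extensional (universal_cstar A)"
  using assms by (auto simp: spectrum_def PiE_iff)

lemma spectrum_norm_le:
  assumes x: "x \<in> spectrum A" and T: "T \<in> universal_cstar A" and K: "unorm_le A T K" "0 \<le> K"
  shows "cmod (x T) \<le> K"
proof (rule ccontr)
  assume less: "\<not> ?thesis"
  then have nz: "x T \<noteq> 0" using K by auto
  let ?T = "uscale A (1 / x T) T"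
  have T': "?T \<in> universal_cstar A" by (rule universal_uscale[OF T])
  have "unorm_le A ?T (K / cmod (x T))"
    unfolding unorm_le_def
  proof (intro ballI)
    fix \<pi> and \<xi> :: "'a vec" assume \<pi>: "\<pi> \<in> reps A" "\<xi> \<in> ell2"
    have "ell2_norm (?T \<pi> \<xi>) = ell2_norm (T \<pi> \<xi>) / cmod (x T)"
      using \<pi> ell2_norm_scale[of "1 / x T" "T \<pi> \<xi>"] by (simp add: norm_divide)
    then show "ell2_norm (?T \<pi> \<xi>) \<le> K / cmod (x T) * ell2_norm \<xi>"
      using unorm_leD[OF K(1) \<pi>] by (simp add: divide_right_mono)
  qed
  moreover have "K / cmod (x T) < 1" using less nz by simp
  moreover have "0 \<le> K / cmod (x T)" using K by simp
  ultimately obtain S where S: "S \<in> universal_cstar A" "S = uadd A ?T (umul A ?T S)"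
    using universal_quasi_inverse[OF T'] by metis
  have "x S = x ?T + x ?T * x S"
    using arg_cong[OF S(2), of x] S(1) T' by (simp add: spectrumD[OF x] universal_umul)
  moreover have "x ?T = 1" using nz by (simp add: spectrumD(2)[OF x T])
  ultimately show False by simp
qed

lemma spectrum_diff_le:
  assumes x: "x \<in> spectrum A" and T: "T \<in> universal_cstar A" and R: "R \<in> uspan A"
    and near: "unear A T R \<epsilon>" and e: "0 \<le> \<epsilon>"
  shows "cmod (x T - x R) \<le> \<epsilon>"
proof -
  note Ru = uspan_universal[OF R]
  have "unorm_le A (uadd A T (uscale A (-1) R)) \<epsilon>"
    using near by (simp add: unorm_le_def unear_def)
  then have "cmod (x (uadd A T (uscale A (-1) R))) \<le> \<epsilon>"
    using e by (intro spectrum_norm_le[OF x] universal_uadd universal_uscale T Ru)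
  then show ?thesis by (simp add: spectrumD[OF x] T Ru universal_uscale)
qed

lemma ev_add: "x \<in> spectrum A \<Longrightarrow> idem e \<Longrightarrow> a \<in> fib A e \<Longrightarrow> b \<in> fib A e \<Longrightarrow>
    ev A (add A a b) x = ev A a x + ev A b x"
  by (simp add: ev_def ucan_simps spectrumD idem_partI)

lemma ev_scale [simp]: "x \<in> spectrum A \<Longrightarrow> a \<in> idem_part A \<Longrightarrow> ev A (scale A z a) x = z * ev A a x"
  by (simp add: ev_def ucan_simps spectrumD)

lemma ev_mul [simp]: "x \<in> spectrum A \<Longrightarrow> a \<in> idem_part A \<Longrightarrow> b \<in> idem_part A \<Longrightarrow>
    ev A (mul A a b) x = ev A a x * ev A b x"
  by (simp add: ev_def ucan_simps spectrumD)

lemma ev_incl: "idem e \<Longrightarrow> idem f \<Longrightarrow> natural_le e f \<Longrightarrow> a \<in> fib A e \<Longrightarrow>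
    ev A (incl A f e a) x = ev A a x"
  by (simp add: ev_def ucan_simps)

lemma ev_norm_le: "x \<in> spectrum A \<Longrightarrow> idem e \<Longrightarrow> a \<in> fib A e \<Longrightarrow> cmod (ev A a x) \<le> nrm A a"
  unfolding ev_def
  by (rule spectrum_norm_le[OF _ ucan_universal[OF idem_partI] unorm_le_ucan[OF idem_partI] nrm_nonneg])

lemma ev_star [simp]:
  assumes x: "x \<in> spectrum A" and a: "a \<in> idem_part A"
  shows "ev A (star A a) x = cnj (ev A a x)"
proof -
  obtain e where e: "idem e" "a \<in> fib A e" using a by (auto simp: idem_part_def)
  show ?thesis
    by (rule fibre_functional(2)[OF comm_fibre[OF e(1)] _ _ _ e(2)])
      (use e x in \<open>simp_all add: ev_add idem_partI[OF e(1)]\<close>)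
qed

lemma ev_uspan_eqI:
  assumes x: "x \<in> spectrum A" and y: "y \<in> spectrum A"
    and eq: "\<And>a. a \<in> idem_part A \<Longrightarrow> ev A a x = ev A a y" and R: "R \<in> uspan A"
  shows "x R = y R"
  using R
proof (induction rule: uspan_induct)
  case zero
  have "uzero A = uscale A 0 (uzero A)" by (intro uops_eqI[where A = A] uops_closed) auto
  then have "x (uzero A) = 0" "y (uzero A) = 0"
    using spectrumD(2)[OF x, of "uzero A" 0] spectrumD(2)[OF y, of "uzero A" 0]
      uspan_universal[OF uspan_zero] by simp_all
  then show ?case by simp
next
  case (step a T z)
  then show ?case
    using eq[OF step(1)]
    by (simp add: spectrumD[OF x] spectrumD[OF y] uspan_universal universal_uscale ev_def)
qed

lemma spectrum_eqI:
  assumes x: "x \<in> spectrum A" and y: "y \<in> spectrum A"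
    and eq: "\<And>a. a \<in> idem_part A \<Longrightarrow> ev A a x = ev A a y"
  shows "x = y"
proof (rule extensionalityI[OF spectrumD(5)[OF x] spectrumD(5)[OF y]])
  fix T assume T: "T \<in> universal_cstar A"
  have "cmod (x T - y T) \<le> 2 * \<epsilon>" if e: "\<epsilon> > 0" for \<epsilon>
  proof -
    obtain R where R: "R \<in> uspan A" "unear A T R \<epsilon>" using T e by (auto simp: universal_cstar_iff)
    have "x R = y R" by (rule ev_uspan_eqI[OF x y eq R(1)])
    then show ?thesis
      using spectrum_diff_le[OF x T R] spectrum_diff_le[OF y T R] e
        norm_triangle_ineq4[of "x T - x R" "y T - y R"] by simp
  qed
  from this[of "cmod (x T - y T) / 4"] show "x T = y T" by (cases "x T = y T") auto
qed

lemma ev_nonzero: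
  assumes x: "x \<in> spectrum A" obtains a where "a \<in> idem_part A" "ev A a x \<noteq> 0"
proof (rule ccontr)
  assume *: "\<not> thesis"
  have 0: "\<And>a. a \<in> idem_part A \<Longrightarrow> ev A a x = 0" using * that by blast
  obtain T where T: "T \<in> universal_cstar A" "x T \<noteq> 0" using spectrumD(4)[OF x] by blast
  have "x R = 0" if "R \<in> uspan A" for R
    using that
  proof (induction rule: uspan_induct)
    case zero
    have "uzero A = uscale A 0 (uzero A)" by (intro uops_eqI[where A = A] uops_closed) auto
    then show ?case
      using spectrumD(2)[OF x, of "uzero A" 0] uspan_universal[OF uspan_zero] by simp
  next
    case (step a T z)
    then show ?case
      using 0[OF step(1)]
      by (simp add: spectrumD[OF x] uspan_universal universal_uscale ev_def)
  qed
  moreover obtain R where "R \<in> uspan A" "unear A T R (cmod (x T) / 2)"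
    using T unfolding universal_cstar_iff by (meson half_gt_zero zero_less_norm_iff)
  ultimately show False using spectrum_diff_le[OF x T(1), of R "cmod (x T) / 2"] T(2) by simp
qed

text \<open>Conversely, a character \<open>\<kappa>\<close> of the bundle over the idempotents is a point of the spectrum:
  \<open>a \<mapsto> \<kappa>(a) \<cdot> id\<close> is a representation, and the matrix entry of \<open>T\<close> in this representation at one
  basis vector is the value of the corresponding character of the universal algebra.\<close>

definition is_char :: "('a \<Rightarrow> complex) \<Rightarrow> bool" where
  "is_char \<kappa> \<longleftrightarrow>
     (\<forall>e. idem e \<longrightarrow> (\<forall>a\<in>fib A e. \<forall>b\<in>fib A e. \<kappa> (add A a b) = \<kappa> a + \<kappa> b)) \<and>
     (\<forall>z. \<forall>a\<in>idem_part A. \<kappa> (scale A z a) = z * \<kappa> a) \<and>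
     (\<forall>a\<in>idem_part A. \<forall>b\<in>idem_part A. \<kappa> (mul A a b) = \<kappa> a * \<kappa> b) \<and>
     (\<forall>e f. idem e \<longrightarrow> idem f \<longrightarrow> natural_le e f \<longrightarrow> (\<forall>a\<in>fib A e. \<kappa> (incl A f e a) = \<kappa> a)) \<and>
     (\<exists>a\<in>idem_part A. \<kappa> a \<noteq> 0)"

lemma spectrum_of_char:
  assumes \<kappa>: "is_char \<kappa>"
  obtains x where "x \<in> spectrum A" "\<And>a. a \<in> idem_part A \<Longrightarrow> ev A a x = \<kappa> a"
proof -
  have k_add: "idem e \<Longrightarrow> a \<in> fib A e \<Longrightarrow> b \<in> fib A e \<Longrightarrow> \<kappa> (add A a b) = \<kappa> a + \<kappa> b"
    and k_scale: "a \<in> idem_part A \<Longrightarrow> \<kappa> (scale A z a) = z * \<kappa> a"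
    and k_mul: "a \<in> idem_part A \<Longrightarrow> b \<in> idem_part A \<Longrightarrow> \<kappa> (mul A a b) = \<kappa> a * \<kappa> b"
    and k_incl: "idem e \<Longrightarrow> idem f \<Longrightarrow> natural_le e f \<Longrightarrow> a \<in> fib A e \<Longrightarrow> \<kappa> (incl A f e a) = \<kappa> a"
    for e f a b z
    using \<kappa> by (simp_all add: is_char_def)
  define \<pi> :: "'a \<Rightarrow> 'a op" where "\<pi> = (\<lambda>a\<in>idem_part A. \<lambda>\<xi>\<in>ell2. \<lambda>i. \<kappa> a * \<xi> i)"
  have \<pi>_apply: "\<pi> a \<xi> = (\<lambda>i. \<kappa> a * \<xi> i)" if "a \<in> idem_part A" "\<xi> \<in> ell2" for a \<xi>
    using that by (simp add: \<pi>_def)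
  have bd: "\<pi> a \<in> bounded_ops" if a: "a \<in> idem_part A" for a
    by (rule bounded_opsI[where K = "cmod (\<kappa> a)"])
      (use a in \<open>simp_all add: \<pi>_def ell2_add ell2_scale ell2_norm_scale distrib_left mult.left_commute\<close>)
  have \<kappa>_star: "\<kappa> (star A a) = cnj (\<kappa> a)" if a: "a \<in> idem_part A" for a
  proof -
    obtain e where e: "idem e" "a \<in> fib A e" using a by (auto simp: idem_part_def)
    show ?thesis
      by (rule fibre_functional(2)[OF comm_fibre[OF e(1)] _ _ _ e(2)])
        (simp_all add: k_add[OF e(1)] k_scale k_mul idem_partI[OF e(1)])
  qed
  have ext: "\<pi> a \<in> extensional ell2" if "a \<in> idem_part A" for a using bounded_opsD(2)[OF bd[OF that]] .
  have rep: "\<pi> \<in> reps A"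
    unfolding reps_def
  proof (intro CollectI conjI)
    show "\<pi> \<in> idem_part A \<rightarrow>\<^sub>E bounded_ops" using bd by (auto simp: \<pi>_def)
    show "\<forall>e. idem e \<longrightarrow> (\<forall>a\<in>fib A e. \<forall>b\<in>fib A e. \<pi> (add A a b) = op_add (\<pi> a) (\<pi> b))"
      by (auto simp: \<pi>_def op_add_def restrict_def k_add distrib_right idem_partI intro!: ext)
    show "\<forall>z. \<forall>a\<in>idem_part A. \<pi> (scale A z a) = op_scale z (\<pi> a)"
      by (auto simp: \<pi>_def op_scale_def restrict_def k_scale mult.assoc intro!: ext)
    show "\<forall>a\<in>idem_part A. \<forall>b\<in>idem_part A. \<pi> (mul A a b) = op_mul (\<pi> a) (\<pi> b)"
      by (auto simp: \<pi>_def op_mul_def compose_def restrict_def k_mul mult.assoc ell2_scale intro!: ext)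
    show "\<forall>a\<in>idem_part A. is_adjoint (\<pi> a) (\<pi> (star A a))"
      by (auto simp: is_adjoint_def \<pi>_apply ell2_inner_def \<kappa>_star algebra_simps)
    show "\<forall>e f. idem e \<longrightarrow> idem f \<longrightarrow> natural_le e f \<longrightarrow> (\<forall>a\<in>fib A e. \<pi> (incl A f e a) = \<pi> a)"
      by (auto simp: \<pi>_def idem_partI incl_closed k_incl)
  qed
  define j :: 'a where "j = undefined"
  define \<delta> :: "'a vec" where "\<delta> = (\<lambda>i. if i = j then 1 else 0)"
  have "((\<lambda>i. (cmod (\<delta> i))\<^sup>2) has_sum 1) UNIV"
    using has_sum_cong_neutral[of "{j}" UNIV "\<lambda>i. 1::real" "\<lambda>i. (cmod (\<delta> i))\<^sup>2" 1]
      has_sum_finite[of "{j}" "\<lambda>i. 1::real"] by (auto simp: \<delta>_def)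
  then have \<delta>: "\<delta> \<in> ell2" "ell2_norm \<delta> = 1"
    by (auto simp: ell2_def ell2_norm_def infsumI summable_on_def)
  define x where "x = (\<lambda>T\<in>universal_cstar A. T \<pi> \<delta> j)"
  have span: "\<exists>c. R \<pi> \<delta> = (\<lambda>i. c * \<delta> i)" if "R \<in> uspan A" for R
    using that
  proof (induction rule: uspan_induct)
    case zero
    show ?case using rep \<delta> by (intro exI[of _ 0]) simp
  next
    case (step a T z)
    then obtain c where "T \<pi> \<delta> = (\<lambda>i. c * \<delta> i)" by blast
    then show ?case
      using rep \<delta> step(1) by (intro exI[of _ "z * \<kappa> a + c"]) (simp add: \<pi>_apply algebra_simps)
  qed
  have diag: "T \<pi> \<delta> = (\<lambda>i. T \<pi> \<delta> j * \<delta> i)" if T: "T \<in> universal_cstar A" for T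
  proof
    fix i
    show "T \<pi> \<delta> i = T \<pi> \<delta> j * \<delta> i"
    proof (cases "i = j")
      case False
      have "cmod (T \<pi> \<delta> i) \<le> \<epsilon>" if e: "\<epsilon> > 0" for \<epsilon>
      proof -
        obtain R where R: "R \<in> uspan A" "unear A T R \<epsilon>" using T e by (auto simp: universal_cstar_iff)
        obtain c where c: "R \<pi> \<delta> = (\<lambda>i. c * \<delta> i)" using span[OF R(1)] by blast
        have "(\<lambda>i. T \<pi> \<delta> i - R \<pi> \<delta> i) \<in> ell2"
          by (intro ell2_diff uops_apply(2)[OF universal_uops[OF T] rep \<delta>(1)]
              uops_apply(2)[OF uspan_uops[OF R(1)] rep \<delta>(1)])
        from cmod_le_ell2_norm[OF this, of i] show ?thesis
          using unearD[OF R(2) rep \<delta>(1)] False by (simp add: c \<delta>(2)) (simp add: \<delta>_def)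
      qed
      from this[of "cmod (T \<pi> \<delta> i) / 2"] show ?thesis
        using False by (cases "T \<pi> \<delta> i = 0") (auto simp: \<delta>_def)
    qed (simp add: \<delta>_def)
  qed
  have ev: "ev A a x = \<kappa> a" if "a \<in> idem_part A" for a
    using that rep \<delta> by (simp add: ev_def x_def \<pi>_apply) (simp add: \<delta>_def)
  have "x \<in> spectrum A"
    unfolding spectrum_def
  proof (intro CollectI conjI ballI allI)
    show "x \<in> universal_cstar A \<rightarrow>\<^sub>E UNIV" by (simp add: x_def)
    show "x (uadd A S T) = x S + x T" if "S \<in> universal_cstar A" "T \<in> universal_cstar A" for S T
      using that rep \<delta> by (simp add: x_def universal_uadd)
    show "x (uscale A z T) = z * x T" if "T \<in> universal_cstar A" for z T
      using that rep \<delta> by (simp add: x_def universal_uscale)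
    show "x (umul A S T) = x S * x T" if S: "S \<in> universal_cstar A" and T: "T \<in> universal_cstar A" for S T
    proof -
      have "S \<pi> (T \<pi> \<delta>) = (\<lambda>i. T \<pi> \<delta> j * S \<pi> \<delta> i)"
        by (subst diag[OF T]) (rule bounded_opsD(4)[OF uops_apply(1)[OF universal_uops[OF S] rep] \<delta>(1)])
      then show ?thesis using S T rep \<delta> by (simp add: x_def universal_umul)
    qed
    obtain a where "a \<in> idem_part A" "\<kappa> a \<noteq> 0" using \<kappa> by (auto simp: is_char_def)
    then show "\<exists>T\<in>universal_cstar A. x T \<noteq> 0"
      using ev[of a] by (intro bexI[of _ "ucan A a"]) (auto simp: ev_def)
  qed
  then show ?thesis using that ev by blast
qed

subsection \<open>The topology of the spectrum\<close>

lemma topspace_spectrum [simp]: "topspace (spectrum_top A) = spectrum A"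
  by (auto simp: spectrum_top_def spectrum_def topspace_product_topology)

end

lemma continuous_map_euclidean_uniform_limit:
  fixes g :: "'a \<Rightarrow> 'b :: metric_space"
  assumes "\<And>\<epsilon>. \<epsilon> > 0 \<Longrightarrow> \<exists>f. continuous_map X euclidean f \<and> (\<forall>x\<in>topspace X. dist (f x) (g x) < \<epsilon>)"
  shows "continuous_map X euclidean g"
proof -
  have "\<exists>f. \<forall>n. continuous_map X euclidean (f n) \<and>
      (\<forall>x\<in>topspace X. dist (f n x) (g x) < inverse (real (Suc n)))"
    using assms[of "inverse (real (Suc _))"] by (intro choice allI) auto
  then obtain f where f: "\<And>n. continuous_map X euclidean (f n)"
    "\<And>n x. x \<in> topspace X \<Longrightarrow> dist (f n x) (g x) < inverse (real (Suc n))" by metis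
  have "continuous_map X Met_TC.mtopology g"
  proof (rule Met_TC.continuous_map_uniform_limit)
    show "\<forall>\<^sub>F n in sequentially. continuous_map X Met_TC.mtopology (f n)" using f(1) by simp
    fix \<epsilon> :: real assume "\<epsilon> > 0"
    then obtain N where N: "inverse (real (Suc N)) < \<epsilon>" using reals_Archimedean by blast
    have "dist (f n x) (g x) < \<epsilon>" if "n \<ge> N" "x \<in> topspace X" for n x
    proof -
      have "inverse (real (Suc n)) \<le> inverse (real (Suc N))"
        using that(1) by (intro le_imp_inverse_le) auto
      then show ?thesis using f(2)[OF that(2), of n] N by linarith
    qed
    then show "\<forall>\<^sub>F n in sequentially. \<forall>x\<in>topspace X. g x \<in> UNIV \<and> dist (f n x) (g x) < \<epsilon>"
      by (auto simp: eventually_sequentially)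
  qed simp
  then show ?thesis by simp
qed

lemma continuous_map_cmult:
  fixes f :: "'a \<Rightarrow> complex"
  assumes "continuous_map X euclidean f" shows "continuous_map X euclidean (\<lambda>x. c * f x)"
proof -
  have "continuous_map euclidean euclidean ((*) c)"
    by (simp add: continuous_on_mult_left flip: subtopology_UNIV)
  from continuous_map_compose[OF assms this] show ?thesis by (simp add: o_def)
qed

context semiabelian_bundle
begin

lemma continuous_map_ev:
  assumes "a \<in> idem_part A" shows "continuous_map (spectrum_top A) euclidean (ev A a)"
proof -
  have "continuous_map (product_topology (\<lambda>_. euclidean) (universal_cstar A)) euclidean (\<lambda>x. x (ucan A a))"
    using assms by (intro continuous_map_product_projection) simp
  then show ?thesis
    unfolding spectrum_top_def ev_def by (rule continuous_map_from_subtopology)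
qed

lemma continuous_map_spectrumI:
  assumes g: "g \<in> topspace Z \<rightarrow> spectrum A"
    and cont: "\<And>a. a \<in> idem_part A \<Longrightarrow> continuous_map Z euclidean (\<lambda>z. ev A a (g z))"
  shows "continuous_map Z (spectrum_top A) g"
proof -
  have span: "continuous_map Z euclidean (\<lambda>z. g z R)" if "R \<in> uspan A" for R
    using that
  proof (induction rule: uspan_induct)
    case zero
    have "uzero A = uscale A 0 (uzero A)" by (intro uops_eqI[where A = A] uops_closed) auto
    then have 0: "g z (uzero A) = 0" if "z \<in> topspace Z" for z
      using spectrumD(2)[of "g z" "uzero A" 0] uspan_universal[OF uspan_zero] g that by fastforce
    have "continuous_map Z euclidean (\<lambda>z. 0 :: complex)" by simp
    then show ?case by (rule continuous_map_eq) (simp add: 0)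
  next
    case (step a T c)
    have "g z (uadd A (uscale A c (ucan A a)) T) = c * ev A a (g z) + g z T" if "z \<in> topspace Z" for z
      using spectrumD[of "g z"] g that step
      by (auto simp: Pi_iff uspan_universal universal_uscale ev_def)
    moreover have "continuous_map Z euclidean (\<lambda>z. c * ev A a (g z) + g z T)"
      by (intro continuous_map_add continuous_map_cmult cont step)
    ultimately show ?case by (auto intro: continuous_map_eq)
  qed
  have "continuous_map Z euclidean (\<lambda>z. g z T)" if T: "T \<in> universal_cstar A" for T
  proof (rule continuous_map_euclidean_uniform_limit)
    fix \<epsilon> :: real assume e: "\<epsilon> > 0"
    then obtain R where R: "R \<in> uspan A" "unear A T R (\<epsilon> / 2)"
      using T unfolding universal_cstar_iff by (meson half_gt_zero)
    have "dist (g z R) (g z T) < \<epsilon>" if "z \<in> topspace Z" for z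
      using spectrum_diff_le[OF _ T R, of "g z"] g that e
      by (auto simp: dist_norm norm_minus_commute Pi_iff intro: le_less_trans)
    then show "\<exists>f. continuous_map Z euclidean f \<and> (\<forall>x\<in>topspace Z. dist (f x) (g x T) < \<epsilon>)"
      using span[OF R(1)] by blast
  qed
  moreover have "g ` topspace Z \<subseteq> extensional (universal_cstar A)"
    using g spectrumD(5) by fastforce
  ultimately show ?thesis
    unfolding spectrum_top_def using g
    by (auto simp: continuous_map_in_subtopology continuous_map_componentwise)
qed

end


section \<open>Points and supports\<close>

lemma complex_pos_iff: "0 < (z :: complex) \<longleftrightarrow> 0 < Re z \<and> Im z = 0"
  by (auto simp: less_complex_def)

lemma complex_pos_mult: "0 < (z :: complex) \<Longrightarrow> 0 < w \<Longrightarrow> 0 < z * w"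
  by (auto simp: complex_pos_iff)

lemma complex_pos_cnj: "0 < (z :: complex) \<Longrightarrow> cnj z = z"
  by (auto simp: complex_pos_iff complex_eq_iff)

lemma complex_pos_cancel: "0 < (z :: complex) \<Longrightarrow> 0 < w * z \<Longrightarrow> 0 < w"
  by (auto simp: complex_pos_iff zero_less_mult_iff)

lemma complex_pos_cnj_mult: "z \<noteq> 0 \<Longrightarrow> 0 < cnj z * z"
  by (auto simp: complex_pos_iff complex_eq_iff sum_squares_gt_zero_iff)

context fell_bundle
begin

lemma fspan_fib: "x \<in> fspan A s M \<Longrightarrow> M \<subseteq> fib A s \<Longrightarrow> x \<in> fib A s"
  by (induction rule: fspan.induct) auto

lemma functional_closed_fspan:
  fixes \<Lambda> :: "'a \<Rightarrow> complex"
  assumes M: "M \<subseteq> fib A s"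
    and add: "\<And>a b. a \<in> fib A s \<Longrightarrow> b \<in> fib A s \<Longrightarrow> \<Lambda> (add A a b) = \<Lambda> a + \<Lambda> b"
    and scale: "\<And>z a. a \<in> fib A s \<Longrightarrow> \<Lambda> (scale A z a) = z * \<Lambda> a"
    and bd: "\<And>a. a \<in> fib A s \<Longrightarrow> cmod (\<Lambda> a) \<le> K * nrm A a"
    and 0: "\<And>m. m \<in> M \<Longrightarrow> \<Lambda> m = 0"
    and a: "a \<in> closed_fspan A s M"
  shows "\<Lambda> a = 0"
proof (rule ccontr)
  assume nz: "\<Lambda> a \<noteq> 0"
  have span: "\<Lambda> y = 0" if "y \<in> fspan A s M" for y
    using that
  proof (induction rule: fspan.induct)
    case zero
    show ?case using scale[OF zero_in, of 0] scale_zero[OF zero_in, of s] by simp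
  next
    case (step m x z)
    then show ?case
      using add[OF scale_in fspan_fib[OF step(2) M], of m z] scale[of m z] 0[OF step(1)] M by auto
  qed
  have aF: "a \<in> fib A s" using a by (simp add: closed_fspan_def)
  define \<epsilon> where "\<epsilon> = cmod (\<Lambda> a) / (\<bar>K\<bar> + 1)"
  have e: "\<epsilon> > 0" using nz by (simp add: \<epsilon>_def)
  then obtain y where y: "y \<in> fspan A s M" "fdist A a y < \<epsilon>"
    using a by (auto simp: closed_fspan_def)
  have yF: "y \<in> fib A s" by (rule fspan_fib[OF y(1) M])
  have "\<Lambda> (add A a (scale A (-1) y)) = \<Lambda> a"
    using add[OF aF scale_in[OF yF]] scale[OF yF] span[OF y(1)] by simp
  then have "cmod (\<Lambda> a) \<le> K * fdist A a y"
    using bd[OF add_in[OF aF scale_in[OF yF]], of "-1"] by (simp add: fdist_def)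
  also have "\<dots> \<le> \<bar>K\<bar> * fdist A a y" using fdist_nonneg[OF aF yF] by (intro mult_right_mono) auto
  also have "\<dots> \<le> \<bar>K\<bar> * \<epsilon>" using y(2) by (intro mult_left_mono) auto
  also have "\<dots> < (\<bar>K\<bar> + 1) * \<epsilon>" using e by simp
  also have "\<dots> = cmod (\<Lambda> a)" by (simp add: \<epsilon>_def add_nonneg_eq_0_iff)
  finally show False by simp
qed

end

context semiabelian_bundle
begin

abbreviation prod_bundle (infixl "\<odot>" 70) where "a \<odot> b \<equiv> mul A a b"
abbreviation star_bundle ("_\<^bold>*" [1000] 999) where "a\<^bold>* \<equiv> star A a"

lemma ev_star_mul_self:
  assumes x: "x \<in> spectrum A" and b: "b \<in> total A"
  shows "0 \<le> Re (ev A (b\<^bold>* \<odot> b) x)" "Im (ev A (b\<^bold>* \<odot> b) x) = 0"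
proof -
  obtain s where s: "b \<in> fib A s" using b by (auto simp: total_def)
  obtain c where c: "c \<in> fib A (sinv s * s)" "b\<^bold>* \<odot> b = c\<^bold>* \<odot> c"
    using star_mul_positive[OF s] by (auto simp: positive_in_def)
  have "c \<in> idem_part A" by (rule idem_partI[OF _ c(1)]) simp
  then have "ev A (b\<^bold>* \<odot> b) x = cnj (ev A c x) * ev A c x" unfolding c(2) using x by simp
  then show "0 \<le> Re (ev A (b\<^bold>* \<odot> b) x)" "Im (ev A (b\<^bold>* \<odot> b) x) = 0" by simp_all
qed

lemma dom_of_iff:
  assumes "b \<in> total A" shows "y \<in> dom_of A b \<longleftrightarrow> y \<in> spectrum A \<and> ev A (b\<^bold>* \<odot> b) y \<noteq> 0"
  using ev_star_mul_self[OF _ assms, of y]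
  by (auto simp: dom_of_def complex_pos_iff complex_eq_iff less_le[where 'a = real])

lemma dom_ofD: "y \<in> dom_of A b \<Longrightarrow> y \<in> spectrum A" "y \<in> dom_of A b \<Longrightarrow> 0 < ev A (b\<^bold>* \<odot> b) y"
  by (auto simp: dom_of_def)

text \<open>The elements \<open>bb\<^sup>*\<close> and \<open>a\<close> commute, and therefore \<open>(b\<^sup>*ab)\<^sup>2 = b\<^sup>*b \<cdot> b\<^sup>*a\<^sup>2b\<close>.\<close>

lemma ev_conj_zero:
  assumes x: "x \<in> spectrum A" and b: "b \<in> total A" and a: "a \<in> idem_part A"
    and 0: "ev A (b\<^bold>* \<odot> b) x = 0"
  shows "ev A (b\<^bold>* \<odot> (a \<odot> b)) x = 0"
proof -
  note [simp] = b a x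
  have "(b\<^bold>* \<odot> (a \<odot> b)) \<odot> (b\<^bold>* \<odot> (a \<odot> b)) = b\<^bold>* \<odot> (a \<odot> ((b \<odot> b\<^bold>*) \<odot> (a \<odot> b)))"
    by (simp add: total_assoc)
  also have "\<dots> = b\<^bold>* \<odot> ((b \<odot> b\<^bold>*) \<odot> (a \<odot> (a \<odot> b)))"
    by (subst idem_part_left_commute[of a]) simp_all
  also have "\<dots> = (b\<^bold>* \<odot> b) \<odot> (b\<^bold>* \<odot> ((a \<odot> a) \<odot> b))" by (simp add: total_assoc)
  finally have "ev A (b\<^bold>* \<odot> (a \<odot> b)) x * ev A (b\<^bold>* \<odot> (a \<odot> b)) x
      = ev A (b\<^bold>* \<odot> b) x * ev A (b\<^bold>* \<odot> ((a \<odot> a) \<odot> b)) x"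
    by (metis ev_mul conj_in_idem(1) idem_part_mul star_mul_self(1) a b x)
  then show ?thesis using 0 by simp
qed

lemma supp_spectrum: "x \<in> supp A e \<Longrightarrow> x \<in> spectrum A"
  by (simp add: supp_def)

lemma supp_pos:
  assumes "idem e" "x \<in> supp A e" obtains c where "c \<in> fib A e" "c \<in> idem_part A" "0 < ev A c x"
proof -
  obtain a where a: "a \<in> fib A e" "ev A a x \<noteq> 0" "x \<in> spectrum A" using assms by (auto simp: supp_def)
  have "a \<in> idem_part A" using a assms by (auto intro: idem_partI)
  then show ?thesis
    using that[of "a\<^bold>* \<odot> a"] a assms complex_pos_cnj_mult[OF a(2)] by (simp add: mul_in_idem star_in_idem)
qed

lemma supp_mult: "idem e \<Longrightarrow> idem f \<Longrightarrow> x \<in> supp A e \<Longrightarrow> x \<in> supp A f \<Longrightarrow> x \<in> supp A (e * f)"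
  unfolding supp_def by (auto intro!: bexI[of _ "_ \<odot> _"] mul_closed simp: idem_partI)

lemma suppI: "idem e \<Longrightarrow> a \<in> fib A e \<Longrightarrow> x \<in> spectrum A \<Longrightarrow> ev A a x \<noteq> 0 \<Longrightarrow> x \<in> supp A e"
  by (auto simp: supp_def)

lemma dom_supp: "b \<in> fib A s \<Longrightarrow> y \<in> dom_of A b \<Longrightarrow> y \<in> supp A (sinv s * s)"
  using mul_closed[OF star_closed] dom_ofD[of y b]
  by (intro suppI[of _ "b\<^bold>* \<odot> b"]) auto

lemma ev_nz_supp: "a \<in> idem_part A \<Longrightarrow> x \<in> spectrum A \<Longrightarrow> ev A a x \<noteq> 0 \<Longrightarrow> \<exists>e. idem e \<and> a \<in> fib A e \<and> x \<in> supp A e"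
  by (auto simp: supp_def idem_part_def)

lemma openin_ev_nz:
  assumes "a \<in> idem_part A" shows "openin (spectrum_top A) {x \<in> spectrum A. ev A a x \<noteq> 0}"
proof -
  have "openin (spectrum_top A) {x \<in> topspace (spectrum_top A). ev A a x \<in> - {0}}"
    by (rule openin_continuous_map_preimage[OF continuous_map_ev[OF assms]]) (auto simp: open_Compl)
  then show ?thesis by simp
qed

lemma openin_supp: assumes "idem e" shows "openin (spectrum_top A) (supp A e)"
proof -
  have "supp A e = (\<Union>a\<in>fib A e. {x \<in> spectrum A. ev A a x \<noteq> 0})" by (auto simp: supp_def)
  then show ?thesis using assms by (auto intro!: openin_Union openin_ev_nz idem_partI)
qed

lemma openin_dom: "b \<in> total A \<Longrightarrow> openin (spectrum_top A) (dom_of A b)"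
  using openin_ev_nz[OF star_mul_self(1)[of b]] dom_of_iff[of b]
  by (simp add: set_eq_iff[of "dom_of A b"]) (smt (verit) Collect_cong Collect_mem_eq)

section \<open>The partial homeomorphisms\<close>

lemma conj_natural_le:
  assumes e: "idem e" and f: "idem f" and le: "natural_le e f"
  shows "natural_le (sinv s * (e * s)) (sinv s * (f * s))"
proof -
  have fe: "f * e = e" using le e by (simp add: natural_le_def sinv_idem mult.assoc idem_def)
  have c: "idem (sinv s * (e * s))" using idem_conj[OF e, of s] by (simp add: mult.assoc)
  have "sinv s * (f * s) * (sinv s * (e * s)) = sinv s * (f * (s * sinv s) * e) * s"
    by (simp add: mult.assoc)
  also have "\<dots> = sinv s * (s * sinv s) * (f * e) * s"
    using f by (simp add: idem_commute[of f] mult.assoc)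
  also have "\<dots> = (sinv s * s * sinv s) * (e * s)" unfolding fe by (simp add: mult.assoc)
  finally have "sinv s * (f * s) * (sinv s * (e * s)) = sinv s * (e * s)" by (simp add: sinv_right)
  then show ?thesis using c by (simp add: natural_le_def sinv_idem mult.assoc idem_def)
qed

text \<open>The map \<open>a \<mapsto> (b\<^sup>*ab)(y) / (b\<^sup>*b)(y)\<close> is multiplicative because \<open>bb\<^sup>*\<close> commutes with \<open>a\<close>, so that
  \<open>b\<^sup>*ab \<cdot> b\<^sup>*a'b = b\<^sup>*b \<cdot> b\<^sup>*aa'b\<close>. It is therefore the evaluation at a point.\<close>

lemma theta_elem_exists:
  assumes b: "b \<in> total A" and y: "y \<in> dom_of A b"
  obtains z where "z \<in> spectrum A"
    "\<And>a. a \<in> idem_part A \<Longrightarrow> ev A (b\<^bold>* \<odot> (a \<odot> b)) y = ev A a z * ev A (b\<^bold>* \<odot> b) y"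
proof -
  obtain s where s: "b \<in> fib A s" using b by (auto simp: total_def)
  note [simp] = b dom_ofD(1)[OF y]
  let ?w = "ev A (b\<^bold>* \<odot> b) y"
  have w: "?w \<noteq> 0" using dom_ofD(2)[OF y] by auto
  define \<kappa> where "\<kappa> a = ev A (b\<^bold>* \<odot> (a \<odot> b)) y / ?w" for a
  have ch: "is_char \<kappa>"
    unfolding is_char_def
  proof (intro conjI allI impI ballI)
    show "\<kappa> (add A a a') = \<kappa> a + \<kappa> a'" if e: "idem e" and a: "a \<in> fib A e" "a' \<in> fib A e" for e a a'
    proof -
      have "b\<^bold>* \<odot> (add A a a' \<odot> b) = add A (b\<^bold>* \<odot> (a \<odot> b)) (b\<^bold>* \<odot> (a' \<odot> b))"
        using mul_add_left[OF a s] mul_add_right[OF star_closed[OF s] mul_closed[OF a(1) s] mul_closed[OF a(2) s]]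
        by simp
      moreover have "idem (sinv s * (e * s))" using idem_conj[OF e, of s] by (simp add: mult.assoc)
      ultimately show ?thesis
        using ev_add[of y "sinv s * (e * s)" "b\<^bold>* \<odot> (a \<odot> b)" "b\<^bold>* \<odot> (a' \<odot> b)"]
          mul_closed[OF star_closed[OF s] mul_closed[OF a(1) s]]
          mul_closed[OF star_closed[OF s] mul_closed[OF a(2) s]]
        by (simp add: \<kappa>_def add_divide_distrib)
    qed
    show "\<kappa> (scale A z a) = z * \<kappa> a" if a: "a \<in> idem_part A" for z a
    proof -
      obtain e where e: "idem e" "a \<in> fib A e" using a by (auto simp: idem_part_def)
      have "b\<^bold>* \<odot> (scale A z a \<odot> b) = scale A z (b\<^bold>* \<odot> (a \<odot> b))"
        using mul_scale_left[OF e(2) s] mul_scale_right[OF star_closed[OF s] mul_closed[OF e(2) s]] by simp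
      then show ?thesis using a by (simp add: \<kappa>_def)
    qed
    show "\<kappa> (a \<odot> a') = \<kappa> a * \<kappa> a'" if a: "a \<in> idem_part A" and a': "a' \<in> idem_part A" for a a'
    proof -
      note [simp] = a a'
      have "(b\<^bold>* \<odot> (a \<odot> b)) \<odot> (b\<^bold>* \<odot> (a' \<odot> b)) = b\<^bold>* \<odot> (a \<odot> ((b \<odot> b\<^bold>*) \<odot> (a' \<odot> b)))"
        by (simp add: total_assoc)
      also have "\<dots> = b\<^bold>* \<odot> ((b \<odot> b\<^bold>*) \<odot> (a \<odot> (a' \<odot> b)))"
        by (subst idem_part_left_commute[of a]) simp_all
      also have "\<dots> = (b\<^bold>* \<odot> b) \<odot> (b\<^bold>* \<odot> ((a \<odot> a') \<odot> b))" by (simp add: total_assoc)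
      finally have "ev A (b\<^bold>* \<odot> (a \<odot> b)) y * ev A (b\<^bold>* \<odot> (a' \<odot> b)) y
          = ?w * ev A (b\<^bold>* \<odot> ((a \<odot> a') \<odot> b)) y"
        by (metis ev_mul conj_in_idem(1) idem_part_mul star_mul_self(1) a a' b dom_ofD(1)[OF y])
      then show ?thesis using w by (simp add: \<kappa>_def field_simps)
    qed
    show "\<kappa> (incl A f e a) = \<kappa> a" if e: "idem e" "idem f" "natural_le e f" "a \<in> fib A e" for e f a
    proof -
      have 1: "incl A f e a \<odot> b = incl A (f * s) (e * s) (a \<odot> b)"
        using incl_mul[OF e(3) natural_le_refl[of s] e(4) s] by (simp add: incl_self[OF s])
      have es: "natural_le (e * s) (f * s)"
      proof -
        have fe: "f * e = e" using e by (simp add: natural_le_def sinv_idem mult.assoc idem_def)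
        have "f * s * sinv (e * s) * (e * s) = f * (s * sinv s) * (e * e) * s"
          using e by (simp add: sinv_mult sinv_idem mult.assoc)
        also have "\<dots> = f * (s * sinv s * e) * s" using e by (simp add: idem_def mult.assoc)
        also have "\<dots> = f * (e * (s * sinv s)) * s"
          by (simp only: idem_commute[OF idem_sinv_mult(2) e(1)])
        also have "\<dots> = f * e * (s * sinv s * s)" by (simp add: mult.assoc)
        finally show ?thesis by (simp add: natural_le_def sinv_left fe)
      qed
      have "b\<^bold>* \<odot> incl A (f * s) (e * s) (a \<odot> b) = incl A (sinv s * (f * s)) (sinv s * (e * s)) (b\<^bold>* \<odot> (a \<odot> b))"
        using incl_mul[OF natural_le_refl[of "sinv s"] es star_closed[OF s] mul_closed[OF e(4) s]]
        by (simp add: incl_self[OF star_closed[OF s]])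
      moreover have "idem (sinv s * (e * s))" "idem (sinv s * (f * s))"
        using idem_conj[OF e(1), of s] idem_conj[OF e(2), of s] by (simp_all add: mult.assoc)
      ultimately show ?thesis
        using ev_incl[OF _ _ conj_natural_le[OF e(1-3), of s] mul_closed[OF star_closed[OF s] mul_closed[OF e(4) s]]]
        by (simp add: \<kappa>_def 1)
    qed
    have "b\<^bold>* \<odot> ((b \<odot> b\<^bold>*) \<odot> b) = (b\<^bold>* \<odot> b) \<odot> (b\<^bold>* \<odot> b)" by (simp add: total_assoc)
    then have "\<kappa> (b \<odot> b\<^bold>*) \<noteq> 0" using w by (simp add: \<kappa>_def)
    then show "\<exists>a\<in>idem_part A. \<kappa> a \<noteq> 0" by (rule bexI) simp
  qed
  obtain z where "z \<in> spectrum A" "\<And>a. a \<in> idem_part A \<Longrightarrow> ev A a z = \<kappa> a"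
    using spectrum_of_char[OF ch] by blast
  then show ?thesis using that w by (simp add: \<kappa>_def)
qed

lemma theta_elem_eqI:
  assumes b: "b \<in> total A" and y: "y \<in> dom_of A b" and z: "z \<in> spectrum A"
    and eq: "\<And>a. a \<in> idem_part A \<Longrightarrow> ev A (b\<^bold>* \<odot> (a \<odot> b)) y = ev A a z * ev A (b\<^bold>* \<odot> b) y"
  shows "theta_elem A b y = z"
  unfolding theta_elem_def
proof (rule the_equality)
  show "z \<in> spectrum A \<and> (\<forall>a\<in>idem_part A. ev A (b\<^bold>* \<odot> a \<odot> b) y = ev A a z * ev A (b\<^bold>* \<odot> b) y)"
    using z eq b by (simp add: total_assoc)
  fix x assume x: "x \<in> spectrum A \<and> (\<forall>a\<in>idem_part A. ev A (b\<^bold>* \<odot> a \<odot> b) y = ev A a x * ev A (b\<^bold>* \<odot> b) y)"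
  have "ev A (b\<^bold>* \<odot> b) y \<noteq> 0" using dom_ofD(2)[OF y] by auto
  moreover have "ev A a x * ev A (b\<^bold>* \<odot> b) y = ev A a z * ev A (b\<^bold>* \<odot> b) y" if "a \<in> idem_part A" for a
    using x eq[OF that] that b by (simp add: total_assoc)
  ultimately show "x = z" using x z by (intro spectrum_eqI) auto
qed

lemma theta_elem:
  assumes b: "b \<in> total A" and y: "y \<in> dom_of A b"
  shows theta_elem_in: "theta_elem A b y \<in> spectrum A"
    and ev_theta: "a \<in> idem_part A \<Longrightarrow>
      ev A (b\<^bold>* \<odot> (a \<odot> b)) y = ev A a (theta_elem A b y) * ev A (b\<^bold>* \<odot> b) y"
proof -
  obtain z where z: "z \<in> spectrum A"
    "\<And>a. a \<in> idem_part A \<Longrightarrow> ev A (b\<^bold>* \<odot> (a \<odot> b)) y = ev A a z * ev A (b\<^bold>* \<odot> b) y"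
    using theta_elem_exists[OF b y] by blast
  have "theta_elem A b y = z" by (rule theta_elem_eqI[OF b y z])
  then show "theta_elem A b y \<in> spectrum A" "a \<in> idem_part A \<Longrightarrow>
      ev A (b\<^bold>* \<odot> (a \<odot> b)) y = ev A a (theta_elem A b y) * ev A (b\<^bold>* \<odot> b) y"
    using z by auto
qed

lemma theta_elem_mul_right:
  assumes b: "b \<in> total A" and y: "y \<in> dom_of A b" and c: "c \<in> idem_part A" "ev A c y \<noteq> 0"
  shows "y \<in> dom_of A (b \<odot> c)" "theta_elem A (b \<odot> c) y = theta_elem A b y"
proof -
  note [simp] = b c(1) dom_ofD(1)[OF y]
  have ev: "ev A ((b \<odot> c)\<^bold>* \<odot> (a \<odot> (b \<odot> c))) y
      = cnj (ev A c y) * ev A c y * ev A (b\<^bold>* \<odot> (a \<odot> b)) y" if "a \<in> idem_part A" for a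
  proof -
    have "(b \<odot> c)\<^bold>* \<odot> (a \<odot> (b \<odot> c)) = c\<^bold>* \<odot> ((b\<^bold>* \<odot> (a \<odot> b)) \<odot> c)"
      using that by (simp add: total_assoc)
    then show ?thesis using that by simp
  qed
  have ev1: "ev A ((b \<odot> c)\<^bold>* \<odot> (b \<odot> c)) y = cnj (ev A c y) * ev A c y * ev A (b\<^bold>* \<odot> b) y"
  proof -
    have "(b \<odot> c)\<^bold>* \<odot> (b \<odot> c) = c\<^bold>* \<odot> ((b\<^bold>* \<odot> b) \<odot> c)" by (simp add: total_assoc)
    then show ?thesis by simp
  qed
  have "ev A ((b \<odot> c)\<^bold>* \<odot> (b \<odot> c)) y \<noteq> 0"
    unfolding ev1 using c(2) dom_ofD(2)[OF y] by auto
  then show dom: "y \<in> dom_of A (b \<odot> c)"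
    by (intro dom_of_iff[THEN iffD2] conjI) simp_all
  show "theta_elem A (b \<odot> c) y = theta_elem A b y"
  proof (rule theta_elem_eqI[OF _ dom theta_elem_in[OF b y]])
    show "ev A ((b \<odot> c)\<^bold>* \<odot> (a \<odot> (b \<odot> c))) y = ev A a (theta_elem A b y) * ev A ((b \<odot> c)\<^bold>* \<odot> (b \<odot> c)) y"
      if "a \<in> idem_part A" for a
      unfolding ev[OF that] ev1 ev_theta[OF b y that] by (simp add: mult_ac)
  qed simp
qed

text \<open>Since \<open>bb'\<^sup>*\<close> lies over an idempotent, it commutes with \<open>a\<close>; hence \<open>b\<^sup>*ab \<cdot> b'\<^sup>*b' = b\<^sup>*b \<cdot> b'\<^sup>*ab'\<close>.\<close>

lemma theta_elem_same_fibre: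
  assumes b: "b \<in> fib A s" "y \<in> dom_of A b" and b': "b' \<in> fib A s" "y \<in> dom_of A b'"
  shows "theta_elem A b' y = theta_elem A b y"
proof -
  have t [simp]: "b \<in> total A" "b' \<in> total A" using b b' by (auto intro: totalI)
  note [simp] = dom_ofD(1)[OF b(2)]
  have nz: "ev A (b\<^bold>* \<odot> b) y \<noteq> 0" using dom_ofD(2)[OF b(2)] by auto
  show ?thesis
  proof (rule theta_elem_eqI[OF t(2) b'(2) theta_elem_in[OF t(1) b(2)]])
    fix a assume a [simp]: "a \<in> idem_part A"
    have bb' [simp]: "b \<odot> b'\<^bold>* \<in> idem_part A" using b b' by simp
    have "(b\<^bold>* \<odot> (a \<odot> b)) \<odot> (b'\<^bold>* \<odot> b') = b\<^bold>* \<odot> (a \<odot> ((b \<odot> b'\<^bold>*) \<odot> b'))" by (simp add: total_assoc)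
    also have "\<dots> = b\<^bold>* \<odot> ((b \<odot> b'\<^bold>*) \<odot> (a \<odot> b'))"
      by (subst idem_part_left_commute[of a]) simp_all
    also have "\<dots> = (b\<^bold>* \<odot> b) \<odot> (b'\<^bold>* \<odot> (a \<odot> b'))" by (simp add: total_assoc)
    finally have "ev A (b\<^bold>* \<odot> (a \<odot> b)) y * ev A (b'\<^bold>* \<odot> b') y
        = ev A (b\<^bold>* \<odot> b) y * ev A (b'\<^bold>* \<odot> (a \<odot> b')) y"
      by (metis ev_mul conj_in_idem(1) star_mul_self(1) a t dom_ofD(1)[OF b(2)])
    then show "ev A (b'\<^bold>* \<odot> (a \<odot> b')) y = ev A a (theta_elem A b y) * ev A (b'\<^bold>* \<odot> b') y"
      using ev_theta[OF t(1) b(2) a] nz by (simp add: mult_ac)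
  qed
qed

lemma theta_eq:
  assumes b: "b \<in> fib A s" and y: "y \<in> dom_of A b"
  shows "theta A s y = theta_elem A b y"
  unfolding theta_def
proof (rule the_equality)
  show "\<exists>c\<in>fib A s. y \<in> dom_of A c \<and> theta_elem A b y = theta_elem A c y" using b y by blast
  fix z assume "\<exists>c\<in>fib A s. y \<in> dom_of A c \<and> z = theta_elem A c y"
  then obtain c where "c \<in> fib A s" "y \<in> dom_of A c" "z = theta_elem A c y" by blast
  then show "z = theta_elem A b y" using theta_elem_same_fibre[OF b y, of c] by simp
qed

lemma theta_elem_dom_star:
  assumes b: "b \<in> total A" and y: "y \<in> dom_of A b"
  shows "ev A (b \<odot> b\<^bold>*) (theta_elem A b y) = ev A (b\<^bold>* \<odot> b) y" "theta_elem A b y \<in> dom_of A (b\<^bold>*)"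
proof -
  note [simp] = b dom_ofD(1)[OF y] theta_elem_in[OF b y]
  have "b\<^bold>* \<odot> ((b \<odot> b\<^bold>*) \<odot> b) = (b\<^bold>* \<odot> b) \<odot> (b\<^bold>* \<odot> b)" by (simp add: total_assoc)
  then have "ev A (b\<^bold>* \<odot> b) y * ev A (b\<^bold>* \<odot> b) y = ev A (b \<odot> b\<^bold>*) (theta_elem A b y) * ev A (b\<^bold>* \<odot> b) y"
    using ev_theta[OF b y, of "b \<odot> b\<^bold>*"] by simp
  then show 1: "ev A (b \<odot> b\<^bold>*) (theta_elem A b y) = ev A (b\<^bold>* \<odot> b) y"
    using dom_ofD(2)[OF y] by auto
  show "theta_elem A b y \<in> dom_of A (b\<^bold>*)" using 1 dom_ofD(2)[OF y] by (auto simp: dom_of_iff)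
qed

lemma dom_mul:
  assumes a: "a \<in> total A" and b: "b \<in> total A" and y: "y \<in> dom_of A b" and ty: "theta_elem A b y \<in> dom_of A a"
  shows "y \<in> dom_of A (a \<odot> b)"
proof -
  note [simp] = a b dom_ofD(1)[OF y]
  have "(a \<odot> b)\<^bold>* \<odot> (a \<odot> b) = b\<^bold>* \<odot> ((a\<^bold>* \<odot> a) \<odot> b)" by (simp add: total_assoc)
  then show ?thesis
    using ev_theta[OF b y, of "a\<^bold>* \<odot> a"] dom_ofD(2)[OF ty] dom_ofD(2)[OF y] by (auto simp: dom_of_iff)
qed

lemma theta_supp:
  assumes b: "b \<in> fib A s" and y: "y \<in> dom_of A b"
  shows "theta_elem A b y \<in> supp A (s * sinv s)"
  using dom_supp[OF star_closed[OF b] theta_elem_dom_star(2)[OF totalI[OF b] y]] by simp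

text \<open>In the line bundle described by \<open>A\<close> the Cauchy-Schwarz inequality is an equality, since its fibres
  are one-dimensional.\<close>

lemma ev_exchange:
  assumes b1: "b1 \<in> fib A s" and b: "b \<in> fib A s" and y: "y \<in> spectrum A"
  shows "ev A (b\<^bold>* \<odot> b) y * ev A (b1\<^bold>* \<odot> b1) y = cnj (ev A (b1\<^bold>* \<odot> b) y) * ev A (b1\<^bold>* \<odot> b) y"
proof -
  have t [simp]: "b \<in> total A" "b1 \<in> total A" using b b1 by (auto intro: totalI)
  have E [simp]: "b1\<^bold>* \<odot> b \<in> idem_part A" "b\<^bold>* \<odot> b1 \<in> idem_part A" using b b1 by simp_all
  have "(b\<^bold>* \<odot> b) \<odot> (b1\<^bold>* \<odot> b1) = (b\<^bold>* \<odot> b1) \<odot> (b1\<^bold>* \<odot> b)"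
    using same_fibre_exchange[OF b1 b] by (simp add: total_assoc)
  moreover have "(b1\<^bold>* \<odot> b)\<^bold>* = b\<^bold>* \<odot> b1" by simp
  then have "ev A (b\<^bold>* \<odot> b1) y = cnj (ev A (b1\<^bold>* \<odot> b) y)" by (metis ev_star[OF y E(1)])
  ultimately show ?thesis
    using ev_mul[OF y star_mul_self(1)[OF t(1)] star_mul_self(1)[OF t(2)]] ev_mul[OF y E(2,1)] by simp
qed

section \<open>Germs and the twist\<close>

lemma germ_rel_sym: "(p, q) \<in> germ_rel A \<Longrightarrow> (q, p) \<in> germ_rel A"
  by (fastforce simp: germ_rel_def)

lemma germ_rel_refl: "x \<in> supp A (sinv s * s) \<Longrightarrow> ((s, x), (s, x)) \<in> germ_rel A"
  by (auto simp: germ_rel_def intro!: exI[of _ "sinv s * s"])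

lemma germ_rel_trans:
  assumes "(p, q) \<in> germ_rel A" "(q, r) \<in> germ_rel A" shows "(p, r) \<in> germ_rel A"
proof -
  obtain s x s' s'' where p: "p = (s, x)" "q = (s', x)" "r = (s'', x)" using assms by (auto simp: germ_rel_def)
  obtain e f where e: "idem e" "s * e = s' * e" "x \<in> supp A e" and f: "idem f" "s' * f = s'' * f" "x \<in> supp A f"
    using assms by (auto simp: p germ_rel_def)
  have "s * (e * f) = s' * (f * e)" using e f idem_commute[of e f] by (metis mult.assoc)
  also have "\<dots> = s'' * (e * f)" using e f idem_commute[of e f] by (metis mult.assoc)
  finally show ?thesis
    using assms e f supp_mult[OF e(1) f(1) e(3) f(3)] idem_mult[OF e(1) f(1)]
    by (auto simp: p germ_rel_def)
qed

lemma germ_eq_iff: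
  assumes "x \<in> supp A (sinv s * s)"
  shows "germ A s x = germ A s' x' \<longleftrightarrow> ((s, x), (s', x')) \<in> germ_rel A"
proof
  assume "germ A s x = germ A s' x'"
  moreover have "(s, x) \<in> germ A s x" using germ_rel_refl[OF assms] by (simp add: germ_def)
  ultimately have "(s, x) \<in> germ A s' x'" by simp
  then show "((s, x), (s', x')) \<in> germ_rel A" by (auto simp: germ_def intro: germ_rel_sym)
next
  assume r: "((s, x), (s', x')) \<in> germ_rel A"
  then show "germ A s x = germ A s' x'"
    unfolding germ_def using germ_rel_trans germ_rel_sym by blast
qed

lemma twist_rel_sym: "(p, q) \<in> twist_rel A \<Longrightarrow> (q, p) \<in> twist_rel A"
  unfolding twist_rel_def by clarsimp (metis)

lemma twist_relI:
  assumes "b \<in> fib A s" "b' \<in> fib A s'" "x \<in> dom_of A b" "x \<in> dom_of A b'" "c \<in> idem_part A" "c' \<in> idem_part A"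
    "0 < ev A c x" "0 < ev A c' x" "b \<odot> c = b' \<odot> c'"
  shows "((b, s, x), (b', s', x)) \<in> twist_rel A"
  using assms by (auto simp: twist_rel_def)

lemma twist_relE:
  assumes "((b, s, x), (b', s', x')) \<in> twist_rel A"
  obtains c c' where "x' = x" "b \<in> fib A s" "b' \<in> fib A s'" "x \<in> dom_of A b" "x \<in> dom_of A b'"
    "c \<in> idem_part A" "c' \<in> idem_part A" "0 < ev A c x" "0 < ev A c' x" "b \<odot> c = b' \<odot> c'"
  using assms by (auto simp: twist_rel_def)

lemma twist_rel_refl:
  assumes "b \<in> fib A s" "x \<in> dom_of A b" shows "((b, s, x), (b, s, x)) \<in> twist_rel A"
  using assms dom_ofD(2)[OF assms(2)] totalI[OF assms(1)]
  by (intro twist_relI[where c = "b\<^bold>* \<odot> b" and c' = "b\<^bold>* \<odot> b"]) auto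

lemma twist_rel_trans:
  assumes "(p, q) \<in> twist_rel A" "(q, r) \<in> twist_rel A" shows "(p, r) \<in> twist_rel A"
proof -
  obtain b s x b' s' x' b'' s'' x'' where p: "p = (b, s, x)" "q = (b', s', x')" "r = (b'', s'', x'')"
    by (metis prod_cases3)
  from assms[unfolded p] obtain c c' d d' where
    1: "x' = x" "b \<in> fib A s" "b' \<in> fib A s'" "x \<in> dom_of A b" "x \<in> dom_of A b'"
      "c \<in> idem_part A" "c' \<in> idem_part A" "0 < ev A c x" "0 < ev A c' x" "b \<odot> c = b' \<odot> c'"
    and 2: "x'' = x" "b'' \<in> fib A s''" "x \<in> dom_of A b''"
      "d \<in> idem_part A" "d' \<in> idem_part A" "0 < ev A d x" "0 < ev A d' x" "b' \<odot> d = b'' \<odot> d'"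
    by (elim twist_relE) blast
  note [simp] = totalI[OF 1(2)] totalI[OF 1(3)] totalI[OF 2(2)] 1(6,7) 2(4,5) dom_ofD(1)[OF 1(4)]
  have "b \<odot> (c \<odot> d) = (b' \<odot> c') \<odot> d" by (simp add: total_assoc flip: 1(10))
  also have "\<dots> = b' \<odot> (d \<odot> c')" using idem_part_commute[OF 1(7) 2(4)] by (simp add: total_assoc)
  also have "\<dots> = (b'' \<odot> d') \<odot> c'" by (simp add: total_assoc flip: 2(8))
  finally have "b \<odot> (c \<odot> d) = b'' \<odot> (d' \<odot> c')" by (simp add: total_assoc)
  then show ?thesis
    unfolding p 1(1) 2(1) using 1 2
    by (intro twist_relI[where c = "c \<odot> d" and c' = "d' \<odot> c'"]) (auto intro: complex_pos_mult)
qed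

lemma twist_class_eq_iff:
  assumes "b \<in> fib A s" "x \<in> dom_of A b"
  shows "twist_class A b s x = twist_class A b' s' x' \<longleftrightarrow> ((b, s, x), (b', s', x')) \<in> twist_rel A"
proof
  assume "twist_class A b s x = twist_class A b' s' x'"
  moreover have "(b, s, x) \<in> twist_class A b s x"
    using twist_rel_refl[OF assms] by (simp add: twist_class_def)
  ultimately have "(b, s, x) \<in> twist_class A b' s' x'" by simp
  then show "((b, s, x), (b', s', x')) \<in> twist_rel A" by (auto simp: twist_class_def intro: twist_rel_sym)
next
  assume r: "((b, s, x), (b', s', x')) \<in> twist_rel A"
  then show "twist_class A b s x = twist_class A b' s' x'"
    unfolding twist_class_def using twist_rel_trans twist_rel_sym by blast
qed

text \<open>Two elements of one fibre define the same element of the twist at \<open>x\<close> as soon as their quotient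
  is positive there.\<close>

lemma twist_class_eq_same_fibre:
  assumes b: "b \<in> fib A s" "x \<in> dom_of A b" and b': "b' \<in> fib A s" and pos: "0 < ev A (b\<^bold>* \<odot> b') x"
  shows "x \<in> dom_of A b'" "twist_class A b s x = twist_class A b' s x"
proof -
  have t: "b \<in> total A" "b' \<in> total A" using b b' by (auto intro: totalI)
  have "ev A (b'\<^bold>* \<odot> b') x * ev A (b\<^bold>* \<odot> b) x \<noteq> 0"
    using ev_exchange[OF b(1) b' dom_ofD(1)[OF b(2)]] pos by auto
  then show d: "x \<in> dom_of A b'" using dom_ofD(1)[OF b(2)] t by (auto simp: dom_of_iff)
  have "((b, s, x), (b', s, x)) \<in> twist_rel A"
    using b b' d pos dom_ofD(2)[OF b(2)] same_fibre_exchange[OF b(1) b'] t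
    by (intro twist_relI[where c = "b\<^bold>* \<odot> b'" and c' = "b\<^bold>* \<odot> b"]) auto
  then show "twist_class A b s x = twist_class A b' s x" by (simp add: twist_class_eq_iff[OF b])
qed

text \<open>If \<open>ac = a'c'\<close> and \<open>bd = b'd'\<close>, then \<open>ab \<cdot> (b\<^sup>*cb) d (b'\<^sup>*b') = (ac)(bd)(b\<^sup>*b)(b'\<^sup>*b')\<close>, and the right hand side does
  not change when the two pairs are exchanged.\<close>

lemma twist_mul_cong:
  assumes a: "((a, s, theta_elem A b y), (a', s', theta_elem A b y)) \<in> twist_rel A"
    and b: "((b, t, y), (b', t', y)) \<in> twist_rel A"
  shows "theta_elem A b y = theta_elem A b' y"
    and "((a \<odot> b, s * t, y), (a' \<odot> b', s' * t', y)) \<in> twist_rel A"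
proof -
  obtain c c' where 1: "a \<in> fib A s" "a' \<in> fib A s'" "theta_elem A b y \<in> dom_of A a" "theta_elem A b y \<in> dom_of A a'"
      "c \<in> idem_part A" "c' \<in> idem_part A" "0 < ev A c (theta_elem A b y)" "0 < ev A c' (theta_elem A b y)" "a \<odot> c = a' \<odot> c'"
    using a by (rule twist_relE)
  obtain d d' where 2: "b \<in> fib A t" "b' \<in> fib A t'" "y \<in> dom_of A b" "y \<in> dom_of A b'"
      "d \<in> idem_part A" "d' \<in> idem_part A" "0 < ev A d y" "0 < ev A d' y" "b \<odot> d = b' \<odot> d'"
    using b by (rule twist_relE)
  note t [simp] = totalI[OF 1(1)] totalI[OF 1(2)] totalI[OF 2(1)] totalI[OF 2(2)]
  note [simp] = 1(5,6) 2(5,6) dom_ofD(1)[OF 2(3)]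
  have nz: "ev A d y \<noteq> 0" "ev A d' y \<noteq> 0" using 2(7,8) by auto
  show th: "theta_elem A b y = theta_elem A b' y"
    using theta_elem_mul_right(2)[OF t(3) 2(3) 2(5) nz(1)] theta_elem_mul_right(2)[OF t(4) 2(4) 2(6) nz(2)] 2(9)
    by simp
  have key: "(p \<odot> q) \<odot> ((q\<^bold>* \<odot> (u \<odot> q)) \<odot> (v \<odot> w)) = (p \<odot> u) \<odot> ((q \<odot> v) \<odot> ((q\<^bold>* \<odot> q) \<odot> w))"
    if [simp]: "p \<in> total A" "q \<in> total A" "u \<in> idem_part A" "v \<in> idem_part A" "w \<in> idem_part A" for p q u v w
  proof -
    have "(p \<odot> q) \<odot> ((q\<^bold>* \<odot> (u \<odot> q)) \<odot> (v \<odot> w)) = p \<odot> ((q \<odot> q\<^bold>*) \<odot> (u \<odot> (q \<odot> (v \<odot> w))))"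
      by (simp add: total_assoc)
    also have "\<dots> = p \<odot> (u \<odot> ((q \<odot> q\<^bold>*) \<odot> (q \<odot> (v \<odot> w))))"
      by (subst idem_part_left_commute[of "q \<odot> q\<^bold>*"]) simp_all
    also have "\<dots> = p \<odot> (u \<odot> (q \<odot> ((q\<^bold>* \<odot> q) \<odot> (v \<odot> w))))" by (simp add: total_assoc)
    also have "(q\<^bold>* \<odot> q) \<odot> (v \<odot> w) = v \<odot> ((q\<^bold>* \<odot> q) \<odot> w)"
      by (rule idem_part_left_commute) simp_all
    finally show ?thesis by (simp add: total_assoc)
  qed
  let ?C = "(b\<^bold>* \<odot> (c \<odot> b)) \<odot> (d \<odot> (b'\<^bold>* \<odot> b'))" and ?C' = "(b'\<^bold>* \<odot> (c' \<odot> b')) \<odot> (d' \<odot> (b\<^bold>* \<odot> b))"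
  have "(b\<^bold>* \<odot> b) \<odot> (b'\<^bold>* \<odot> b') = (b'\<^bold>* \<odot> b') \<odot> (b\<^bold>* \<odot> b)" by (rule idem_part_commute) simp_all
  then have eq: "(a \<odot> b) \<odot> ?C = (a' \<odot> b') \<odot> ?C'"
    using key[of a b c d "b'\<^bold>* \<odot> b'"] key[of a' b' c' d' "b\<^bold>* \<odot> b"] 1(9) 2(9) by simp
  have p: "0 < ev A (b\<^bold>* \<odot> (c \<odot> b)) y" "0 < ev A (b'\<^bold>* \<odot> (c' \<odot> b')) y"
    using ev_theta[OF t(3) 2(3) 1(5)] ev_theta[OF t(4) 2(4) 1(6)] 1(7,8) dom_ofD(2)[OF 2(3)] dom_ofD(2)[OF 2(4)] th
    by (auto intro: complex_pos_mult)
  show "((a \<odot> b, s * t, y), (a' \<odot> b', s' * t', y)) \<in> twist_rel A"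
  proof (rule twist_relI[OF mul_closed[OF 1(1) 2(1)] mul_closed[OF 1(2) 2(2)], where c = ?C and c' = ?C'])
    show "y \<in> dom_of A (a \<odot> b)" by (rule dom_mul[OF t(1,3) 2(3) 1(3)])
    show "y \<in> dom_of A (a' \<odot> b')" using 1(4) th by (intro dom_mul t 2(4)) simp
    show "0 < ev A ?C y" "0 < ev A ?C' y"
      using p 2(7,8) dom_ofD(2)[OF 2(3)] dom_ofD(2)[OF 2(4)] by (simp_all add: complex_pos_mult)
  qed (use eq in simp_all)
qed

text \<open>If \<open>ac = a'c'\<close>, then \<open>a\<^sup>* \<cdot> (ac\<^sup>*a\<^sup>*)(a'a'\<^sup>*) = (ac)\<^sup>*(aa\<^sup>*)(a'a'\<^sup>*)\<close>, and the right hand side does not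
  change when the two sides are exchanged.\<close>

lemma twist_inv_cong:
  assumes a: "((a, s, y), (a', s', y)) \<in> twist_rel A"
  shows "theta_elem A a y = theta_elem A a' y"
    and "((a\<^bold>*, sinv s, theta_elem A a y), (a'\<^bold>*, sinv s', theta_elem A a y)) \<in> twist_rel A"
proof -
  obtain c c' where 1: "a \<in> fib A s" "a' \<in> fib A s'" "y \<in> dom_of A a" "y \<in> dom_of A a'"
      "c \<in> idem_part A" "c' \<in> idem_part A" "0 < ev A c y" "0 < ev A c' y" "a \<odot> c = a' \<odot> c'"
    using a by (rule twist_relE)
  note t [simp] = totalI[OF 1(1)] totalI[OF 1(2)]
  note [simp] = 1(5,6) dom_ofD(1)[OF 1(3)]
  have nz: "ev A c y \<noteq> 0" "ev A c' y \<noteq> 0" using 1(7,8) by auto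
  show th: "theta_elem A a y = theta_elem A a' y"
    using theta_elem_mul_right(2)[OF t(1) 1(3) 1(5) nz(1)] theta_elem_mul_right(2)[OF t(2) 1(4) 1(6) nz(2)] 1(9)
    by simp
  have z [simp]: "theta_elem A a y \<in> spectrum A" by (rule theta_elem_in[OF t(1) 1(3)])
  have key: "p\<^bold>* \<odot> ((p \<odot> (u\<^bold>* \<odot> p\<^bold>*)) \<odot> w) = (p \<odot> u)\<^bold>* \<odot> ((p \<odot> p\<^bold>*) \<odot> w)"
    if [simp]: "p \<in> total A" "u \<in> idem_part A" "w \<in> idem_part A" for p u w
  proof -
    have "p\<^bold>* \<odot> ((p \<odot> (u\<^bold>* \<odot> p\<^bold>*)) \<odot> w) = (p\<^bold>* \<odot> p) \<odot> (u\<^bold>* \<odot> (p\<^bold>* \<odot> w))" by (simp add: total_assoc)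
    also have "\<dots> = u\<^bold>* \<odot> ((p\<^bold>* \<odot> p) \<odot> (p\<^bold>* \<odot> w))" by (rule idem_part_left_commute) simp_all
    finally show ?thesis by (simp add: total_assoc)
  qed
  have pos: "0 < ev A (p \<odot> (u\<^bold>* \<odot> p\<^bold>*)) (theta_elem A p y)"
    if [simp]: "p \<in> total A" "u \<in> idem_part A" and p: "y \<in> dom_of A p" "0 < ev A u y" for p u
  proof -
    have "ev A (p \<odot> (u\<^bold>* \<odot> p\<^bold>*)) (theta_elem A p y) * ev A (p\<^bold>* \<odot> p) y
        = ev A (p\<^bold>* \<odot> ((p \<odot> (u\<^bold>* \<odot> p\<^bold>*)) \<odot> p)) y"
      by (rule ev_theta[OF that(1) p(1), symmetric]) simp
    also have "p\<^bold>* \<odot> ((p \<odot> (u\<^bold>* \<odot> p\<^bold>*)) \<odot> p) = (p\<^bold>* \<odot> p) \<odot> (u\<^bold>* \<odot> (p\<^bold>* \<odot> p))"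
      by (simp add: total_assoc)
    also have "ev A \<dots> y = ev A (p\<^bold>* \<odot> p) y * (ev A u y * ev A (p\<^bold>* \<odot> p) y)"
      using complex_pos_cnj[OF p(2)] by simp
    finally have "ev A (p \<odot> (u\<^bold>* \<odot> p\<^bold>*)) (theta_elem A p y) * ev A (p\<^bold>* \<odot> p) y
        = ev A (p\<^bold>* \<odot> p) y * (ev A u y * ev A (p\<^bold>* \<odot> p) y)" .
    then have "0 < ev A (p \<odot> (u\<^bold>* \<odot> p\<^bold>*)) (theta_elem A p y) * ev A (p\<^bold>* \<odot> p) y"
      by (metis complex_pos_mult p(2) dom_ofD(2)[OF p(1)])
    then show ?thesis by (rule complex_pos_cancel[OF dom_ofD(2)[OF p(1)]])
  qed
  let ?C = "(a \<odot> (c\<^bold>* \<odot> a\<^bold>*)) \<odot> (a' \<odot> a'\<^bold>*)" and ?C' = "(a' \<odot> (c'\<^bold>* \<odot> a'\<^bold>*)) \<odot> (a \<odot> a\<^bold>*)"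
  have "(a \<odot> a\<^bold>*) \<odot> (a' \<odot> a'\<^bold>*) = (a' \<odot> a'\<^bold>*) \<odot> (a \<odot> a\<^bold>*)" by (rule idem_part_commute) simp_all
  then have eq: "a\<^bold>* \<odot> ?C = a'\<^bold>* \<odot> ?C'"
    using key[of a c "a' \<odot> a'\<^bold>*"] key[of a' c' "a \<odot> a\<^bold>*"] 1(9) by simp
  show "((a\<^bold>*, sinv s, theta_elem A a y), (a'\<^bold>*, sinv s', theta_elem A a y)) \<in> twist_rel A"
  proof (rule twist_relI[OF star_closed[OF 1(1)] star_closed[OF 1(2)], where c = ?C and c' = ?C'])
    show "theta_elem A a y \<in> dom_of A (a\<^bold>*)" "theta_elem A a y \<in> dom_of A (a'\<^bold>*)"
      using theta_elem_dom_star(2)[OF t(1) 1(3)] theta_elem_dom_star(2)[OF t(2) 1(4)] th by simp_all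
    show "0 < ev A ?C (theta_elem A a y)" "0 < ev A ?C' (theta_elem A a y)"
      using pos[OF t(1) 1(5) 1(3) 1(7)] pos[OF t(2) 1(6) 1(4) 1(8)] th z
        theta_elem_dom_star(1)[OF t(1) 1(3)] theta_elem_dom_star(1)[OF t(2) 1(4)]
        dom_ofD(2)[OF 1(3)] dom_ofD(2)[OF 1(4)] by (simp_all add: complex_pos_mult)
  qed (use eq in simp_all)
qed

lemma scale_dom:
  assumes b: "b \<in> fib A s" and z: "z \<noteq> 0" shows "dom_of A (scale A z b) = dom_of A b"
proof -
  have t: "b \<in> total A" "scale A z b \<in> total A" using b by (auto intro: totalI)
  have "(scale A z b)\<^bold>* \<odot> scale A z b = scale A (cnj z * z) (b\<^bold>* \<odot> b)"
    using star_scale[OF b, of z] mul_scale_left[OF star_closed[OF b] scale_in[OF b]]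
      mul_scale_right[OF star_closed[OF b] b] scale_scale[OF mul_closed[OF star_closed[OF b] b]] by simp
  then have "ev A ((scale A z b)\<^bold>* \<odot> scale A z b) y = cnj z * z * ev A (b\<^bold>* \<odot> b) y" if "y \<in> spectrum A" for y
    using that t by simp
  then show ?thesis using z by (auto simp: dom_of_iff t)
qed

end

locale saturated_bundle = semiabelian_bundle +
  assumes saturated: "saturated A"
begin

text \<open>Saturation makes the products \<open>cb\<close> with \<open>c \<in> fib A (sinv s)\<close> and \<open>b \<in> fib A s\<close> span a dense subspace of
  \<open>fib A (sinv s * s)\<close>. If \<open>b\<^sup>*b\<close> vanishes at \<open>x\<close>, then so does \<open>(cb)\<^sup>*(cb) = b\<^sup>*(c\<^sup>*c)b\<close>.\<close>

lemma supp_dom: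
  assumes x: "x \<in> supp A (sinv s * s)" obtains b where "b \<in> fib A s" "x \<in> dom_of A b"
proof (rule ccontr)
  assume neg: "\<not> thesis"
  let ?e = "sinv s * s"
  have xs [simp]: "x \<in> spectrum A" using supp_spectrum[OF x] .
  have "\<And>b. b \<in> fib A s \<Longrightarrow> x \<notin> dom_of A b" using neg that by blast
  then have 0: "ev A (b\<^bold>* \<odot> b) x = 0" if "b \<in> fib A s" for b
    using that dom_of_iff[OF totalI[OF that], of x] by auto
  have "ev A a x = 0" if "a \<in> fib A ?e" for a
  proof (rule functional_closed_fspan[where s = ?e and K = 1 and M = "{mul A a b | a b. a \<in> fib A (sinv s) \<and> b \<in> fib A s}"])
    show "{mul A a b | a b. a \<in> fib A (sinv s) \<and> b \<in> fib A s} \<subseteq> fib A ?e" by (auto intro: mul_closed)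
    show "a \<in> closed_fspan A ?e {mul A a b | a b. a \<in> fib A (sinv s) \<and> b \<in> fib A s}"
      using saturated that by (simp add: saturated_def)
    show "ev A (add A a b) x = ev A a x + ev A b x" if "a \<in> fib A ?e" "b \<in> fib A ?e" for a b
      using that by (intro ev_add) simp_all
    show "ev A (scale A z a) x = z * ev A a x" if "a \<in> fib A ?e" for z a
      using that by (intro ev_scale idem_partI[of ?e]) simp_all
    show "cmod (ev A a x) \<le> 1 * nrm A a" if "a \<in> fib A ?e" for a
      using ev_norm_le[OF xs _ that] by simp
    fix m assume "m \<in> {mul A a b | a b. a \<in> fib A (sinv s) \<and> b \<in> fib A s}"
    then obtain c b where m: "m = c \<odot> b" "c \<in> fib A (sinv s)" "b \<in> fib A s" by blast
    have t [simp]: "c \<in> total A" "b \<in> total A" using m by (auto intro: totalI)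
    have E: "m \<in> idem_part A" using m mul_closed[OF m(2,3)] by (auto intro: idem_partI[of ?e])
    have "m\<^bold>* \<odot> m = b\<^bold>* \<odot> ((c\<^bold>* \<odot> c) \<odot> b)" by (simp add: m total_assoc)
    then have "cnj (ev A m x) * ev A m x = 0"
      using ev_conj_zero[OF xs t(2) _ 0[OF m(3)], of "c\<^bold>* \<odot> c"] ev_mul[OF xs idem_part_star[OF E] E] E by simp
    then show "ev A m x = 0" by simp
  qed
  then show False using x by (auto simp: supp_def)
qed

end


section \<open>Refinements\<close>

lemma refinement_semi_abelian:
  fixes A :: "('s :: inverse_semigroup, 'a) fell" and B :: "('t :: inverse_semigroup, 'b) fell"
  assumes B: "fell_bundle B" and A: "semi_abelian A" and ref: "refinement B A"
  shows "semi_abelian B"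
proof -
  obtain \<phi> \<psi> where m: "fell_morphism B A \<phi> \<psi>" and inj: "\<And>t. inj_on \<psi> (fib B t)"
    using ref by (auto simp: refinement_def)
  have hom: "\<And>t t'. \<phi> (t * t') = \<phi> t * \<phi> t'" and fib: "\<And>t a. a \<in> fib B t \<Longrightarrow> \<psi> a \<in> fib A (\<phi> t)"
    and mul: "\<And>t t' a b. a \<in> fib B t \<Longrightarrow> b \<in> fib B t' \<Longrightarrow> \<psi> (mul B a b) = mul A (\<psi> a) (\<psi> b)"
    using m by (auto simp: fell_morphism_def)
  show ?thesis
    unfolding semi_abelian_def
  proof (intro allI impI ballI)
    fix e a b assume e: "idem e" and a: "a \<in> fib B e" and b: "b \<in> fib B e"
    have "idem (\<phi> e)" by (rule hom_idem[OF hom e])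
    then have "\<psi> (mul B a b) = \<psi> (mul B b a)"
      using A a b by (simp add: mul fib semi_abelian_def)
    then show "mul B a b = mul B b a"
      using inj_onD[OF inj[of e]] fell_bundle.mul_in_idem[OF B e a b] fell_bundle.mul_in_idem[OF B e b a]
      by blast
  qed
qed

locale bundle_refinement = A: saturated_bundle A + B: saturated_bundle B
  for A :: "('s :: inverse_semigroup, 'a) fell" and B :: "('t :: inverse_semigroup, 'b) fell" +
  fixes \<phi> :: "'t \<Rightarrow> 's" and \<psi> :: "'b \<Rightarrow> 'a"
  assumes morphism: "fell_morphism B A \<phi> \<psi>"
    and ess_inj: "idem (\<phi> t) \<Longrightarrow> idem t"
    and inj: "inj_on \<psi> (fib B t)"
    and dense: "fib A s = closed_fspan A s (\<Union>t\<in>\<phi> -` {s}. \<psi> ` fib B t)"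
begin

lemma phi_mult: "\<phi> (t * t') = \<phi> t * \<phi> t'"
  and psi_fib: "a \<in> fib B t \<Longrightarrow> \<psi> a \<in> fib A (\<phi> t)"
  and psi_add: "a \<in> fib B t \<Longrightarrow> b \<in> fib B t \<Longrightarrow> \<psi> (add B a b) = add A (\<psi> a) (\<psi> b)"
  and psi_scale: "a \<in> fib B t \<Longrightarrow> \<psi> (scale B z a) = scale A z (\<psi> a)"
  and psi_mul: "a \<in> fib B t \<Longrightarrow> b \<in> fib B t' \<Longrightarrow> \<psi> (mul B a b) = mul A (\<psi> a) (\<psi> b)"
  and psi_star: "a \<in> fib B t \<Longrightarrow> \<psi> (star B a) = star A (\<psi> a)"
  and psi_incl: "natural_le t t' \<Longrightarrow> a \<in> fib B t \<Longrightarrow> \<psi> (incl B t' t a) = incl A (\<phi> t') (\<phi> t) (\<psi> a)"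
  using morphism by (simp_all add: fell_morphism_def)

lemma phi_sinv: "\<phi> (sinv t) = sinv (\<phi> t)"
  by (rule hom_sinv) (rule phi_mult)

lemma phi_idem: "idem t \<Longrightarrow> idem (\<phi> t)"
  by (rule hom_idem) (rule phi_mult)

lemma psi_idem_part [simp]: "a \<in> idem_part B \<Longrightarrow> \<psi> a \<in> idem_part A"
  by (auto simp: idem_part_def intro: phi_idem psi_fib)

lemma psi_total [simp]: "a \<in> total B \<Longrightarrow> \<psi> a \<in> total A"
  by (auto simp: total_def intro: psi_fib)

lemma psi_total_mul: "a \<in> total B \<Longrightarrow> b \<in> total B \<Longrightarrow> \<psi> (mul B a b) = mul A (\<psi> a) (\<psi> b)"
  by (auto simp: total_def psi_mul)

lemma psi_total_star: "a \<in> total B \<Longrightarrow> \<psi> (star B a) = star A (\<psi> a)"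
  by (auto simp: total_def psi_star)

lemma dense_functional:
  fixes \<Lambda> :: "'a \<Rightarrow> complex"
  assumes "\<And>a b. a \<in> fib A s \<Longrightarrow> b \<in> fib A s \<Longrightarrow> \<Lambda> (add A a b) = \<Lambda> a + \<Lambda> b"
    and "\<And>z a. a \<in> fib A s \<Longrightarrow> \<Lambda> (scale A z a) = z * \<Lambda> a"
    and "\<And>a. a \<in> fib A s \<Longrightarrow> cmod (\<Lambda> a) \<le> K * nrm A a"
    and 0: "\<And>t b. \<phi> t = s \<Longrightarrow> b \<in> fib B t \<Longrightarrow> \<Lambda> (\<psi> b) = 0"
    and a: "a \<in> fib A s"
  shows "\<Lambda> a = 0"
  by (rule A.functional_closed_fspan[OF _ assms(1-3), where M = "\<Union>t\<in>\<phi> -` {s}. \<psi> ` fib B t" and a = a])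
    (use 0 a dense[of s] psi_fib in auto)

lemma psi_isometric: "idem f \<Longrightarrow> b \<in> fib B f \<Longrightarrow> nrm A (\<psi> b) = nrm B b"
  by (rule fibre_hom_isometric[OF B.comm_fibre A.comm_fibre, of f "\<phi> f"])
    (auto intro: phi_idem psi_fib psi_add psi_scale psi_mul psi_star inj)

lemma psi_fdist:
  assumes f: "idem f" and b: "b \<in> fib B f" "b' \<in> fib B f"
  shows "fdist A (\<psi> b) (\<psi> b') = fdist B b b'"
proof -
  have "\<psi> (add B b (scale B (-1) b')) = add A (\<psi> b) (scale A (-1) (\<psi> b'))"
    using psi_add[OF b(1) B.scale_in[OF b(2)]] psi_scale[OF b(2)] by simp
  then show ?thesis
    using psi_isometric[OF f B.add_in[OF b(1) B.scale_in[OF b(2)]], of "-1"] by (simp add: fdist_def)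
qed

lemma psi_zero: "\<psi> (zero B t) = zero A (\<phi> t)"
  using psi_scale[OF B.zero_in, of 0 t] B.scale_zero[OF B.zero_in, of t]
    A.scale_zero[OF psi_fib[OF B.zero_in], of t] by simp

subsection \<open>Extension of points\<close>

text \<open>The product of \<open>a\<close> and \<open>\<psi> b\<^sub>0\<close>, moved to the fibre over \<open>\<phi> f\<close> by an inclusion map. It lies in
  \<open>\<psi>(fib B f)\<close>: clearly so for \<open>a \<in> \<psi>(fib B t)\<close>, where \<open>t\<close> is idempotent by essential injectivity if
  \<open>\<phi> t = e\<close>; these \<open>a\<close> span a dense subspace, and \<open>\<psi>(fib B f)\<close> is closed because \<open>\<psi>\<close> is isometric
  on \<open>fib B f\<close>.\<close>

definition cut :: "'t \<Rightarrow> 'b \<Rightarrow> 's \<Rightarrow> 'a \<Rightarrow> 'a" where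
  "cut f b0 e a = incl A (\<phi> f) (e * \<phi> f) (mul A a (\<psi> b0))"

context
  fixes f :: 't and b0 :: 'b
  assumes f: "idem f" and b0: "b0 \<in> fib B f"
begin

lemma cut_le: "idem e \<Longrightarrow> natural_le (e * \<phi> f) (\<phi> f)"
  by (intro natural_le_idem phi_idem f)

lemma cut_simps:
  assumes e: "idem e" and a: "a \<in> fib A e" and a': "a' \<in> fib A e"
  shows "cut f b0 e a \<in> fib A (\<phi> f)"
    "cut f b0 e (add A a a') = add A (cut f b0 e a) (cut f b0 e a')"
    "cut f b0 e (scale A z a) = scale A z (cut f b0 e a)"
    "fdist A (cut f b0 e a) (cut f b0 e a') \<le> fdist A a a' * nrm B b0"
proof -
  note le = cut_le[OF e] and p = psi_fib[OF b0]
  note m = A.mul_closed[OF a p] A.mul_closed[OF a' p]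
  show "cut f b0 e a \<in> fib A (\<phi> f)" unfolding cut_def by (rule A.incl_closed[OF le m(1)])
  show "cut f b0 e (add A a a') = add A (cut f b0 e a) (cut f b0 e a')"
    unfolding cut_def A.mul_add_left[OF a a' p] by (rule A.incl_add[OF le m])
  show "cut f b0 e (scale A z a) = scale A z (cut f b0 e a)"
    unfolding cut_def A.mul_scale_left[OF a p] by (rule A.incl_scale[OF le m(1)])
  show "fdist A (cut f b0 e a) (cut f b0 e a') \<le> fdist A a a' * nrm B b0"
    unfolding cut_def A.fdist_incl[OF le m] psi_isometric[OF f b0, symmetric]
    by (rule A.fdist_mul_left[OF a a' p])
qed

lemma cut_psi:
  assumes t: "idem t" and b: "b \<in> fib B t"
  shows "incl B f (t * f) (mul B b b0) \<in> fib B f"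
    "\<psi> (incl B f (t * f) (mul B b b0)) = cut f b0 (\<phi> t) (\<psi> b)"
proof -
  note le = natural_le_idem[OF t f]
  show "incl B f (t * f) (mul B b b0) \<in> fib B f" by (rule B.incl_closed[OF le B.mul_closed[OF b b0]])
  show "\<psi> (incl B f (t * f) (mul B b b0)) = cut f b0 (\<phi> t) (\<psi> b)"
    unfolding cut_def psi_incl[OF le B.mul_closed[OF b b0]] psi_mul[OF b b0] phi_mult ..
qed

lemma cut_in_image:
  assumes e: "idem e" and a: "a \<in> fib A e"
  obtains b where "b \<in> fib B f" "\<psi> b = cut f b0 e a"
proof -
  let ?M = "\<Union>t\<in>\<phi> -` {e}. \<psi> ` fib B t"
  have M: "?M \<subseteq> fib A e" using psi_fib by auto
  have span: "\<exists>b\<in>fib B f. \<psi> b = cut f b0 e y" if "y \<in> fspan A e ?M" for y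
    using that
  proof (induction rule: fspan.induct)
    case zero
    have "cut f b0 e (zero A e) = scale A 0 (cut f b0 e (zero A e))"
      using cut_simps(3)[OF e A.zero_in A.zero_in, of 0] by (simp add: A.scale_zero[OF A.zero_in])
    then have "cut f b0 e (zero A e) = \<psi> (zero B f)"
      using A.scale_zero[OF cut_simps(1)[OF e A.zero_in A.zero_in]] by (simp add: psi_zero)
    then show ?case using B.zero_in by metis
  next
    case (step m y z)
    then obtain t c where t: "\<phi> t = e" and c: "c \<in> fib B t" "m = \<psi> c" by auto
    have ti: "idem t" using ess_inj e t by simp
    obtain b where b: "b \<in> fib B f" "\<psi> b = cut f b0 e y" using step by blast
    have m: "m \<in> fib A e" and y: "y \<in> fib A e" using M step(1) A.fspan_fib[OF step(2) M] by auto
    let ?c = "incl B f (t * f) (mul B c b0)"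
    have "\<psi> (add B (scale B z ?c) b) = cut f b0 e (add A (scale A z m) y)"
      using cut_psi[OF ti c(1)] psi_add[OF B.scale_in[OF cut_psi(1)[OF ti c(1)]] b(1)]
        psi_scale[OF cut_psi(1)[OF ti c(1)]] cut_simps(2)[OF e A.scale_in[OF m] y] cut_simps(3)[OF e m m]
      by (simp add: b t c(2))
    then show ?case using B.add_in[OF B.scale_in[OF cut_psi(1)[OF ti c(1)]] b(1)] by blast
  qed
  have "\<exists>y. y \<in> fspan A e ?M \<and> fdist A a y < inverse (real (Suc n))" for n
  proof -
    have "a \<in> closed_fspan A e ?M" using a dense[of e] by simp
    moreover have "0 < inverse (real (Suc n))" by simp
    ultimately show ?thesis unfolding closed_fspan_def by blast
  qed
  then obtain y where y: "\<And>n. y n \<in> fspan A e ?M" "\<And>n. fdist A a (y n) < inverse (real (Suc n))" by metis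
  have yF: "y n \<in> fib A e" for n by (rule A.fspan_fib[OF y(1) M])
  obtain b where b: "\<And>n. b n \<in> fib B f" "\<And>n. \<psi> (b n) = cut f b0 e (y n)"
    using span[OF y(1)] by metis
  let ?K = "nrm B b0"
  have K: "0 \<le> ?K" by (rule B.nrm_nonneg[OF b0])
  have near: "fdist A (cut f b0 e (y n)) (cut f b0 e a) \<le> inverse (real (Suc n)) * ?K" for n
    using cut_simps(4)[OF e yF a, of n] mult_right_mono[OF less_imp_le[OF y(2)[of n]] K]
      A.fdist_commute[OF a yF, of n] by simp
  have lim0: "(\<lambda>n. inverse (real (Suc n)) * ?K) \<longlonglongrightarrow> 0"
    using tendsto_mult[OF LIMSEQ_inverse_real_of_nat tendsto_const, of ?K] by simp
  note cF = cut_simps(1)[OF e yF yF] and caF = cut_simps(1)[OF e a a]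
  have "\<exists>N. \<forall>m\<ge>N. \<forall>n\<ge>N. fdist B (b m) (b n) < \<epsilon>" if eps: "\<epsilon> > 0" for \<epsilon>
  proof -
    obtain N where N: "\<And>n. n \<ge> N \<Longrightarrow> inverse (real (Suc n)) * ?K < \<epsilon> / 2"
      using order_tendstoD(2)[OF lim0, of "\<epsilon> / 2"] eps by (auto simp: eventually_sequentially)
    have "fdist B (b m) (b n) < \<epsilon>" if "m \<ge> N" "n \<ge> N" for m n
      using A.fdist_triangle[OF cF[of m] caF cF[of n]] near[of m] near[of n] N[OF that(1)] N[OF that(2)]
        A.fdist_commute[OF caF cF, of n] psi_fdist[OF f b(1) b(1), of m n] b(2) by simp
    then show ?thesis by blast
  qed
  then obtain l where l: "l \<in> fib B f" "(\<lambda>n. fdist B (b n) l) \<longlonglongrightarrow> 0"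
    using B.fibre_complete[of b f, OF b(1)] by metis
  have "fdist A (\<psi> l) (cut f b0 e a) \<le> fdist B (b n) l + inverse (real (Suc n)) * ?K" for n
    using A.fdist_triangle[OF psi_fib[OF l(1)] cF[of n] caF] near[of n] psi_fdist[OF f l(1) b(1), of n]
      B.fdist_commute[OF l(1) b(1), of n] b(2) by simp
  moreover have "(\<lambda>n. fdist B (b n) l + inverse (real (Suc n)) * ?K) \<longlonglongrightarrow> 0 + 0"
    by (intro tendsto_add l(2) lim0)
  ultimately have "fdist A (\<psi> l) (cut f b0 e a) \<le> 0 + 0" by (intro LIMSEQ_le_const) auto
  then have "\<psi> l = cut f b0 e a"
    using A.fdist_nonneg[OF psi_fib[OF l(1)] caF] A.fdist_eq_0[OF psi_fib[OF l(1)] caF] by simp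
  then show ?thesis using that l(1) by blast
qed

end

text \<open>A point \<open>x\<close> with \<open>b\<^sub>0(x) \<noteq> 0\<close> is therefore extended to \<open>A\<close> by \<open>a \<mapsto> (a b\<^sub>0)(x) / b\<^sub>0(x)\<close>.\<close>

lemma extend_point:
  assumes x: "x \<in> spectrum B"
  obtains y where "y \<in> spectrum A" "\<And>b. b \<in> idem_part B \<Longrightarrow> ev A (\<psi> b) y = ev B b x"
proof -
  obtain b0 where b0E: "b0 \<in> idem_part B" and nz: "ev B b0 x \<noteq> 0" by (rule B.ev_nonzero[OF x])
  obtain f where f: "idem f" and b0: "b0 \<in> fib B f" using b0E by (auto simp: idem_part_def)
  define u where "u = \<phi> f"
  have u: "idem u" "u * u = u" using phi_idem[OF f] by (simp_all add: u_def idem_def)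
  \<comment> \<open>\<open>\<psi> (\<beta> a)\<close> is the product of \<open>a\<close> and \<open>\<psi> b0\<close>; the idempotent \<open>e\<close> is determined by \<open>a\<close>, since the fibres are disjoint.\<close>
  define \<beta> where "\<beta> a = (SOME b. b \<in> fib B f \<and> (\<exists>e. idem e \<and> a \<in> fib A e \<and> \<psi> b = cut f b0 e a))" for a
  define \<kappa> where "\<kappa> a = ev B (\<beta> a) x / ev B b0 x" for a
  have beta: "\<beta> a \<in> fib B f" "\<psi> (\<beta> a) = cut f b0 e a" if e: "idem e" and a: "a \<in> fib A e" for e a
  proof -
    obtain b where b: "b \<in> fib B f" "\<psi> b = cut f b0 e a" using cut_in_image[OF f b0 e a] .
    have ex: "\<exists>b. b \<in> fib B f \<and> (\<exists>e. idem e \<and> a \<in> fib A e \<and> \<psi> b = cut f b0 e a)"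
      using b e a by blast
    have "\<beta> a \<in> fib B f \<and> (\<exists>e. idem e \<and> a \<in> fib A e \<and> \<psi> (\<beta> a) = cut f b0 e a)"
      unfolding \<beta>_def by (rule someI_ex[OF ex])
    then obtain e' where e': "\<beta> a \<in> fib B f" "a \<in> fib A e'" "\<psi> (\<beta> a) = cut f b0 e' a" by blast
    have "e' = e" using A.disjoint[of e' e] a e'(2) by blast
    then show "\<beta> a \<in> fib B f" "\<psi> (\<beta> a) = cut f b0 e a" using e' by simp_all
  qed
  have kappa: "\<kappa> a = ev B b x / ev B b0 x"
    if "idem e" "a \<in> fib A e" "b \<in> fib B f" "\<psi> b = cut f b0 e a" for e a b
  proof -
    have "\<beta> a = b" using beta[OF that(1,2)] that(3,4) inj_onD[OF inj[of f]] by metis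
    then show ?thesis by (simp add: \<kappa>_def)
  qed
  have kpsi: "\<kappa> (\<psi> b) = ev B b x" if b: "b \<in> idem_part B" for b
  proof -
    obtain t where t: "idem t" "b \<in> fib B t" using b by (auto simp: idem_part_def)
    have "\<kappa> (\<psi> b) = ev B (incl B f (t * f) (mul B b b0)) x / ev B b0 x"
      by (rule kappa[OF phi_idem[OF t(1)] psi_fib[OF t(2)] cut_psi[OF f b0 t]])
    also have "ev B (incl B f (t * f) (mul B b b0)) x = ev B b x * ev B b0 x"
      using B.ev_incl[OF idem_mult[OF t(1) f] f natural_le_idem[OF t(1) f] B.mul_closed[OF t(2) b0]]
        x b b0E by simp
    finally show ?thesis using nz by simp
  qed
  have ch: "A.is_char \<kappa>"
    unfolding A.is_char_def
  proof (intro conjI allI impI ballI)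
    show "\<kappa> (add A a a') = \<kappa> a + \<kappa> a'" if e: "idem e" and a: "a \<in> fib A e" and a': "a' \<in> fib A e" for e a a'
    proof -
      have "\<psi> (add B (\<beta> a) (\<beta> a')) = cut f b0 e (add A a a')"
        using psi_add[OF beta(1)[OF e a] beta(1)[OF e a']] cut_simps(2)[OF f b0 e a a'] beta(2)[OF e a]
          beta(2)[OF e a'] by simp
      then have "\<kappa> (add A a a') = ev B (add B (\<beta> a) (\<beta> a')) x / ev B b0 x"
        by (rule kappa[OF e A.add_in[OF a a'] B.add_in[OF beta(1)[OF e a] beta(1)[OF e a']]])
      then show ?thesis
        using B.ev_add[OF x f beta(1)[OF e a] beta(1)[OF e a']] by (simp add: \<kappa>_def add_divide_distrib)
    qed
    show "\<kappa> (scale A z a) = z * \<kappa> a" if aE: "a \<in> idem_part A" for z a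
    proof -
      obtain e where e: "idem e" and a: "a \<in> fib A e" using aE by (auto simp: idem_part_def)
      have "\<psi> (scale B z (\<beta> a)) = cut f b0 e (scale A z a)"
        using psi_scale[OF beta(1)[OF e a]] cut_simps(3)[OF f b0 e a a] beta(2)[OF e a] by simp
      then have "\<kappa> (scale A z a) = ev B (scale B z (\<beta> a)) x / ev B b0 x"
        by (rule kappa[OF e A.scale_in[OF a] B.scale_in[OF beta(1)[OF e a]]])
      then show ?thesis
        using B.ev_scale[OF x B.idem_partI[OF f beta(1)[OF e a]]] by (simp add: \<kappa>_def)
    qed
    show "\<kappa> (mul A a a') = \<kappa> a * \<kappa> a'" if aE: "a \<in> idem_part A" and aE': "a' \<in> idem_part A" for a a'
    proof -
      obtain e where e: "idem e" and a: "a \<in> fib A e" using aE by (auto simp: idem_part_def)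
      obtain e' where e': "idem e'" and a': "a' \<in> fib A e'" using aE' by (auto simp: idem_part_def)
      have ee: "idem (e * e')" by (rule idem_mult[OF e e'])
      have aa: "mul A a a' \<in> fib A (e * e')" by (rule A.mul_closed[OF a a'])
      let ?p = "\<psi> b0"
      have p: "?p \<in> fib A u" and pE: "?p \<in> idem_part A" using psi_fib[OF b0] b0E by (simp_all add: u_def)
      note le = cut_le[OF f b0, folded u_def]
      have s: "e * u * (e' * u) = e * e' * u * u"
        using idem_commute[OF u(1) e'] by (metis mult.assoc)
      have "\<psi> (mul B (\<beta> a) (\<beta> a')) = mul A (cut f b0 e a) (cut f b0 e' a')"
        using psi_mul[OF beta(1)[OF e a] beta(1)[OF e' a']] beta(2)[OF e a] beta(2)[OF e' a'] by simp
      also have "\<dots> = incl A (u * u) (e * u * (e' * u)) (mul A (mul A a ?p) (mul A a' ?p))"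
        unfolding cut_def u_def[symmetric]
        by (rule A.incl_mul[OF le[OF e] le[OF e'] A.mul_closed[OF a p] A.mul_closed[OF a' p]])
      also have "mul A (mul A a ?p) (mul A a' ?p) = mul A (mul A (mul A a a') ?p) ?p"
        using aE aE' pE A.idem_part_left_commute[OF pE aE', of ?p] by (simp add: A.total_assoc)
      also have "incl A (u * u) (e * u * (e' * u)) \<dots> = mul A (cut f b0 (e * e') (mul A a a')) ?p"
        unfolding cut_def u_def[symmetric] s
        using A.incl_mul[OF le[OF ee] natural_le_refl[of u] A.mul_closed[OF aa p] p] by (simp add: A.incl_self[OF p])
      also have "\<dots> = \<psi> (mul B (\<beta> (mul A a a')) b0)"
        using psi_mul[OF beta(1)[OF ee aa] b0] beta(2)[OF ee aa] by simp
      finally have "mul B (\<beta> a) (\<beta> a') = mul B (\<beta> (mul A a a')) b0"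
        by (rule inj_onD[OF inj[of f]])
          (intro B.mul_in_idem[OF f] beta(1)[OF e a] beta(1)[OF e' a'] beta(1)[OF ee aa] b0)+
      then have "ev B (\<beta> a) x * ev B (\<beta> a') x = ev B (\<beta> (mul A a a')) x * ev B b0 x"
        using B.ev_mul[OF x B.idem_partI[OF f beta(1)[OF e a]] B.idem_partI[OF f beta(1)[OF e' a']]]
          B.ev_mul[OF x B.idem_partI[OF f beta(1)[OF ee aa]] b0E] by simp
      then show ?thesis using nz by (simp add: \<kappa>_def field_simps)
    qed
    show "\<kappa> (incl A e' e a) = \<kappa> a" if e: "idem e" "idem e'" "natural_le e e'" and a: "a \<in> fib A e" for e e' a
    proof -
      have "natural_le (u * (e * u)) (u * (e' * u))"
        using A.conj_natural_le[OF e, of u] sinv_idem[OF u(1)] by simp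
      moreover have "u * (e * u) = e * u" "u * (e' * u) = e' * u"
        using idem_commute[OF u(1) e(1)] idem_commute[OF u(1) e(2)] u(2) by (metis mult.assoc)+
      ultimately have le: "natural_le (e * u) (e' * u)" by simp
      have p: "\<psi> b0 \<in> fib A u" using psi_fib[OF b0] by (simp add: u_def)
      have "mul A (incl A e' e a) (\<psi> b0) = incl A (e' * u) (e * u) (mul A a (\<psi> b0))"
        using A.incl_mul[OF e(3) natural_le_refl[of u] a p] by (simp add: A.incl_self[OF p])
      then have "cut f b0 e' (incl A e' e a) = cut f b0 e a"
        unfolding cut_def u_def[symmetric]
        using A.incl_incl[OF le cut_le[OF f b0 e(2), folded u_def] A.mul_closed[OF a p]] by simp
      then have "\<psi> (\<beta> a) = cut f b0 e' (incl A e' e a)" using beta(2)[OF e(1) a] by simp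
      then have "\<kappa> (incl A e' e a) = ev B (\<beta> a) x / ev B b0 x"
        by (rule kappa[OF e(2) A.incl_closed[OF e(3) a] beta(1)[OF e(1) a]])
      then show ?thesis by (simp add: \<kappa>_def)
    qed
    show "\<exists>a\<in>idem_part A. \<kappa> a \<noteq> 0" using kpsi[OF b0E] nz b0E by (intro bexI[of _ "\<psi> b0"]) auto
  qed
  obtain y where "y \<in> spectrum A" "\<And>a. a \<in> idem_part A \<Longrightarrow> ev A a y = \<kappa> a"
    using A.spectrum_of_char[OF ch] by blast
  then show ?thesis using that kpsi psi_idem_part by metis
qed

lemma supp_lift:
  assumes e: "idem e" and y: "y \<in> supp A e"
  obtains f b where "\<phi> f = e" "idem f" "b \<in> fib B f" "ev A (\<psi> b) y \<noteq> 0"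
proof (rule ccontr)
  assume neg: "\<not> thesis"
  have ys: "y \<in> spectrum A" by (rule A.supp_spectrum[OF y])
  have "ev A a y = 0" if "a \<in> fib A e" for a
  proof (rule dense_functional[where s = e and K = 1])
    show "ev A (\<psi> b) y = 0" if "\<phi> t = e" "b \<in> fib B t" for t b
      using neg \<open>\<And>f b. \<lbrakk>\<phi> f = e; idem f; b \<in> fib B f; ev A (\<psi> b) y \<noteq> 0\<rbrakk> \<Longrightarrow> thesis\<close> that ess_inj e by blast
  qed (use that e ys A.ev_norm_le[OF ys e] in \<open>auto simp: A.ev_add A.idem_partI\<close>)
  then show False using y by (auto simp: supp_def)
qed

lemma point_eqI:
  assumes y: "y \<in> spectrum A" and z: "z \<in> spectrum A"
    and eq: "\<And>b. b \<in> idem_part B \<Longrightarrow> ev A (\<psi> b) y = ev A (\<psi> b) z"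
  shows "y = z"
proof (rule A.spectrum_eqI[OF y z])
  fix a assume "a \<in> idem_part A"
  then obtain e where e: "idem e" "a \<in> fib A e" by (auto simp: idem_part_def)
  have "ev A a y - ev A a z = 0"
  proof (rule dense_functional[where s = e and K = 2 and \<Lambda> = "\<lambda>a. ev A a y - ev A a z"])
    show "ev A (\<psi> b) y - ev A (\<psi> b) z = 0" if "\<phi> t = e" "b \<in> fib B t" for t b
      using eq[of b] that ess_inj[of t] e(1) B.idem_partI[of t b] by simp
    show "cmod (ev A a y - ev A a z) \<le> 2 * nrm A a" if "a \<in> fib A e" for a
      using norm_triangle_ineq4[of "ev A a y" "ev A a z"] A.ev_norm_le[OF y e(1) that] A.ev_norm_le[OF z e(1) that]
      by simp
  qed (use e y z in \<open>auto simp: A.ev_add A.idem_partI algebra_simps\<close>)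
  then show "ev A a y = ev A a z" by simp
qed

text \<open>The inverse of the restriction \<open>y \<mapsto> y \<circ> \<psi>\<close> of characters.\<close>

definition point_map :: "'b point \<Rightarrow> 'a point" where
  "point_map x = (THE y. y \<in> spectrum A \<and> (\<forall>b\<in>idem_part B. ev A (\<psi> b) y = ev B b x))"

lemma point_map_props:
  assumes x: "x \<in> spectrum B"
  shows "point_map x \<in> spectrum A \<and> (\<forall>b\<in>idem_part B. ev A (\<psi> b) (point_map x) = ev B b x)"
  unfolding point_map_def
proof (rule theI'[where P = "\<lambda>y. y \<in> spectrum A \<and> (\<forall>b\<in>idem_part B. ev A (\<psi> b) y = ev B b x)"])
  obtain y where y: "y \<in> spectrum A" "\<And>b. b \<in> idem_part B \<Longrightarrow> ev A (\<psi> b) y = ev B b x"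
    by (rule extend_point[OF x]) blast
  show "\<exists>!y. y \<in> spectrum A \<and> (\<forall>b\<in>idem_part B. ev A (\<psi> b) y = ev B b x)"
    using y by (intro ex1I[of _ y]) (auto intro: point_eqI)
qed

lemma point_map_in [simp]: "x \<in> spectrum B \<Longrightarrow> point_map x \<in> spectrum A"
  and ev_point_map [simp]: "x \<in> spectrum B \<Longrightarrow> b \<in> idem_part B \<Longrightarrow> ev A (\<psi> b) (point_map x) = ev B b x"
  using point_map_props by auto

lemma point_map_eqI:
  "x \<in> spectrum B \<Longrightarrow> y \<in> spectrum A \<Longrightarrow> (\<And>b. b \<in> idem_part B \<Longrightarrow> ev A (\<psi> b) y = ev B b x) \<Longrightarrow> point_map x = y"
  by (rule point_eqI) auto

lemma point_map_inj: "x \<in> spectrum B \<Longrightarrow> x' \<in> spectrum B \<Longrightarrow> point_map x = point_map x' \<Longrightarrow> x = x'"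
  by (rule B.spectrum_eqI) (auto simp flip: ev_point_map)

lemma point_map_surj:
  assumes y: "y \<in> spectrum A" obtains x where "x \<in> spectrum B" "y = point_map x"
proof -
  obtain a where a: "a \<in> idem_part A" "ev A a y \<noteq> 0" by (rule A.ev_nonzero[OF y])
  obtain e where e: "idem e" "y \<in> supp A e" using A.ev_nz_supp[OF a(1) y a(2)] by blast
  obtain f b where b: "idem f" "b \<in> fib B f" "ev A (\<psi> b) y \<noteq> 0" by (rule supp_lift[OF e]) blast
  have ch: "B.is_char (\<lambda>b. ev A (\<psi> b) y)"
    unfolding B.is_char_def
  proof (intro conjI allI impI ballI)
    show "\<exists>b\<in>idem_part B. ev A (\<psi> b) y \<noteq> 0" using b B.idem_partI by blast
    show "ev A (\<psi> (add B a b)) y = ev A (\<psi> a) y + ev A (\<psi> b) y"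
      if "idem e" "a \<in> fib B e" "b \<in> fib B e" for e a b
      using A.ev_add[OF y phi_idem[OF that(1)] psi_fib[OF that(2)] psi_fib[OF that(3)]] psi_add[OF that(2,3)] by simp
    show "ev A (\<psi> (scale B z a)) y = z * ev A (\<psi> a) y" if a: "a \<in> idem_part B" for z a
      using A.ev_scale[OF y psi_idem_part[OF a]] a psi_scale by (auto elim: B.idem_partE)
    show "ev A (\<psi> (mul B a b)) y = ev A (\<psi> a) y * ev A (\<psi> b) y"
      if "a \<in> idem_part B" "b \<in> idem_part B" for a b
      using that y by (simp add: psi_total_mul)
    show "ev A (\<psi> (incl B f e a)) y = ev A (\<psi> a) y"
      if "idem e" "idem f" "natural_le e f" "a \<in> fib B e" for e f a
    proof -
      have "natural_le (\<phi> e) (\<phi> f)"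
        using that(3) unfolding natural_le_def by (metis phi_mult phi_sinv)
      then show ?thesis
        using A.ev_incl[OF phi_idem[OF that(1)] phi_idem[OF that(2)] _ psi_fib[OF that(4)]]
          psi_incl[OF that(3,4)] by simp
    qed
  qed
  obtain x where x: "x \<in> spectrum B" "\<And>b. b \<in> idem_part B \<Longrightarrow> ev B b x = ev A (\<psi> b) y"
    using B.spectrum_of_char[OF ch] by blast
  then show ?thesis using that point_map_eqI[OF x(1) y] by metis
qed

lemma point_map_image: "point_map ` spectrum B = spectrum A"
  using point_map_surj by auto

text \<open>For \<open>a\<close> over an idempotent, the function \<open>x \<mapsto> a(point_map x)\<close> is a uniform limit of linear
  combinations of functions \<open>x \<mapsto> b(x)\<close>, by density.\<close>

lemma point_map_homeomorphic: "homeomorphic_map (spectrum_top B) (spectrum_top A) point_map"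
proof -
  define g where "g = inv_into (spectrum B) point_map"
  have inj_on: "inj_on point_map (spectrum B)" by (auto intro: inj_onI point_map_inj)
  have g: "g y \<in> spectrum B" "point_map (g y) = y" if "y \<in> spectrum A" for y
    using that inv_into_into[of y point_map "spectrum B"] f_inv_into_f[of y point_map "spectrum B"]
    by (simp_all add: g_def point_map_image)
  have gp: "g (point_map x) = x" if "x \<in> spectrum B" for x
    using that inj_on by (simp add: g_def)
  have 1: "continuous_map (spectrum_top B) (spectrum_top A) point_map"
  proof (rule A.continuous_map_spectrumI)
    show "point_map \<in> topspace (spectrum_top B) \<rightarrow> spectrum A" by simp
    fix a assume "a \<in> idem_part A"
    then obtain e where e: "idem e" and a: "a \<in> fib A e" by (auto simp: idem_part_def)
    let ?M = "\<Union>t\<in>\<phi> -` {e}. \<psi> ` fib B t"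
    have M: "?M \<subseteq> fib A e" using psi_fib by auto
    have span: "continuous_map (spectrum_top B) euclidean (\<lambda>z. ev A y (point_map z))"
      if "y \<in> fspan A e ?M" for y
      using that
    proof (induction rule: fspan.induct)
      case zero
      have "ev A (zero A e) (point_map z) = 0" if "z \<in> spectrum B" for z
        using A.ev_scale[OF point_map_in[OF that] A.idem_partI[OF e A.zero_in], of 0]
        by (simp add: A.scale_zero[OF A.zero_in])
      moreover have "continuous_map (spectrum_top B) euclidean (\<lambda>z. 0 :: complex)" by simp
      ultimately show ?case by (elim continuous_map_eq) simp
    next
      case (step m y c)
      then obtain t b where t: "\<phi> t = e" and b: "b \<in> fib B t" "m = \<psi> b" by auto
      have bE: "b \<in> idem_part B" using ess_inj[of t] e t b by (auto intro: B.idem_partI)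
      have m: "m \<in> fib A e" and y: "y \<in> fib A e" using M step(1) A.fspan_fib[OF step(2) M] by auto
      have "continuous_map (spectrum_top B) euclidean (\<lambda>z. c * ev B b z + ev A y (point_map z))"
        by (intro continuous_map_add continuous_map_cmult B.continuous_map_ev bE step.IH)
      then show ?case
        by (rule continuous_map_eq)
          (simp add: A.ev_add[OF _ e A.scale_in[OF m] y] A.idem_partI[OF e m] bE flip: b(2), simp add: b(2) bE)
    qed
    show "continuous_map (spectrum_top B) euclidean (\<lambda>z. ev A a (point_map z))"
    proof (rule continuous_map_euclidean_uniform_limit)
      fix \<epsilon> :: real assume eps: "\<epsilon> > 0"
      have "a \<in> closed_fspan A e ?M" using a dense[of e] by simp
      then obtain y where y: "y \<in> fspan A e ?M" "fdist A a y < \<epsilon>"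
        using eps unfolding closed_fspan_def by blast
      have yF: "y \<in> fib A e" by (rule A.fspan_fib[OF y(1) M])
      have "dist (ev A y (point_map z)) (ev A a (point_map z)) < \<epsilon>" if z: "z \<in> spectrum B" for z
      proof -
        have "ev A (add A a (scale A (-1) y)) (point_map z) = ev A a (point_map z) - ev A y (point_map z)"
          using z by (simp add: A.ev_add[OF _ e a A.scale_in[OF yF]] A.idem_partI[OF e yF])
        then show ?thesis
          using A.ev_norm_le[OF point_map_in[OF z] e A.add_in[OF a A.scale_in[OF yF]], of "-1"] y(2)
          by (simp add: fdist_def dist_norm norm_minus_commute)
      qed
      then show "\<exists>f. continuous_map (spectrum_top B) euclidean f \<and>
          (\<forall>x\<in>topspace (spectrum_top B). dist (f x) (ev A a (point_map x)) < \<epsilon>)"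
        using span[OF y(1)] by (intro exI[of _ "\<lambda>z. ev A y (point_map z)"]) simp
    qed
  qed
  have 2: "continuous_map (spectrum_top A) (spectrum_top B) g"
  proof (rule B.continuous_map_spectrumI)
    show "g \<in> topspace (spectrum_top A) \<rightarrow> spectrum B" using g by simp
    fix b assume b: "b \<in> idem_part B"
    have "ev A (\<psi> b) y = ev B b (g y)" if "y \<in> spectrum A" for y
      using ev_point_map[OF g(1)[OF that] b] g(2)[OF that] by simp
    then show "continuous_map (spectrum_top A) euclidean (\<lambda>y. ev B b (g y))"
      using A.continuous_map_ev[OF psi_idem_part[OF b]] by (elim continuous_map_eq) simp
  qed
  have "homeomorphic_maps (spectrum_top B) (spectrum_top A) point_map g"
    unfolding homeomorphic_maps_def using 1 2 g gp by simp
  then show ?thesis by (auto simp: homeomorphic_map_maps)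
qed

lemma open_point_map:
  assumes "openin (spectrum_top B) U" shows "openin (spectrum_top A) (point_map ` U)"
  using point_map_homeomorphic assms by (simp add: homeomorphic_map_openness_eq)

lemma open_point_map_vimage:
  assumes "openin (spectrum_top A) V" shows "openin (spectrum_top B) {x \<in> spectrum B. point_map x \<in> V}"
  using openin_continuous_map_preimage[OF homeomorphic_imp_continuous_map[OF point_map_homeomorphic] assms]
  by simp

end


section \<open>Elements and topologies of the two groupoids\<close>

lemma homeomorphic_map_generated:
  assumes bij: "bij_betw f (\<Union>S) (\<Union>T)"
    and img: "\<And>U. U \<in> S \<Longrightarrow> openin (topology_generated_by T) (f ` U)"
    and pre: "\<And>V. V \<in> T \<Longrightarrow> openin (topology_generated_by S) {x \<in> \<Union>S. f x \<in> V}"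
  shows "homeomorphic_map (topology_generated_by S) (topology_generated_by T) f"
proof -
  have inj: "inj_on f (\<Union>S)" and im: "f ` (\<Union>S) = \<Union>T" using bij by (auto simp: bij_betw_def)
  define g where "g = inv_into (\<Union>S) f"
  have g: "g y \<in> \<Union>S" "f (g y) = y" if "y \<in> \<Union>T" for y
    using that inv_into_into[of y f "\<Union>S"] f_inv_into_f[of y f "\<Union>S"] by (simp_all add: g_def im)
  have gf: "g (f x) = x" if "x \<in> \<Union>S" for x using inv_into_f_f[OF inj that] by (simp add: g_def)
  have 1: "continuous_map (topology_generated_by S) (topology_generated_by T) f"
  proof (rule continuous_on_generated_topo)
    fix V assume "V \<in> T"
    then have "openin (topology_generated_by S) {x \<in> \<Union>S. f x \<in> V}" by (rule pre)
    moreover have "f -` V \<inter> topspace (topology_generated_by S) = {x \<in> \<Union>S. f x \<in> V}" by auto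
    ultimately show "openin (topology_generated_by S) (f -` V \<inter> topspace (topology_generated_by S))" by simp
  qed (simp add: im)
  have 2: "continuous_map (topology_generated_by T) (topology_generated_by S) g"
  proof (rule continuous_on_generated_topo)
    fix U assume U: "U \<in> S"
    have "g -` U \<inter> topspace (topology_generated_by T) = f ` U"
    proof (intro set_eqI iffI)
      fix y assume y: "y \<in> g -` U \<inter> topspace (topology_generated_by T)"
      then have "f (g y) = y" using g(2) by simp
      then show "y \<in> f ` U" using y by force
    next
      fix y assume "y \<in> f ` U"
      then obtain x where x: "x \<in> U" "y = f x" by auto
      then have "x \<in> \<Union>S" using U by auto
      then show "y \<in> g -` U \<inter> topspace (topology_generated_by T)" using x gf[of x] im by auto
    qed
    then show "openin (topology_generated_by T) (g -` U \<inter> topspace (topology_generated_by T))"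
      using img[OF U] by simp
  qed (use g in auto)
  have "homeomorphic_maps (topology_generated_by S) (topology_generated_by T) f g"
    unfolding homeomorphic_maps_def using 1 2 g gf by simp
  then show ?thesis by (auto simp: homeomorphic_map_maps)
qed

lemma germ_relI:
  assumes "x \<in> supp A (sinv s * s)" "x \<in> supp A (sinv s' * s')" "idem e" "s * e = s' * e" "x \<in> supp A e"
  shows "((s, x), (s', x)) \<in> germ_rel A"
  using assms unfolding germ_rel_def by blast

lemma germ_relE:
  assumes "((s, x), (s', x')) \<in> germ_rel A"
  obtains e where "x' = x" "x \<in> supp A (sinv s * s)" "x \<in> supp A (sinv s' * s')" "idem e" "s * e = s' * e"
    "x \<in> supp A e"
  using assms unfolding germ_rel_def by blast

lemma twist_gmulI:
  assumes "g = twist_class A a s (theta_elem A b y)" "h = twist_class A b t y" "k = twist_class A (mul A a b) (s * t) y"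
    "a \<in> fib A s" "b \<in> fib A t" "y \<in> dom_of A b" "theta_elem A b y \<in> dom_of A a"
  shows "(g, h, k) \<in> gmul (twist_groupoid A)"
  unfolding twist_groupoid_def top_groupoid.select_convs using assms by blast

lemma twist_ginvI:
  assumes "g = twist_class A b t y" "h = twist_class A (star A b) (sinv t) (theta_elem A b y)"
    "b \<in> fib A t" "y \<in> dom_of A b"
  shows "(g, h) \<in> ginv (twist_groupoid A)"
  unfolding twist_groupoid_def top_groupoid.select_convs using assms by blast

lemma associated_twisted_groupoid_simps:
  "base (associated_twisted_groupoid A) = spectrum_top A"
  "grpd (associated_twisted_groupoid A) = germ_groupoid A"
  "twist (associated_twisted_groupoid A) = twist_groupoid A"
  "unit (associated_twisted_groupoid A) = {(x, germ A e x) | e x. idem e \<and> x \<in> supp A e}"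
  "emb (associated_twisted_groupoid A) = {((z, x), twist_class A (scale A z c) e x) | z c e x.
       z \<in> sphere 0 1 \<and> idem e \<and> c \<in> fib A e \<and> x \<in> spectrum A \<and> 0 < ev A c x}"
  "proj (associated_twisted_groupoid A) = {(twist_class A b s x, germ A s x) | b s x. b \<in> fib A s \<and> x \<in> dom_of A b}"
  for A :: "('x :: inverse_semigroup, 'y) fell"
  by (simp_all add: associated_twisted_groupoid_def)

lemma idem_source: "idem e \<Longrightarrow> sinv e * e = e" for e :: "'x :: inverse_semigroup"
  by (simp add: sinv_idem) (simp add: idem_def)

context saturated_bundle
begin

lemma theta_props:
  assumes x: "x \<in> supp A (sinv s * s)"
  obtains b where "b \<in> fib A s" "x \<in> dom_of A b" "theta A s x = theta_elem A b x"
    "theta A s x \<in> supp A (s * sinv s)"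
proof -
  obtain b where b: "b \<in> fib A s" "x \<in> dom_of A b" by (rule supp_dom[OF x])
  show ?thesis using that[OF b theta_eq[OF b]] theta_supp[OF b] theta_eq[OF b] by simp
qed

lemma supp_prod:
  assumes y: "y \<in> supp A (sinv t * t)" and z: "theta A t y \<in> supp A (sinv s * s)"
  shows "y \<in> supp A (sinv (s * t) * (s * t))"
proof -
  obtain b where b: "b \<in> fib A t" "y \<in> dom_of A b" "theta A t y = theta_elem A b y" using theta_props[OF y] by blast
  obtain a where a: "a \<in> fib A s" "theta A t y \<in> dom_of A a" using supp_dom[OF z] by blast
  have "y \<in> dom_of A (mul A a b)" using dom_mul[OF totalI[OF a(1)] totalI[OF b(1)] b(2)] a(2) b(3) by simp
  then show ?thesis by (rule dom_supp[OF mul_closed[OF a(1) b(1)]])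
qed

lemma topspace_germs:
  "\<Union>{germ A s ` U | s U. U \<subseteq> supp A (sinv s * s) \<and> openin (spectrum_top A) U}
    = {germ A s x | s x. x \<in> supp A (sinv s * s)}"
  using openin_supp[OF idem_sinv_mult(1)] by blast

lemma topspace_germ_groupoid: "topspace (gtop (germ_groupoid A)) = {germ A s x | s x. x \<in> supp A (sinv s * s)}"
  by (simp add: germ_groupoid_def topspace_germs)

lemma scale_unit_in_dom: "b \<in> fib A s \<Longrightarrow> x \<in> dom_of A b \<Longrightarrow> z \<in> sphere 0 1 \<Longrightarrow> x \<in> dom_of A (scale A z b)"
  using scale_dom[of b s z] by fastforce

lemma topspace_twists:
  "\<Union>{{twist_class A (scale A z b) s x | z x. z \<in> V \<and> x \<in> U} | b s U V.
      b \<in> fib A s \<and> U \<subseteq> dom_of A b \<and> openin (spectrum_top A) U \<and> openin (top_of_set (sphere 0 1)) V}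
    = {twist_class A b s x | b s x. b \<in> fib A s \<and> x \<in> dom_of A b}" (is "\<Union>?S = ?T")
proof (intro set_eqI iffI)
  fix w assume "w \<in> \<Union>?S"
  then obtain b s U V z x where *: "b \<in> fib A s" "U \<subseteq> dom_of A b" "openin (top_of_set (sphere 0 1)) V"
    "z \<in> V" "x \<in> U" "w = twist_class A (scale A z b) s x" by blast
  then have "z \<in> sphere 0 1" using openin_subset by fastforce
  then show "w \<in> ?T" using * scale_unit_in_dom[of b s x z] scale_in[of b s z] by blast
next
  fix w assume "w \<in> ?T"
  then obtain b s x where b: "b \<in> fib A s" "x \<in> dom_of A b" and w: "w = twist_class A b s x" by blast
  have "openin (top_of_set (sphere 0 1)) (sphere 0 1 :: complex set)" by simp
  moreover have "w = twist_class A (scale A 1 b) s x" using w scale_one[OF b(1)] by simp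
  moreover have "(1 :: complex) \<in> sphere 0 1" by simp
  ultimately have w: "w \<in> {twist_class A (scale A z b) s x | z x. z \<in> sphere 0 1 \<and> x \<in> dom_of A b}"
    using b(2) by blast
  show "w \<in> \<Union>?S"
    by (rule UnionI[OF _ w], rule CollectI, intro exI[of _ b] exI[of _ s] exI[of _ "dom_of A b"] exI[of _ "sphere 0 1"])
      (use b openin_dom[OF totalI[OF b(1)]] in simp)
qed

lemma topspace_twist_groupoid:
  "topspace (gtop (twist_groupoid A)) = {twist_class A b s x | b s x. b \<in> fib A s \<and> x \<in> dom_of A b}"
  by (simp add: twist_groupoid_def topspace_twists)

lemma openin_twist_basic:
  assumes "b \<in> fib A s" "U \<subseteq> dom_of A b" "openin (spectrum_top A) U" "openin (top_of_set (sphere 0 1)) V"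
  shows "openin (gtop (twist_groupoid A)) {twist_class A (scale A z b) s x | z x. z \<in> V \<and> x \<in> U}"
  unfolding twist_groupoid_def top_groupoid.select_convs using assms by (intro topology_generated_by_Basis) blast

text \<open>Multiplying \<open>b\<close> by an element \<open>d\<close> that is positive at \<open>x\<close> replaces \<open>t\<close> by its restriction \<open>t * k\<close>
  without changing the class.\<close>

lemma twist_rel_restrict:
  assumes b: "b \<in> fib A t" "x \<in> dom_of A b" and d: "d \<in> fib A k" "idem k" "0 < ev A d x"
  shows "x \<in> dom_of A (mul A b d)" "((b, t, x), (mul A b d, t * k, x)) \<in> twist_rel A"
proof -
  have dE: "d \<in> idem_part A" using d by (auto intro: idem_partI)
  have nz: "ev A d x \<noteq> 0" using d(3) by auto
  note t = totalI[OF b(1)]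
  show dom: "x \<in> dom_of A (mul A b d)" by (rule theta_elem_mul_right(1)[OF t b(2) dE nz])
  show "((b, t, x), (mul A b d, t * k, x)) \<in> twist_rel A"
    by (rule twist_relI[OF b(1) mul_closed[OF b(1) d(1)] b(2) dom, where c = "mul A d d" and c' = d])
      (use dE d(3) t dom_ofD(1)[OF b(2)] in \<open>simp_all add: total_assoc complex_pos_mult\<close>)
qed

end

context bundle_refinement
begin

section \<open>The comparison of germs\<close>

lemma point_map_pos: "x \<in> spectrum B \<Longrightarrow> b \<in> total B \<Longrightarrow>
    ev A (mul A (star A (\<psi> b)) (\<psi> b)) (point_map x) = ev B (mul B (star B b) b) x"
  using ev_point_map[of x "mul B (star B b) b"] by (simp add: psi_total_mul psi_total_star)

lemma point_map_dom: "x \<in> spectrum B \<Longrightarrow> b \<in> total B \<Longrightarrow> point_map x \<in> dom_of A (\<psi> b) \<longleftrightarrow> x \<in> dom_of B b"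
  by (simp add: dom_of_def point_map_pos)

lemma point_map_supp: "idem f \<Longrightarrow> x \<in> supp B f \<Longrightarrow> point_map x \<in> supp A (\<phi> f)"
  unfolding supp_def by (auto intro!: bexI[of _ "\<psi> _"] psi_fib simp: B.idem_partI)

lemma point_map_supp_source: "x \<in> supp B (sinv t * t) \<Longrightarrow> point_map x \<in> supp A (sinv (\<phi> t) * \<phi> t)"
  using point_map_supp[of "sinv t * t" x] by (simp add: phi_mult phi_sinv)

lemma point_map_theta_elem:
  assumes b: "b \<in> total B" and x: "x \<in> dom_of B b"
  shows "point_map (theta_elem B b x) = theta_elem A (\<psi> b) (point_map x)"
proof -
  note xs = B.dom_ofD(1)[OF x]
  have dom: "point_map x \<in> dom_of A (\<psi> b)" using x xs b by (simp add: point_map_dom)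
  note tb = psi_total[OF b]
  show ?thesis
  proof (rule point_map_eqI[OF B.theta_elem_in[OF b x] A.theta_elem_in[OF tb dom]])
    fix c assume c: "c \<in> idem_part B"
    have "ev A (\<psi> c) (theta_elem A (\<psi> b) (point_map x)) * ev B (mul B (star B b) b) x
        = ev A (\<psi> (mul B (star B b) (mul B c b))) (point_map x)"
      using A.ev_theta[OF tb dom psi_idem_part[OF c]] b c xs
      by (simp add: psi_total_mul psi_total_star point_map_pos del: ev_point_map)
    also have "\<dots> = ev B c (theta_elem B b x) * ev B (mul B (star B b) b) x"
      using B.ev_theta[OF b x c] xs b c by simp
    finally show "ev A (\<psi> c) (theta_elem A (\<psi> b) (point_map x)) = ev B c (theta_elem B b x)"
      using B.dom_ofD(2)[OF x] by auto
  qed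
qed

lemma point_map_theta:
  assumes x: "x \<in> supp B (sinv t * t)"
  shows "point_map (theta B t x) = theta A (\<phi> t) (point_map x)"
proof -
  obtain b where b: "b \<in> fib B t" "x \<in> dom_of B b" "theta B t x = theta_elem B b x"
    using B.theta_props[OF x] by blast
  have "point_map x \<in> dom_of A (\<psi> b)" using b B.dom_ofD(1)[OF b(2)] by (simp add: point_map_dom B.totalI)
  then show ?thesis
    using A.theta_eq[OF psi_fib[OF b(1)]] point_map_theta_elem[OF B.totalI[OF b(1)] b(2)] b(3) by simp
qed

text \<open>If all \<open>b\<close> over \<open>\<phi>\<^sup>-\<^sup>1(s)\<close> vanished at \<open>x\<close>, then by the exchange identity the functional
  \<open>a' \<mapsto> (a\<^sup>*a')(h x)\<close>, with \<open>h\<close> for \<open>point_map\<close>, would vanish at all \<open>\<psi> b\<close>, and by density at \<open>a\<close> itself.\<close>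

lemma lift_fibre:
  assumes a: "a \<in> fib A s" and x: "x \<in> spectrum B" "point_map x \<in> dom_of A a"
  obtains t b where "\<phi> t = s" "b \<in> fib B t" "x \<in> dom_of B b"
proof (rule ccontr)
  assume "\<not> thesis"
  then have neg: "\<And>t b. \<phi> t = s \<Longrightarrow> b \<in> fib B t \<Longrightarrow> x \<notin> dom_of B b" using that by blast
  let ?y = "point_map x"
  have y: "?y \<in> spectrum A" using x by simp
  have E: "mul A (star A a) a' \<in> fib A (sinv s * s)" if "a' \<in> fib A s" for a'
    by (rule A.mul_closed[OF A.star_closed[OF a] that])
  have id: "idem (sinv s * s)" by simp
  have "ev A (mul A (star A a) a) ?y = 0"
  proof (rule dense_functional[where s = s and \<Lambda> = "\<lambda>a'. ev A (mul A (star A a) a') ?y" and K = "nrm A a"])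
    show "ev A (mul A (star A a) (add A b c)) ?y = ev A (mul A (star A a) b) ?y + ev A (mul A (star A a) c) ?y"
      if "b \<in> fib A s" "c \<in> fib A s" for b c
      using A.mul_add_right[OF A.star_closed[OF a] that] A.ev_add[OF y id E[OF that(1)] E[OF that(2)]] by simp
    show "ev A (mul A (star A a) (scale A z b)) ?y = z * ev A (mul A (star A a) b) ?y" if "b \<in> fib A s" for z b
      using A.mul_scale_right[OF A.star_closed[OF a] that] A.ev_scale[OF y A.idem_partI[OF id E[OF that]]] by simp
    show "cmod (ev A (mul A (star A a) b) ?y) \<le> nrm A a * nrm A b" if "b \<in> fib A s" for b
      using A.ev_norm_le[OF y id E[OF that]] A.nrm_mul[OF A.star_closed[OF a] that] A.nrm_star[OF a] by simp
    show "ev A (mul A (star A a) (\<psi> b)) ?y = 0" if "\<phi> t = s" "b \<in> fib B t" for t b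
    proof -
      have "ev B (mul B (star B b) b) x = 0"
        using neg[OF that] B.dom_of_iff[OF B.totalI[OF that(2)]] x by blast
      then have "ev A (mul A (star A (\<psi> b)) (\<psi> b)) ?y = 0"
        using point_map_pos[OF x(1) B.totalI[OF that(2)]] by simp
      then have "cnj (ev A (mul A (star A a) (\<psi> b)) ?y) * ev A (mul A (star A a) (\<psi> b)) ?y = 0"
        using A.ev_exchange[OF a _ y, of "\<psi> b"] psi_fib[OF that(2)] that(1) by simp
      then show ?thesis by simp
    qed
  qed (rule a)
  then show False using A.dom_ofD(2)[OF x(2)] by simp
qed

lemma lift_germ:
  assumes x: "x \<in> spectrum B" and y: "point_map x \<in> supp A (sinv s * s)"
  obtains t where "\<phi> t = s" "x \<in> supp B (sinv t * t)"
proof -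
  obtain a where a: "a \<in> fib A s" "point_map x \<in> dom_of A a" by (rule A.supp_dom[OF y])
  obtain t b where "\<phi> t = s" "b \<in> fib B t" "x \<in> dom_of B b" by (rule lift_fibre[OF a(1) x a(2)])
  then show ?thesis using that B.dom_supp by blast
qed

lemma lift_supp:
  assumes e: "idem e" and x: "x \<in> spectrum B" and y: "point_map x \<in> supp A e"
  obtains f where "\<phi> f = e" "idem f" "x \<in> supp B f"
proof -
  obtain f b where "\<phi> f = e" "idem f" "b \<in> fib B f" "ev A (\<psi> b) (point_map x) \<noteq> 0" by (rule supp_lift[OF e y])
  then show ?thesis using that B.suppI[of f b x] x ev_point_map[OF x B.idem_partI] by metis
qed

text \<open>Two elements of \<open>T\<close> with the same image under \<open>\<phi>\<close> are compatible by essential injectivity, hence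
  agree on the idempotent on which both are defined.\<close>

lemma agree_near_point:
  assumes x: "x \<in> supp B (sinv t * t)" "x \<in> supp B (sinv t' * t')"
    and e: "idem e" "point_map x \<in> supp A e" "\<phi> t * e = \<phi> t' * e"
  obtains k where "idem k" "x \<in> supp B k" "t * k = t' * k"
proof -
  obtain g where g: "\<phi> g = e" "idem g" "x \<in> supp B g"
    by (rule lift_supp[OF e(1) B.supp_spectrum[OF x(1)] e(2)])
  let ?p = "t * g" and ?q = "t' * g"
  have pq: "\<phi> ?p = \<phi> ?q" using e(3) g(1) by (simp add: phi_mult)
  have "idem (\<phi> (sinv ?p * ?q))" "idem (\<phi> (?p * sinv ?q))"
    unfolding phi_mult[of "sinv _"] phi_mult[of _ "sinv _"] phi_sinv pq by simp_all
  then have i: "?p * ((sinv ?p * ?p) * (sinv ?q * ?q)) = ?q * ((sinv ?p * ?p) * (sinv ?q * ?q))"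
    by (intro compatible_agree ess_inj)
  have supp: "x \<in> supp B (sinv (r * g) * (r * g))" if "x \<in> supp B (sinv r * r)" for r
  proof -
    have "sinv (r * g) * (r * g) = g * (sinv r * r) * g"
      using g(2) by (simp add: sinv_mult sinv_idem mult.assoc)
    then show ?thesis using B.supp_mult g that idem_mult idem_sinv_mult(1) by metis
  qed
  let ?k = "g * ((sinv ?p * ?p) * (sinv ?q * ?q))"
  have "x \<in> supp B ?k"
    by (intro B.supp_mult g idem_mult idem_sinv_mult supp x)
  moreover have "t * ?k = t' * ?k" using i by (simp add: mult.assoc)
  moreover have "idem ?k" by (intro idem_mult g idem_sinv_mult)
  ultimately show ?thesis using that by blast
qed

definition germ_map :: "('t \<times> 'b point) set \<Rightarrow> ('s \<times> 'a point) set" where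
  "germ_map G = (\<Union>(t, x)\<in>G. germ A (\<phi> t) (point_map x))"

lemma germ_rel_map:
  assumes "((t, x), (t', x')) \<in> germ_rel B"
  shows "((\<phi> t, point_map x), (\<phi> t', point_map x')) \<in> germ_rel A"
proof -
  obtain e where x: "x' = x" "x \<in> supp B (sinv t * t)" "x \<in> supp B (sinv t' * t')"
    and e: "idem e" "t * e = t' * e" "x \<in> supp B e" by (rule germ_relE[OF assms])
  have "\<phi> t * \<phi> e = \<phi> t' * \<phi> e" using arg_cong[OF e(2), of \<phi>] by (simp only: phi_mult)
  then show ?thesis unfolding x(1)
    by (rule germ_relI[OF point_map_supp_source[OF x(2)] point_map_supp_source[OF x(3)] phi_idem[OF e(1)]
      _ point_map_supp[OF e(1,3)]])
qed

lemma germ_map [simp]: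
  assumes x: "x \<in> supp B (sinv t * t)"
  shows "germ_map (germ B t x) = germ A (\<phi> t) (point_map x)"
proof -
  have "germ A (\<phi> t') (point_map x') = germ A (\<phi> t) (point_map x)" if m: "(t', x') \<in> germ B t x" for t' x'
  proof -
    have "((t, x), (t', x')) \<in> germ_rel B" using m by (simp add: germ_def)
    from germ_rel_map[OF this] show ?thesis using A.germ_eq_iff[OF point_map_supp_source[OF x]] by blast
  qed
  moreover have "(t, x) \<in> germ B t x" using B.germ_rel_refl[OF x] by (simp add: germ_def)
  ultimately show ?thesis unfolding germ_map_def by blast
qed

lemma germ_map_inj:
  assumes x: "x \<in> supp B (sinv t * t)" and x': "x' \<in> supp B (sinv t' * t')"
    and eq: "germ A (\<phi> t) (point_map x) = germ A (\<phi> t') (point_map x')"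
  shows "germ B t x = germ B t' x'"
proof -
  have r: "((\<phi> t, point_map x), (\<phi> t', point_map x')) \<in> germ_rel A"
    using eq A.germ_eq_iff[OF point_map_supp_source[OF x]] by simp
  obtain e where e: "point_map x' = point_map x" "idem e" "\<phi> t * e = \<phi> t' * e" "point_map x \<in> supp A e"
    by (rule germ_relE[OF r])
  have xx: "x' = x" by (rule point_map_inj[OF B.supp_spectrum[OF x'] B.supp_spectrum[OF x] e(1)])
  obtain k where "idem k" "x \<in> supp B k" "t * k = t' * k"
    by (rule agree_near_point[OF x x'[unfolded xx] e(2,4,3)])
  then show ?thesis unfolding B.germ_eq_iff[OF x] xx by (intro germ_relI[OF x x'[unfolded xx]])
qed

lemma germ_map_eqD:
  assumes "g \<in> topspace (gtop (germ_groupoid B))" "x \<in> supp B (sinv t * t)"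
    "germ_map g = germ A (\<phi> t) (point_map x)"
  shows "g = germ B t x"
proof -
  obtain t' x' where g: "g = germ B t' x'" "x' \<in> supp B (sinv t' * t')"
    using assms(1) unfolding B.topspace_germ_groupoid by blast
  then show ?thesis using germ_map_inj[OF g(2) assms(2)] assms(3) germ_map[OF g(2)] by simp
qed

lemma germ_map_homeomorphic:
  "homeomorphic_map (gtop (germ_groupoid B)) (gtop (germ_groupoid A)) germ_map"
proof -
  let ?S = "{germ B s ` U | s U. U \<subseteq> supp B (sinv s * s) \<and> openin (spectrum_top B) U}"
  let ?T = "{germ A s ` U | s U. U \<subseteq> supp A (sinv s * s) \<and> openin (spectrum_top A) U}"
  have "homeomorphic_map (topology_generated_by ?S) (topology_generated_by ?T) germ_map"
  proof (rule homeomorphic_map_generated)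
    show "bij_betw germ_map (\<Union>?S) (\<Union>?T)"
      unfolding A.topspace_germs B.topspace_germs bij_betw_def
    proof
      show "inj_on germ_map {germ B s x | s x. x \<in> supp B (sinv s * s)}"
        using germ_map_eqD unfolding inj_on_def B.topspace_germ_groupoid by (smt (verit) germ_map mem_Collect_eq)
      show "germ_map ` {germ B s x | s x. x \<in> supp B (sinv s * s)} = {germ A s x | s x. x \<in> supp A (sinv s * s)}"
      proof (intro set_eqI iffI)
        fix g assume "g \<in> germ_map ` {germ B s x | s x. x \<in> supp B (sinv s * s)}"
        then obtain t x where "x \<in> supp B (sinv t * t)" "g = germ A (\<phi> t) (point_map x)" by auto
        then show "g \<in> {germ A s x | s x. x \<in> supp A (sinv s * s)}" using point_map_supp_source by blast
      next
        fix g assume "g \<in> {germ A s x | s x. x \<in> supp A (sinv s * s)}"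
        then obtain s y where y: "y \<in> supp A (sinv s * s)" and g: "g = germ A s y" by blast
        obtain x where x: "x \<in> spectrum B" "y = point_map x" by (rule point_map_surj[OF A.supp_spectrum[OF y]])
        obtain t where "\<phi> t = s" "x \<in> supp B (sinv t * t)" using lift_germ[OF x(1)] y x(2) by metis
        then show "g \<in> germ_map ` {germ B s x | s x. x \<in> supp B (sinv s * s)}"
          using g x(2) by (intro image_eqI[of _ _ "germ B t x"]) auto
      qed
    qed
  next
    fix W assume "W \<in> ?S"
    then obtain t U where U: "W = germ B t ` U" "U \<subseteq> supp B (sinv t * t)" "openin (spectrum_top B) U" by blast
    have "germ_map ` W = germ A (\<phi> t) ` (point_map ` U)"
      unfolding U(1) image_image using U(2) by (intro image_cong) auto
    moreover have "point_map ` U \<subseteq> supp A (sinv (\<phi> t) * \<phi> t)" using U(2) point_map_supp_source by blast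
    moreover have "openin (spectrum_top A) (point_map ` U)" by (rule open_point_map[OF U(3)])
    ultimately have "germ_map ` W \<in> ?T" by blast
    then show "openin (topology_generated_by ?T) (germ_map ` W)" by (rule topology_generated_by_Basis)
  next
    fix W assume "W \<in> ?T"
    then obtain s V where V: "W = germ A s ` V" "V \<subseteq> supp A (sinv s * s)" "openin (spectrum_top A) V" by blast
    define U where "U t = {x \<in> spectrum B. point_map x \<in> V} \<inter> supp B (sinv t * t)" for t
    have U: "germ B t ` U t \<in> ?S" for t
    proof -
      have "U t \<subseteq> supp B (sinv t * t)" by (auto simp: U_def)
      moreover have "openin (spectrum_top B) (U t)"
        unfolding U_def by (intro openin_Int open_point_map_vimage V(3) B.openin_supp idem_sinv_mult)
      ultimately show ?thesis by blast
    qed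
    have eq: "{g \<in> \<Union>?S. germ_map g \<in> W} = (\<Union>t\<in>\<phi> -` {s}. germ B t ` U t)"
    proof (intro set_eqI iffI)
      fix g assume "g \<in> {g \<in> \<Union>?S. germ_map g \<in> W}"
      then have g: "g \<in> topspace (gtop (germ_groupoid B))" "germ_map g \<in> W"
        by (simp_all add: B.topspace_germ_groupoid B.topspace_germs)
      then obtain y where y: "y \<in> V" "germ_map g = germ A s y" using V(1) by blast
      obtain x where x: "x \<in> spectrum B" "y = point_map x"
        using point_map_surj A.supp_spectrum y(1) V(2) by blast
      obtain t where t: "\<phi> t = s" "x \<in> supp B (sinv t * t)"
        using lift_germ[OF x(1)] y(1) x(2) V(2) by blast
      have "g = germ B t x" by (rule germ_map_eqD[OF g(1) t(2)]) (simp add: y(2) t(1) x(2))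
      then show "g \<in> (\<Union>t\<in>\<phi> -` {s}. germ B t ` U t)" using t x y(1) by (auto simp: U_def)
    next
      fix g assume "g \<in> (\<Union>t\<in>\<phi> -` {s}. germ B t ` U t)"
      then obtain t x where t: "\<phi> t = s" "x \<in> U t" "g = germ B t x" by auto
      then have "germ_map g \<in> W" using V(1) by (auto simp: U_def)
      moreover have "g \<in> \<Union>?S" using U[of t] t(2,3) by blast
      ultimately show "g \<in> {g \<in> \<Union>?S. germ_map g \<in> W}" by simp
    qed
    show "openin (topology_generated_by ?S) {g \<in> \<Union>?S. germ_map g \<in> W}"
      unfolding eq
    proof (rule openin_Union)
      fix W' assume "W' \<in> (\<lambda>t. germ B t ` U t) ` (\<phi> -` {s})"
      then show "openin (topology_generated_by ?S) W'" using topology_generated_by_Basis[OF U] by fast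
    qed
  qed
  then show ?thesis by (simp add: germ_groupoid_def)
qed

lemma germ_map_iso: "top_groupoid_iso (germ_groupoid B) (germ_groupoid A) germ_map"
  unfolding top_groupoid_iso_def
proof (intro conjI ballI germ_map_homeomorphic)
  let ?G = "topspace (gtop (germ_groupoid B))"
  fix g h assume g: "g \<in> ?G" and h: "h \<in> ?G"
  show "(g, h, k) \<in> gmul (germ_groupoid B) \<longleftrightarrow> (germ_map g, germ_map h, germ_map k) \<in> gmul (germ_groupoid A)"
    if k: "k \<in> ?G" for k
  proof
    assume "(g, h, k) \<in> gmul (germ_groupoid B)"
    then obtain s t y where *: "g = germ B s (theta B t y)" "h = germ B t y" "k = germ B (s * t) y"
      and y: "y \<in> supp B (sinv t * t)" "theta B t y \<in> supp B (sinv s * s)" by (auto simp: germ_groupoid_def)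
    have "germ_map g = germ A (\<phi> s) (theta A (\<phi> t) (point_map y))" "germ_map h = germ A (\<phi> t) (point_map y)"
      "germ_map k = germ A (\<phi> s * \<phi> t) (point_map y)"
      using * y B.supp_prod[OF y] point_map_theta[OF y(1)] by (simp_all add: phi_mult)
    then show "(germ_map g, germ_map h, germ_map k) \<in> gmul (germ_groupoid A)"
      using point_map_supp_source[OF y(1)] point_map_supp_source[OF y(2)] point_map_theta[OF y(1)]
      by (auto simp: germ_groupoid_def)
  next
    assume "(germ_map g, germ_map h, germ_map k) \<in> gmul (germ_groupoid A)"
    then obtain s t y where *: "germ_map g = germ A s (theta A t y)" "germ_map h = germ A t y" "germ_map k = germ A (s * t) y"
      and y: "y \<in> supp A (sinv t * t)" "theta A t y \<in> supp A (sinv s * s)" by (auto simp: germ_groupoid_def)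
    obtain x where x: "x \<in> spectrum B" "y = point_map x" by (rule point_map_surj[OF A.supp_spectrum[OF y(1)]])
    obtain t' where t': "\<phi> t' = t" "x \<in> supp B (sinv t' * t')" using lift_germ[OF x(1)] y(1) x(2) by metis
    have th: "theta A t y = point_map (theta B t' x)" using point_map_theta[OF t'(2)] t'(1) x(2) by simp
    have ths: "theta B t' x \<in> spectrum B" using B.theta_props[OF t'(2)] B.supp_spectrum by metis
    obtain s' where s': "\<phi> s' = s" "theta B t' x \<in> supp B (sinv s' * s')"
      using lift_germ[OF ths] y(2) th by metis
    have "g = germ B s' (theta B t' x)" by (rule germ_map_eqD[OF g s'(2)]) (simp add: *(1) s'(1) th)
    moreover have "h = germ B t' x" by (rule germ_map_eqD[OF h t'(2)]) (simp add: *(2) t'(1) x(2))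
    moreover have "k = germ B (s' * t') x"
      by (rule germ_map_eqD[OF k B.supp_prod[OF t'(2) s'(2)]]) (simp add: *(3) t'(1) s'(1) x(2) phi_mult)
    ultimately show "(g, h, k) \<in> gmul (germ_groupoid B)" using t'(2) s'(2) by (auto simp: germ_groupoid_def)
  qed
  have src: "theta B t x \<in> supp B (sinv (sinv t) * sinv t)" if "x \<in> supp B (sinv t * t)" for t x
    using B.theta_props[OF that] by (metis sinv_sinv)
  show "(g, h) \<in> ginv (germ_groupoid B) \<longleftrightarrow> (germ_map g, germ_map h) \<in> ginv (germ_groupoid A)"
  proof
    assume "(g, h) \<in> ginv (germ_groupoid B)"
    then obtain t x where *: "g = germ B t x" "h = germ B (sinv t) (theta B t x)" and x: "x \<in> supp B (sinv t * t)"
      by (auto simp: germ_groupoid_def)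
    have "germ_map g = germ A (\<phi> t) (point_map x)" "germ_map h = germ A (sinv (\<phi> t)) (theta A (\<phi> t) (point_map x))"
      using * x src[OF x] point_map_theta[OF x] by (simp_all add: phi_sinv)
    then show "(germ_map g, germ_map h) \<in> ginv (germ_groupoid A)"
      using point_map_supp_source[OF x] by (auto simp: germ_groupoid_def)
  next
    assume "(germ_map g, germ_map h) \<in> ginv (germ_groupoid A)"
    then obtain s y where *: "germ_map g = germ A s y" "germ_map h = germ A (sinv s) (theta A s y)"
      and y: "y \<in> supp A (sinv s * s)" by (auto simp: germ_groupoid_def)
    obtain x where x: "x \<in> spectrum B" "y = point_map x" by (rule point_map_surj[OF A.supp_spectrum[OF y]])
    obtain t where t: "\<phi> t = s" "x \<in> supp B (sinv t * t)" using lift_germ[OF x(1)] y x(2) by metis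
    have "g = germ B t x" by (rule germ_map_eqD[OF g t(2)]) (simp add: *(1) t(1) x(2))
    moreover have "h = germ B (sinv t) (theta B t x)"
      by (rule germ_map_eqD[OF h src[OF t(2)]]) (use *(2) t(1) x(2) point_map_theta[OF t(2)] in \<open>simp add: phi_sinv\<close>)
    ultimately show "(g, h) \<in> ginv (germ_groupoid B)" using t(2) by (auto simp: germ_groupoid_def)
  qed
qed

section \<open>The comparison of twists\<close>

definition twist_map :: "('b \<times> 't \<times> 'b point) set \<Rightarrow> ('a \<times> 's \<times> 'a point) set" where
  "twist_map W = (\<Union>(b, t, x)\<in>W. twist_class A (\<psi> b) (\<phi> t) (point_map x))"

lemma twist_rel_map:
  assumes "((b, t, x), (b', t', x')) \<in> twist_rel B"
  shows "((\<psi> b, \<phi> t, point_map x), (\<psi> b', \<phi> t', point_map x')) \<in> twist_rel A"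
proof -
  obtain c c' where 1: "x' = x" "b \<in> fib B t" "b' \<in> fib B t'" "x \<in> dom_of B b" "x \<in> dom_of B b'"
    "c \<in> idem_part B" "c' \<in> idem_part B" "0 < ev B c x" "0 < ev B c' x" "mul B b c = mul B b' c'"
    using assms by (rule B.twist_relE)
  note x = B.dom_ofD(1)[OF 1(4)]
  note t = B.totalI[OF 1(2)] B.totalI[OF 1(3)]
  show ?thesis
    unfolding 1(1)
    by (rule A.twist_relI[where c = "\<psi> c" and c' = "\<psi> c'"])
      (use 1 x t in \<open>simp_all add: psi_fib point_map_dom flip: psi_total_mul\<close>)
qed

lemma twist_map [simp]:
  assumes b: "b \<in> fib B t" "x \<in> dom_of B b"
  shows "twist_map (twist_class B b t x) = twist_class A (\<psi> b) (\<phi> t) (point_map x)"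
proof -
  have d: "point_map x \<in> dom_of A (\<psi> b)" using b B.dom_ofD(1)[OF b(2)] by (simp add: point_map_dom B.totalI)
  have "twist_class A (\<psi> b') (\<phi> t') (point_map x') = twist_class A (\<psi> b) (\<phi> t) (point_map x)"
    if m: "(b', t', x') \<in> twist_class B b t x" for b' t' x'
  proof -
    have "((b, t, x), (b', t', x')) \<in> twist_rel B" using m by (simp add: twist_class_def)
    from twist_rel_map[OF this] show ?thesis using A.twist_class_eq_iff[OF psi_fib[OF b(1)] d] by blast
  qed
  moreover have "(b, t, x) \<in> twist_class B b t x" using B.twist_rel_refl[OF b] by (simp add: twist_class_def)
  ultimately show ?thesis unfolding twist_map_def by blast
qed

text \<open>Both elements are restricted to a common fibre, by the corresponding statement for germs. There
  the classes agree as soon as \<open>b\<^sup>*b'\<close> is positive at \<open>x\<close>, and this can be read off from the images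
  under \<open>\<psi>\<close>.\<close>

lemma twist_map_inj:
  assumes b: "b \<in> fib B t" "x \<in> dom_of B b" and b': "b' \<in> fib B t'" "x' \<in> dom_of B b'"
    and eq: "twist_class A (\<psi> b) (\<phi> t) (point_map x) = twist_class A (\<psi> b') (\<phi> t') (point_map x')"
  shows "twist_class B b t x = twist_class B b' t' x'"
proof -
  note x = B.dom_ofD(1)[OF b(2)]
  note tb [simp] = B.totalI[OF b(1)] B.totalI[OF b'(1)]
  have d: "point_map x \<in> dom_of A (\<psi> b)" using b x by (simp add: point_map_dom)
  have r: "((\<psi> b, \<phi> t, point_map x), (\<psi> b', \<phi> t', point_map x')) \<in> twist_rel A"
    using eq A.twist_class_eq_iff[OF psi_fib[OF b(1)] d] by simp
  then obtain c c' where c: "point_map x' = point_map x" "c \<in> idem_part A" "c' \<in> idem_part A"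
    "0 < ev A c (point_map x)" "0 < ev A c' (point_map x)" "mul A (\<psi> b) c = mul A (\<psi> b') c'"
    by (rule A.twist_relE) blast
  have xx: "x' = x" using point_map_inj[OF B.dom_ofD(1)[OF b'(2)] x c(1)] .
  note b'x = b'(2)[unfolded xx]
  obtain e e' where e: "idem e" "c \<in> fib A e" and e': "idem e'" "c' \<in> fib A e'"
    using c by (auto simp: idem_part_def)
  have y: "point_map x \<in> spectrum A" using x by simp
  have "\<phi> t * e = \<phi> t' * e'"
    using A.disjoint[of "\<phi> t * e" "\<phi> t' * e'"] A.mul_closed[OF psi_fib[OF b(1)] e(2)]
      A.mul_closed[OF psi_fib[OF b'(1)] e'(2)] c(6) by auto
  then have "(\<phi> t * e) * (e * e') = (\<phi> t' * e') * (e' * e)" using idem_commute[OF e(1) e'(1)] by simp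
  then have ag: "\<phi> t * (e * e') = \<phi> t' * (e * e')"
    using e(1) e'(1) idem_commute[OF e(1) e'(1)] unfolding idem_def by (metis mult.assoc)
  have supp: "point_map x \<in> supp A (e * e')"
    using c by (intro A.supp_mult e e' A.suppI[OF _ e(2) y] A.suppI[OF _ e'(2) y]) auto
  obtain k where k: "idem k" "x \<in> supp B k" "t * k = t' * k"
    using agree_near_point[OF B.dom_supp[OF b] B.dom_supp[OF b'(1) b'x] idem_mult[OF e(1) e'(1)] supp ag] .
  obtain d where d: "d \<in> fib B k" "d \<in> idem_part B" "0 < ev B d x" by (rule B.supp_pos[OF k(1,2)])
  let ?b = "mul B b d" and ?b' = "mul B b' d"
  note r1 = B.twist_rel_restrict[OF b d(1) k(1) d(3)] and r2 = B.twist_rel_restrict[OF b'(1) b'x d(1) k(1) d(3)]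
  have F: "?b \<in> fib B (t * k)" "?b' \<in> fib B (t * k)"
    using B.mul_closed[OF b(1) d(1)] B.mul_closed[OF b'(1) d(1)] k(3) by simp_all
  have "mul A (\<psi> ?b) c = mul A (\<psi> ?b') c'"
  proof -
    have "mul A (\<psi> ?b) c = mul A (mul A (\<psi> b) c) (\<psi> d)"
      using c(2) d A.idem_part_commute[OF psi_idem_part[OF d(2)] c(2)] by (simp add: psi_total_mul A.total_assoc)
    also have "mul A (\<psi> b) c = mul A (\<psi> b') c'" by (rule c(6))
    also have "mul A (mul A (\<psi> b') c') (\<psi> d) = mul A (\<psi> ?b') c'"
      using c(3) d A.idem_part_commute[OF psi_idem_part[OF d(2)] c(3)] by (simp add: psi_total_mul A.total_assoc)
    finally show ?thesis .
  qed
  then have eq2: "mul A (mul A (star A (\<psi> ?b)) (\<psi> ?b)) c = mul A (mul A (star A (\<psi> ?b)) (\<psi> ?b')) c'"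
    using A.totalI[OF psi_fib[OF F(1)]] A.totalI[OF psi_fib[OF F(2)]] c(2,3) by (simp only: A.total_assoc A.total_star A.idem_part_total)
  have E: "mul B (star B ?b) ?b \<in> idem_part B" "mul B (star B ?b) ?b' \<in> idem_part B"
    by (rule B.star_mul_same_fib(1)[OF F(1)]; rule F)+
  have psiE: "mul A (star A (\<psi> ?b)) (\<psi> ?b) = \<psi> (mul B (star B ?b) ?b)"
    "mul A (star A (\<psi> ?b)) (\<psi> ?b') = \<psi> (mul B (star B ?b) ?b')"
    using psi_mul[OF B.star_closed[OF F(1)] F(1)] psi_mul[OF B.star_closed[OF F(1)] F(2)] psi_star[OF F(1)] by simp_all
  have "ev B (mul B (star B ?b) ?b) x * ev A c (point_map x) = ev B (mul B (star B ?b) ?b') x * ev A c' (point_map x)"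
    using arg_cong[OF eq2[unfolded psiE], of "\<lambda>a. ev A a (point_map x)"]
      A.ev_mul[OF y psi_idem_part[OF E(1)] c(2)] A.ev_mul[OF y psi_idem_part[OF E(2)] c(3)]
      ev_point_map[OF x E(1)] ev_point_map[OF x E(2)] by simp
  then have "0 < ev B (mul B (star B ?b) ?b') x * ev A c' (point_map x)"
    using complex_pos_mult[OF B.dom_ofD(2)[OF r1(1)] c(4)] by simp
  then have "0 < ev B (mul B (star B ?b) ?b') x" by (rule complex_pos_cancel[OF c(5)])
  then have "twist_class B ?b (t * k) x = twist_class B ?b' (t * k) x"
    by (rule B.twist_class_eq_same_fibre(2)[OF F(1) r1(1) F(2)])
  moreover have "twist_class B b t x = twist_class B ?b (t * k) x"
    using r1(2) B.twist_class_eq_iff[OF b] by simp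
  moreover have "twist_class B b' t' x = twist_class B ?b' (t * k) x"
    using r2(2) B.twist_class_eq_iff[OF b'(1) b'x] k(3) by simp
  ultimately show ?thesis by (simp add: xx)
qed

lemma twist_map_eqD:
  assumes "w \<in> topspace (gtop (twist_groupoid B))" "b \<in> fib B t" "x \<in> dom_of B b"
    "twist_map w = twist_class A (\<psi> b) (\<phi> t) (point_map x)"
  shows "w = twist_class B b t x"
proof -
  obtain b' t' x' where w: "w = twist_class B b' t' x'" "b' \<in> fib B t'" "x' \<in> dom_of B b'"
    using assms(1) unfolding B.topspace_twist_groupoid by blast
  then show ?thesis using twist_map_inj[OF w(2,3) assms(2,3)] assms(4) twist_map[OF w(2,3)] by simp
qed

text \<open>If \<open>a\<close> and \<open>\<psi> b\<close> lie in the same fibre, then near \<open>x\<close> they differ, up to positive functions, by the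
  phase of \<open>a\<^sup>*\<psi>(b)\<close>; multiplying \<open>b\<close> with the conjugate of this phase yields the class of \<open>a\<close>.\<close>

definition phase :: "'a \<Rightarrow> 'b \<Rightarrow> 'b point \<Rightarrow> complex" where
  "phase a b x = sgn (cnj (ev A (mul A (star A a) (\<psi> b)) (point_map x)))"

lemma phase_props:
  assumes a: "a \<in> fib A s" "point_map x \<in> dom_of A a" and b: "b \<in> fib B t" "x \<in> dom_of B b" and t: "\<phi> t = s"
  shows "ev A (mul A (star A a) (\<psi> b)) (point_map x) \<noteq> 0" "phase a b x \<in> sphere 0 1"
    "z \<in> sphere 0 1 \<Longrightarrow> twist_class A (scale A z a) s (point_map x)
      = twist_class A (\<psi> (scale B (z * phase a b x) b)) (\<phi> t) (point_map x)"
proof -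
  let ?y = "point_map x" and ?\<mu> = "ev A (mul A (star A a) (\<psi> b)) (point_map x)"
  note x = B.dom_ofD(1)[OF b(2)]
  have y: "?y \<in> spectrum A" using x by simp
  have pb: "\<psi> b \<in> fib A s" using psi_fib[OF b(1)] t by simp
  have "?y \<in> dom_of A (\<psi> b)" using b x by (simp add: point_map_dom B.totalI)
  then have "cnj ?\<mu> * ?\<mu> \<noteq> 0"
    using A.ev_exchange[OF a(1) pb y] A.dom_ofD(2)[OF a(2)] A.dom_ofD(2)[of ?y "\<psi> b"] by force
  then show nz: "?\<mu> \<noteq> 0" by simp
  show "phase a b x \<in> sphere 0 1" using nz by (simp add: phase_def norm_sgn)
  assume z: "z \<in> sphere 0 1"
  have E: "mul A (star A a) (\<psi> b) \<in> idem_part A" by (rule A.star_mul_same_fib(1)[OF a(1) pb])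
  have sF: "mul A (star A a) (\<psi> b) \<in> fib A (sinv s * s)" by (rule A.mul_closed[OF A.star_closed[OF a(1)] pb])
  have "mul A (star A (scale A z a)) (\<psi> (scale B (z * phase a b x) b))
      = scale A (cnj z * z * phase a b x) (mul A (star A a) (\<psi> b))"
    using A.star_scale[OF a(1), of z] psi_scale[OF b(1)] A.mul_scale_left[OF A.star_closed[OF a(1)] A.scale_in[OF pb]]
      A.mul_scale_right[OF A.star_closed[OF a(1)] pb] A.scale_scale[OF sF] by (simp add: mult.assoc)
  moreover have "cnj z * z = 1" using z by (simp add: mult.commute complex_norm_square[symmetric])
  moreover have "phase a b x * ?\<mu> = of_real (cmod ?\<mu>)"
  proof -
    have "cnj ?\<mu> * ?\<mu> = of_real (cmod ?\<mu>) * of_real (cmod ?\<mu>)"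
      by (metis complex_norm_square mult.commute power2_eq_square of_real_mult)
    then show ?thesis using nz by (simp add: phase_def sgn_div_norm scaleR_conv_of_real field_simps)
  qed
  ultimately have "0 < ev A (mul A (star A (scale A z a)) (\<psi> (scale B (z * phase a b x) b))) ?y"
    using A.ev_scale[OF y E] nz by (simp add: complex_pos_iff)
  moreover have "\<psi> (scale B (z * phase a b x) b) \<in> fib A s" using psi_fib[OF B.scale_in[OF b(1)]] t by simp
  ultimately show "twist_class A (scale A z a) s ?y = twist_class A (\<psi> (scale B (z * phase a b x) b)) (\<phi> t) ?y"
    using A.twist_class_eq_same_fibre(2)[OF A.scale_in[OF a(1)] A.scale_unit_in_dom[OF a z]] t by simp
qed

lemma lift_twist:
  assumes a: "a \<in> fib A s" and x: "x \<in> spectrum B" "point_map x \<in> dom_of A a"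
  obtains t b where "\<phi> t = s" "b \<in> fib B t" "x \<in> dom_of B b"
    "twist_class A a s (point_map x) = twist_class A (\<psi> b) (\<phi> t) (point_map x)"
proof -
  obtain t b where t: "\<phi> t = s" and b: "b \<in> fib B t" "x \<in> dom_of B b" by (rule lift_fibre[OF a x])
  note p = phase_props[OF a x(2) b t]
  have "twist_class A a s (point_map x) = twist_class A (\<psi> (scale B (phase a b x) b)) (\<phi> t) (point_map x)"
    using p(3)[of 1] by (simp add: A.scale_one[OF a])
  then show ?thesis using that[OF t B.scale_in[OF b(1)] B.scale_unit_in_dom[OF b p(2)]] by simp
qed

lemma phase_continuous:
  assumes a: "a \<in> fib A s" and b: "b \<in> fib B t" and t: "\<phi> t = s"
  shows "continuous_map (subtopology (spectrum_top B) ({x \<in> spectrum B. point_map x \<in> dom_of A a} \<inter> dom_of B b))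
    euclidean (phase a b)"
proof -
  let ?X = "subtopology (spectrum_top B) ({x \<in> spectrum B. point_map x \<in> dom_of A a} \<inter> dom_of B b)"
  let ?\<mu> = "\<lambda>x. ev A (mul A (star A a) (\<psi> b)) (point_map x)"
  have pb: "\<psi> b \<in> fib A s" using psi_fib[OF b] t by simp
  have E: "mul A (star A a) (\<psi> b) \<in> idem_part A" by (rule A.star_mul_same_fib(1)[OF a pb])
  have "continuous_map (spectrum_top B) euclidean ?\<mu>"
    using continuous_map_compose[OF homeomorphic_imp_continuous_map[OF point_map_homeomorphic] A.continuous_map_ev[OF E]]
    by (simp add: o_def)
  then have "continuous_map ?X euclidean ?\<mu>" by (rule continuous_map_from_subtopology)
  moreover have "?\<mu> ` topspace ?X \<subseteq> - {0}" using phase_props(1)[OF a _ b _ t] by auto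
  ultimately have "continuous_map ?X (top_of_set (- {0})) ?\<mu>" by (auto simp: continuous_map_in_subtopology)
  moreover have "continuous_map (top_of_set (- {0})) euclidean (\<lambda>w :: complex. sgn (cnj w))"
    unfolding continuous_map_iff_continuous by (intro continuous_intros) auto
  ultimately have "continuous_map ?X euclidean ((\<lambda>w. sgn (cnj w)) \<circ> ?\<mu>)" by (rule continuous_map_compose)
  then show ?thesis by (simp add: o_def phase_def[abs_def])
qed

text \<open>Basic open sets map to basic open sets. For a basic open set around \<open>[z a, s, y]\<close>, a lift
  \<open>b\<close> of \<open>a\<close> and its phase \<open>\<zeta>\<close>, the class \<open>[z b, t, x]\<close> is mapped to the class of \<open>z \<zeta>(x)\<^sup>* a\<close>; as
  \<open>\<zeta>\<close> is continuous, this stays in the given set for \<open>z\<close> and \<open>x\<close> near the given values.\<close>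

lemma twist_map_homeomorphic:
  "homeomorphic_map (gtop (twist_groupoid B)) (gtop (twist_groupoid A)) twist_map"
proof -
  let ?S = "{{twist_class B (scale B z b) s x | z x. z \<in> V \<and> x \<in> U} | b s U V.
      b \<in> fib B s \<and> U \<subseteq> dom_of B b \<and> openin (spectrum_top B) U \<and> openin (top_of_set (sphere 0 1)) V}"
  let ?T = "{{twist_class A (scale A z b) s x | z x. z \<in> V \<and> x \<in> U} | b s U V.
      b \<in> fib A s \<and> U \<subseteq> dom_of A b \<and> openin (spectrum_top A) U \<and> openin (top_of_set (sphere 0 1)) V}"
  have S: "gtop (twist_groupoid B) = topology_generated_by ?S" by (simp add: twist_groupoid_def)
  have T: "gtop (twist_groupoid A) = topology_generated_by ?T" by (simp add: twist_groupoid_def)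
  have "homeomorphic_map (topology_generated_by ?S) (topology_generated_by ?T) twist_map"
  proof (rule homeomorphic_map_generated)
    show "bij_betw twist_map (\<Union>?S) (\<Union>?T)"
      unfolding A.topspace_twists B.topspace_twists bij_betw_def
    proof
      show "inj_on twist_map {twist_class B b s x | b s x. b \<in> fib B s \<and> x \<in> dom_of B b}"
        using twist_map_eqD unfolding inj_on_def B.topspace_twist_groupoid by (smt (verit) twist_map mem_Collect_eq)
      show "twist_map ` {twist_class B b s x | b s x. b \<in> fib B s \<and> x \<in> dom_of B b}
          = {twist_class A b s x | b s x. b \<in> fib A s \<and> x \<in> dom_of A b}"
      proof (intro set_eqI iffI)
        fix w assume "w \<in> twist_map ` {twist_class B b s x | b s x. b \<in> fib B s \<and> x \<in> dom_of B b}"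
        then obtain b t x where b: "b \<in> fib B t" "x \<in> dom_of B b" "w = twist_class A (\<psi> b) (\<phi> t) (point_map x)" by auto
        then have "point_map x \<in> dom_of A (\<psi> b)" using B.dom_ofD(1)[OF b(2)] by (simp add: point_map_dom B.totalI)
        then show "w \<in> {twist_class A b s x | b s x. b \<in> fib A s \<and> x \<in> dom_of A b}" using b psi_fib by blast
      next
        fix w assume "w \<in> {twist_class A b s x | b s x. b \<in> fib A s \<and> x \<in> dom_of A b}"
        then obtain a s y where a: "a \<in> fib A s" "y \<in> dom_of A a" "w = twist_class A a s y" by blast
        obtain x where x: "x \<in> spectrum B" "y = point_map x" by (rule point_map_surj[OF A.dom_ofD(1)[OF a(2)]])
        obtain t b where "b \<in> fib B t" "x \<in> dom_of B b" "w = twist_class A (\<psi> b) (\<phi> t) (point_map x)"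
          using lift_twist[OF a(1) x(1)] a(2,3) x(2) by metis
        then show "w \<in> twist_map ` {twist_class B b s x | b s x. b \<in> fib B s \<and> x \<in> dom_of B b}"
          by (intro image_eqI[of _ _ "twist_class B b t x"]) (simp, blast)
      qed
    qed
  next
    fix W assume "W \<in> ?S"
    then obtain b t U V where *: "W = {twist_class B (scale B z b) t x | z x. z \<in> V \<and> x \<in> U}"
      "b \<in> fib B t" "U \<subseteq> dom_of B b" "openin (spectrum_top B) U" "openin (top_of_set (sphere 0 1)) V" by blast
    have V: "V \<subseteq> sphere 0 1" using openin_subset[OF *(5)] by simp
    have 1: "twist_map (twist_class B (scale B z b) t x) = twist_class A (scale A z (\<psi> b)) (\<phi> t) (point_map x)"
      if zx: "z \<in> V" "x \<in> U" for z x
    proof -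
      have "z \<in> sphere 0 1" "x \<in> dom_of B b" using zx V *(3) by (blast, blast)
      then show ?thesis using psi_scale[OF *(2)] twist_map[OF B.scale_in[OF *(2)] B.scale_unit_in_dom[OF *(2)]] by metis
    qed
    have "twist_map ` W = {twist_class A (scale A z (\<psi> b)) (\<phi> t) y | z y. z \<in> V \<and> y \<in> point_map ` U}"
    proof (intro set_eqI iffI)
      fix w assume "w \<in> twist_map ` W"
      then obtain z x where "z \<in> V" "x \<in> U" "w = twist_map (twist_class B (scale B z b) t x)" using *(1) by blast
      then show "w \<in> {twist_class A (scale A z (\<psi> b)) (\<phi> t) y | z y. z \<in> V \<and> y \<in> point_map ` U}"
        using 1 by blast
    next
      fix w assume "w \<in> {twist_class A (scale A z (\<psi> b)) (\<phi> t) y | z y. z \<in> V \<and> y \<in> point_map ` U}"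
      then obtain z x where zx: "z \<in> V" "x \<in> U" "w = twist_class A (scale A z (\<psi> b)) (\<phi> t) (point_map x)" by blast
      then have "w = twist_map (twist_class B (scale B z b) t x)" using 1 by simp
      then show "w \<in> twist_map ` W" using zx(1,2) *(1) by blast
    qed
    moreover have "point_map ` U \<subseteq> dom_of A (\<psi> b)"
      using *(2,3) B.dom_ofD(1) by (auto simp: point_map_dom B.totalI)
    ultimately show "openin (topology_generated_by ?T) (twist_map ` W)"
      using A.openin_twist_basic[OF psi_fib[OF *(2)] _ open_point_map[OF *(4)] *(5)] unfolding T by simp
  next
    fix W assume "W \<in> ?T"
    then obtain a s U V where *: "W = {twist_class A (scale A z a) s y | z y. z \<in> V \<and> y \<in> U}"
      "a \<in> fib A s" "U \<subseteq> dom_of A a" "openin (spectrum_top A) U" "openin (top_of_set (sphere 0 1)) V" by blast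
    have V: "V \<subseteq> sphere 0 1" using openin_subset[OF *(5)] by simp
    let ?P = "{w \<in> \<Union>?S. twist_map w \<in> W}"
    show "openin (topology_generated_by ?S) ?P"
    proof (subst openin_subopen, intro ballI)
      fix w assume "w \<in> ?P"
      then have w: "w \<in> topspace (gtop (twist_groupoid B))" "twist_map w \<in> W"
        by (simp_all add: B.topspace_twist_groupoid B.topspace_twists)
      then obtain z0 y0 where z0: "z0 \<in> V" and y0: "y0 \<in> U" "twist_map w = twist_class A (scale A z0 a) s y0"
        using *(1) by blast
      obtain x0 where x0: "x0 \<in> spectrum B" "y0 = point_map x0"
        using point_map_surj A.dom_ofD(1) y0(1) *(3) by blast
      have x0a: "point_map x0 \<in> dom_of A a" using x0(2) y0(1) *(3) by blast
      obtain t b where t: "\<phi> t = s" and b: "b \<in> fib B t" "x0 \<in> dom_of B b" by (rule lift_fibre[OF *(2) x0(1) x0a])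
      have z0s: "z0 \<in> sphere 0 1" using V z0 by blast
      let ?\<zeta> = "phase a b"
      have \<zeta>0: "?\<zeta> x0 \<in> sphere 0 1" by (rule phase_props(2)[OF *(2) x0a b t])
      obtain O' where O': "open O'" "V = sphere 0 1 \<inter> O'" using *(5) by (auto simp: openin_open)
      then obtain \<epsilon> where eps: "\<epsilon> > 0" "ball z0 \<epsilon> \<subseteq> O'" using z0 by (meson IntE openE)
      define D where "D = {x \<in> spectrum B. point_map x \<in> dom_of A a} \<inter> dom_of B b"
      have Dopen: "openin (spectrum_top B) D"
        unfolding D_def
        by (intro openin_Int open_point_map_vimage A.openin_dom A.totalI[OF *(2)] B.openin_dom B.totalI[OF b(1)])
      define U' where "U' = {x \<in> D. dist (?\<zeta> x) (?\<zeta> x0) < \<epsilon> / 2} \<inter> {x \<in> spectrum B. point_map x \<in> U}"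
      have Dtop: "topspace (subtopology (spectrum_top B) D) = D" by (auto simp: D_def)
      have "openin (subtopology (spectrum_top B) D) {x \<in> topspace (subtopology (spectrum_top B) D). ?\<zeta> x \<in> ball (?\<zeta> x0) (\<epsilon> / 2)}"
        by (rule openin_continuous_map_preimage[OF phase_continuous[OF *(2) b(1) t, folded D_def]]) simp
      then have "openin (spectrum_top B) {x \<in> D. dist (?\<zeta> x) (?\<zeta> x0) < \<epsilon> / 2}"
        unfolding Dtop using openin_trans_full[OF _ Dopen] by (simp add: dist_commute)
      then have U'open: "openin (spectrum_top B) U'"
        unfolding U'_def by (intro openin_Int open_point_map_vimage *(4))
      define V' where "V' = sphere 0 1 \<inter> ball (z0 * ?\<zeta> x0) (\<epsilon> / 2)"
      have V'open: "openin (top_of_set (sphere 0 1)) V'" unfolding V'_def by (simp add: openin_open_Int)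
      have U'dom: "U' \<subseteq> dom_of B b" by (auto simp: U'_def D_def)
      let ?N = "{twist_class B (scale B z b) t x | z x. z \<in> V' \<and> x \<in> U'}"
      have Nopen: "openin (topology_generated_by ?S) ?N"
        using B.openin_twist_basic[OF b(1) U'dom U'open V'open] unfolding S .
      have z\<zeta>: "z0 * ?\<zeta> x0 \<in> sphere 0 1" using z0s \<zeta>0 by (simp add: norm_mult)
      have "x0 \<in> U'" using x0 y0(1) b(2) x0a eps by (simp add: U'_def D_def)
      moreover have "z0 * ?\<zeta> x0 \<in> V'" using z\<zeta> eps by (simp add: V'_def)
      moreover have "w = twist_class B (scale B (z0 * ?\<zeta> x0) b) t x0"
      proof (rule twist_map_eqD[OF w(1) B.scale_in[OF b(1)] B.scale_unit_in_dom[OF b z\<zeta>]])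
        show "twist_map w = twist_class A (\<psi> (scale B (z0 * ?\<zeta> x0) b)) (\<phi> t) (point_map x0)"
          using y0(2) phase_props(3)[OF *(2) x0a b t z0s] x0(2) by simp
      qed
      ultimately have wN: "w \<in> ?N" by blast
      have "?N \<subseteq> ?P"
      proof
        fix v assume "v \<in> ?N"
        then obtain z x where z: "z \<in> V'" and x: "x \<in> U'" and v: "v = twist_class B (scale B z b) t x" by blast
        have zs: "z \<in> sphere 0 1" using z by (simp add: V'_def)
        have xD: "x \<in> dom_of B b" "point_map x \<in> dom_of A a" "point_map x \<in> U" using x by (auto simp: U'_def D_def)
        have \<zeta>s: "?\<zeta> x \<in> sphere 0 1" by (rule phase_props(2)[OF *(2) xD(2) b(1) xD(1) t])
        define z' where "z' = z * cnj (?\<zeta> x)"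
        have cc: "cnj (?\<zeta> x) * ?\<zeta> x = 1" using \<zeta>s by (simp add: mult.commute complex_norm_square[symmetric])
        have z'\<zeta>: "z' * ?\<zeta> x = z" using cc by (simp add: z'_def mult.assoc)
        have z's: "z' \<in> sphere 0 1" using zs \<zeta>s by (simp add: z'_def norm_mult)
        have "dist z0 z' = cmod ((z0 - z') * ?\<zeta> x)" using \<zeta>s by (simp add: dist_norm norm_mult)
        also have "(z0 - z') * ?\<zeta> x = z0 * (?\<zeta> x - ?\<zeta> x0) + (z0 * ?\<zeta> x0 - z)"
          unfolding left_diff_distrib z'\<zeta> by (simp add: algebra_simps)
        also have "cmod \<dots> \<le> cmod (?\<zeta> x - ?\<zeta> x0) + cmod (z0 * ?\<zeta> x0 - z)"
          using norm_triangle_ineq[of "z0 * (?\<zeta> x - ?\<zeta> x0)" "z0 * ?\<zeta> x0 - z"] z0s by (simp add: norm_mult)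
        also have "\<dots> < \<epsilon>" using z x by (simp add: V'_def U'_def dist_norm)
        finally have "z' \<in> V" using eps(2) O'(2) z's by auto
        moreover have "twist_map v = twist_class A (scale A z' a) s (point_map x)"
          using phase_props(3)[OF *(2) xD(2) b(1) xD(1) t z's] twist_map[OF B.scale_in[OF b(1)] B.scale_unit_in_dom[OF b(1) xD(1) zs]]
          by (simp add: v z'\<zeta>)
        ultimately have "twist_map v \<in> W" using *(1) xD(3) by blast
        moreover have "v \<in> \<Union>?S"
          unfolding B.topspace_twists v using B.scale_in[OF b(1)] B.scale_unit_in_dom[OF b(1) xD(1) zs] by blast
        ultimately show "v \<in> ?P" by simp
      qed
      then show "\<exists>N. openin (topology_generated_by ?S) N \<and> w \<in> N \<and> N \<subseteq> ?P"
        using Nopen wN by blast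
    qed
  qed
  then show ?thesis unfolding S T .
qed

lemma twist_map_iso: "top_groupoid_iso (twist_groupoid B) (twist_groupoid A) twist_map"
  unfolding top_groupoid_iso_def
proof (intro conjI ballI twist_map_homeomorphic)
  let ?G = "topspace (gtop (twist_groupoid B))"
  have dom: "point_map x \<in> dom_of A (\<psi> b)" if "b \<in> fib B t" "x \<in> dom_of B b" for b t x
    using that B.dom_ofD(1)[OF that(2)] by (simp add: point_map_dom B.totalI)
  fix g h assume g: "g \<in> ?G" and h: "h \<in> ?G"
  show "(g, h, k) \<in> gmul (twist_groupoid B) \<longleftrightarrow> (twist_map g, twist_map h, twist_map k) \<in> gmul (twist_groupoid A)"
    if k: "k \<in> ?G" for k
  proof
    assume "(g, h, k) \<in> gmul (twist_groupoid B)"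
    then obtain a b s t y where *: "g = twist_class B a s (theta_elem B b y)" "h = twist_class B b t y"
        "k = twist_class B (mul B a b) (s * t) y"
      and a: "a \<in> fib B s" and b: "b \<in> fib B t" "y \<in> dom_of B b" and ty: "theta_elem B b y \<in> dom_of B a"
      by (auto simp: twist_groupoid_def)
    note th = point_map_theta_elem[OF B.totalI[OF b(1)] b(2)]
    have im: "twist_map g = twist_class A (\<psi> a) (\<phi> s) (theta_elem A (\<psi> b) (point_map y))"
      "twist_map h = twist_class A (\<psi> b) (\<phi> t) (point_map y)"
      "twist_map k = twist_class A (mul A (\<psi> a) (\<psi> b)) (\<phi> s * \<phi> t) (point_map y)"
      using * twist_map[OF a ty] twist_map[OF b] th psi_mul[OF a b(1)] phi_mult[of s t]
        twist_map[OF B.mul_closed[OF a b(1)] B.dom_mul[OF B.totalI[OF a] B.totalI[OF b(1)] b(2) ty]] by simp_all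
    show "(twist_map g, twist_map h, twist_map k) \<in> gmul (twist_groupoid A)"
      by (rule twist_gmulI[OF im psi_fib[OF a] psi_fib[OF b(1)] dom[OF b] dom[OF a ty, unfolded th]])
  next
    assume "(twist_map g, twist_map h, twist_map k) \<in> gmul (twist_groupoid A)"
    then obtain a b s t y where *: "twist_map g = twist_class A a s (theta_elem A b y)" "twist_map h = twist_class A b t y"
        "twist_map k = twist_class A (mul A a b) (s * t) y"
      and a: "a \<in> fib A s" and b: "b \<in> fib A t" "y \<in> dom_of A b" and ty: "theta_elem A b y \<in> dom_of A a"
      by (auto simp: twist_groupoid_def)
    obtain x where x: "x \<in> spectrum B" "y = point_map x" by (rule point_map_surj[OF A.dom_ofD(1)[OF b(2)]])
    obtain t' b' where b': "\<phi> t' = t" "b' \<in> fib B t'" "x \<in> dom_of B b'"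
      "twist_class A b t y = twist_class A (\<psi> b') (\<phi> t') y"
      using lift_twist[OF b(1) x(1)] b(2) x(2) by metis
    have rb: "((b, t, y), (\<psi> b', \<phi> t', y)) \<in> twist_rel A" using b'(4) A.twist_class_eq_iff[OF b] by simp
    have th: "theta_elem A b y = point_map (theta_elem B b' x)"
      using A.theta_elem_same_fibre[OF b, of "\<psi> b'"] psi_fib[OF b'(2)] b'(1) dom[OF b'(2,3)] x(2)
        point_map_theta_elem[OF B.totalI[OF b'(2)] b'(3)] by simp
    note ths = B.theta_elem_in[OF B.totalI[OF b'(2)] b'(3)]
    obtain s' a' where a': "\<phi> s' = s" "a' \<in> fib B s'" "theta_elem B b' x \<in> dom_of B a'"
      "twist_class A a s (theta_elem A b y) = twist_class A (\<psi> a') (\<phi> s') (theta_elem A b y)"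
      using lift_twist[OF a ths] ty th by metis
    have ra: "((a, s, theta_elem A b y), (\<psi> a', \<phi> s', theta_elem A b y)) \<in> twist_rel A"
      using a'(4) A.twist_class_eq_iff[OF a ty] by simp
    note rab = A.twist_mul_cong(2)[OF ra rb]
    have domab: "y \<in> dom_of A (mul A a b)" by (rule A.dom_mul[OF A.totalI[OF a] A.totalI[OF b(1)] b(2) ty])
    have domab': "x \<in> dom_of B (mul B a' b')"
      by (rule B.dom_mul[OF B.totalI[OF a'(2)] B.totalI[OF b'(2)] b'(3) a'(3)])
    have "g = twist_class B a' s' (theta_elem B b' x)"
      by (rule twist_map_eqD[OF g a'(2,3)]) (use *(1) a'(4) th in simp)
    moreover have "h = twist_class B b' t' x"
      by (rule twist_map_eqD[OF h b'(2,3)]) (use *(2) b'(4) x(2) in simp)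
    moreover have "k = twist_class B (mul B a' b') (s' * t') x"
      by (rule twist_map_eqD[OF k B.mul_closed[OF a'(2) b'(2)] domab'])
        (use *(3) rab A.twist_class_eq_iff[OF A.mul_closed[OF a b(1)] domab] x(2) in
          \<open>simp add: phi_mult psi_mul[OF a'(2) b'(2)]\<close>)
    ultimately show "(g, h, k) \<in> gmul (twist_groupoid B)"
      by (rule twist_gmulI[OF _ _ _ a'(2) b'(2,3) a'(3)])
  qed
  show "(g, h) \<in> ginv (twist_groupoid B) \<longleftrightarrow> (twist_map g, twist_map h) \<in> ginv (twist_groupoid A)"
  proof
    assume "(g, h) \<in> ginv (twist_groupoid B)"
    then obtain b t x where *: "g = twist_class B b t x" "h = twist_class B (star B b) (sinv t) (theta_elem B b x)"
      and b: "b \<in> fib B t" "x \<in> dom_of B b" by (auto simp: twist_groupoid_def)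
    have im: "twist_map g = twist_class A (\<psi> b) (\<phi> t) (point_map x)"
      "twist_map h = twist_class A (star A (\<psi> b)) (sinv (\<phi> t)) (theta_elem A (\<psi> b) (point_map x))"
      using * twist_map[OF b] twist_map[OF B.star_closed[OF b(1)] B.theta_elem_dom_star(2)[OF B.totalI[OF b(1)] b(2)]]
        point_map_theta_elem[OF B.totalI[OF b(1)] b(2)] by (simp_all add: phi_sinv psi_star[OF b(1)])
    show "(twist_map g, twist_map h) \<in> ginv (twist_groupoid A)"
      by (rule twist_ginvI[OF im psi_fib[OF b(1)] dom[OF b]])
  next
    assume "(twist_map g, twist_map h) \<in> ginv (twist_groupoid A)"
    then obtain a s y where *: "twist_map g = twist_class A a s y" "twist_map h = twist_class A (star A a) (sinv s) (theta_elem A a y)"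
      and a: "a \<in> fib A s" "y \<in> dom_of A a" by (auto simp: twist_groupoid_def)
    obtain x where x: "x \<in> spectrum B" "y = point_map x" by (rule point_map_surj[OF A.dom_ofD(1)[OF a(2)]])
    obtain t b where b: "\<phi> t = s" "b \<in> fib B t" "x \<in> dom_of B b"
      "twist_class A a s y = twist_class A (\<psi> b) (\<phi> t) y"
      using lift_twist[OF a(1) x(1)] a(2) x(2) by metis
    have r: "((a, s, y), (\<psi> b, \<phi> t, y)) \<in> twist_rel A" using b(4) A.twist_class_eq_iff[OF a] by simp
    note inv = A.twist_inv_cong[OF r]
    have th: "theta_elem A a y = point_map (theta_elem B b x)"
      using inv(1) point_map_theta_elem[OF B.totalI[OF b(2)] b(3)] x(2) by simp
    have "g = twist_class B b t x"
      by (rule twist_map_eqD[OF g b(2,3)]) (use *(1) b(4) x(2) in simp)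
    moreover have "h = twist_class B (star B b) (sinv t) (theta_elem B b x)"
      by (rule twist_map_eqD[OF h B.star_closed[OF b(2)] B.theta_elem_dom_star(2)[OF B.totalI[OF b(2)] b(3)]])
        (use *(2) inv(2) A.twist_class_eq_iff[OF A.star_closed[OF a(1)] A.theta_elem_dom_star(2)[OF A.totalI[OF a(1)] a(2)]] th in
          \<open>simp add: phi_sinv psi_star[OF b(2)]\<close>)
    ultimately show "(g, h) \<in> ginv (twist_groupoid B)" by (rule twist_ginvI[OF _ _ b(2,3)])
  qed
qed

section \<open>The isomorphism\<close>

lemma unit_iff:
  assumes x: "x \<in> spectrum B" and g: "g \<in> topspace (gtop (germ_groupoid B))"
  shows "(x, g) \<in> unit (associated_twisted_groupoid B)
    \<longleftrightarrow> (point_map x, germ_map g) \<in> unit (associated_twisted_groupoid A)"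
proof
  assume "(x, g) \<in> unit (associated_twisted_groupoid B)"
  then obtain e where e: "idem e" "x \<in> supp B e" "g = germ B e x" by (auto simp: associated_twisted_groupoid_simps)
  then have "germ_map g = germ A (\<phi> e) (point_map x)" using idem_source[OF e(1)] by simp
  then show "(point_map x, germ_map g) \<in> unit (associated_twisted_groupoid A)"
    using phi_idem[OF e(1)] point_map_supp[OF e(1,2)] by (auto simp: associated_twisted_groupoid_simps)
next
  assume "(point_map x, germ_map g) \<in> unit (associated_twisted_groupoid A)"
  then obtain e where e: "idem e" "point_map x \<in> supp A e" "germ_map g = germ A e (point_map x)"
    by (auto simp: associated_twisted_groupoid_simps)
  obtain f where f: "\<phi> f = e" "idem f" "x \<in> supp B f" by (rule lift_supp[OF e(1) x e(2)])
  have "g = germ B f x" by (rule germ_map_eqD[OF g]) (use f e idem_source[OF f(2)] in simp_all)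
  then show "(x, g) \<in> unit (associated_twisted_groupoid B)"
    using f by (auto simp: associated_twisted_groupoid_simps)
qed

lemma emb_iff:
  assumes z: "z \<in> sphere 0 1" and x: "x \<in> spectrum B" and w: "w \<in> topspace (gtop (twist_groupoid B))"
  shows "((z, x), w) \<in> emb (associated_twisted_groupoid B)
    \<longleftrightarrow> ((z, point_map x), twist_map w) \<in> emb (associated_twisted_groupoid A)"
proof -
  have dom: "x \<in> dom_of B (scale B z c)" if "idem e" "c \<in> fib B e" "0 < ev B c x" for c e
  proof -
    have "ev B (mul B (star B c) c) x = cnj (ev B c x) * ev B c x"
      using B.idem_partI[OF that(1,2)] x by simp
    then have "x \<in> dom_of B c" using x that(3) complex_pos_cnj_mult[of "ev B c x"] by (auto simp: dom_of_def)
    then show ?thesis by (rule B.scale_unit_in_dom[OF that(2) _ z])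
  qed
  show ?thesis
  proof
    assume "((z, x), w) \<in> emb (associated_twisted_groupoid B)"
    then obtain c e where c: "idem e" "c \<in> fib B e" "0 < ev B c x" "w = twist_class B (scale B z c) e x"
      by (auto simp: associated_twisted_groupoid_simps)
    have "twist_map w = twist_class A (scale A z (\<psi> c)) (\<phi> e) (point_map x)"
      using twist_map[OF B.scale_in[OF c(2)] dom[OF c(1-3)]] psi_scale[OF c(2)] c(4) by simp
    then show "((z, point_map x), twist_map w) \<in> emb (associated_twisted_groupoid A)"
      using z x phi_idem[OF c(1)] psi_fib[OF c(2)] c(3) ev_point_map[OF x B.idem_partI[OF c(1,2)]]
        point_map_in[OF x] unfolding associated_twisted_groupoid_simps by force
  next
    assume "((z, point_map x), twist_map w) \<in> emb (associated_twisted_groupoid A)"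
    then obtain c e where c: "idem e" "c \<in> fib A e" "0 < ev A c (point_map x)"
      "twist_map w = twist_class A (scale A z c) e (point_map x)"
      by (auto simp: associated_twisted_groupoid_simps)
    let ?y = "point_map x"
    have y: "?y \<in> spectrum A" using x by simp
    have cE: "c \<in> idem_part A" by (rule A.idem_partI[OF c(1,2)])
    have "?y \<in> supp A e" by (rule A.suppI[OF c(1,2) y]) (use c(3) in auto)
    then obtain f where f: "\<phi> f = e" "idem f" "x \<in> supp B f" using lift_supp[OF c(1) x] by blast
    obtain d where d: "d \<in> fib B f" "d \<in> idem_part B" "0 < ev B d x" by (rule B.supp_pos[OF f(2,3)])
    note domd = dom[OF f(2) d(1,3)]
    have pd: "scale A z (\<psi> d) = \<psi> (scale B z d)" by (simp add: psi_scale[OF d(1)])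
    have pdF: "\<psi> d \<in> fib A e" using psi_fib[OF d(1)] f(1) by simp
    have domc: "?y \<in> dom_of A (scale A z c)"
    proof -
      have "ev A (mul A (star A c) c) ?y = cnj (ev A c ?y) * ev A c ?y" using cE y by simp
      then have "?y \<in> dom_of A c" using y c(3) complex_pos_cnj_mult[of "ev A c ?y"] by (auto simp: dom_of_def)
      then show ?thesis by (rule A.scale_unit_in_dom[OF c(2) _ z])
    qed
    have domd': "?y \<in> dom_of A (\<psi> (scale B z d))"
      using domd x by (simp add: point_map_dom B.totalI[OF B.scale_in[OF d(1)]])
    have "mul A (scale A z c) (\<psi> d) = mul A (\<psi> (scale B z d)) c"
      unfolding pd[symmetric] A.mul_scale_left[OF c(2) pdF] A.mul_scale_left[OF pdF c(2)]
      by (simp add: A.fibre_commute[OF c(1,2) pdF])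
    moreover have "\<psi> (scale B z d) \<in> fib A e" using A.scale_in[OF pdF] pd by metis
    moreover have "0 < ev A (\<psi> d) ?y" using ev_point_map[OF x d(2)] d(3) by simp
    ultimately have "((scale A z c, e, ?y), (\<psi> (scale B z d), e, ?y)) \<in> twist_rel A"
      using A.twist_relI[OF A.scale_in[OF c(2)] _ domc domd' A.idem_partI[OF c(1) pdF] cE] c(3) by blast
    then have "twist_map w = twist_class A (\<psi> (scale B z d)) (\<phi> f) ?y"
      using c(4) f(1) A.twist_class_eq_iff[OF A.scale_in[OF c(2)] domc] by simp
    then have "w = twist_class B (scale B z d) f x"
      by (rule twist_map_eqD[OF w B.scale_in[OF d(1)] domd])
    then show "((z, x), w) \<in> emb (associated_twisted_groupoid B)"
      using z x d f(2) unfolding associated_twisted_groupoid_simps by blast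
  qed
qed

lemma proj_iff:
  assumes w: "w \<in> topspace (gtop (twist_groupoid B))" and g: "g \<in> topspace (gtop (germ_groupoid B))"
  shows "(w, g) \<in> proj (associated_twisted_groupoid B)
    \<longleftrightarrow> (twist_map w, germ_map g) \<in> proj (associated_twisted_groupoid A)"
proof
  assume "(w, g) \<in> proj (associated_twisted_groupoid B)"
  then obtain b t x where b: "b \<in> fib B t" "x \<in> dom_of B b" "w = twist_class B b t x" "g = germ B t x"
    by (auto simp: associated_twisted_groupoid_simps)
  have "twist_map w = twist_class A (\<psi> b) (\<phi> t) (point_map x)" "germ_map g = germ A (\<phi> t) (point_map x)"
    using b B.dom_supp[OF b(1,2)] by simp_all
  moreover have "point_map x \<in> dom_of A (\<psi> b)"
    using b B.dom_ofD(1)[OF b(2)] by (simp add: point_map_dom B.totalI)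
  ultimately show "(twist_map w, germ_map g) \<in> proj (associated_twisted_groupoid A)"
    using psi_fib[OF b(1)] unfolding associated_twisted_groupoid_simps by blast
next
  assume "(twist_map w, germ_map g) \<in> proj (associated_twisted_groupoid A)"
  then obtain a s y where a: "a \<in> fib A s" "y \<in> dom_of A a" "twist_map w = twist_class A a s y" "germ_map g = germ A s y"
    by (auto simp: associated_twisted_groupoid_simps)
  obtain x where x: "x \<in> spectrum B" "y = point_map x" by (rule point_map_surj[OF A.dom_ofD(1)[OF a(2)]])
  obtain t b where b: "\<phi> t = s" "b \<in> fib B t" "x \<in> dom_of B b" "twist_class A a s y = twist_class A (\<psi> b) (\<phi> t) y"
    using lift_twist[OF a(1) x(1)] a(2) x(2) by metis
  have "w = twist_class B b t x" by (rule twist_map_eqD[OF w b(2,3)]) (use a(3) b(4) x(2) in simp)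
  moreover have "g = germ B t x"
    by (rule germ_map_eqD[OF g B.dom_supp[OF b(2,3)]]) (use a(4) b(1) x(2) in simp)
  ultimately show "(w, g) \<in> proj (associated_twisted_groupoid B)"
    using b(2,3) unfolding associated_twisted_groupoid_simps by blast
qed

theorem twisted_groupoids_isomorphic:
  "twisted_groupoid_isomorphic (associated_twisted_groupoid B) (associated_twisted_groupoid A)"
  unfolding twisted_groupoid_isomorphic_def
proof (intro exI conjI ballI)
  show "homeomorphic_map (base (associated_twisted_groupoid B)) (base (associated_twisted_groupoid A)) point_map"
    by (simp add: associated_twisted_groupoid_simps point_map_homeomorphic)
  show "top_groupoid_iso (grpd (associated_twisted_groupoid B)) (grpd (associated_twisted_groupoid A)) germ_map"
    by (simp add: associated_twisted_groupoid_simps germ_map_iso)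
  show "top_groupoid_iso (twist (associated_twisted_groupoid B)) (twist (associated_twisted_groupoid A)) twist_map"
    by (simp add: associated_twisted_groupoid_simps twist_map_iso)
qed (simp_all add: unit_iff emb_iff proj_iff associated_twisted_groupoid_simps(1-3))

end

theorem proposition8p9:
  fixes A :: "('s :: inverse_semigroup, 'a) fell"
    and B :: "('t :: inverse_semigroup, 'b) fell"
  assumes "fell_bundle A" and "saturated A" and "semi_abelian A"
    and "fell_bundle B" and "saturated B" and "refinement B A"
  shows "twisted_groupoid_isomorphic
           (associated_twisted_groupoid B) (associated_twisted_groupoid A)"
proof -
  have B: "semi_abelian B" by (rule refinement_semi_abelian[OF assms(4,3,6)])
  obtain \<phi> \<psi> where m: "fell_morphism B A \<phi> \<psi>" "surj \<phi>" "\<And>t. idem (\<phi> t) \<Longrightarrow> idem t" "\<And>t. inj_on \<psi> (fib B t)"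
    "\<And>s. fib A s = closed_fspan A s (\<Union>t\<in>\<phi> -` {s}. \<psi> ` fib B t)"
    using assms(6) unfolding refinement_def by blast
  interpret A: fell_bundle A by (rule assms(1))
  interpret B: fell_bundle B by (rule assms(4))
  interpret bundle_refinement A B \<phi> \<psi>
    by unfold_locales (use assms B m in auto)
  show ?thesis by (rule twisted_groupoids_isomorphic)
qed

end
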